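(* Let $G=(V,E)$ be a directed graph with $n=|V|$ and $m=|E|$, with edge weights $w:E\to\mathbb{R}$, and let $s\in V$ be a source. In the comparison-based model, the single-source bottleneck path problem on $(G,w,s)$ can be solved by a (Las Vegas) randomized algorithm in expected $O(m\sqrt{\log n})$ time.
   Context: The capacity of a path traversing edges $e_1,\dots,e_l$ is $\min_{1\le i\le l} w(e_i)$. For $u,v\in V$, $b(u,v)$ is the maximum capacity over all paths from $u$ to $v$. The single-source bottleneck path (SSBP) problem asks: given $(G,w,s)$, output $b(s,t)$ for every $t\in V$. In the comparison-based model, edge weights may only be accessed via comparisons. *)

theory Defs
  imports
    "HOL-Probability.Probability"
    "HOL-Library.Log_Nat"
    "Graph_Theory.Pair_Digraph"
begin

section \<open>Bottleneck paths\<close>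

text \<open>
  Capacities live in \<^typ>\<open>ereal\<close>: the empty path has capacity \<open>\<infinity>\<close> (the minimum over no edges), and
  \<open>b(u,v) = -\<infinity>\<close> if there is no path from \<open>u\<close> to \<open>v\<close>. A finite graph has only finitely many paths,
  so the supremum below is a maximum whenever a path exists.
\<close>

definition path_capacity :: "('e \<Rightarrow> real) \<Rightarrow> 'e list \<Rightarrow> ereal" where
  "path_capacity w p = (INF e\<in>set p. ereal (w e))"

definition bottleneck :: "'v pair_pre_digraph \<Rightarrow> ('v \<times> 'v \<Rightarrow> real) \<Rightarrow> 'v \<Rightarrow> 'v \<Rightarrow> ereal" where
  "bottleneck G w u v = (SUP p\<in>{p. pre_digraph.apath (with_proj G) u p v}. path_capacity w p)"

lemma bottleneck_attained:
  assumes "pair_fin_digraph G" and "pre_digraph.apath (with_proj G) u p v"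
  shows "\<exists>q. pre_digraph.apath (with_proj G) u q v \<and> path_capacity w q = bottleneck G w u v"
proof -
  interpret pair_fin_digraph G by fact
  let ?A = "path_capacity w ` {p. apath u p v}"
  have fin: "finite ?A" and ne: "?A \<noteq> {}"
    using apaths_finite[of u v] assms(2) by auto
  then have "Sup ?A = Max ?A"
    by (simp add: Max_Sup)
  with Max_in[OF fin ne] show ?thesis
    by (auto simp: bottleneck_def)
qed

text \<open>Allowing paths to repeat vertices makes no difference.\<close>

lemma bottleneck_eq_awalk:
  assumes "pair_fin_digraph G"
  shows "bottleneck G w u v = (SUP p\<in>{p. pre_digraph.awalk (with_proj G) u p v}. path_capacity w p)"
proof -
  interpret pair_fin_digraph G by fact
  show ?thesis
    unfolding bottleneck_def
  proof (rule antisym)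
    show "(SUP p\<in>{p. apath u p v}. path_capacity w p) \<le> (SUP p\<in>{p. awalk u p v}. path_capacity w p)"
      by (rule SUP_subset_mono) (auto simp: apath_def)
    show "(SUP p\<in>{p. awalk u p v}. path_capacity w p) \<le> (SUP p\<in>{p. apath u p v}. path_capacity w p)"
    proof (rule SUP_least)
      fix p assume "p \<in> {p. awalk u p v}"
      then have p: "awalk u p v" by simp
      have "path_capacity w p \<le> path_capacity w (awalk_to_apath p)"
        unfolding path_capacity_def
        by (rule INF_superset_mono) (use awalk_to_apath_subset[OF p] in auto)
      also have "\<dots> \<le> (SUP p\<in>{p. apath u p v}. path_capacity w p)"
        by (rule SUP_upper) (use apath_awalk_to_apath[OF p] in simp)
      finally show "path_capacity w p \<le> (SUP p\<in>{p. apath u p v}. path_capacity w p)" .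
    qed
  qed
qed

section \<open>A randomized comparison-based word RAM\<close>

text \<open>
  Programs are structured programs over word-valued scalars and word-indexed arrays of words. The
  elements to be compared (here: edge weights) are not words. They are named by indices, and a program can
  learn about them only through \<open>Cmp i j\<close>, which asks the oracle of the semantics whether the
  element with index \<open>i\<close> is at most the element with index \<open>j\<close>.
\<close>

datatype aexp =
    Const nat
  | Var string
  | Arr string aexp
  | Add aexp aexp
  | Sub aexp aexp
  | Mul aexp aexp
  | Div aexp aexp
  | Mod aexp aexp

datatype bexp =
    Eq aexp aexp
  | Less aexp aexp
  | Cmp aexp aexp
  | Not bexp
  | And bexp bexp

datatype com =
    Skip
  | Assign string aexp
  | Store string aexp aexp
  | Random string aexp
  | Seq com com
  | Cond bexp com com
  | While bexp com

record state =
  scalar :: "string \<Rightarrow> nat"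
  arr :: "string \<Rightarrow> nat \<Rightarrow> nat"

text \<open>
  Words have \<open>W\<close> bits. Arithmetic is modulo \<open>2 ^ W\<close>, except that subtraction is truncated at \<open>0\<close>.
\<close>

fun aval :: "nat \<Rightarrow> state \<Rightarrow> aexp \<Rightarrow> nat" where
  "aval W \<sigma> (Const k) = k mod 2 ^ W"
| "aval W \<sigma> (Var x) = scalar \<sigma> x"
| "aval W \<sigma> (Arr A i) = arr \<sigma> A (aval W \<sigma> i)"
| "aval W \<sigma> (Add a b) = (aval W \<sigma> a + aval W \<sigma> b) mod 2 ^ W"
| "aval W \<sigma> (Sub a b) = aval W \<sigma> a - aval W \<sigma> b"
| "aval W \<sigma> (Mul a b) = (aval W \<sigma> a * aval W \<sigma> b) mod 2 ^ W"
| "aval W \<sigma> (Div a b) = aval W \<sigma> a div aval W \<sigma> b"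
| "aval W \<sigma> (Mod a b) = aval W \<sigma> a mod aval W \<sigma> b"

fun bval :: "nat \<Rightarrow> (nat \<Rightarrow> nat \<Rightarrow> bool) \<Rightarrow> state \<Rightarrow> bexp \<Rightarrow> bool" where
  "bval W le \<sigma> (Eq a b) \<longleftrightarrow> aval W \<sigma> a = aval W \<sigma> b"
| "bval W le \<sigma> (Less a b) \<longleftrightarrow> aval W \<sigma> a < aval W \<sigma> b"
| "bval W le \<sigma> (Cmp a b) \<longleftrightarrow> le (aval W \<sigma> a) (aval W \<sigma> b)"
| "bval W le \<sigma> (Not b) \<longleftrightarrow> \<not> bval W le \<sigma> b"
| "bval W le \<sigma> (And a b) \<longleftrightarrow> bval W le \<sigma> a \<and> bval W le \<sigma> b"

text \<open>
  A configuration is a stack of commands still to be executed together with a state; it has halted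
  when the stack is empty. \<open>Random x a\<close> draws \<open>x\<close> uniformly from \<open>{..<k}\<close>, where \<open>k\<close> is the value
  of \<open>a\<close> (and sets \<open>x\<close> to \<open>0\<close> if \<open>k = 0\<close>).
\<close>

type_synonym config = "com list \<times> state"

definition halted :: "config \<Rightarrow> bool" where
  "halted c \<longleftrightarrow> fst c = []"

fun step :: "nat \<Rightarrow> (nat \<Rightarrow> nat \<Rightarrow> bool) \<Rightarrow> config \<Rightarrow> config pmf" where
  "step W le ([], \<sigma>) = return_pmf ([], \<sigma>)"
| "step W le (Skip # K, \<sigma>) = return_pmf (K, \<sigma>)"
| "step W le (Assign x a # K, \<sigma>) =
     return_pmf (K, \<sigma>\<lparr>scalar := (scalar \<sigma>)(x := aval W \<sigma> a)\<rparr>)"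
| "step W le (Store A i a # K, \<sigma>) =
     return_pmf (K, \<sigma>\<lparr>arr := (arr \<sigma>)(A := (arr \<sigma> A)(aval W \<sigma> i := aval W \<sigma> a))\<rparr>)"
| "step W le (Random x a # K, \<sigma>) =
     map_pmf (\<lambda>v. (K, \<sigma>\<lparr>scalar := (scalar \<sigma>)(x := v)\<rparr>))
       (if aval W \<sigma> a = 0 then return_pmf 0 else pmf_of_set {..<aval W \<sigma> a})"
| "step W le (Seq c d # K, \<sigma>) = return_pmf (c # d # K, \<sigma>)"
| "step W le (Cond b c d # K, \<sigma>) = return_pmf ((if bval W le \<sigma> b then c else d) # K, \<sigma>)"
| "step W le (While b c # K, \<sigma>) =
     return_pmf (if bval W le \<sigma> b then c # While b c # K else K, \<sigma>)"

primrec run :: "nat \<Rightarrow> (nat \<Rightarrow> nat \<Rightarrow> bool) \<Rightarrow> nat \<Rightarrow> config \<Rightarrow> config pmf" where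
  "run W le 0 c = return_pmf c"
| "run W le (Suc k) c = bind_pmf (step W le c) (run W le k)"

text \<open>
  Every step costs one unit of time; the expressions of a fixed program have constant size. The step
  after the first \<open>k\<close> ones is executed iff the computation has not halted by then, so by linearity
  the sum below is the expected number of executed steps (infinite if the program fails to halt with
  positive probability).
\<close>

definition expected_time :: "nat \<Rightarrow> (nat \<Rightarrow> nat \<Rightarrow> bool) \<Rightarrow> config \<Rightarrow> ennreal" where
  "expected_time W le c = (\<Sum>k. ennreal (measure_pmf.prob (run W le k c) {d. \<not> halted d}))"

section \<open>Single-source bottleneck paths on the RAM\<close>

text \<open>
  A graph on the vertices \<open>{..<n}\<close> is given as a list \<open>es\<close> of its edges in arbitrary order: the
  arrays \<open>src\<close> and \<open>dst\<close> hold the endpoints of the edges, and the weights are accessible through the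
  comparison oracle only. All other memory is initially zero.
\<close>

definition edge_le :: "(nat \<times> nat) list \<Rightarrow> (nat \<times> nat \<Rightarrow> real) \<Rightarrow> nat \<Rightarrow> nat \<Rightarrow> bool" where
  "edge_le es w i j \<longleftrightarrow> i < length es \<and> j < length es \<and> w (es ! i) \<le> w (es ! j)"

definition initial_state :: "nat \<Rightarrow> (nat \<times> nat) list \<Rightarrow> nat \<Rightarrow> state" where
  "initial_state n es s =
     \<lparr>scalar = (\<lambda>_. 0)(''n'' := n, ''m'' := length es, ''s'' := s),
      arr = (\<lambda>_ _. 0)
        (''src'' := \<lambda>i. if i < length es then fst (es ! i) else 0,
         ''dst'' := \<lambda>i. if i < length es then snd (es ! i) else 0)\<rparr>"

text \<open>
  For each vertex \<open>t\<close> the array \<open>out\<close> has to name \<open>b(s,t)\<close>: \<open>0\<close> stands for \<open>-\<infinity>\<close>, a number \<open>i\<close> between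
  \<open>1\<close> and \<open>m\<close> for the weight of the \<open>i\<close>-th edge, and larger numbers for \<open>\<infinity>\<close>.
\<close>

definition decode_value :: "(nat \<times> nat) list \<Rightarrow> (nat \<times> nat \<Rightarrow> real) \<Rightarrow> nat \<Rightarrow> ereal" where
  "decode_value es w r =
     (if r = 0 then -\<infinity> else if r \<le> length es then ereal (w (es ! (r - 1))) else \<infinity>)"

definition ssbp_output_correct ::
  "nat pair_pre_digraph \<Rightarrow> (nat \<times> nat) list \<Rightarrow> (nat \<times> nat \<Rightarrow> real) \<Rightarrow> nat \<Rightarrow> state \<Rightarrow> bool" where
  "ssbp_output_correct G es w s \<sigma> \<longleftrightarrow>
     (\<forall>t\<in>pverts G. decode_value es w (arr \<sigma> ''out'' t) = bottleneck G w s t)"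

text \<open>\<open>floorlog 2 n\<close> is the number of binary digits of \<open>n\<close>, so words have \<open>O(log n)\<close> bits.\<close>

definition word_bits :: "nat \<Rightarrow> nat \<Rightarrow> nat" where
  "word_bits c n = c * floorlog 2 n"

end

theory Submission
  imports Defs
begin

text \<open>
  Let \<open>T\<close> be the least number with \<open>m < 2 ^ (T * T)\<close>, so that \<open>T = O(sqrt (log n))\<close>. Every edge is sampled
  with probability \<open>1 / T\<close>; since \<open>m / T\<close> samples are expected, sorting them takes \<open>O(m T)\<close> time. The sorted
  sample divides the ranks of the edges into fewer than \<open>2 ^ (T * T)\<close> levels, and the level of the
  bottleneck value of each vertex is found in \<open>T\<close> rounds, each of which divides the length of the
  interval known to contain the level by \<open>2 ^ T\<close>. Edges whose ends have different intervals are dropped after they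
  have been turned into source values of their heads. In a round all source values have to be located in
  their new intervals, by binary searches of length \<open>T\<close>, before a bucket queue finishes the round in linear
  time. The vertices of a component are visited along a depth-first walk and a search is made only if the
  interval of the previous value does not fit: each further search in the same component can be charged
  to a dropped edge or to a source value that becomes useless, so that all rounds together spend \<open>O(m T)\<close> on them,
  and the first search is paid for by the size of the component, since components of size at most \<open>T\<close> are skipped.
  After the rounds each component has at most \<open>T\<close> vertices or a constant level. A level contains
  \<open>O(T)\<close> ranks in expectation, so removing the vertices of each component in decreasing order
  of value, with one pass over the component for each value, takes \<open>O(m T)\<close> expected time as well.
\<close>

section \<open>Step-counting reasoning about RAM programs\<close>

text \<open>The balance behind \<open>T\<close>: sorting a sample of expected size
  \<open>m / T\<close> takes at most \<open>T * T\<close> merge passes, and \<open>T\<close> rounds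
  gaining \<open>T\<close> bits each exhaust the \<open>T * T\<close> bits of a level, so both sides
  come to \<open>m * T\<close>. The obstacle is that a round has to place many source values by
  comparisons only; a search of length \<open>T\<close> for each of them in each round would give
  \<open>m * T * T\<close>. The charging argument removes this factor and dictates what is stored:
  each vertex carries a single code \<open>h v\<close>, an edge that fails the threshold survives
  only as such a code, and the potential \<open>XP\<close> counts live edges and codes that can
  still matter. Randomness influences the cost only: the deterministic parts are proved for an
  arbitrary sorted sample with a step budget that depends on it, and the last part takes
  expectations through a function that is an exact conditional expectation at each coin flip. Node
  numbers of linked lists are never reused; they fit into a word because a node costs steps, so
  \<open>nn\<close> plus the remaining budget never grows.\<close>

text \<open>The word modulus is an opaque parameter \<open>M\<close>, so that the simplifier never meets \<open>2 ^ W\<close>.\<close>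

primrec av :: "nat \<Rightarrow> state \<Rightarrow> aexp \<Rightarrow> nat" where
  "av M st (Const k) = k mod M"
| "av M st (Var x) = scalar st x"
| "av M st (Arr A i) = arr st A (av M st i)"
| "av M st (Add a b) = (av M st a + av M st b) mod M"
| "av M st (Sub a b) = av M st a - av M st b"
| "av M st (Mul a b) = (av M st a * av M st b) mod M"
| "av M st (Div a b) = av M st a div av M st b"
| "av M st (Mod a b) = av M st a mod av M st b"

primrec bv :: "nat \<Rightarrow> (nat \<Rightarrow> nat \<Rightarrow> bool) \<Rightarrow> state \<Rightarrow> bexp \<Rightarrow> bool" where
  "bv M le st (Eq a b) \<longleftrightarrow> av M st a = av M st b"
| "bv M le st (Less a b) \<longleftrightarrow> av M st a < av M st b"
| "bv M le st (Cmp a b) \<longleftrightarrow> le (av M st a) (av M st b)"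
| "bv M le st (Not b) \<longleftrightarrow> \<not> bv M le st b"
| "bv M le st (And a b) \<longleftrightarrow> bv M le st a \<and> bv M le st b"

lemma aval_av: "aval W st a = av (2 ^ W) st a"
  by (induction a) auto

lemma bval_bv: "bval W le st b = bv (2 ^ W) le st b"
  by (induction b) (auto simp: aval_av)

abbreviation upds :: "string \<Rightarrow> nat \<Rightarrow> state \<Rightarrow> state" where
  "upds x v st \<equiv> st\<lparr>scalar := (scalar st)(x := v)\<rparr>"

abbreviation upda :: "string \<Rightarrow> nat \<Rightarrow> nat \<Rightarrow> state \<Rightarrow> state" where
  "upda A i v st \<equiv> st\<lparr>arr := (arr st)(A := (arr st A)(i := v))\<rparr>"

text \<open>There is no rule for \<open>Random\<close>, so \<open>exec\<close> describes
  deterministic computations only; the one random draw of the program is handled by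
  \<open>good_step\<close>.\<close>

inductive exec :: "nat \<Rightarrow> (nat \<Rightarrow> nat \<Rightarrow> bool) \<Rightarrow> com \<Rightarrow> state \<Rightarrow> nat \<Rightarrow> state \<Rightarrow> bool"
  for M le where
  exec_Skip: "exec M le Skip st 1 st"
| exec_Assign: "exec M le (Assign x a) st 1 (upds x (av M st a) st)"
| exec_Store: "exec M le (Store A i a) st 1 (upda A (av M st i) (av M st a) st)"
| exec_Seq: "exec M le c st t st' \<Longrightarrow> exec M le d st' u st'' \<Longrightarrow> exec M le (Seq c d) st (Suc (t + u)) st''"
| exec_CondT: "bv M le st b \<Longrightarrow> exec M le c st t st' \<Longrightarrow> exec M le (Cond b c d) st (Suc t) st'"
| exec_CondF: "\<not> bv M le st b \<Longrightarrow> exec M le d st t st' \<Longrightarrow> exec M le (Cond b c d) st (Suc t) st'"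
| exec_WhileF: "\<not> bv M le st b \<Longrightarrow> exec M le (While b c) st 1 st"
| exec_WhileT: "bv M le st b \<Longrightarrow> exec M le c st t st' \<Longrightarrow> exec M le (While b c) st' u st''
    \<Longrightarrow> exec M le (While b c) st (Suc (t + u)) st''"

primrec wvars :: "com \<Rightarrow> string set" where
  "wvars Skip = {}"
| "wvars (Assign x a) = {x}"
| "wvars (Store A i a) = {}"
| "wvars (Random x a) = {x}"
| "wvars (Seq c d) = wvars c \<union> wvars d"
| "wvars (Cond b c d) = wvars c \<union> wvars d"
| "wvars (While b c) = wvars c"

primrec warrs :: "com \<Rightarrow> string set" where
  "warrs Skip = {}"
| "warrs (Assign x a) = {}"
| "warrs (Store A i a) = {A}"
| "warrs (Random x a) = {}"
| "warrs (Seq c d) = warrs c \<union> warrs d"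
| "warrs (Cond b c d) = warrs c \<union> warrs d"
| "warrs (While b c) = warrs c"

definition unch :: "com \<Rightarrow> state \<Rightarrow> state \<Rightarrow> bool" where
  "unch c st st' \<longleftrightarrow> (\<forall>x. x \<notin> wvars c \<longrightarrow> scalar st' x = scalar st x) \<and> (\<forall>A. A \<notin> warrs c \<longrightarrow> arr st' A = arr st A)"

lemma exec_unch: "exec M le c st t st' \<Longrightarrow> unch c st st'"
  unfolding unch_def by (induction rule: exec.induct) auto

text \<open>In \<open>wp M le c Q st n\<close> the number \<open>n\<close> is a budget of steps, and \<open>Q\<close> speaks about the final state
  and the unspent budget. Since every step costs one unit, loops need no separate variant.\<close>

definition wp :: "nat \<Rightarrow> (nat \<Rightarrow> nat \<Rightarrow> bool) \<Rightarrow> com \<Rightarrow> (state \<Rightarrow> nat \<Rightarrow> bool) \<Rightarrow> state \<Rightarrow> nat \<Rightarrow> bool" where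
  "wp M le c Q st n \<longleftrightarrow> (\<exists>t st'. exec M le c st t st' \<and> t \<le> n \<and> Q st' (n - t))"

inductive_cases exec_SkipE: "exec M le Skip st t st'"
inductive_cases exec_AssignE: "exec M le (Assign x a) st t st'"
inductive_cases exec_StoreE: "exec M le (Store A i a) st t st'"
inductive_cases exec_SeqE: "exec M le (Seq c d) st t st'"
inductive_cases exec_CondE: "exec M le (Cond b c d) st t st'"

lemma wp_Skip: "wp M le Skip Q st n \<longleftrightarrow> 1 \<le> n \<and> Q st (n - 1)"
  unfolding wp_def by (auto elim!: exec_SkipE intro: exec_Skip intro!: exI[of _ "1::nat"])

lemma wp_Assign: "wp M le (Assign x a) Q st n \<longleftrightarrow> 1 \<le> n \<and> Q (upds x (av M st a) st) (n - 1)"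
proof -
  have "exec M le (Assign x a) st t st' \<longleftrightarrow> t = 1 \<and> st' = upds x (av M st a) st" for t st'
    by (auto elim!: exec_AssignE simp: exec_Assign[simplified])
  then show ?thesis by (simp add: wp_def)
qed

lemma wp_Store: "wp M le (Store A i a) Q st n \<longleftrightarrow> 1 \<le> n \<and> Q (upda A (av M st i) (av M st a) st) (n - 1)"
proof -
  have "exec M le (Store A i a) st t st' \<longleftrightarrow> t = 1 \<and> st' = upda A (av M st i) (av M st a) st" for t st'
    by (auto elim!: exec_StoreE simp: exec_Store[simplified])
  then show ?thesis by (simp add: wp_def)
qed

lemma wp_Seq: "wp M le (Seq c d) Q st n \<longleftrightarrow> 1 \<le> n \<and> wp M le c (wp M le d Q) st (n - 1)"
proof
  assume "wp M le (Seq c d) Q st n"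
  then obtain t st' where 1: "exec M le (Seq c d) st t st'" "t \<le> n" "Q st' (n - t)"
    unfolding wp_def by blast
  from 1(1) obtain t1 st1 t2 where 2: "t = Suc (t1 + t2)" "exec M le c st t1 st1" "exec M le d st1 t2 st'"
    by (elim exec_SeqE) auto
  have "n - t = n - 1 - t1 - t2" using 2(1) by simp
  then show "1 \<le> n \<and> wp M le c (wp M le d Q) st (n - 1)"
    unfolding wp_def using 1 2 by (intro conjI exI[of _ t1] exI[of _ st1] exI[of _ t2] exI[of _ st']) auto
next
  assume "1 \<le> n \<and> wp M le c (wp M le d Q) st (n - 1)"
  then obtain t1 st1 t2 st' where 2: "1 \<le> n" "exec M le c st t1 st1" "t1 \<le> n - 1" "exec M le d st1 t2 st'"
    "t2 \<le> n - 1 - t1" "Q st' (n - 1 - t1 - t2)"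
    unfolding wp_def by blast
  have "n - 1 - t1 - t2 = n - Suc (t1 + t2)" by simp
  then show "wp M le (Seq c d) Q st n"
    unfolding wp_def using 2 exec_Seq[OF 2(2,4)] by (intro exI[of _ "Suc (t1 + t2)"] exI[of _ st']) auto
qed

lemma wp_Cond: "wp M le (Cond b c d) Q st n \<longleftrightarrow>
   1 \<le> n \<and> (if bv M le st b then wp M le c Q st (n - 1) else wp M le d Q st (n - 1))"
proof
  assume "wp M le (Cond b c d) Q st n"
  then show "1 \<le> n \<and> (if bv M le st b then wp M le c Q st (n - 1) else wp M le d Q st (n - 1))"
    unfolding wp_def by (auto elim!: exec_CondE) (metis Suc_le_mono Suc_pred diff_Suc_eq_diff_pred less_le_trans zero_less_Suc)+
next
  assume *: "1 \<le> n \<and> (if bv M le st b then wp M le c Q st (n - 1) else wp M le d Q st (n - 1))"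
  then obtain t st' where t: "exec M le (if bv M le st b then c else d) st t st'" "t \<le> n - 1" "Q st' (n - 1 - t)"
    unfolding wp_def by (auto split: if_splits)
  have "exec M le (Cond b c d) st (Suc t) st'"
    using t(1) by (cases "bv M le st b") (auto intro: exec_CondT exec_CondF)
  moreover have "n - 1 - t = n - Suc t" by simp
  ultimately show "wp M le (Cond b c d) Q st n"
    unfolding wp_def using t * by (intro exI[of _ "Suc t"] exI[of _ st']) auto
qed

lemma wp_frame:
  assumes "wp M le c Q st n"
    and "\<And>st' n'. Q st' n' \<Longrightarrow> unch c st st' \<Longrightarrow> n' \<le> n \<Longrightarrow> R st' n'"
  shows "wp M le c R st n"
  using assms exec_unch unfolding wp_def by (metis diff_le_self)

lemma wp_mono: "wp M le c Q st n \<Longrightarrow> (\<And>st' n'. Q st' n' \<Longrightarrow> R st' n') \<Longrightarrow> wp M le c R st n"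
  unfolding wp_def by blast

lemma wp_WhileF: "\<not> bv M le st b \<Longrightarrow> 1 \<le> n \<Longrightarrow> Q st (n - 1) \<Longrightarrow> wp M le (While b c) Q st n"
  unfolding wp_def using exec_WhileF[of M le st b c] by force

lemma wp_WhileT:
  assumes "bv M le st b" "1 \<le> n" "wp M le c (wp M le (While b c) Q) st (n - 1)"
  shows "wp M le (While b c) Q st n"
proof -
  obtain t1 st1 t2 st' where 2: "exec M le c st t1 st1" "t1 \<le> n - 1" "exec M le (While b c) st1 t2 st'"
    "t2 \<le> n - 1 - t1" "Q st' (n - 1 - t1 - t2)"
    using assms(3) unfolding wp_def by blast
  have "n - 1 - t1 - t2 = n - Suc (t1 + t2)" by simp
  then show ?thesis
    unfolding wp_def using 2 assms exec_WhileT[OF assms(1) 2(1,3)]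
    by (intro exI[of _ "Suc (t1 + t2)"] exI[of _ st']) auto
qed

text \<open>Induction on the budget: every round of the loop spends a step. \<open>body\<close> and
  \<open>exit\<close> receive \<open>unch c st0 st\<close> for free, so an invariant need only speak
  about what the loop body writes.\<close>

lemma wp_While:
  assumes I: "I st0 n0"
    and body: "\<And>st n. I st n \<Longrightarrow> unch c st0 st \<Longrightarrow> bv M le st b \<Longrightarrow> 1 \<le> n \<and> wp M le c I st (n - 1)"
    and exit: "\<And>st n. I st n \<Longrightarrow> unch c st0 st \<Longrightarrow> \<not> bv M le st b \<Longrightarrow> 1 \<le> n \<and> Q st (n - 1)"
  shows "wp M le (While b c) Q st0 n0"
proof -
  have "I st n \<Longrightarrow> unch c st0 st \<Longrightarrow> wp M le (While b c) Q st n" for st n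
  proof (induction n arbitrary: st rule: less_induct)
    case (less n)
    show ?case
    proof (cases "bv M le st b")
      case True
      note b = body[OF less.prems True]
      have "wp M le c (wp M le (While b c) Q) st (n - 1)"
      proof (rule wp_frame[OF conjunct2[OF b]])
        fix st' n' assume *: "I st' n'" "unch c st st'" "n' \<le> n - 1"
        have "unch c st0 st'" using less.prems(2) *(2) unfolding unch_def by auto
        with * show "wp M le (While b c) Q st' n'" using b by (intro less.IH) auto
      qed
      with b True show ?thesis by (intro wp_WhileT) auto
    next
      case False
      then show ?thesis using exit[OF less.prems] by (intro wp_WhileF) auto
    qed
  qed
  with I show ?thesis by (simp add: unch_def)
qed

subsection \<open>Expected running time\<close>

text \<open>Partial correctness of all finite runs together with a bound on the expected time. Only
  the sampling loop is analysed at this level; the other loops enter through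
  \<open>good_wp\<close>.\<close>

definition good :: "nat \<Rightarrow> (nat \<Rightarrow> nat \<Rightarrow> bool) \<Rightarrow> (state \<Rightarrow> bool) \<Rightarrow> config \<Rightarrow> ennreal \<Rightarrow> bool" where
  "good W le ok c B \<longleftrightarrow> (\<forall>k. \<forall>d\<in>set_pmf (run W le k c). halted d \<longrightarrow> ok (snd d)) \<and> expected_time W le c \<le> B"

text \<open>First-step analysis: the term for \<open>k = 0\<close> is 1 because \<open>c\<close> has
  not halted, and the shifted series is exchanged with the integral.\<close>

lemma expected_time_step:
  assumes "\<not> halted c"
  shows "expected_time W le c = 1 + (\<integral>\<^sup>+ d. expected_time W le d \<partial>measure_pmf (step W le c))"
proof -
  have *: "ennreal (measure_pmf.prob (run W le (Suc k) c) {d. \<not> halted d})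
    = (\<integral>\<^sup>+ d. ennreal (measure_pmf.prob (run W le k d) {d. \<not> halted d}) \<partial>measure_pmf (step W le c))" for k
    by (simp add: measure_pmf.emeasure_eq_measure[symmetric])
  have "expected_time W le c = ennreal (measure_pmf.prob (run W le 0 c) {d. \<not> halted d})
    + (\<Sum>k. ennreal (measure_pmf.prob (run W le (Suc k) c) {d. \<not> halted d}))"
    unfolding expected_time_def by (subst suminf_offset[of _ 1]) (auto simp: summableI)
  also have "ennreal (measure_pmf.prob (run W le 0 c) {d. \<not> halted d}) = 1"
    using assms by simp
  also have "(\<Sum>k. ennreal (measure_pmf.prob (run W le (Suc k) c) {d. \<not> halted d}))
    = (\<integral>\<^sup>+ d. expected_time W le d \<partial>measure_pmf (step W le c))"
    unfolding expected_time_def * by (rule nn_integral_suminf[symmetric]) simp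
  finally show ?thesis .
qed

lemma run_halted: "run W le k ([], st) = return_pmf ([], st)"
  by (induction k) (auto simp: bind_return_pmf)

lemma good_Nil: "ok st \<Longrightarrow> good W le ok ([], st) B"
  by (auto simp: good_def run_halted expected_time_def halted_def)

lemma good_step:
  assumes "\<not> halted c" "\<And>d. d \<in> set_pmf (step W le c) \<Longrightarrow> good W le ok d (f d)"
    "1 + (\<integral>\<^sup>+ d. f d \<partial>measure_pmf (step W le c)) \<le> B"
  shows "good W le ok c B"
proof -
  have "halted d \<longrightarrow> ok (snd d)" if "d \<in> set_pmf (run W le k c)" for k d
    using that assms(1,2) by (cases k) (auto simp: good_def)
  moreover have "(\<integral>\<^sup>+ d. expected_time W le d \<partial>measure_pmf (step W le c)) \<le> (\<integral>\<^sup>+ d. f d \<partial>measure_pmf (step W le c))"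
    using assms(2) by (intro nn_integral_mono_AE AE_pmfI) (auto simp: good_def)
  then have "expected_time W le c \<le> B"
    unfolding expected_time_step[OF assms(1)] using assms(3) by (meson add_left_mono order_trans)
  ultimately show ?thesis by (auto simp: good_def)
qed

lemma good_step_det:
  assumes "step W le (c # K, st) = return_pmf d" "good W le ok d B"
  shows "good W le ok (c # K, st) (1 + B)"
  by (rule good_step[where f = "\<lambda>_. B"]) (use assms in \<open>auto simp: halted_def\<close>)

text \<open>A terminating big-step execution is a deterministic prefix of the small-step run,
  whatever stack \<open>K\<close> of commands follows it.\<close>

lemma good_exec:
  assumes "exec M le c st t st'" "M = 2 ^ W" "good W le ok (K, st') B"
  shows "good W le ok (c # K, st) (of_nat t + B)"
  using assms
proof (induction arbitrary: K B rule: exec.induct)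
  case (exec_Seq c st t st' d u st'')
  have "good W le ok (c # d # K, st) (of_nat t + (of_nat u + B))"
    using exec_Seq by blast
  from good_step_det[OF _ this, of "Seq c d" K] show ?case by (simp add: add.assoc)
next
  case (exec_WhileT st b c t st' u st'')
  have "good W le ok (c # While b c # K, st) (of_nat t + (of_nat u + B))"
    using exec_WhileT by blast
  from good_step_det[OF _ this, of "While b c" K] exec_WhileT.hyps(1) exec_WhileT.prems(1)
  show ?case by (simp add: add.assoc bval_bv)
next
  case (exec_CondT st b c t st' d)
  from good_step_det[OF _ exec_CondT.IH[OF exec_CondT.prems], of "Cond b c d" K] exec_CondT.hyps(1) exec_CondT.prems(1)
  show ?case by (simp add: add.assoc bval_bv)
next
  case (exec_CondF st b d t st' c)
  from good_step_det[OF _ exec_CondF.IH[OF exec_CondF.prems], of "Cond b c d" K] exec_CondF.hyps(1) exec_CondF.prems(1)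
  show ?case by (simp add: add.assoc bval_bv)
qed (auto intro!: good_step_det simp: aval_av bval_bv)

lemma good_mono: "good W le ok c B \<Longrightarrow> B \<le> B' \<Longrightarrow> good W le ok c B'"
  by (auto simp: good_def)

text \<open>The unspent part of the budget stays available to the continuation, so no exact step
  counts are needed.\<close>

lemma good_wp:
  assumes "wp (2 ^ W) le c (\<lambda>st' n'. good W le ok (K, st') (of_nat n' + B)) st n"
  shows "good W le ok (c # K, st) (of_nat n + B)"
proof -
  obtain t st' where "exec (2 ^ W) le c st t st'" "t \<le> n" "good W le ok (K, st') (of_nat (n - t) + B)"
    using assms unfolding wp_def by blast
  from good_exec[OF this(1) refl this(3)] \<open>t \<le> n\<close> show ?thesis
    by (auto simp: add.assoc[symmetric] of_nat_add[symmetric] simp del: of_nat_add)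
qed

section \<open>Bottleneck values as ranks\<close>

locale ssbp_graph =
  fixes es :: "(nat \<times> nat) list" and w :: "nat \<times> nat \<Rightarrow> real" and s :: nat
begin

abbreviation m :: nat where "m \<equiv> length es"

definition src :: "nat \<Rightarrow> nat" where "src e = fst (es ! e)"
definition dst :: "nat \<Rightarrow> nat" where "dst e = snd (es ! e)"

definition leq :: "nat \<Rightarrow> nat \<Rightarrow> bool" where
  "leq i j \<longleftrightarrow> w (es ! i) < w (es ! j) \<or> w (es ! i) = w (es ! j) \<and> i \<le> j"

text \<open>Ties are broken by the index, so that weights become distinct ranks in \<open>{1..m}\<close>; rank \<open>0\<close> plays
  the role of \<open>-\<infinity>\<close>. A code \<open>c\<close> names nothing if \<open>c = 0\<close> and the edge \<open>c - 1\<close> otherwise.\<close>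

definition rk :: "nat \<Rightarrow> nat" where "rk i = card {j. j < m \<and> leq j i}"
definition rkc :: "nat \<Rightarrow> nat" where "rkc c = (if c = 0 then 0 else rk (c - 1))"

lemma leq_trans: "leq i j \<Longrightarrow> leq j k \<Longrightarrow> leq i k"
  unfolding leq_def by auto

lemma rk_le_iff: assumes "i < m" "j < m" shows "rk i \<le> rk j \<longleftrightarrow> leq i j"
proof
  assume "leq i j"
  then show "rk i \<le> rk j" unfolding rk_def by (intro card_mono) (auto intro: leq_trans)
next
  assume le: "rk i \<le> rk j"
  show "leq i j"
  proof (rule ccontr)
    assume "\<not> leq i j"
    then have "{k. k < m \<and> leq k j} \<subset> {k. k < m \<and> leq k i}"
      using assms unfolding leq_def by auto
    then have "rk j < rk i" unfolding rk_def by (intro psubset_card_mono) auto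
    with le show False by simp
  qed
qed

lemma rk_pos: "i < m \<Longrightarrow> 1 \<le> rk i"
  unfolding rk_def using card_mono[of "{j. j < m \<and> leq j i}" "{i}"] by (auto simp: leq_def)

lemma rk_le_m: "rk i \<le> m"
  unfolding rk_def using card_mono[of "{..<m}" "{j. j < m \<and> leq j i}"] by auto

lemma rk_inj: "i < m \<Longrightarrow> j < m \<Longrightarrow> rk i = rk j \<longleftrightarrow> i = j"
  using rk_le_iff[of i j] rk_le_iff[of j i] by (auto simp: leq_def)

lemma rkc_0[simp]: "rkc 0 = 0" and rkc_Suc[simp]: "rkc (Suc e) = rk e"
  by (auto simp: rkc_def)

lemma rkc_le_m: "rkc c \<le> m" by (simp add: rkc_def rk_le_m)

section \<open>Reachability through edges of at least a given rank\<close>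

inductive reach :: "nat \<Rightarrow> nat \<Rightarrow> bool" for x where
  reach_s: "reach x s"
| reach_step: "reach x (src e) \<Longrightarrow> e < m \<Longrightarrow> x \<le> rk e \<Longrightarrow> reach x (dst e)"

text \<open>The source is excluded from the search, so its value is set to \<open>0\<close>.\<close>

definition Bn :: "nat \<Rightarrow> nat" where
  "Bn v = (if v = s then 0 else card {x \<in> {1..m}. reach x v})"

lemma reach_antimono: "reach y v \<Longrightarrow> x \<le> y \<Longrightarrow> reach x v"
  by (induction rule: reach.induct) (auto intro: reach.intros)

text \<open>The thresholds at which \<open>v\<close> is reachable are downward closed, so their
  number, which is \<open>Bn v\<close>, is also the largest of them.\<close>

lemma Bn_ge_iff: assumes "1 \<le> x" "x \<le> m" "v \<noteq> s" shows "x \<le> Bn v \<longleftrightarrow> reach x v"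
proof
  assume "reach x v"
  then have "{1..x} \<subseteq> {x \<in> {1..m}. reach x v}" using assms by (auto intro: reach_antimono)
  from card_mono[OF _ this] show "x \<le> Bn v" using assms by (auto simp: Bn_def)
next
  assume le: "x \<le> Bn v"
  show "reach x v"
  proof (rule ccontr)
    assume "\<not> reach x v"
    then have "{y \<in> {1..m}. reach y v} \<subseteq> {1..<x}"
      by (auto simp: not_le[symmetric] intro: reach_antimono)
    from card_mono[OF _ this] have "Bn v \<le> x - 1" using assms by (auto simp: Bn_def)
    with le assms show False by simp
  qed
qed

lemma Bn_le_m: "Bn v \<le> m"
proof -
  have "card {x \<in> {1..m}. reach x v} \<le> card {1..m}" by (rule card_mono) auto
  then show ?thesis by (simp add: Bn_def)
qed

lemma Bn_s[simp]: "Bn s = 0" by (simp add: Bn_def)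

text \<open>One relaxation step. The head must not be \<open>s\<close>, because \<open>Bn s\<close>
  is 0 by convention; edges out of \<open>s\<close> are covered by \<open>Bn_source\<close>.\<close>

lemma Bn_edge: assumes "e < m" "src e \<noteq> s" "dst e \<noteq> s" "x \<le> Bn (src e)" "x \<le> rk e"
  shows "x \<le> Bn (dst e)"
proof (cases "x = 0")
  case False
  have "x \<le> m" using assms(5) rk_le_m le_trans by blast
  with False assms show ?thesis
    using Bn_ge_iff[of x "src e"] Bn_ge_iff[of x "dst e"] reach_step[of x e] by auto
qed simp

lemma Bn_source: assumes "e < m" "src e = s" "dst e \<noteq> s" shows "rk e \<le> Bn (dst e)"
proof -
  have "reach (rk e) (dst e)" using reach_step[of "rk e" e] reach_s assms by auto
  with assms show ?thesis using Bn_ge_iff[of "rk e" "dst e"] rk_pos rk_le_m by auto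
qed

lemma Bn_attained: assumes "v \<noteq> s" "Bn v \<noteq> 0" shows "\<exists>e<m. Bn v = rk e"
proof -
  have "rk ` {..<m} = {1..m}"
  proof (rule card_subset_eq)
    show "card (rk ` {..<m}) = card {1..m}"
      using rk_inj by (subst card_image) (auto simp: inj_on_def)
  qed (use rk_pos rk_le_m in auto)
  moreover have "Bn v \<in> {1..m}" using assms Bn_le_m by auto
  ultimately show ?thesis by (metis imageE lessThan_iff)
qed

text \<open>The last edge of a path that witnesses the value enters \<open>v\<close>. Hence heads of
  edges are the only vertices from which components have to be explored.\<close>

lemma Bn_pos_dst: assumes "Bn v \<noteq> 0" shows "\<exists>e<m. dst e = v"
proof -
  have "v \<noteq> s" using assms by (auto simp: Bn_def)
  with assms have "reach (Bn v) v" using Bn_ge_iff[of "Bn v" v] Bn_le_m by auto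
  then show ?thesis using \<open>v \<noteq> s\<close> by cases auto
qed

section \<open>From ranks back to capacities of paths\<close>

lemma reach_awalk:
  assumes "pair_fin_digraph G" "set es = parcs G" "s \<in> pverts G"
  shows "reach x v \<longleftrightarrow> (\<exists>p. pre_digraph.awalk (with_proj G) s p v \<and> (\<forall>a\<in>set p. \<exists>e<m. es ! e = a \<and> x \<le> rk e))"
proof -
  interpret pair_fin_digraph G by fact
  show ?thesis
  proof
    assume "reach x v"
    then show "\<exists>p. awalk s p v \<and> (\<forall>a\<in>set p. \<exists>e<m. es ! e = a \<and> x \<le> rk e)"
    proof induction
      case reach_s
      then show ?case using assms(3) by (intro exI[of _ "[]"]) (auto simp: awalk_Nil_iff)
    next
      case (reach_step e)
      then obtain p where p: "awalk s p (src e)" "\<forall>a\<in>set p. \<exists>e<m. es ! e = a \<and> x \<le> rk e" by blast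
      have "es ! e \<in> parcs G" using reach_step(2) assms(2) by (metis nth_mem)
      then have "awalk s (p @ [es ! e]) (dst e)"
        using p(1) by (intro awalk_appendI[of _ _ "src e"]) (auto simp: src_def dst_def arc_implies_awalk)
      then show ?case using p(2) reach_step by (intro exI[of _ "p @ [es ! e]"]) auto
    qed
  next
    assume "\<exists>p. awalk s p v \<and> (\<forall>a\<in>set p. \<exists>e<m. es ! e = a \<and> x \<le> rk e)"
    then obtain p where "awalk s p v" "\<forall>a\<in>set p. \<exists>e<m. es ! e = a \<and> x \<le> rk e" by blast
    then show "reach x v"
    proof (induction p arbitrary: v rule: rev_induct)
      case Nil
      then have "v = s" by (auto simp: awalk_Nil_iff)
      then show ?case by (simp only: reach_s)
    next
      case (snoc a p)
      then obtain e where e: "e < m" "es ! e = a" "x \<le> rk e" by auto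
      have "awalk s p (fst a)" "v = snd a" using snoc.prems(1) by (auto simp: awalk_simps)
      with snoc e have "reach x (src e)" "v = dst e" by (auto simp: src_def dst_def)
      with e show ?case by (auto intro: reach_step)
    qed
  qed
qed

text \<open>Rank order refines weight order, so the tie-breaking is invisible in the result: a path
  at threshold \<open>rk e\<close> has capacity at least the weight of \<open>e\<close>, and no path
  does better.\<close>

lemma decode_bottleneck:
  assumes "pair_fin_digraph G" "set es = parcs G" "s \<in> pverts G"
    and "c \<le> m" "v \<noteq> s" "rkc c = Bn v"
  shows "decode_value es w c = bottleneck G w s v"
proof -
  interpret pair_fin_digraph G by fact
  note ra = reach_awalk[OF assms(1-3)]
  have in_es: "\<exists>e<m. es ! e = a" if "awalk s p v" "a \<in> set p" for a p
  proof -
    have "a \<in> parcs G" using that by (auto simp: awalk_def)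
    then show ?thesis using assms(2) by (metis in_set_conv_nth)
  qed
  \<comment> \<open>Otherwise all edges of \<open>p\<close> are strictly heavier than
    \<open>e\<close>, hence of larger rank, and \<open>p\<close> reaches \<open>v\<close> at
    threshold \<open>Suc (rk e)\<close>. As \<open>v \<noteq> s\<close>, the path has an edge, which
    keeps this threshold in the range \<open>1..m\<close> required by
    \<open>Bn_ge_iff\<close>.\<close>
  have le_min: "\<exists>a\<in>set p. w a \<le> w (es ! e)"
    if p: "awalk s p v" and e: "e < m" "Bn v \<le> rk e" for p e
  proof (rule ccontr)
    assume "\<not> ?thesis"
    then have *: "w (es ! e) < w a" if "a \<in> set p" for a using that by force
    have **: "rk e < rk e'" if "e' < m" "es ! e' \<in> set p" for e'
    proof -
      have "\<not> leq e' e" using *[OF that(2)] by (auto simp: leq_def)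
      then show ?thesis using rk_le_iff[of e' e] that e by auto
    qed
    have "reach (Suc (rk e)) v" unfolding ra
      using p ** in_es by (intro exI[of _ p]) (metis Suc_leI)
    moreover have "p \<noteq> []" using p assms(5) by (auto simp: awalk_Nil_iff)
    then obtain a where a: "a \<in> set p" by (cases p) auto
    with in_es[OF p this] ** have "Suc (rk e) \<le> m" using rk_le_m by (metis Suc_leI order.trans)
    ultimately have "Suc (rk e) \<le> Bn v" using Bn_ge_iff[of "Suc (rk e)" v] assms(5) by auto
    with e show False by simp
  qed
  show ?thesis
  proof (cases "c = 0")
    case True
    \<comment> \<open>Every edge has rank at least 1, so any path to \<open>v\<close> would make
      \<open>Bn v\<close> positive.\<close>
    have False if p: "awalk s p v" for p
    proof -
      have "\<forall>a\<in>set p. \<exists>e<m. es ! e = a \<and> 1 \<le> rk e" using in_es[OF p] rk_pos by blast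
      then have "reach 1 v" unfolding ra using p by blast
      moreover have "p \<noteq> []" using p assms(5) by (auto simp: awalk_Nil_iff)
      then have "1 \<le> m" using in_es[OF p, of "hd p"] by force
      ultimately show False using Bn_ge_iff[of 1 v] assms(5,6) True by auto
    qed
    then have "{p. awalk s p v} = {}" by auto
    then show ?thesis using True
      by (simp add: decode_value_def bottleneck_eq_awalk[OF assms(1)] bot_ereal_def)
  next
    case False
    define e where "e = c - 1"
    have e: "e < m" "Bn v = rk e" "c = Suc e" using False assms by (auto simp: e_def rkc_def)
    have "reach (rk e) v" using Bn_ge_iff[of "rk e" v] e rk_pos rk_le_m assms(5) by auto
    then obtain p where p: "awalk s p v" "\<forall>a\<in>set p. \<exists>e'<m. es ! e' = a \<and> rk e \<le> rk e'" unfolding ra by blast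
    have "(SUP p\<in>{p. awalk s p v}. path_capacity w p) = ereal (w (es ! e))"
    proof (rule antisym)
      show "(SUP p\<in>{p. awalk s p v}. path_capacity w p) \<le> ereal (w (es ! e))"
      proof (rule SUP_least)
        fix q assume "q \<in> {p. awalk s p v}"
        with le_min[of q e] e obtain a where "a \<in> set q" "w a \<le> w (es ! e)" by auto
        then show "path_capacity w q \<le> ereal (w (es ! e))"
          unfolding path_capacity_def by (intro INF_lower2[of a]) auto
      qed
      have "ereal (w (es ! e)) \<le> path_capacity w p"
        unfolding path_capacity_def
      proof (rule INF_greatest)
        fix a assume "a \<in> set p"
        then obtain e' where "e' < m" "es ! e' = a" "rk e \<le> rk e'" using p by blast
        then show "ereal (w (es ! e)) \<le> ereal (w a)" using rk_le_iff[of e e'] e by (auto simp: leq_def)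
      qed
      also have "\<dots> \<le> (SUP p\<in>{p. awalk s p v}. path_capacity w p)" using p by (intro SUP_upper) auto
      finally show "ereal (w (es ! e)) \<le> (SUP p\<in>{p. awalk s p v}. path_capacity w p)" .
    qed
    then show ?thesis using e by (simp add: decode_value_def bottleneck_eq_awalk[OF assms(1)])
  qed
qed

lemma decode_source:
  assumes "pair_fin_digraph G" "s \<in> pverts G" "m < c"
  shows "decode_value es w c = bottleneck G w s s"
proof -
  interpret pair_fin_digraph G by fact
  have "awalk s [] s" using assms(2) by (simp add: awalk_Nil_iff)
  then have "path_capacity w [] \<le> (SUP p\<in>{p. awalk s p s}. path_capacity w p)" by (intro SUP_upper) auto
  then show ?thesis using assms(3)
    by (simp add: decode_value_def bottleneck_eq_awalk[OF assms(1)] path_capacity_def top_ereal_def)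
qed

section \<open>Live edges and source values\<close>

text \<open>The search keeps a set \<open>A\<close> of live edges and, for every vertex, a code \<open>h v\<close> of the best
  edge known to lead directly to \<open>v\<close> at its full value. Together they always determine the values \<open>Bn\<close>.\<close>

inductive flow :: "nat set \<Rightarrow> (nat \<Rightarrow> nat) \<Rightarrow> nat \<Rightarrow> nat \<Rightarrow> bool" for A h x where
  flow_h: "x \<le> rkc (h v) \<Longrightarrow> flow A h x v"
| flow_step: "flow A h x (src e) \<Longrightarrow> e \<in> A \<Longrightarrow> x \<le> rk e \<Longrightarrow> flow A h x (dst e)"

definition sinv :: "nat set \<Rightarrow> (nat \<Rightarrow> nat) \<Rightarrow> bool" where
  "sinv A h \<longleftrightarrow> (\<forall>e\<in>A. e < m \<and> src e \<noteq> s \<and> dst e \<noteq> s) \<and>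
     (\<forall>v. h v \<noteq> 0 \<longrightarrow> h v \<le> m \<and> dst (h v - 1) = v) \<and>
     (\<forall>v. rkc (h v) \<le> Bn v) \<and> (\<forall>v. 1 \<le> Bn v \<longrightarrow> flow A h (Bn v) v)"

lemma flow_antimono: "flow A h y v \<Longrightarrow> x \<le> y \<Longrightarrow> flow A h x v"
  by (induction rule: flow.induct) (auto intro: flow.intros)

text \<open>Together with the last clause of \<open>sinv\<close> and \<open>flow_antimono\<close>
  this makes \<open>flow A h x v\<close> equivalent to \<open>x \<le> Bn v\<close> for positive
  \<open>x\<close>.\<close>

lemma flow_sound: "flow A h x v \<Longrightarrow> sinv A h \<Longrightarrow> x \<le> Bn v"
proof (induction rule: flow.induct)
  case (flow_h v)
  then show ?case unfolding sinv_def by (meson order_trans)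
next
  case (flow_step e)
  then show ?case using Bn_edge[of e x] by (auto simp: sinv_def)
qed

lemma sinvD:
  assumes "sinv A h"
  shows "e \<in> A \<Longrightarrow> e < m" "e \<in> A \<Longrightarrow> src e \<noteq> s" "e \<in> A \<Longrightarrow> dst e \<noteq> s"
    "h v \<noteq> 0 \<Longrightarrow> h v \<le> m" "h v \<noteq> 0 \<Longrightarrow> dst (h v - 1) = v" "rkc (h v) \<le> Bn v"
    "1 \<le> Bn v \<Longrightarrow> flow A h (Bn v) v"
  using assms by (auto simp: sinv_def)

text \<open>A path that returns to \<open>s\<close> can be cut there: when the induction meets an
  edge out of \<open>s\<close>, the source value of its head already covers the threshold.\<close>

lemma sinv_init:
  assumes A: "A = {e. e < m \<and> src e \<noteq> s \<and> dst e \<noteq> s}"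
    and h: "\<And>v. h v \<noteq> 0 \<Longrightarrow> h v \<le> m \<and> dst (h v - 1) = v \<and> src (h v - 1) = s \<and> v \<noteq> s"
    and hmax: "\<And>e. e < m \<Longrightarrow> src e = s \<Longrightarrow> dst e \<noteq> s \<Longrightarrow> rk e \<le> rkc (h (dst e))"
  shows "sinv A h"
proof -
  have "rkc (h v) \<le> Bn v" for v
  proof (cases "h v = 0")
    case False
    then show ?thesis using h[OF False] Bn_source[of "h v - 1"] by (auto simp: rkc_def)
  qed simp
  moreover have "flow A h x v" if "reach x v" "v \<noteq> s" for x v
    using that
  proof induction
    case (reach_step e)
    show ?case
    proof (cases "src e = s")
      case True
      then show ?thesis using hmax[of e] reach_step by (intro flow_h) auto
    next
      case False
      with reach_step A show ?thesis by (auto intro: flow_step)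
    qed
  qed simp
  then have "flow A h (Bn v) v" if "1 \<le> Bn v" for v
  proof -
    have "v \<noteq> s" using that by auto
    with that Bn_ge_iff[of "Bn v" v] Bn_le_m have "reach (Bn v) v" by auto
    with \<open>v \<noteq> s\<close> \<open>\<And>x v. reach x v \<Longrightarrow> v \<noteq> s \<Longrightarrow> flow A h x v\<close> show ?thesis by blast
  qed
  ultimately show ?thesis using h by (auto simp: sinv_def A)
qed

text \<open>If the value of the tail is at least \<open>rk e\<close>, the edge is itself the
  limiting one: it delivers exactly its rank to its head, so a source value of that rank replaces it
  without loss.\<close>

lemma sinv_fail:
  assumes I: "sinv A h" and sub: "A' \<subseteq> A"
    and h: "\<And>v. h' v = h v \<or> (\<exists>e\<in>A - A'. h' v = Suc e \<and> dst e = v)"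
    and mono: "\<And>v. rkc (h v) \<le> rkc (h' v)"
    and kill: "\<And>e. e \<in> A - A' \<Longrightarrow> rk e \<le> rkc (h' (dst e)) \<and> rk e \<le> Bn (src e)"
  shows "sinv A' h'"
proof -
  have "flow A' h' x v" if "flow A h x v" for x v
    using that
  proof induction
    case (flow_h v)
    then show ?case using mono[of v] by (intro flow.flow_h) auto
  next
    case (flow_step e)
    show ?case
    proof (cases "e \<in> A'")
      case True
      with flow_step show ?thesis by (auto intro: flow.flow_step)
    next
      case False
      with flow_step kill[of e] show ?thesis by (intro flow.flow_h) auto
    qed
  qed
  moreover have "rkc (h' v) \<le> Bn v" for v
  proof -
    have "rkc (h' v) \<le> Bn v" if "e \<in> A - A'" "h' v = Suc e" "dst e = v" for e
      using that kill[of e] Bn_edge[of e "rk e"] sinvD[OF I] by auto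
    then show ?thesis using h[of v] sinvD(6)[OF I, of v] by auto
  qed
  moreover have "h' v \<le> m \<and> dst (h' v - 1) = v" if "h' v \<noteq> 0" for v
    using h[of v] sinvD(1,4,5)[OF I] that by (auto simp: Suc_le_eq)
  ultimately show ?thesis
    using sinvD[OF I] sub unfolding sinv_def by blast
qed

text \<open>Such an edge is too weak for the value of its head, but it may still carry smaller
  thresholds to vertices beyond. Induction from large thresholds downward shows that these arrive at
  the head anyway.\<close>

lemma sinv_kill:
  assumes I: "sinv A h" and sub: "A' \<subseteq> A"
    and kill: "\<And>e. e \<in> A - A' \<Longrightarrow> Bn (src e) < Bn (dst e)"
  shows "sinv A' h"
proof -
  have "\<forall>v. flow A h x v \<longrightarrow> flow A' h x v" if "1 \<le> x" for x
    using that
  proof (induction "m - x" arbitrary: x rule: less_induct)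
    case less
    show ?case
    proof (intro allI impI)
      fix v assume "flow A h x v"
      then show "flow A' h x v"
      proof induction
        case (flow_step e)
        show ?case
        proof (cases "e \<in> A'")
          case True
          with flow_step show ?thesis by (auto intro: flow.flow_step)
        next
          case False
          \<comment> \<open>The dropped edge carried less than the full value of its head, and the
            flow at that larger threshold survives by induction.\<close>
          have "x \<le> Bn (src e)" using flow_sound[OF _ I] flow_step by blast
          then have lt: "x < Bn (dst e)" using kill[of e] flow_step False by auto
          then have "m - Bn (dst e) < m - x" using Bn_le_m[of "dst e"] by auto
          then have "flow A' h (Bn (dst e)) (dst e)"
            using less.hyps[of "Bn (dst e)"] sinvD(7)[OF I, of "dst e"] lt by auto
          then show ?thesis using lt by (auto intro: flow_antimono)
        qed
      qed (rule flow.flow_h)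
    qed
  qed
  then show ?thesis using sinvD[OF I] sub unfolding sinv_def by blast
qed

end

section \<open>The program\<close>

abbreviation Seq_syntax :: "com \<Rightarrow> com \<Rightarrow> com" (infixr ";;" 60) where
  "c ;; d \<equiv> Seq c d"

text \<open>
  Memory: \<open>al\<close> flags the live edges, \<open>h\<close> holds the codes of the source values, \<open>hd\<close> and \<open>nx\<close> the adjacency
  lists, \<open>bh\<close>, \<open>bn\<close> and \<open>bv\<close> the buckets as linked lists of nodes \<open>1..nn\<close>. The sorted sample of size \<open>r\<close> starts
  at \<open>S[o + 1]\<close>. The level of \<open>v\<close> is known to lie in \<open>{lo[v]..<lo[v] + D}\<close>, in the current round it is refined
  to length \<open>Dn\<close>. The entries of \<open>vis\<close> and \<open>asg\<close> are stamped with the round \<open>rd\<close>, so that they need no clearing.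
  Code \<open>0\<close> and sample index \<open>0\<close> stand for \<open>-\<infinity>\<close>; since \<open>And\<close> evaluates both arguments, the comparisons with
  meaningless indices that are made in these cases are masked by the other conjunct.
\<close>

definition leqE :: "aexp \<Rightarrow> aexp \<Rightarrow> bexp" where
  "leqE a b = And (Cmp a b) (Not (And (Cmp b a) (Less b a)))"

definition passE :: "aexp \<Rightarrow> aexp \<Rightarrow> bexp" where
  "passE c e = Not (And (Not (Eq c (Const 0))) (Not (leqE (Sub c (Const 1)) e)))"

definition lamE :: "aexp \<Rightarrow> aexp" where
  "lamE j = Arr ''S'' (Add (Var ''o'') j)"

definition levE :: "aexp \<Rightarrow> aexp \<Rightarrow> bexp" where
  "levE j e = Not (And (Not (Eq j (Const 0))) (Not (leqE (lamE j) e)))"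

text \<open>Indices above \<open>r\<close> act as the threshold plus infinity, so the interval of a
  search may stick out beyond the sample.\<close>

definition aboveE :: "aexp \<Rightarrow> aexp \<Rightarrow> bexp" where
  "aboveE j e = And (Not (Less (Var ''r'') j)) (leqE (lamE j) e)"

definition relax_c :: com where
  "relax_c = Cond (passE (Arr ''h'' (Var ''v'')) (Var ''e''))
     (Store ''h'' (Var ''v'') (Add (Var ''e'') (Const 1))) Skip"

definition push_c :: "string \<Rightarrow> string \<Rightarrow> com" where
  "push_c X G = Assign ''nn'' (Add (Var ''nn'') (Const 1)) ;;
     Store ''bv'' (Var ''nn'') (Var X) ;;
     Store ''bn'' (Var ''nn'') (Arr ''bh'' (Var G)) ;;
     Store ''bh'' (Var G) (Var ''nn'')"

definition loc_body_c :: com where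
  "loc_body_c = Cond (aboveE (Add (Var ''g'') (Var ''p'')) (Var ''e''))
       (Assign ''g'' (Add (Var ''g'') (Var ''p''))) Skip ;;
     Assign ''p'' (Div (Var ''p'') (Const 2))"

definition loc_c :: com where
  "loc_c = Assign ''g'' (Var ''y'') ;; Assign ''p'' (Div (Var ''D'') (Const 2)) ;;
     While (Not (Less (Var ''p'') (Var ''Dn''))) loc_body_c"

text \<open>In the rounds, where \<open>fin\<close> is 0, a new source value must be queued at once,
  for the lower bucket that it belongs to is still to be drained. In the final phase the next scan
  for the best code finds it.\<close>

definition scan_fail_c :: com where
  "scan_fail_c = Store ''al'' (Var ''e'') (Const 0) ;; relax_c ;;
     Cond (And (Eq (Var ''fin'') (Const 0)) (And (Not (Eq (Arr ''asg'' (Var ''v'')) (Var ''rd'')))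
         (levE (Arr ''lo'' (Var ''v'')) (Var ''e''))))
       (Assign ''y'' (Arr ''lo'' (Var ''v'')) ;; loc_c ;; push_c ''v'' ''g'') Skip"

definition scan_body_c :: com where
  "scan_body_c = Cond (Eq (Mod (Var ''a'') (Const 2)) (Const 0))
       (Assign ''e'' (Sub (Div (Var ''a'') (Const 2)) (Const 1)) ;;
        Cond (Eq (Arr ''al'' (Var ''e'')) (Const 1))
          (Assign ''v'' (Arr ''dst'' (Var ''e'')) ;;
           Cond (passE (Var ''th'') (Var ''e''))
             (Cond (Eq (Arr ''asg'' (Var ''v'')) (Var ''rd'')) Skip (push_c ''v'' ''bi''))
             scan_fail_c)
          Skip)
       Skip ;;
     Assign ''a'' (Arr ''nx'' (Var ''a''))"

definition scan_c :: com where
  "scan_c = While (Not (Eq (Var ''a'') (Const 0))) scan_body_c"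

text \<open>The factor \<open>fin\<close> lets the same code serve the rounds, where
  \<open>out\<close> keeps the value 0, and the final phase, where \<open>th\<close> is the code of
  the value just settled.\<close>

definition visit_c :: com where
  "visit_c = Store ''asg'' (Var ''x'') (Var ''rd'') ;; Store ''lo'' (Var ''x'') (Var ''bi'') ;;
     Store ''out'' (Var ''x'') (Mul (Var ''th'') (Var ''fin'')) ;;
     Assign ''a'' (Arr ''hd'' (Var ''x'')) ;; scan_c"

definition drain_body_c :: com where
  "drain_body_c = Assign ''c'' (Arr ''bh'' (Var ''bi'')) ;; Assign ''x'' (Arr ''bv'' (Var ''c'')) ;;
      Store ''bh'' (Var ''bi'') (Arr ''bn'' (Var ''c'')) ;;
      Cond (Eq (Arr ''asg'' (Var ''x'')) (Var ''rd'')) Skip visit_c"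

definition drain_c :: com where
  "drain_c = While (Not (Eq (Arr ''bh'' (Var ''bi'')) (Const 0))) drain_body_c"

definition dial_body_c :: com where
  "dial_body_c = Assign ''i'' (Sub (Var ''i'') (Const 1)) ;; Assign ''bi'' (Var ''i'') ;;
     Cond (Eq (Var ''i'') (Const 0)) (Assign ''th'' (Const 0))
       (Assign ''th'' (Add (lamE (Var ''i'')) (Const 1))) ;;
     drain_c"

text \<open>Dial's bucket queue with sample indices as keys, from the highest down. Bucket 0 is
  drained with code 0, that is minus infinity, at which every edge passes.\<close>

definition dial_c :: com where
  "dial_c = Assign ''i'' (Add (Var ''r'') (Const 1)) ;; While (Less (Const 0) (Var ''i'')) dial_body_c"

definition kill_body_c :: com where
  "kill_body_c = Cond (Eq (Arr ''lo'' (Arr ''src'' (Var ''i''))) (Arr ''lo'' (Arr ''dst'' (Var ''i'')))) Skip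
       (Store ''al'' (Var ''i'') (Const 0)) ;;
     Assign ''i'' (Add (Var ''i'') (Const 1))"

definition kill_c :: com where
  "kill_c = Assign ''i'' (Const 0) ;; While (Less (Var ''i'') (Var ''m'')) kill_body_c"

text \<open>\<open>u\<close> and \<open>par\<close> hold vertex numbers increased by one, with 0
  below the root; \<open>pt\<close> points to the unread rest of an adjacency list. Edges are
  followed in both directions, so an undirected component is explored.\<close>

definition dfs_body_c :: com where
  "dfs_body_c = Assign ''a'' (Arr ''pt'' (Sub (Var ''u'') (Const 1))) ;;
      Cond (Eq (Var ''a'') (Const 0))
        (Assign ''u'' (Arr ''par'' (Sub (Var ''u'') (Const 1))))
        (Store ''pt'' (Sub (Var ''u'') (Const 1)) (Arr ''nx'' (Var ''a'')) ;;
         Assign ''e'' (Sub (Div (Var ''a'') (Const 2)) (Const 1)) ;;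
         Cond (Eq (Arr ''al'' (Var ''e'')) (Const 1))
           (Cond (Eq (Mod (Var ''a'') (Const 2)) (Const 0))
              (Assign ''v'' (Arr ''dst'' (Var ''e''))) (Assign ''v'' (Arr ''src'' (Var ''e''))) ;;
            Cond (Eq (Arr ''vis'' (Var ''v'')) (Var ''rd'')) Skip
              (Store ''vis'' (Var ''v'') (Var ''rd'') ;;
               Store ''pt'' (Var ''v'') (Arr ''hd'' (Var ''v'')) ;;
               Store ''par'' (Var ''v'') (Var ''u'') ;;
               Store ''L'' (Var ''k'') (Var ''v'') ;;
               Assign ''k'' (Add (Var ''k'') (Const 1)) ;;
               Assign ''u'' (Add (Var ''v'') (Const 1))))
           Skip)"

definition dfs_c :: com where
  "dfs_c = Store ''vis'' (Var ''v'') (Var ''rd'') ;; Store ''pt'' (Var ''v'') (Arr ''hd'' (Var ''v'')) ;;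
     Store ''par'' (Var ''v'') (Const 0) ;; Store ''L'' (Const 0) (Var ''v'') ;;
     Assign ''k'' (Const 1) ;; Assign ''u'' (Add (Var ''v'') (Const 1)) ;;
     While (Not (Eq (Var ''u'') (Const 0))) dfs_body_c"

text \<open>\<open>g\<close> still holds the interval found by the last search. Two comparisons
  decide whether the next code falls into it, and only a miss costs a search.\<close>

definition locate_body_c :: com where
  "locate_body_c = Assign ''x'' (Arr ''L'' (Var ''t'')) ;;
        Cond (Eq (Arr ''h'' (Var ''x'')) (Const 0)) Skip
          (Assign ''e'' (Sub (Arr ''h'' (Var ''x'')) (Const 1)) ;;
           Assign ''y'' (Arr ''lo'' (Var ''x'')) ;;
           Cond (levE (Var ''y'') (Var ''e''))
             (Cond (And (levE (Var ''g'') (Var ''e'')) (Not (aboveE (Add (Var ''g'') (Var ''Dn'')) (Var ''e''))))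
                Skip loc_c ;;
              push_c ''x'' ''g'')
             Skip) ;;
     Assign ''t'' (Add (Var ''t'') (Const 1))"

definition locate_c :: com where
  "locate_c = Assign ''g'' (Arr ''lo'' (Arr ''L'' (Const 0))) ;; Assign ''t'' (Const 0) ;;
     While (Less (Var ''t'') (Var ''k'')) locate_body_c"

definition comps_body_c :: "com \<Rightarrow> com" where
  "comps_body_c b = Assign ''v'' (Arr ''dst'' (Var ''i'')) ;;
     Cond (Eq (Arr ''vis'' (Var ''v'')) (Var ''rd'')) Skip (dfs_c ;; b) ;;
     Assign ''i'' (Add (Var ''i'') (Const 1))"

definition comps_c :: "com \<Rightarrow> com" where
  "comps_c b = Assign ''i'' (Const 0) ;; While (Less (Var ''i'') (Var ''m'')) (comps_body_c b)"

definition round_c :: com where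
  "round_c = Assign ''rd'' (Add (Var ''rd'') (Const 1)) ;;
     Assign ''Dn'' (Div (Var ''D'') (Var ''z'')) ;;
     comps_c (Cond (Less (Var ''T'') (Var ''k'')) locate_c Skip) ;;
     dial_c ;; kill_c ;; Assign ''D'' (Var ''Dn'')"

definition best_body_c :: com where
  "best_body_c = Assign ''x'' (Arr ''L'' (Var ''t'')) ;;
        Cond (And (And (Not (Eq (Arr ''asg'' (Var ''x'')) (Var ''rd''))) (Not (Eq (Arr ''h'' (Var ''x'')) (Const 0))))
            (passE (Var ''b'') (Sub (Arr ''h'' (Var ''x'')) (Const 1))))
          (Assign ''b'' (Arr ''h'' (Var ''x''))) Skip ;;
     Assign ''t'' (Add (Var ''t'') (Const 1))"

definition best_c :: com where
  "best_c = Assign ''b'' (Const 0) ;; Assign ''t'' (Const 0) ;;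
     While (Less (Var ''t'') (Var ''k'')) best_body_c"

text \<open>The best code names its own vertex, as the head of the edge \<open>b - 1\<close>. Bucket
  0 suffices because a single threshold is active at a time.\<close>

definition peel_body_c :: com where
  "peel_body_c = best_c ;;
        Cond (Eq (Var ''b'') (Const 0)) (Assign ''go'' (Const 0))
          (Assign ''th'' (Var ''b'') ;; Assign ''bi'' (Const 0) ;;
           Assign ''v'' (Arr ''dst'' (Sub (Var ''b'') (Const 1))) ;;
           push_c ''v'' ''bi'' ;; drain_c)"

definition peel_c :: com where
  "peel_c = Assign ''go'' (Const 1) ;; While (Eq (Var ''go'') (Const 1)) peel_body_c"

definition search_c :: com where
  "search_c = While (Less (Var ''rd'') (Var ''T'')) round_c ;;
     Assign ''fin'' (Const 1) ;; Assign ''rd'' (Add (Var ''rd'') (Const 1)) ;;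
     comps_c peel_c ;;
     Store ''out'' (Var ''s'') (Add (Var ''m'') (Const 1))"

lemma credit_le: "Suc 0 \<le> n - k \<longleftrightarrow> Suc k \<le> n" by auto

lemmas wps = wp_Skip wp_Assign wp_Store wp_Seq wp_Cond credit_le

lemma wv_relax: "wvars relax_c = {}" "warrs relax_c = {''h''}"
  by (auto simp: relax_c_def)
lemma wv_push: "wvars (push_c X G) = {''nn''}" "warrs (push_c X G) = {''bv'', ''bn'', ''bh''}"
  by (auto simp: push_c_def)
lemma wv_loc: "wvars loc_body_c = {''g'', ''p''}" "warrs loc_body_c = {}"
  "wvars loc_c = {''g'', ''p''}" "warrs loc_c = {}"
  by (auto simp: loc_c_def loc_body_c_def)
lemma wv_scan: "wvars scan_body_c = {''g'', ''p'', ''nn'', ''a'', ''e'', ''v'', ''y''}"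
  "warrs scan_body_c = {''h'', ''al'', ''bv'', ''bn'', ''bh''}"
  "wvars scan_c = {''g'', ''p'', ''nn'', ''a'', ''e'', ''v'', ''y''}"
  "warrs scan_c = {''h'', ''al'', ''bv'', ''bn'', ''bh''}"
  by (auto simp: scan_c_def scan_body_c_def scan_fail_c_def wv_relax wv_push wv_loc)
lemma wv_visit: "wvars visit_c = {''g'', ''p'', ''nn'', ''a'', ''e'', ''v'', ''y''}"
  "warrs visit_c = {''h'', ''al'', ''bv'', ''bn'', ''bh'', ''asg'', ''lo'', ''out''}"
  by (auto simp: visit_c_def wv_scan)
lemma wv_drain: "wvars drain_body_c = {''g'', ''p'', ''nn'', ''a'', ''e'', ''v'', ''y'', ''c'', ''x''}"
  "warrs drain_body_c = {''h'', ''al'', ''bv'', ''bn'', ''bh'', ''asg'', ''lo'', ''out''}"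
  "wvars drain_c = {''g'', ''p'', ''nn'', ''a'', ''e'', ''v'', ''y'', ''c'', ''x''}"
  "warrs drain_c = {''h'', ''al'', ''bv'', ''bn'', ''bh'', ''asg'', ''lo'', ''out''}"
  by (auto simp: drain_c_def drain_body_c_def wv_visit)
lemma wv_dial: "wvars dial_body_c = {''g'', ''p'', ''nn'', ''a'', ''e'', ''v'', ''y'', ''c'', ''x'', ''i'', ''bi'', ''th''}"
  "warrs dial_body_c = {''h'', ''al'', ''bv'', ''bn'', ''bh'', ''asg'', ''lo'', ''out''}"
  "wvars dial_c = {''g'', ''p'', ''nn'', ''a'', ''e'', ''v'', ''y'', ''c'', ''x'', ''i'', ''bi'', ''th''}"
  "warrs dial_c = {''h'', ''al'', ''bv'', ''bn'', ''bh'', ''asg'', ''lo'', ''out''}"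
  by (auto simp: dial_c_def dial_body_c_def wv_drain)
lemma wv_kill: "wvars kill_body_c = {''i''}" "warrs kill_body_c = {''al''}"
  "wvars kill_c = {''i''}" "warrs kill_c = {''al''}"
  by (auto simp: kill_c_def kill_body_c_def)
lemma wv_dfs: "wvars dfs_body_c = {''a'', ''u'', ''e'', ''v'', ''k''}"
  "warrs dfs_body_c = {''pt'', ''vis'', ''par'', ''L''}"
  "wvars dfs_c = {''a'', ''u'', ''e'', ''v'', ''k''}"
  "warrs dfs_c = {''pt'', ''vis'', ''par'', ''L''}"
  by (auto simp: dfs_c_def dfs_body_c_def)
lemma wv_locate: "wvars locate_body_c = {''g'', ''p'', ''nn'', ''t'', ''x'', ''e'', ''y''}"
  "warrs locate_body_c = {''bv'', ''bn'', ''bh''}"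
  "wvars locate_c = {''g'', ''p'', ''nn'', ''t'', ''x'', ''e'', ''y''}"
  "warrs locate_c = {''bv'', ''bn'', ''bh''}"
  by (auto simp: locate_c_def locate_body_c_def wv_push wv_loc)
lemma wv_best: "wvars best_body_c = {''b'', ''t'', ''x''}" "warrs best_body_c = {}"
  "wvars best_c = {''b'', ''t'', ''x''}" "warrs best_c = {}"
  by (auto simp: best_c_def best_body_c_def)
lemma wv_peel: "wvars peel_body_c = {''g'', ''p'', ''nn'', ''a'', ''e'', ''v'', ''y'', ''c'', ''x'', ''go'', ''b'', ''t'', ''th'', ''bi''}"
  "warrs peel_body_c = {''h'', ''al'', ''bv'', ''bn'', ''bh'', ''asg'', ''lo'', ''out''}"
  "wvars peel_c = {''g'', ''p'', ''nn'', ''a'', ''e'', ''v'', ''y'', ''c'', ''x'', ''go'', ''b'', ''t'', ''th'', ''bi''}"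
  "warrs peel_c = {''h'', ''al'', ''bv'', ''bn'', ''bh'', ''asg'', ''lo'', ''out''}"
  by (auto simp: peel_c_def peel_body_c_def wv_best wv_drain wv_push)
lemma wv_comps: "wvars (comps_body_c b) = {''i'', ''a'', ''u'', ''e'', ''v'', ''k''} \<union> wvars b"
  "warrs (comps_body_c b) = {''pt'', ''vis'', ''par'', ''L''} \<union> warrs b"
  "wvars (comps_c b) = {''i'', ''a'', ''u'', ''e'', ''v'', ''k''} \<union> wvars b"
  "warrs (comps_c b) = {''pt'', ''vis'', ''par'', ''L''} \<union> warrs b"
  by (auto simp: comps_c_def comps_body_c_def wv_dfs)

section \<open>Linked lists\<close>

text \<open>The cap \<open>c - 1\<close> makes the recursion total. It is inactive on the lists of
  the program, whose links always point to smaller numbers.\<close>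

fun lst :: "(nat \<Rightarrow> nat) \<Rightarrow> nat \<Rightarrow> nat list" where
  "lst nx c = (if c = 0 then [] else c # lst nx (min (nx c) (c - 1)))"

declare lst.simps[simp del]

lemma lst_0[simp]: "lst nx 0 = []" by (simp add: lst.simps)
lemma lst_step: "c \<noteq> 0 \<Longrightarrow> nx c < c \<Longrightarrow> lst nx c = c # lst nx (nx c)"
  by (subst lst.simps) (simp add: min_absorb1)
lemma lst_le: "x \<in> set (lst nx c) \<Longrightarrow> 1 \<le> x \<and> x \<le> c"
proof (induction nx c rule: lst.induct)
  case (1 nx c)
  show ?case
  proof (cases "c = 0")
    case False
    have "x = c \<or> x \<in> set (lst nx (min (nx c) (c - 1)))"
      using "1.prems" False by (subst (asm) lst.simps) auto
    then show ?thesis using "1.IH"[OF False] False by auto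
  qed (use 1 in simp)
qed
lemma lst_upd: "c < q \<Longrightarrow> lst (nx(q := y)) c = lst nx c"
proof (induction nx c rule: lst.induct)
  case (1 nx c)
  then show ?case by (subst (1 2) lst.simps) (auto simp: fun_upd_other simp del: fun_upd_apply)
qed

definition bkt :: "state \<Rightarrow> nat \<Rightarrow> nat set" where
  "bkt st j = arr st ''bv'' ` set (lst (arr st ''bn'') (arr st ''bh'' j))"

text \<open>Counts entries with multiplicity, unlike the sets \<open>bkt\<close>: a vertex can be
  queued repeatedly, and each entry costs a pop.\<close>

definition blen :: "nat \<Rightarrow> state \<Rightarrow> nat" where
  "blen r st = (\<Sum>j\<le>r. length (lst (arr st ''bn'') (arr st ''bh'' j)))"

definition bwf :: "state \<Rightarrow> bool" where
  "bwf st \<longleftrightarrow> (\<forall>c. c \<noteq> 0 \<longrightarrow> arr st ''bn'' c < c) \<and> (\<forall>j. arr st ''bh'' j \<le> scalar st ''nn'')"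

lemma bkt_cong:
  assumes "arr st' ''bv'' = arr st ''bv''" "arr st' ''bn'' = arr st ''bn''" "arr st' ''bh'' = arr st ''bh''"
  shows "bkt st' = bkt st" "blen r st' = blen r st"
    "scalar st' ''nn'' = scalar st ''nn'' \<Longrightarrow> bwf st' = bwf st"
  using assms by (simp_all add: bkt_def[abs_def] blen_def bwf_def)

text \<open>The fresh node number exceeds every list head, so by \<open>lst_upd\<close> the older
  lists stay as they are. The 7 steps are four assignments or stores and three sequencing
  steps.\<close>

lemma wp_push:
  assumes bw: "bwf st" and nn: "scalar st ''nn'' + 1 < M" and g: "scalar st G \<le> r" and X: "X \<noteq> ''nn''" "G \<noteq> ''nn''"
    and n: "7 \<le> n"
    and Q: "\<And>st'. unch (push_c X G) st st' \<Longrightarrow> bwf st' \<Longrightarrow> scalar st' ''nn'' = scalar st ''nn'' + 1 \<Longrightarrow>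
       bkt st' = (bkt st)(scalar st G := insert (scalar st X) (bkt st (scalar st G))) \<Longrightarrow>
       blen r st' = blen r st + 1 \<Longrightarrow> Q st' (n - 7)"
  shows "wp M le (push_c X G) Q st n"
proof -
  define q where "q = scalar st ''nn'' + 1"
  define gg where "gg = scalar st G"
  define xx where "xx = scalar st X"
  have bw': "\<And>c. c \<noteq> 0 \<Longrightarrow> arr st ''bn'' c < c" "\<And>j. arr st ''bh'' j < q"
    using bw by (auto simp: bwf_def q_def less_Suc_eq_le)
  have M1: "1 < M" "q < M" using nn by (auto simp: q_def)
  define st' where "st' = upda ''bh'' gg q (upda ''bn'' q (arr st ''bh'' gg) (upda ''bv'' q xx (upds ''nn'' q st)))"
  have old: "lst (arr st' ''bn'') (arr st ''bh'' j) = lst (arr st ''bn'') (arr st ''bh'' j)" for j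
    using bw'(2)[of j] by (simp add: st'_def lst_upd)
  have new: "lst (arr st' ''bn'') q = q # lst (arr st ''bn'') (arr st ''bh'' gg)"
    using bw'(2)[of gg] by (subst lst_step) (auto simp: st'_def q_def lst_upd)
  have L: "lst (arr st' ''bn'') (arr st' ''bh'' j) = (if j = gg then q # lst (arr st ''bn'') (arr st ''bh'' gg)
     else lst (arr st ''bn'') (arr st ''bh'' j))" for j
    using old[of j] new by (auto simp: st'_def)
  have bvq: "arr st' ''bv'' ` set (lst (arr st ''bn'') (arr st ''bh'' j)) = bkt st j" for j
    unfolding bkt_def using lst_le[of q "arr st ''bn''" "arr st ''bh'' j"] bw'(2)[of j]
    by (intro image_cong) (auto simp: st'_def)
  have b1: "bkt st' = (bkt st)(gg := insert xx (bkt st gg))"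
  proof
    fix j
    have "bkt st' j = arr st' ''bv'' ` set (if j = gg then q # lst (arr st ''bn'') (arr st ''bh'' gg)
     else lst (arr st ''bn'') (arr st ''bh'' j))"
      unfolding bkt_def[of st'] L ..
    also have "\<dots> = ((bkt st)(gg := insert xx (bkt st gg))) j"
      using bvq[of j] by (auto simp: st'_def)
    finally show "bkt st' j = ((bkt st)(gg := insert xx (bkt st gg))) j" .
  qed
  have b2: "blen r st' = blen r st + 1"
  proof -
    have "blen r st' = (\<Sum>j\<le>r. length (lst (arr st ''bn'') (arr st ''bh'' j)) + (if j = gg then 1 else 0))"
      unfolding blen_def L by (intro sum.cong) auto
    then show ?thesis using g by (simp add: blen_def sum.distrib gg_def)
  qed
  have b3: "bwf st'" using bw' by (auto simp: bwf_def st'_def less_imp_le)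
  have "wp M le (push_c X G) Q st n \<longleftrightarrow> Q st' (n - 7)"
    using n M1 X by (simp add: push_c_def wps st'_def q_def xx_def gg_def eval_nat_numeral)
  moreover have "Q st' (n - 7)"
    using b1 b2 b3 by (intro Q) (auto simp: unch_def wv_push st'_def gg_def xx_def q_def)
  ultimately show ?thesis by simp
qed

section \<open>Sampled thresholds\<close>

definition blk :: "nat \<Rightarrow> nat \<Rightarrow> nat" where "blk d x = x div d * d"

lemma blk_le: "blk d x \<le> x" by (simp add: blk_def)
lemma blk_mono: "x \<le> y \<Longrightarrow> blk d x \<le> blk d y" by (simp add: blk_def div_le_mono)
lemma dvd_blk: "d dvd blk d x" by (simp add: blk_def)
lemma less_blk: "0 < d \<Longrightarrow> x < blk d x + d"
  by (simp add: blk_def) (metis dividend_less_div_times add.commute)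
lemma blk_eqI: assumes "d dvd g" "g \<le> x" "x < g + d" shows "blk d x = g"
proof -
  obtain q where q: "g = q * d" using assms(1) by (auto simp: dvd_def mult.commute)
  have "x div d = q" using assms q by (intro div_nat_eqI) (auto simp: mult.commute)
  then show ?thesis by (simp add: blk_def q)
qed
lemma le_blk: "d dvd g \<Longrightarrow> 0 < d \<Longrightarrow> g \<le> x \<Longrightarrow> g \<le> blk d x"
  using blk_mono[of g x d] by (auto simp: blk_def dvd_def)
lemma blk_one[simp]: "blk (Suc 0) x = x" by (simp add: blk_def)
text \<open>Fixes an arbitrary sorted sample \<open>lam\<close>; nothing about its distribution is
  assumed, as it affects only the cost. The bounds on \<open>M\<close> exclude overflow of cell
  numbers, vertex numbers increased by one, edge codes and interval ends.\<close>

locale ssbp_run = ssbp_graph +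
  fixes M T r off :: nat and lam :: "nat \<Rightarrow> nat"
  assumes lam_m: "\<And>i. 1 \<le> i \<Longrightarrow> i \<le> r \<Longrightarrow> lam i < length es"
    and lam_mono: "\<And>i j. 1 \<le> i \<Longrightarrow> i < j \<Longrightarrow> j \<le> r \<Longrightarrow> ssbp_graph.rk es w (lam i) < ssbp_graph.rk es w (lam j)"
    and T_pos: "1 \<le> T" and m_T: "length es < 2 ^ (T * T)" and r_m: "r \<le> length es"
    and M_off: "off + r + 1 < M" and M_T: "2 * length es + 2 ^ (T * T) + T + 10 < M"
    and M_src: "\<And>e. e < length es \<Longrightarrow> fst (es ! e) + 1 < M"
    and M_dst: "\<And>e. e < length es \<Longrightarrow> snd (es ! e) + 1 < M"
begin

definition Lev :: "nat \<Rightarrow> nat" where "Lev x = card {i \<in> {1..r}. rk (lam i) \<le> x}"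

lemma Lev_le_r: "Lev x \<le> r"
proof -
  have "card {i \<in> {1..r}. rk (lam i) \<le> x} \<le> card {1..r}" by (rule card_mono) auto
  then show ?thesis by (simp add: Lev_def)
qed

text \<open>Because the sample is sorted, comparing a level with \<open>i\<close> takes a single
  comparison of edges, namely with the \<open>i\<close>-th sample.\<close>

lemma Lev_ge_iff: assumes "1 \<le> i" "i \<le> r" shows "i \<le> Lev x \<longleftrightarrow> rk (lam i) \<le> x"
proof
  assume "rk (lam i) \<le> x"
  then have "rk (lam j) \<le> x" if "1 \<le> j" "j \<le> i" for j
    using lam_mono[of j i] that assms by (cases "j = i") auto
  then have "{1..i} \<subseteq> {i \<in> {1..r}. rk (lam i) \<le> x}" using assms by auto
  from card_mono[OF _ this] show "i \<le> Lev x" by (auto simp: Lev_def)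
next
  assume le: "i \<le> Lev x"
  show "rk (lam i) \<le> x"
  proof (rule ccontr)
    assume c: "\<not> rk (lam i) \<le> x"
    have "\<not> rk (lam j) \<le> x" if "i \<le> j" "j \<le> r" for j
      using lam_mono[of i j] that assms c by (cases "j = i") auto
    then have "{i \<in> {1..r}. rk (lam i) \<le> x} \<subseteq> {1..<i}" by (auto simp: not_le[symmetric])
    from card_mono[OF _ this] have "Lev x \<le> i - 1" by (auto simp: Lev_def)
    with le assms show False by simp
  qed
qed

lemma Lev_mono: "x \<le> y \<Longrightarrow> Lev x \<le> Lev y"
  unfolding Lev_def by (intro card_mono) auto

lemma Lev_pos: "0 < Lev x \<Longrightarrow> 0 < x"
  using Lev_ge_iff[of 1 x] Lev_le_r[of x] rk_pos[of "lam 1"] lam_m[of 1] by auto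

abbreviation le :: "nat \<Rightarrow> nat \<Rightarrow> bool" where "le \<equiv> edge_le es w"

lemma bv_leqE: "av M st a < m \<Longrightarrow> av M st b < m \<Longrightarrow> bv M le st (leqE a b) \<longleftrightarrow> rk (av M st a) \<le> rk (av M st b)"
  by (auto simp: leqE_def rk_le_iff leq_def edge_le_def)

lemma M_small: "1 < M" "2 < M" "3 < M" "10 < M" "2 * m + 10 < M" using M_T by auto

lemma M_1[simp]: "Suc 0 < M" "M \<noteq> Suc 0" "0 < M" using M_small by auto

lemma c_mod[simp]: "Suc 0 mod M = Suc 0" "2 mod M = 2" "3 mod M = 3"
  using M_small by auto

lemma bv_passE: "av M st c \<le> m \<Longrightarrow> av M st e < m \<Longrightarrow> bv M le st (passE c e) \<longleftrightarrow> rkc (av M st c) \<le> rk (av M st e)"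
  using bv_leqE[of st "Sub c (Const 1)" e] by (cases "av M st c = 0") (auto simp: passE_def rkc_def)

definition thr :: "state \<Rightarrow> bool" where
  "thr st \<longleftrightarrow> scalar st ''r'' = r \<and> scalar st ''o'' = off \<and> (\<forall>i. 1 \<le> i \<and> i \<le> r \<longrightarrow> arr st ''S'' (off + i) = lam i)"

lemma av_lamE: "thr st \<Longrightarrow> 1 \<le> av M st j \<Longrightarrow> av M st j \<le> r \<Longrightarrow> av M st (lamE j) = lam (av M st j)"
  using M_off by (auto simp: lamE_def thr_def)

lemma bv_levE: "thr st \<Longrightarrow> av M st j \<le> r \<Longrightarrow> av M st e < m \<Longrightarrow>
    bv M le st (levE j e) \<longleftrightarrow> av M st j \<le> Lev (rk (av M st e))"
  using lam_m[of "av M st j"] Lev_ge_iff[of "av M st j"]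
  by (cases "av M st j = 0") (auto simp: levE_def av_lamE bv_leqE)

lemma bv_aboveE: "thr st \<Longrightarrow> 1 \<le> av M st j \<Longrightarrow> av M st e < m \<Longrightarrow>
    bv M le st (aboveE j e) \<longleftrightarrow> av M st j \<le> Lev (rk (av M st e))"
  using lam_m[of "av M st j"] Lev_ge_iff[of "av M st j"] Lev_le_r[of "rk (av M st e)"]
  by (cases "av M st j \<le> r") (auto simp: aboveE_def av_lamE bv_leqE thr_def[of st])

text \<open>The interval shrinks from \<open>Dn * 2 ^ k\<close> to \<open>Dn\<close> by halving and
  stays aligned, so the final \<open>g\<close> is the level rounded down to a multiple of
  \<open>Dn\<close>.\<close>

lemma wp_loc:
  assumes thr: "thr st" and e: "scalar st ''e'' < m" and D: "scalar st ''D'' = scalar st ''Dn'' * 2 ^ k"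
    and Dn: "0 < scalar st ''Dn''" and DM: "m + scalar st ''D'' < M"
    and y: "scalar st ''D'' dvd scalar st ''y''" "scalar st ''y'' \<le> Lev (rk (scalar st ''e''))"
       "Lev (rk (scalar st ''e'')) < scalar st ''y'' + scalar st ''D''"
    and n: "6 * k + 10 \<le> n"
    and Q: "\<And>st' n'. unch loc_c st st' \<Longrightarrow> n \<le> n' + (6 * k + 10) \<Longrightarrow> n' \<le> n \<Longrightarrow>
       scalar st' ''g'' = blk (scalar st ''Dn'') (Lev (rk (scalar st ''e''))) \<Longrightarrow> Q st' n'"
  shows "wp M le loc_c Q st n"
proof -
  define L where "L = Lev (rk (scalar st ''e''))"
  define d where "d = scalar st ''Dn''"
  \<comment> \<open>\<open>p\<close> is half the current length \<open>d * 2 ^ k'\<close>. For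
    \<open>k' = 0\<close> this is \<open>d div 2 < d\<close>, which ends the loop; for larger
    \<open>k'\<close> it is at least \<open>d\<close>.\<close>
  define I where "I = (\<lambda>(st' :: state) n'. \<exists>k'. scalar st' ''p'' = d * 2 ^ k' div 2 \<and> d * 2 ^ k' dvd scalar st' ''g'' \<and>
     scalar st' ''g'' \<le> L \<and> L < scalar st' ''g'' + d * 2 ^ k' \<and> k' \<le> k \<and> 6 * k' + 2 \<le> n' \<and> n + 6 * k' \<le> n' + 6 * k + 5 \<and> n' \<le> n)"
  have dM: "d < M"
  proof -
    have "d \<le> scalar st ''D''" unfolding D d_def by simp
    then show ?thesis using DM by linarith
  qed
  define st0 where "st0 = st\<lparr>scalar := (scalar st)(''g'' := scalar st ''y'', ''p'' := scalar st ''D'' div 2)\<rparr>"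
  have loop: "wp M le (While (Not (Less (Var ''p'') (Var ''Dn''))) loc_body_c) Q st0 n0"
    if n0: "n = n0 + 4" for n0
  proof (rule wp_While[where I = I])
    show "I st0 n0" unfolding I_def using y n n0 by (intro exI[of _ k]) (auto simp: D d_def L_def st0_def)
    next
      fix st' n' assume I: "I st' n'" and u: "unch loc_body_c st0 st'" and b: "bv M le st' (Not (Less (Var ''p'') (Var ''Dn'')))"
      from u have fr: "scalar st' ''Dn'' = d" "scalar st' ''e'' = scalar st ''e''" and thr': "thr st'"
        using thr by (auto simp: unch_def d_def thr_def wv_loc st0_def)
      from I obtain k' where k': "scalar st' ''p'' = d * 2 ^ k' div 2" "d * 2 ^ k' dvd scalar st' ''g''"
       "scalar st' ''g'' \<le> L" "L < scalar st' ''g'' + d * 2 ^ k'" "k' \<le> k" "6 * k' + 2 \<le> n'" "n + 6 * k' \<le> n' + 6 * k + 5" "n' \<le> n"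
        unfolding I_def by blast
      have "k' \<noteq> 0" using b k'(1) fr Dn by (intro notI) (simp add: d_def)
      then obtain l where l: "k' = Suc l" by (cases k') auto
      have p: "scalar st' ''p'' = d * 2 ^ l" using k'(1) l by simp
      have "d * 2 ^ l \<le> scalar st ''D''" using k'(5) l unfolding D d_def by (intro mult_le_mono2 power_increasing) auto
      then have "scalar st' ''g'' + d * 2 ^ l < M" using DM k'(3) Lev_le_r[of "rk (scalar st ''e'')"] r_m by (simp add: L_def)
      then have gp: "(scalar st' ''g'' + scalar st' ''p'') mod M = scalar st' ''g'' + d * 2 ^ l" using p by simp
      have "0 < d * 2 ^ l" using Dn by (simp add: d_def)
      then have d1: "Suc 0 \<le> scalar st' ''g'' + d * 2 ^ l" by linarith
      have ab: "bv M le st' (aboveE (Add (Var ''g'') (Var ''p'')) (Var ''e'')) \<longleftrightarrow> scalar st' ''g'' + d * 2 ^ l \<le> L"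
        using bv_aboveE[OF thr', of "Add (Var ''g'') (Var ''p'')" "Var ''e''"] gp fr(2) e d1 by (simp add: L_def)
      have dv: "d * 2 ^ l dvd scalar st' ''g''" by (rule dvd_trans[OF _ k'(2)]) (simp add: l)
      show "1 \<le> n' \<and> wp M le loc_body_c I st' (n' - 1)"
        using k' l ab gp p dv unfolding I_def
        by (auto simp: loc_body_c_def wps intro!: exI[of _ l])
    next
      fix st' n' assume I: "I st' n'" and u: "unch loc_body_c st0 st'" and b: "\<not> bv M le st' (Not (Less (Var ''p'') (Var ''Dn'')))"
      from u have fr: "scalar st' ''Dn'' = d" by (auto simp: unch_def d_def wv_loc st0_def)
      from I obtain k' where k': "scalar st' ''p'' = d * 2 ^ k' div 2" "d * 2 ^ k' dvd scalar st' ''g''"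
       "scalar st' ''g'' \<le> L" "L < scalar st' ''g'' + d * 2 ^ k'" "k' \<le> k" "6 * k' + 2 \<le> n'" "n + 6 * k' \<le> n' + 6 * k + 5" "n' \<le> n"
        unfolding I_def by blast
      have "k' = 0"
      proof (rule ccontr)
        assume "k' \<noteq> 0"
        then obtain l where "k' = Suc l" by (cases k') auto
        then have "scalar st' ''p'' = d * 2 ^ l" using k'(1) by simp
        moreover have "d * 1 \<le> d * 2 ^ l" by (intro mult_le_mono2) simp
        ultimately show False using b fr by simp
      qed
      then have "scalar st' ''g'' = blk d L" using k' by (intro blk_eqI[symmetric]) auto
      then have "Q st' (n' - 1)" using k' \<open>k' = 0\<close> u
        by (intro Q) (auto simp: unch_def wv_loc d_def L_def st0_def)
      then show "1 \<le> n' \<and> Q st' (n' - 1)" using k'(6) by simp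
  qed
  show ?thesis using n by (auto simp: loc_c_def wps st0_def[symmetric] intro!: loop)
qed

end

section \<open>Draining a bucket\<close>

context ssbp_run
begin

definition As :: "state \<Rightarrow> nat set" where "As st = {v. arr st ''asg'' v = scalar st ''rd''}"
definition Al :: "state \<Rightarrow> nat set" where "Al st = {e. e < m \<and> arr st ''al'' e = 1}"

definition A0 :: "nat set" where "A0 = {e. e < m \<and> src e \<noteq> s \<and> dst e \<noteq> s}"
definition V :: "nat set" where "V = src ` {..<m} \<union> dst ` {..<m}"

text \<open>The codes \<open>2 * e + 2\<close> and \<open>2 * e + 3\<close> stand for the edge \<open>e\<close> as seen from its tail and its head.\<close>

definition adj :: "nat \<Rightarrow> nat list" where
  "adj v = rev (filter (\<lambda>c. 2 \<le> c \<and> c div 2 - 1 \<in> A0 \<and>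
     (if even c then src (c div 2 - 1) else dst (c div 2 - 1)) = v) [0..<2 * m + 2])"

lemma set_adj: "c \<in> set (adj v) \<longleftrightarrow> 2 \<le> c \<and> c < 2 * m + 2 \<and> c div 2 - 1 \<in> A0 \<and>
     (if even c then src (c div 2 - 1) else dst (c div 2 - 1)) = v"
  unfolding adj_def set_rev set_filter set_upt mem_Collect_eq atLeastLessThan_iff by blast

definition stb :: "state \<Rightarrow> bool" where
  "stb st \<longleftrightarrow> thr st \<and> (\<forall>e<m. arr st ''src'' e = src e \<and> arr st ''dst'' e = dst e) \<and>
     scalar st ''m'' = m \<and> scalar st ''T'' = T \<and> scalar st ''z'' = 2 ^ T \<and>
     (\<forall>c. c \<noteq> 0 \<longrightarrow> arr st ''nx'' c < c) \<and> (\<forall>v. lst (arr st ''nx'') (arr st ''hd'' v) = adj v)"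

lemma stb_unch:
  assumes "unch c st st'" "stb st" "{''r'', ''o'', ''m'', ''T'', ''z''} \<inter> wvars c = {}"
    "{''S'', ''src'', ''dst'', ''nx'', ''hd''} \<inter> warrs c = {}"
  shows "stb st'"
  using assms unfolding stb_def thr_def unch_def by auto

lemma stb_thr: "stb st \<Longrightarrow> thr st" by (simp add: stb_def)

section \<open>The effect of scanning edges at one threshold\<close>

text \<open>\<open>F\<close> is the set of edges scanned so far. An edge of rank at least \<open>\<theta>\<close> is passed, any other one is
  removed from \<open>A\<close> and turned into a source value. \<open>X\<close> is an a priori bound on what can be reached.\<close>

definition prel where
  "prel fin d lo X i \<theta> A h S bk F A' h' S' bk' \<longleftrightarrow>
     A' = A - {e \<in> F. rk e < \<theta>} \<and> F \<subseteq> A \<and> (\<forall>e\<in>F. src e \<in> S' - S) \<and>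
     (\<forall>e\<in>F. \<theta> \<le> rk e \<longrightarrow> dst e \<in> S' \<union> bk' i) \<and>
     bk i \<subseteq> S' \<union> bk' i \<and> bk' i \<subseteq> X \<union> S \<and> S \<subseteq> S' \<and> S' - S \<subseteq> X \<and>
     (\<forall>v. h' v = h v \<or> (\<exists>e\<in>A - A'. h' v = Suc e \<and> dst e = v)) \<and>
     (\<forall>v. rkc (h v) \<le> rkc (h' v)) \<and> (\<forall>e\<in>A - A'. rk e \<le> rkc (h' (dst e))) \<and>
     (\<forall>j. j \<noteq> i \<longrightarrow> bk j \<subseteq> bk' j) \<and>
     (\<forall>j x. j \<noteq> i \<longrightarrow> x \<in> bk' j \<longrightarrow> x \<in> bk j \<or>
        fin = (0::nat) \<and> (\<exists>e\<in>A - A'. dst e = x \<and> lo x \<le> Lev (rk e) \<and> j = blk d (Lev (rk e)))) \<and>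
     (fin = 0 \<longrightarrow> (\<forall>e\<in>A - A'. lo (dst e) \<le> Lev (rk e) \<longrightarrow> dst e \<in> S' \<union> bk' (blk d (Lev (rk e)))))"

lemma prelD:
  assumes "prel fin d lo X i \<theta> A h S bk F A' h' S' bk'"
  shows "A' = A - {e \<in> F. rk e < \<theta>}" "F \<subseteq> A" "e \<in> F \<Longrightarrow> src e \<in> S' - S"
    "e \<in> F \<Longrightarrow> \<theta> \<le> rk e \<Longrightarrow> dst e \<in> S' \<union> bk' i" "bk i \<subseteq> S' \<union> bk' i" "bk' i \<subseteq> X \<union> S"
    "S \<subseteq> S'" "S' - S \<subseteq> X" "h' v = h v \<or> (\<exists>e\<in>A - A'. h' v = Suc e \<and> dst e = v)"
    "rkc (h v) \<le> rkc (h' v)" "e \<in> A - A' \<Longrightarrow> rk e \<le> rkc (h' (dst e))"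
    "j \<noteq> i \<Longrightarrow> bk j \<subseteq> bk' j"
    "j \<noteq> i \<Longrightarrow> x \<in> bk' j \<Longrightarrow> x \<in> bk j \<or>
        fin = (0::nat) \<and> (\<exists>e\<in>A - A'. dst e = x \<and> lo x \<le> Lev (rk e) \<and> j = blk d (Lev (rk e)))"
    "fin = 0 \<Longrightarrow> e \<in> A - A' \<Longrightarrow> lo (dst e) \<le> Lev (rk e) \<Longrightarrow> dst e \<in> S' \<union> bk' (blk d (Lev (rk e)))"
proof -
  note P = assms[unfolded prel_def]
  note P1 = P[THEN conjunct1] note R1 = P[THEN conjunct2]
  note P2 = R1[THEN conjunct1] note R2 = R1[THEN conjunct2]
  note P3 = R2[THEN conjunct1] note R3 = R2[THEN conjunct2]
  note P4 = R3[THEN conjunct1] note R4 = R3[THEN conjunct2]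
  note P5 = R4[THEN conjunct1] note R5 = R4[THEN conjunct2]
  note P6 = R5[THEN conjunct1] note R6 = R5[THEN conjunct2]
  note P7 = R6[THEN conjunct1] note R7 = R6[THEN conjunct2]
  note P8 = R7[THEN conjunct1] note R8 = R7[THEN conjunct2]
  note P9 = R8[THEN conjunct1] note R9 = R8[THEN conjunct2]
  note P10 = R9[THEN conjunct1] note R10 = R9[THEN conjunct2]
  note P11 = R10[THEN conjunct1] note R11 = R10[THEN conjunct2]
  note P12 = R11[THEN conjunct1] note R12 = R11[THEN conjunct2]
  note P13 = R12[THEN conjunct1] note P14 = R12[THEN conjunct2]
  show "A' = A - {e \<in> F. rk e < \<theta>}" "F \<subseteq> A" "bk i \<subseteq> S' \<union> bk' i" "bk' i \<subseteq> X \<union> S"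
    "S \<subseteq> S'" "S' - S \<subseteq> X" by (fact P1 P2 P5 P6 P7 P8)+
  show "e \<in> F \<Longrightarrow> src e \<in> S' - S" using P3 by blast
  show "e \<in> F \<Longrightarrow> \<theta> \<le> rk e \<Longrightarrow> dst e \<in> S' \<union> bk' i" using P4 by blast
  show "h' v = h v \<or> (\<exists>e\<in>A - A'. h' v = Suc e \<and> dst e = v)" by (rule P9[THEN spec])
  show "rkc (h v) \<le> rkc (h' v)" by (rule P10[THEN spec])
  show "e \<in> A - A' \<Longrightarrow> rk e \<le> rkc (h' (dst e))" by (rule P11[THEN bspec])
  show "j \<noteq> i \<Longrightarrow> bk j \<subseteq> bk' j" using P12 by blast
  show "j \<noteq> i \<Longrightarrow> x \<in> bk' j \<Longrightarrow> x \<in> bk j \<or>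
        fin = (0::nat) \<and> (\<exists>e\<in>A - A'. dst e = x \<and> lo x \<le> Lev (rk e) \<and> j = blk d (Lev (rk e)))" 
    by (rule P13[THEN spec, THEN spec, THEN mp, THEN mp])
  show "fin = 0 \<Longrightarrow> e \<in> A - A' \<Longrightarrow> lo (dst e) \<le> Lev (rk e) \<Longrightarrow> dst e \<in> S' \<union> bk' (blk d (Lev (rk e)))"
    by (rule P14[THEN mp, THEN bspec, THEN mp])
qed

lemma prelI:
  assumes "A' = A - {e \<in> F. rk e < \<theta>}" "F \<subseteq> A" "\<And>e. e \<in> F \<Longrightarrow> src e \<in> S' - S"
    "\<And>e. e \<in> F \<Longrightarrow> \<theta> \<le> rk e \<Longrightarrow> dst e \<in> S' \<union> bk' i" "bk i \<subseteq> S' \<union> bk' i" "bk' i \<subseteq> X \<union> S"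
    "S \<subseteq> S'" "S' - S \<subseteq> X" "\<And>v. h' v = h v \<or> (\<exists>e\<in>A - A'. h' v = Suc e \<and> dst e = v)"
    "\<And>v. rkc (h v) \<le> rkc (h' v)" "\<And>e. e \<in> A - A' \<Longrightarrow> rk e \<le> rkc (h' (dst e))"
    "\<And>j. j \<noteq> i \<Longrightarrow> bk j \<subseteq> bk' j"
    "\<And>j x. j \<noteq> i \<Longrightarrow> x \<in> bk' j \<Longrightarrow> x \<in> bk j \<or>
        fin = (0::nat) \<and> (\<exists>e\<in>A - A'. dst e = x \<and> lo x \<le> Lev (rk e) \<and> j = blk d (Lev (rk e)))"
    "\<And>e. fin = 0 \<Longrightarrow> e \<in> A - A' \<Longrightarrow> lo (dst e) \<le> Lev (rk e) \<Longrightarrow> dst e \<in> S' \<union> bk' (blk d (Lev (rk e)))"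
  shows "prel fin d lo X i \<theta> A h S bk F A' h' S' bk'"
  unfolding prel_def
  by (intro conjI ballI allI impI; (rule assms; assumption)?; (rule assms)?)

lemma prel_refl: "bk i \<subseteq> X \<union> S \<Longrightarrow> prel fin d lo X i \<theta> A h S bk {} A h S bk"
  by (rule prelI) auto

lemma prel_pass:
  assumes P: "prel fin d lo X i \<theta> A h S bk F A' h' S' bk'" and e: "e \<in> A'" "src e \<in> S' - S" "\<theta> \<le> rk e" "dst e \<in> X \<union> S"
    and b: "dst e \<in> S' \<and> bk'' = bk' \<or> bk'' = bk'(i := insert (dst e) (bk' i))"
  shows "prel fin d lo X i \<theta> A h S bk (insert e F) A' h' S' bk''"
proof -
  note P' = prelD[OF P]
  have F: "{e' \<in> insert e F. rk e' < \<theta>} = {e \<in> F. rk e < \<theta>}" using e by auto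
  have b1: "bk' j \<subseteq> bk'' j" "j \<noteq> i \<Longrightarrow> bk'' j = bk' j" for j using b by auto
  have b2: "dst e \<in> S' \<union> bk'' i" using b by auto
  show ?thesis
  proof (rule prelI)
    show "A' = A - {e' \<in> insert e F. rk e' < \<theta>}" unfolding F by (rule P'(1))
    show "insert e F \<subseteq> A" using e P'(1,2) by blast
    show "e' \<in> insert e F \<Longrightarrow> src e' \<in> S' - S" for e' using P'(3)[of e'] e(2) by blast
    show "e' \<in> insert e F \<Longrightarrow> \<theta> \<le> rk e' \<Longrightarrow> dst e' \<in> S' \<union> bk'' i" for e' using P'(4)[of e'] b1(1)[of i] b2 by blast
    show "bk i \<subseteq> S' \<union> bk'' i" using P'(5) b1(1)[of i] by blast
    show "bk'' i \<subseteq> X \<union> S" using b e(4) P'(6) by auto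
    show "j \<noteq> i \<Longrightarrow> bk j \<subseteq> bk'' j" for j using P'(12)[of j] b1(1)[of j] by blast
    show "j \<noteq> i \<Longrightarrow> x \<in> bk'' j \<Longrightarrow> x \<in> bk j \<or>
        fin = (0::nat) \<and> (\<exists>e\<in>A - A'. dst e = x \<and> lo x \<le> Lev (rk e) \<and> j = blk d (Lev (rk e)))" for j x
      using P'(13)[of j x] b1(2)[of j] by simp
    show "fin = 0 \<Longrightarrow> e' \<in> A - A' \<Longrightarrow> lo (dst e') \<le> Lev (rk e') \<Longrightarrow> dst e' \<in> S' \<union> bk'' (blk d (Lev (rk e')))" for e'
      using P'(14)[of e'] b1(1)[of "blk d (Lev (rk e'))"] by blast
  qed (fact P')+
qed

lemma prel_fail:
  assumes P: "prel fin d lo X i \<theta> A h S bk F A' h' S' bk'" and e: "e \<in> A'" "src e \<in> S' - S" "rk e < \<theta>"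
    and ls: "fin = 0 \<Longrightarrow> Lev (rk e) < i"
    and h: "h'' = h'(dst e := (if rkc (h' (dst e)) \<le> rk e then Suc e else h' (dst e)))"
    and b: "bk'' = (if fin = 0 \<and> dst e \<notin> S' \<and> lo (dst e) \<le> Lev (rk e)
              then bk'(blk d (Lev (rk e)) := insert (dst e) (bk' (blk d (Lev (rk e))))) else bk')"
  shows "prel fin d lo X i \<theta> A h S bk (insert e F) (A' - {e}) h'' S' bk''"
proof -
  note P' = prelD[OF P]
  define j where "j = blk d (Lev (rk e))"
  \<comment> \<open>The level of a failing edge lies below \<open>i\<close>, so its head is queued
    in a lower bucket and the bucket being drained is not touched.\<close>
  have ji: "fin = 0 \<Longrightarrow> j \<noteq> i" using ls blk_le[of d "Lev (rk e)"] by (auto simp: j_def)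
  have eA: "e \<in> A" using e P'(1) by auto
  have bi: "bk'' i = bk' i" using b ji by (auto simp: j_def)
  have bsub: "bk' j' \<subseteq> bk'' j'" for j' using b by auto
  have bnew: "x \<in> bk'' j' \<Longrightarrow> x \<in> bk' j' \<or> fin = 0 \<and> x = dst e \<and> lo x \<le> Lev (rk e) \<and> j' = j" for x j'
    using b by (auto simp: j_def split: if_splits)
  have binc: "fin = 0 \<Longrightarrow> lo (dst e) \<le> Lev (rk e) \<Longrightarrow> dst e \<in> S' \<union> bk'' j" using b by (auto simp: j_def)
  have hn: "h'' v = h' v \<or> h'' v = Suc e \<and> dst e = v" "rkc (h' v) \<le> rkc (h'' v)" "rk e \<le> rkc (h'' (dst e))" for v
    using h by auto
  have AA: "A - (A' - {e}) = insert e (A - A')" using eA by auto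
  show ?thesis
  proof (rule prelI, unfold AA)
    show "A' - {e} = A - {e' \<in> insert e F. rk e' < \<theta>}" using P'(1) e by blast
    show "insert e F \<subseteq> A" using P'(2) eA by blast
    show "e' \<in> insert e F \<Longrightarrow> src e' \<in> S' - S" for e' using P'(3)[of e'] e(2) by blast
    show "e' \<in> insert e F \<Longrightarrow> \<theta> \<le> rk e' \<Longrightarrow> dst e' \<in> S' \<union> bk'' i" for e' using P'(4)[of e'] e(3) bi by (cases "e' = e") simp_all
    show "bk i \<subseteq> S' \<union> bk'' i" "bk'' i \<subseteq> X \<union> S" using P'(5,6) bi by blast+
    show "h'' v = h v \<or> (\<exists>e\<in>insert e (A - A'). h'' v = Suc e \<and> dst e = v)" for v
      using hn(1)[of v] P'(9)[of v] by auto
    show "rkc (h v) \<le> rkc (h'' v)" for v using P'(10)[of v] hn(2)[of v] by linarith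
    show "e' \<in> insert e (A - A') \<Longrightarrow> rk e' \<le> rkc (h'' (dst e'))" for e'
      using P'(11)[of e'] hn(2)[of "dst e'"] hn(3) by (cases "e' = e") auto
    show "j \<noteq> i \<Longrightarrow> bk j \<subseteq> bk'' j" for j using P'(12)[of j] bsub[of j] by blast
    show "x \<in> bk j' \<or> fin = 0 \<and>
       (\<exists>e\<in>insert e (A - A'). dst e = x \<and> lo x \<le> Lev (rk e) \<and> j' = blk d (Lev (rk e)))" if "j' \<noteq> i" "x \<in> bk'' j'" for j' x
      using P'(13)[OF that(1), of x] bnew[OF that(2)] by (auto simp: j_def)
    show "dst e' \<in> S' \<union> bk'' (blk d (Lev (rk e')))"
      if "fin = 0" "e' \<in> insert e (A - A')" "lo (dst e') \<le> Lev (rk e')" for e'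
      using P'(14)[of e'] bsub[of "blk d (Lev (rk e'))"] binc that unfolding j_def by (cases "e' = e") blast+
  qed (fact P')+
qed

lemma prel_pop:
  assumes P: "prel fin d lo X i \<theta> A h S bk F A' h' S' bk'" and x: "x \<in> bk' i"
    and b: "bk' i \<subseteq> insert x (bk'' i)" "bk'' i \<subseteq> bk' i" "\<And>j. j \<noteq> i \<Longrightarrow> bk'' j = bk' j"
  shows "prel fin d lo X i \<theta> A h S bk F A' h' (insert x S') bk''"
proof -
  note P' = prelD[OF P]
  have b1: "bk' j \<subseteq> insert x (bk'' j)" for j using b by (cases "j = i") auto
  show ?thesis
  proof (rule prelI)
    show "e' \<in> F \<Longrightarrow> src e' \<in> insert x S' - S" for e' using P'(3)[of e'] by blast
    show "e' \<in> F \<Longrightarrow> \<theta> \<le> rk e' \<Longrightarrow> dst e' \<in> insert x S' \<union> bk'' i" for e' using P'(4)[of e'] b(1) by blast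
    show "bk i \<subseteq> insert x S' \<union> bk'' i" "bk'' i \<subseteq> X \<union> S" "S \<subseteq> insert x S'" "insert x S' - S \<subseteq> X"
      using P'(5-8) b(1,2) x by blast+
    show "j \<noteq> i \<Longrightarrow> bk j \<subseteq> bk'' j" for j using P'(12)[of j] b(3)[of j] by simp
    show "j \<noteq> i \<Longrightarrow> x' \<in> bk'' j \<Longrightarrow> x' \<in> bk j \<or>
        fin = (0::nat) \<and> (\<exists>e\<in>A - A'. dst e = x' \<and> lo x' \<le> Lev (rk e) \<and> j = blk d (Lev (rk e)))" for j x'
      using P'(13)[of j x'] b(3)[of j] by simp
    show "fin = 0 \<Longrightarrow> e' \<in> A - A' \<Longrightarrow> lo (dst e') \<le> Lev (rk e') \<Longrightarrow>
        dst e' \<in> insert x S' \<union> bk'' (blk d (Lev (rk e')))" for e'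
      using P'(14)[of e'] b1[of "blk d (Lev (rk e'))"] by blast
  qed (fact P')+
qed

lemma wp_relax:
  assumes "scalar st ''e'' < m" "arr st ''h'' (scalar st ''v'') \<le> m" "2 \<le> n"
    and "Q (upda ''h'' (scalar st ''v'') (if rkc (arr st ''h'' (scalar st ''v'')) \<le> rk (scalar st ''e'')
         then Suc (scalar st ''e'') else arr st ''h'' (scalar st ''v'')) st) (n - 2)"
  shows "wp M le relax_c Q st n"
proof -
  have p: "bv M le st (passE (Arr ''h'' (Var ''v'')) (Var ''e'')) \<longleftrightarrow>
      rkc (arr st ''h'' (scalar st ''v'')) \<le> rk (scalar st ''e'')"
    using bv_passE[of st "Arr ''h'' (Var ''v'')" "Var ''e''"] assms by simp
  have "Suc (scalar st ''e'') < M" using assms(1) M_T by simp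
  moreover have "n - Suc (Suc 0) = n - 2" by simp
  moreover have "st\<lparr>arr := arr st\<rparr> = st" by simp
  ultimately show ?thesis using assms(3,4)
    by (cases "rkc (arr st ''h'' (scalar st ''v'')) \<le> rk (scalar st ''e'')") (simp_all add: relax_c_def wps p)
qed

lemma wp_scan_fail:
  assumes st: "thr st" "bwf st" "scalar st ''nn'' + n < M"
    and e: "e = scalar st ''e''" "e < m" and v: "v = scalar st ''v''" "arr st ''h'' v \<le> m"
    and lo: "arr st ''lo'' v \<le> r"
    and loc: "scalar st ''fin'' = 0 \<Longrightarrow> v \<notin> As st \<Longrightarrow> arr st ''lo'' v \<le> Lev (rk e) \<Longrightarrow>
        scalar st ''D'' = scalar st ''Dn'' * 2 ^ T \<and> 0 < scalar st ''Dn'' \<and> m + scalar st ''D'' < M \<and>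
        scalar st ''D'' dvd arr st ''lo'' v \<and> Lev (rk e) < arr st ''lo'' v + scalar st ''D''"
    and n: "6 * T + 40 \<le> n"
    and Q: "\<And>st' n'. unch scan_fail_c st st' \<Longrightarrow> n \<le> n' + (6 * T + 40) \<Longrightarrow> n' \<le> n \<Longrightarrow>
        Al st' = Al st - {e} \<Longrightarrow>
        arr st' ''h'' = (arr st ''h'')(v := (if rkc (arr st ''h'' v) \<le> rk e then Suc e else arr st ''h'' v)) \<Longrightarrow>
        bkt st' = (if scalar st ''fin'' = 0 \<and> v \<notin> As st \<and> arr st ''lo'' v \<le> Lev (rk e)
          then (bkt st)(blk (scalar st ''Dn'') (Lev (rk e)) := insert v (bkt st (blk (scalar st ''Dn'') (Lev (rk e)))))
          else bkt st) \<Longrightarrow>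
        blen r st' \<le> blen r st + 1 \<Longrightarrow> bwf st' \<Longrightarrow> scalar st' ''nn'' + n' \<le> scalar st ''nn'' + n \<Longrightarrow> Q st' n'"
  shows "wp M le scan_fail_c Q st n"
proof -
  define st1 where "st1 = upda ''al'' e 0 st"
  define st2 where "st2 = upda ''h'' v (if rkc (arr st ''h'' v) \<le> rk e then Suc e else arr st ''h'' v) st1"
  define b where "b = And (Eq (Var ''fin'') (Const 0)) (And (Not (Eq (Arr ''asg'' (Var ''v'')) (Var ''rd'')))
         (levE (Arr ''lo'' (Var ''v'')) (Var ''e'')))"
  have thr2: "thr st2" using st(1) by (simp add: thr_def st2_def st1_def)
  have bb: "bv M le st2 b \<longleftrightarrow> scalar st ''fin'' = 0 \<and> v \<notin> As st \<and> arr st ''lo'' v \<le> Lev (rk e)"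
    using bv_levE[OF thr2, of "Arr ''lo'' (Var ''v'')" "Var ''e''"] lo e v
    by (simp add: b_def As_def st2_def st1_def)
  have Al2: "Al st2 = Al st - {e}" by (auto simp: Al_def st2_def st1_def)
  have bk2: "bkt st2 = bkt st" "blen r st2 = blen r st" "bwf st2"
    using bkt_cong[of st2 st] st(2) by (auto simp: st2_def st1_def)
  have h2: "arr st2 ''h'' = (arr st ''h'')(v := (if rkc (arr st ''h'' v) \<le> rk e then Suc e else arr st ''h'' v))"
    by (simp add: st2_def st1_def)
  have nn2: "scalar st2 ''nn'' = scalar st ''nn''" by (simp add: st2_def st1_def)
  have main: "wp M le (Cond b (Assign ''y'' (Arr ''lo'' (Var ''v'')) ;; loc_c ;; push_c ''v'' ''g'') Skip) Q st2 n2"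
    if n2: "n = n2 + 5" for n2
  proof (cases "bv M le st2 b")
    case False
    have u2: "unch scan_fail_c st st2"
      by (simp add: unch_def st2_def st1_def scan_fail_c_def wv_relax wv_loc wv_push)
    have bk3: "bkt st2 = (if scalar st ''fin'' = 0 \<and> v \<notin> As st \<and> arr st ''lo'' v \<le> Lev (rk e)
          then (bkt st)(blk (scalar st ''Dn'') (Lev (rk e)) := insert v (bkt st (blk (scalar st ''Dn'') (Lev (rk e)))))
          else bkt st)" unfolding bb[symmetric] using False bk2(1) by simp
    have "Q st2 (n2 - 2)"
      by (rule Q[OF u2 _ _ Al2 h2 bk3]) (use n n2 bk2 nn2 in simp_all)
    then show ?thesis using False n n2 by (simp add: wps numeral_2_eq_2)
  next
    case True
    with loc bb have l: "scalar st ''D'' = scalar st ''Dn'' * 2 ^ T" "0 < scalar st ''Dn''" "m + scalar st ''D'' < M"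
        "scalar st ''D'' dvd arr st ''lo'' v" "Lev (rk e) < arr st ''lo'' v + scalar st ''D''" "arr st ''lo'' v \<le> Lev (rk e)" by auto
    define st3 where "st3 = upds ''y'' (arr st ''lo'' v) st2"
    have thr3: "thr st3" using thr2 by (simp add: thr_def st3_def)
    have "wp M le loc_c (wp M le (push_c ''v'' ''g'') Q) st3 n3" if n3: "n2 = n3 + 4" for n3
    proof (rule wp_loc[where k = T])
      fix st4 n4
      assume u4: "unch loc_c st3 st4" and n4: "n3 \<le> n4 + (6 * T + 10)" "n4 \<le> n3"
        and g: "scalar st4 ''g'' = blk (scalar st3 ''Dn'') (Lev (rk (scalar st3 ''e'')))"
      have fr4: "arr st4 = arr st3" "\<And>x. x \<noteq> ''g'' \<Longrightarrow> x \<noteq> ''p'' \<Longrightarrow> scalar st4 x = scalar st3 x"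
        using u4 by (auto simp: unch_def wv_loc)
      have g': "scalar st4 ''g'' = blk (scalar st ''Dn'') (Lev (rk e))"
        using g e by (simp add: st3_def st2_def st1_def)
      have bk4: "bkt st4 = bkt st" "blen r st4 = blen r st" "bwf st4"
        using bkt_cong[of st4 st2] bk2 fr4 by (auto simp: st3_def)
      have nn4: "scalar st4 ''nn'' = scalar st ''nn''" using fr4 by (simp add: st3_def st2_def st1_def)
      show "wp M le (push_c ''v'' ''g'') Q st4 n4"
      proof (rule wp_push[where r = r])
        show "bwf st4" by fact
        show "scalar st4 ''nn'' + 1 < M" using st(3) nn4 n by simp
        show "scalar st4 ''g'' \<le> r" using g' blk_le Lev_le_r order_trans by metis
        show "7 \<le> n4" using n4 n n2 n3 by simp
        fix st5
        assume u5: "unch (push_c ''v'' ''g'') st4 st5" and b5: "bwf st5" "scalar st5 ''nn'' = scalar st4 ''nn'' + 1"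
          "bkt st5 = (bkt st4)(scalar st4 ''g'' := insert (scalar st4 ''v'') (bkt st4 (scalar st4 ''g'')))"
          "blen r st5 = blen r st4 + 1"
        have fr5: "\<And>A. A \<noteq> ''bv'' \<Longrightarrow> A \<noteq> ''bn'' \<Longrightarrow> A \<noteq> ''bh'' \<Longrightarrow> arr st5 A = arr st4 A"
            "\<And>x. x \<noteq> ''nn'' \<Longrightarrow> scalar st5 x = scalar st4 x"
          using u5 by (auto simp: unch_def wv_push)
        show "Q st5 (n4 - 7)"
        proof (rule Q)
          show "unch scan_fail_c st st5"
            using fr5 fr4 by (auto simp: unch_def scan_fail_c_def wv_relax wv_loc wv_push st3_def st2_def st1_def)
          show "Al st5 = Al st - {e}" using fr5 fr4 Al2 by (simp add: Al_def st3_def)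
          show "arr st5 ''h'' = (arr st ''h'')(v := (if rkc (arr st ''h'' v) \<le> rk e then Suc e else arr st ''h'' v))"
            using fr5 fr4 h2 by (simp add: st3_def)
          have "scalar st4 ''v'' = v" using fr4 v by (simp add: st3_def st2_def st1_def)
          then show "bkt st5 = (if scalar st ''fin'' = 0 \<and> v \<notin> As st \<and> arr st ''lo'' v \<le> Lev (rk e)
          then (bkt st)(blk (scalar st ''Dn'') (Lev (rk e)) := insert v (bkt st (blk (scalar st ''Dn'') (Lev (rk e)))))
          else bkt st)" using b5(3) bk4(1) g' True bb by simp
        qed (use b5 bk4 nn4 n4 n n2 n3 in auto)
      qed auto
    qed (use thr3 l e n n2 n3 in \<open>auto simp: st3_def st2_def st1_def\<close>)
    from this[of "n2 - 4"] have "wp M le loc_c (wp M le (push_c ''v'' ''g'') Q) st3 (n2 - 4)" using n n2 by simp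
    moreover have "st2\<lparr>scalar := (scalar st2)(''y'' := arr st2 ''lo'' (scalar st2 ''v''))\<rparr> = st3"
      using v by (simp add: st3_def st2_def st1_def)
    ultimately show ?thesis using True n n2 by (simp add: wps eval_nat_numeral)
  qed
  have "wp M le relax_c (wp M le (Cond b (Assign ''y'' (Arr ''lo'' (Var ''v'')) ;; loc_c ;; push_c ''v'' ''g'') Skip) Q) st1 (n - 3)"
    by (rule wp_relax) (use main[of "n - 5"] e v n in \<open>auto simp: st1_def st2_def\<close>)
  then show ?thesis using n e unfolding scan_fail_c_def b_def[symmetric]
    by (simp add: wps st1_def eval_nat_numeral)
qed

end

lemma unch_trans: "unch c st st' \<Longrightarrow> unch d st' st'' \<Longrightarrow> wvars d \<subseteq> wvars c \<Longrightarrow> warrs d \<subseteq> warrs c \<Longrightarrow> unch c st st''"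
  unfolding unch_def by (metis subsetD)

lemma bkt_scalar[simp]: "bkt (st\<lparr>scalar := f\<rparr>) = bkt st" "blen r (st\<lparr>scalar := f\<rparr>) = blen r st"
  by (simp_all add: bkt_def[abs_def] blen_def)

lemma bwf_scalar: "f ''nn'' = scalar st ''nn'' \<Longrightarrow> bwf (st\<lparr>scalar := f\<rparr>) = bwf st"
  by (simp add: bwf_def)

context ssbp_run
begin

section \<open>Scanning the edges of a vertex and emptying a bucket\<close>

lemma Al_scalar[simp]: "Al (st\<lparr>scalar := f\<rparr>) = Al st"
  by (simp add: Al_def)

lemma As_scalar: "f ''rd'' = scalar st ''rd'' \<Longrightarrow> As (st\<lparr>scalar := f\<rparr>) = As st"
  by (simp add: As_def)

lemma fin_Al[simp]: "finite (Al st)" by (simp add: Al_def)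
lemma fin_V[simp]: "finite V" by (simp add: V_def)

text \<open>Up to settled vertices, \<open>X\<close> is closed under the edges that pass the
  threshold. The last clause places the level of a failing edge inside the old interval of its head,
  which is what the binary search needs.\<close>

definition dpre :: "state \<Rightarrow> nat set \<Rightarrow> bool" where
  "dpre st X \<longleftrightarrow> stb st \<and> bwf st \<and> scalar st ''bi'' \<le> r \<and> scalar st ''th'' \<le> m \<and> scalar st ''fin'' \<le> 1 \<and>
     Al st \<subseteq> A0 \<and> (\<forall>v. arr st ''h'' v \<le> m) \<and> X \<subseteq> V \<and> (\<forall>v. arr st ''lo'' v \<le> r) \<and>
     (\<forall>e\<in>Al st. src e \<in> X \<and> rkc (scalar st ''th'') \<le> rk e \<longrightarrow> dst e \<in> X \<union> As st) \<and>
     bkt st (scalar st ''bi'') \<subseteq> X \<union> As st \<and>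
     (scalar st ''fin'' = 0 \<longrightarrow> (\<forall>e<m. rk e < rkc (scalar st ''th'') \<longrightarrow> Lev (rk e) < scalar st ''bi'') \<and>
        scalar st ''D'' = scalar st ''Dn'' * 2 ^ T \<and> 0 < scalar st ''Dn'' \<and> m + scalar st ''D'' < M \<and>
        (\<forall>e\<in>Al st. src e \<in> X \<and> dst e \<notin> As st \<longrightarrow> scalar st ''D'' dvd arr st ''lo'' (dst e) \<and>
           (rk e < rkc (scalar st ''th'') \<and> arr st ''lo'' (dst e) \<le> Lev (rk e) \<longrightarrow>
             Lev (rk e) < arr st ''lo'' (dst e) + scalar st ''D'')))"

definition DI :: "state \<Rightarrow> nat set \<Rightarrow> nat set \<Rightarrow> state \<Rightarrow> bool" where
  "DI st0 X F st \<longleftrightarrow> prel (scalar st0 ''fin'') (scalar st0 ''Dn'') (arr st0 ''lo'') X (scalar st0 ''bi'')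
       (rkc (scalar st0 ''th'')) (Al st0) (arr st0 ''h'') (As st0) (bkt st0) F (Al st) (arr st ''h'') (As st) (bkt st) \<and>
     bwf st \<and> (\<forall>v. arr st ''lo'' v = (if v \<in> As st - As st0 then scalar st0 ''bi'' else arr st0 ''lo'' v)) \<and>
     (\<forall>v. arr st ''out'' v = (if v \<in> As st - As st0 then scalar st0 ''th'' * scalar st0 ''fin'' else arr st0 ''out'' v)) \<and>
     unch drain_c st0 st"

text \<open>Draining pays for visits of unassigned vertices, for bucket entries, and for the search made when
  an edge dies.\<close>

definition Pot :: "state \<Rightarrow> nat" where
  "Pot st = 80 * (\<Sum>v\<in>V - As st. 1 + length (adj v)) + 20 * blen r st + (10 * T + 100) * card (Al st)"

lemma DI_scalar:
  assumes "DI st0 X F st" "f ''rd'' = scalar st ''rd''" "f ''nn'' = scalar st ''nn''"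
    "\<And>x. x \<notin> wvars drain_c \<Longrightarrow> f x = scalar st x"
  shows "DI st0 X F (st\<lparr>scalar := f\<rparr>)"
  using assms As_scalar[of f st] bwf_scalar[of f st] by (simp add: DI_def unch_def)

lemma Pot_scalar: "f ''rd'' = scalar st ''rd'' \<Longrightarrow> Pot (st\<lparr>scalar := f\<rparr>) = Pot st"
  by (simp add: Pot_def As_scalar)

lemma DI_h: assumes "dpre st0 X" "DI st0 X F st" shows "arr st ''h'' v \<le> m"
proof -
  have "prel (scalar st0 ''fin'') (scalar st0 ''Dn'') (arr st0 ''lo'') X (scalar st0 ''bi'')
       (rkc (scalar st0 ''th'')) (Al st0) (arr st0 ''h'') (As st0) (bkt st0) F (Al st) (arr st ''h'') (As st) (bkt st)"
    using assms(2) by (simp add: DI_def)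
  from prelD(9)[OF this, of v] assms(1) show ?thesis by (auto simp: dpre_def Al_def Suc_le_eq)
qed

text \<open>\<open>R\<close> is the budget reserved for later and \<open>N\<close> a fixed bound on
  \<open>nn + n\<close>. Allocating a node spends steps, so this sum never grows and node numbers
  stay below \<open>M\<close>.\<close>

definition scan_post :: "state \<Rightarrow> nat set \<Rightarrow> nat \<Rightarrow> nat set \<Rightarrow> nat \<Rightarrow> nat \<Rightarrow> nat list \<Rightarrow> nat set \<Rightarrow> nat \<Rightarrow> state \<Rightarrow> nat \<Rightarrow> bool" where
  "scan_post st0 X x S' R a rest F N st n \<longleftrightarrow> DI st0 X F st \<and> scalar st ''x'' = x \<and> As st = S' \<and> scalar st ''a'' = a \<and>
     R + Pot st + 50 * length rest + 7 \<le> n \<and> scalar st ''nn'' + n \<le> N"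

lemma wp_scan_edge:
  assumes pre: "dpre st0 X" and I: "DI st0 X F st" and x: "scalar st ''x'' = x" "As st = S'" "x \<in> S' - As st0"
    and a: "scalar st ''a'' = 2 * e + 2" and e: "e \<in> A0" "src e = x"
    and F': "F' = F \<union> (if e \<in> Al st0 then {e} else {})"
    and n: "R + Pot st + 50 * length rest + 50 \<le> n" "scalar st ''nn'' + n \<le> N" "N < M"
  shows "wp M le (Assign ''e'' (Sub (Div (Var ''a'') (Const 2)) (Const 1)) ;;
        Cond (Eq (Arr ''al'' (Var ''e'')) (Const 1))
          (Assign ''v'' (Arr ''dst'' (Var ''e'')) ;;
           Cond (passE (Var ''th'') (Var ''e''))
             (Cond (Eq (Arr ''asg'' (Var ''v'')) (Var ''rd'')) Skip (push_c ''v'' ''bi''))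
             scan_fail_c)
          Skip) (scan_post st0 X x S' R (2 * e + 2) rest F' N) st n"
proof -
  let ?Q = "scan_post st0 X x S' R (2 * e + 2) rest F' N"
  have u: "unch drain_c st0 st" using I by (simp add: DI_def)
  have em: "e < m" using e by (simp add: A0_def)
  have pr: "prel (scalar st0 ''fin'') (scalar st0 ''Dn'') (arr st0 ''lo'') X (scalar st0 ''bi'')
       (rkc (scalar st0 ''th'')) (Al st0) (arr st0 ''h'') (As st0) (bkt st0) F (Al st) (arr st ''h'') (As st) (bkt st)"
    using I by (simp add: DI_def)
  note P = prelD[OF pr]
  have fr: "scalar st ''th'' = scalar st0 ''th''" "scalar st ''fin'' = scalar st0 ''fin''" "scalar st ''bi'' = scalar st0 ''bi''"
     "scalar st ''D'' = scalar st0 ''D''" "scalar st ''Dn'' = scalar st0 ''Dn''" "scalar st ''rd'' = scalar st0 ''rd''"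
    using u by (simp_all add: unch_def wv_drain)
  have st: "stb st" using stb_unch[OF u] pre by (simp add: dpre_def wv_drain)
  define st1 where "st1 = upds ''e'' e st"
  have I1: "DI st0 X F st1" unfolding st1_def by (rule DI_scalar[OF I]) (auto simp: wv_drain)
  have P1: "Pot st1 = Pot st" unfolding st1_def by (simp add: Pot_scalar)
  have As1: "As st1 = S'" using x by (simp add: st1_def As_scalar)
  have al: "arr st ''al'' e = 1 \<longleftrightarrow> e \<in> Al st" using em by (simp add: Al_def)
  show ?thesis
  proof (cases "e \<in> Al st")
    case False
    have "F' = F" using F' P(1) False by auto
    then have "?Q st1 (n - 4)" using I1 P1 As1 x a n by (simp add: scan_post_def st1_def) linarith
    then show ?thesis using False al a n by (simp add: wps st1_def numeral_2_eq_2[symmetric])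
  next
    case True
    have eAl0: "e \<in> Al st0" using P(1) True by auto
    then have F'': "F' = insert e F" using F' by auto
    have esrc: "src e \<in> As st - As st0" using x e by simp
    have xX: "x \<in> X" using P(8) x by blast
    define v where "v = dst e"
    define st2 where "st2 = upds ''v'' v st1"
    have I2: "DI st0 X F st2" unfolding st2_def by (rule DI_scalar[OF I1]) (auto simp: wv_drain)
    have P2: "Pot st2 = Pot st" unfolding st2_def using P1 by (simp add: Pot_scalar)
    have As2: "As st2 = S'" using As1 by (simp add: st2_def As_scalar)
    have sc2: "scalar st2 ''x'' = x" "scalar st2 ''a'' = 2 * e + 2" "scalar st2 ''e'' = e" "scalar st2 ''v'' = v"
        "scalar st2 ''nn'' = scalar st ''nn''" "scalar st2 ''bi'' = scalar st0 ''bi''" "scalar st2 ''fin'' = scalar st0 ''fin''"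
        "scalar st2 ''D'' = scalar st0 ''D''" "scalar st2 ''Dn'' = scalar st0 ''Dn''"
        "scalar st2 ''th'' = scalar st0 ''th''" "scalar st2 ''rd'' = scalar st0 ''rd''"
      using x a fr by (simp_all add: st2_def st1_def)
    have ar2: "arr st2 = arr st" by (simp add: st2_def st1_def)
    have bk2: "bkt st2 = bkt st" "blen r st2 = blen r st" "bwf st2" "Al st2 = Al st"
      using I2 by (simp_all add: st2_def st1_def DI_def)
    have dv: "arr st ''dst'' e = v" using st em by (simp add: stb_def v_def)
    have pb: "bv M le st2 (passE (Var ''th'') (Var ''e'')) \<longleftrightarrow> rkc (scalar st0 ''th'') \<le> rk e"
      using bv_passE[of st2 "Var ''th''" "Var ''e''"] sc2 em pre by (simp add: dpre_def)
    have red: ?thesis if "wp M le (Cond (passE (Var ''th'') (Var ''e''))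
             (Cond (Eq (Arr ''asg'' (Var ''v'')) (Var ''rd'')) Skip (push_c ''v'' ''bi'')) scan_fail_c) ?Q st2 (n - 5)"
      using that True al a n dv by (simp add: wps st2_def st1_def numeral_2_eq_2[symmetric])
    show ?thesis
    proof (rule red, cases "rkc (scalar st0 ''th'') \<le> rk e")
      case pass: True
      have vX: "dst e \<in> X \<union> As st0" using pre eAl0 pass xX e by (simp add: dpre_def)
      have va: "arr st2 ''asg'' (scalar st2 ''v'') = scalar st2 ''rd'' \<longleftrightarrow> v \<in> S'" using As2 sc2 by (auto simp: As_def)
      have C: "wp M le (Cond (Eq (Arr ''asg'' (Var ''v'')) (Var ''rd'')) Skip (push_c ''v'' ''bi'')) ?Q st2 (n - 6)"
      proof (cases "v \<in> S'")
        case vS: True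
        have "prel (scalar st0 ''fin'') (scalar st0 ''Dn'') (arr st0 ''lo'') X (scalar st0 ''bi'')
       (rkc (scalar st0 ''th'')) (Al st0) (arr st0 ''h'') (As st0) (bkt st0) F' (Al st) (arr st ''h'') (As st) (bkt st)"
          unfolding F'' by (rule prel_pass[OF pr True esrc pass vX]) (use vS x in \<open>auto simp: v_def\<close>)
        then have "DI st0 X F' st2" using I2 As2 x ar2 bk2 by (simp add: DI_def)
        then have "?Q st2 (n - 8)" using P2 As2 sc2 n by (simp add: scan_post_def) linarith
        then show ?thesis using vS va n by (simp add: wps numeral_2_eq_2[symmetric])
      next
        case vS: False
        have "wp M le (push_c ''v'' ''bi'') ?Q st2 (n - 7)"
        proof (rule wp_push[where r = r])
          show "bwf st2" by fact
          show "scalar st2 ''nn'' + 1 < M" using sc2 n by simp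
          show "scalar st2 ''bi'' \<le> r" using sc2 pre by (simp add: dpre_def)
          show "7 \<le> n - 7" using n by simp
          fix st3 assume u3: "unch (push_c ''v'' ''bi'') st2 st3" and b3: "bwf st3" "scalar st3 ''nn'' = scalar st2 ''nn'' + 1"
            "bkt st3 = (bkt st2)(scalar st2 ''bi'' := insert (scalar st2 ''v'') (bkt st2 (scalar st2 ''bi'')))"
            "blen r st3 = blen r st2 + 1"
          have fr3: "\<And>x. x \<noteq> ''nn'' \<Longrightarrow> scalar st3 x = scalar st2 x"
             "\<And>A. A \<notin> {''bv'', ''bn'', ''bh''} \<Longrightarrow> arr st3 A = arr st2 A" using u3 by (simp_all add: unch_def wv_push)
          have As3: "As st3 = S'" "Al st3 = Al st" using As2 fr3 bk2 by (simp_all add: As_def Al_def)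
          have "prel (scalar st0 ''fin'') (scalar st0 ''Dn'') (arr st0 ''lo'') X (scalar st0 ''bi'')
             (rkc (scalar st0 ''th'')) (Al st0) (arr st0 ''h'') (As st0) (bkt st0) F' (Al st) (arr st ''h'') (As st) (bkt st3)"
            unfolding F'' by (rule prel_pass[OF pr True esrc pass vX]) (use b3 sc2 bk2 in \<open>auto simp: v_def\<close>)
          moreover have "unch drain_c st0 st3"
            by (rule unch_trans[of _ _ st2, OF _ u3]) (use I2 in \<open>auto simp: DI_def wv_push wv_drain\<close>)
          ultimately have "DI st0 X F' st3" using I2 As2 As3 x fr3 ar2 b3 by (simp add: DI_def)
          moreover have "Pot st3 = Pot st + 20" using b3 As3 x bk2 by (simp add: Pot_def)
          ultimately show "?Q st3 (n - 7 - 7)" using As3 fr3 sc2 n b3 by (simp add: scan_post_def) linarith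
        qed simp_all
        then show ?thesis using vS va n by (simp add: wps numeral_2_eq_2[symmetric])
      qed
      then show "wp M le (Cond (passE (Var ''th'') (Var ''e''))
             (Cond (Eq (Arr ''asg'' (Var ''v'')) (Var ''rd'')) Skip (push_c ''v'' ''bi'')) scan_fail_c) ?Q st2 (n - 5)"
        using pb pass n wp_Cond[of M le "passE (Var ''th'') (Var ''e'')"] by simp
    next
      case fail: False
      \<comment> \<open>The edge is still live, so its own share \<open>10 * T + 100\<close> of the
        potential is available; it pays for the search made when the edge dies.\<close>
      have "card (Al st) \<noteq> 0" using True by auto
      then have "Suc 0 \<le> card (Al st)" by linarith
      then have "(10 * T + 100) * 1 \<le> (10 * T + 100) * card (Al st)" by (intro mult_le_mono2) simp
      then have "10 * T + 100 \<le> (10 * T + 100) * card (Al st)" by simp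
      then have nbig: "R + 10 * T + 100 + 50 \<le> n" using n(1) unfolding Pot_def by linarith
      have lo2: "v \<notin> As st2 \<Longrightarrow> arr st2 ''lo'' v = arr st0 ''lo'' v" using I2 by (simp add: DI_def)
      have lor: "arr st2 ''lo'' v \<le> r" using I2 pre by (simp add: DI_def dpre_def)
      have C: "wp M le scan_fail_c ?Q st2 (n - 6)"
      proof (rule wp_scan_fail)
        show "thr st2" using st by (simp add: stb_def thr_def st2_def st1_def)
        show "bwf st2" "e < m" "e = scalar st2 ''e''" "v = scalar st2 ''v''" using sc2 em bk2 by simp_all
        show "scalar st2 ''nn'' + (n - 6) < M" using n sc2 by simp
        show "arr st2 ''h'' v \<le> m" using DI_h[OF pre I2] .
        show "arr st2 ''lo'' v \<le> r" by fact
        show "6 * T + 40 \<le> n - 6" using nbig by simp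
        show "scalar st2 ''D'' = scalar st2 ''Dn'' * 2 ^ T \<and> 0 < scalar st2 ''Dn'' \<and> m + scalar st2 ''D'' < M \<and>
          scalar st2 ''D'' dvd arr st2 ''lo'' v \<and> Lev (rk e) < arr st2 ''lo'' v + scalar st2 ''D''"
          if f: "scalar st2 ''fin'' = 0" and w: "v \<notin> As st2" "arr st2 ''lo'' v \<le> Lev (rk e)"
        proof -
          have f0: "scalar st0 ''fin'' = 0" using f sc2 by simp
          have "src e \<in> X \<and> dst e \<notin> As st0 \<longrightarrow> scalar st0 ''D'' dvd arr st0 ''lo'' (dst e) \<and>
             (rk e < rkc (scalar st0 ''th'') \<and> arr st0 ''lo'' (dst e) \<le> Lev (rk e) \<longrightarrow>
             Lev (rk e) < arr st0 ''lo'' (dst e) + scalar st0 ''D'')"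
            using pre f0 eAl0 unfolding dpre_def by blast
          moreover have "scalar st0 ''D'' = scalar st0 ''Dn'' * 2 ^ T" "0 < scalar st0 ''Dn''" "m + scalar st0 ''D'' < M"
            using pre f0 by (simp_all add: dpre_def)
          moreover have "dst e \<notin> As st0" using w(1) As2 x P(7) by (auto simp: v_def)
          ultimately show ?thesis using w lo2[OF w(1)] sc2 xX e fail by (simp add: v_def)
        qed
        fix st3 n3
        assume u3: "unch scan_fail_c st2 st3" and n3: "n - 6 \<le> n3 + (6 * T + 40)" "n3 \<le> n - 6"
          and A3: "Al st3 = Al st2 - {e}"
          and h3: "arr st3 ''h'' = (arr st2 ''h'')(v := (if rkc (arr st2 ''h'' v) \<le> rk e then Suc e else arr st2 ''h'' v))"
          and b3: "bkt st3 = (if scalar st2 ''fin'' = 0 \<and> v \<notin> As st2 \<and> arr st2 ''lo'' v \<le> Lev (rk e)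
          then (bkt st2)(blk (scalar st2 ''Dn'') (Lev (rk e)) := insert v (bkt st2 (blk (scalar st2 ''Dn'') (Lev (rk e)))))
          else bkt st2)" and bl3: "blen r st3 \<le> blen r st2 + 1" "bwf st3"
          and nn3: "scalar st3 ''nn'' + n3 \<le> scalar st2 ''nn'' + (n - 6)"
        have wvf: "wvars scan_fail_c = {''g'', ''p'', ''nn'', ''y''}" "warrs scan_fail_c = {''h'', ''al'', ''bv'', ''bn'', ''bh''}"
          by (auto simp: scan_fail_c_def wv_relax wv_loc wv_push)
        have fr3: "\<And>x. x \<notin> {''g'', ''p'', ''nn'', ''y''} \<Longrightarrow> scalar st3 x = scalar st2 x"
             "\<And>A. A \<notin> {''h'', ''al'', ''bv'', ''bn'', ''bh''} \<Longrightarrow> arr st3 A = arr st2 A"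
          using u3 unfolding unch_def wvf by blast+
        have As3: "As st3 = S'" using As2 fr3 by (simp add: As_def)
        have ff: "rk e < rkc (scalar st0 ''th'')" using fail by simp
        have lo3: "v \<notin> As st \<Longrightarrow> arr st2 ''lo'' v = arr st0 ''lo'' v" using lo2 As2 x by simp
        have "prel (scalar st0 ''fin'') (scalar st0 ''Dn'') (arr st0 ''lo'') X (scalar st0 ''bi'')
             (rkc (scalar st0 ''th'')) (Al st0) (arr st0 ''h'') (As st0) (bkt st0) F' (Al st - {e}) (arr st3 ''h'') (As st) (bkt st3)"
          unfolding F''
        proof (rule prel_fail[OF pr True esrc ff])
          show "scalar st0 ''fin'' = 0 \<Longrightarrow> Lev (rk e) < scalar st0 ''bi''" using pre ff em by (simp add: dpre_def)
          show "arr st3 ''h'' = (arr st ''h'')(dst e := (if rkc (arr st ''h'' (dst e)) \<le> rk e then Suc e else arr st ''h'' (dst e)))"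
            using h3 ar2 by (simp add: v_def)
          show "bkt st3 = (if scalar st0 ''fin'' = 0 \<and> dst e \<notin> As st \<and> arr st0 ''lo'' (dst e) \<le> Lev (rk e)
              then (bkt st)(blk (scalar st0 ''Dn'') (Lev (rk e)) := insert (dst e) (bkt st (blk (scalar st0 ''Dn'') (Lev (rk e))))) else bkt st)"
            unfolding b3 sc2 bk2 v_def[symmetric] As2 x(2) using lo3[unfolded x(2)] by (simp cong: conj_cong)
        qed
        moreover have "unch drain_c st0 st3"
          by (rule unch_trans[of _ _ st2, OF _ u3]) (use I2 in \<open>auto simp: DI_def wvf wv_drain\<close>)
        ultimately have "DI st0 X F' st3" using I2 As2 As3 x fr3 ar2 A3 bk2 bl3 by (simp add: DI_def)
        moreover have "Pot st3 + (10 * T + 100) \<le> Pot st + 20"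
        proof -
          have "card (Al st) = Suc (card (Al st3))" using card_Suc_Diff1[OF fin_Al True] A3 bk2 by simp
          then show ?thesis using bl3 bk2 As3 x by (simp add: Pot_def)
        qed
        ultimately show "?Q st3 n3" using As3 fr3 sc2 n n3 nn3 by (simp add: scan_post_def) linarith
      qed
      then show "wp M le (Cond (passE (Var ''th'') (Var ''e''))
             (Cond (Eq (Arr ''asg'' (Var ''v'')) (Var ''rd'')) Skip (push_c ''v'' ''bi'')) scan_fail_c) ?Q st2 (n - 5)"
        using pb fail n wp_Cond[of M le "passE (Var ''th'') (Var ''e'')"] by simp
    qed
  qed
qed

lemma wp_scan:
  assumes pre: "dpre st0 X" and x: "scalar st ''x'' = x" "x \<in> As st - As st0"
    and I: "DI st0 X {e \<in> Al st0. src e \<in> As st - As st0 - {x}} st"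
    and a: "lst (arr st ''nx'') (scalar st ''a'') = adj x"
    and n: "R + Pot st + 50 * length (adj x) + 7 \<le> n" "scalar st ''nn'' + n \<le> N" "N < M"
    and Q: "\<And>st' n'. DI st0 X {e \<in> Al st0. src e \<in> As st' - As st0} st' \<Longrightarrow> R + Pot st' \<le> n' \<Longrightarrow>
        scalar st' ''nn'' + n' \<le> N \<Longrightarrow> Q st' n'"
  shows "wp M le scan_c Q st n"
proof -
  \<comment> \<open>Only even codes count: an edge is scanned from its tail, although it is listed
    at both ends.\<close>
  define F where "F = (\<lambda>dn. {e \<in> Al st0. src e \<in> As st - As st0 - {x}} \<union> {e \<in> Al st0. src e = x \<and> 2 * e + 2 \<in> set dn})"
  define J where "J = (\<lambda>st' n'. \<exists>dn. adj x = dn @ lst (arr st' ''nx'') (scalar st' ''a'') \<and>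
     scan_post st0 X x (As st) R (scalar st' ''a'') (lst (arr st' ''nx'') (scalar st' ''a'')) (F dn) N st' n')"
  have al0: "Al st0 \<subseteq> A0" using pre by (simp add: dpre_def)
  show ?thesis
    unfolding scan_c_def
  proof (rule wp_While[where I = J])
    show "J st n" unfolding J_def
      by (rule exI[of _ "[]"]) (use a I x n in \<open>simp add: scan_post_def F_def\<close>)
  next
    fix st1 n1 assume J1: "J st1 n1" and b: "bv M le st1 (Not (Eq (Var ''a'') (Const 0)))"
    from J1 obtain dn where dn: "adj x = dn @ lst (arr st1 ''nx'') (scalar st1 ''a'')"
      "scan_post st0 X x (As st) R (scalar st1 ''a'') (lst (arr st1 ''nx'') (scalar st1 ''a'')) (F dn) N st1 n1"
      unfolding J_def by blast
    define a1 where "a1 = scalar st1 ''a''"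
    have I1: "DI st0 X (F dn) st1" and As1: "As st1 = As st" "scalar st1 ''x'' = x"
      and nn1: "scalar st1 ''nn'' + n1 \<le> N" using dn(2) by (simp_all add: scan_post_def)
    have nx0: "arr st1 ''nx'' = arr st0 ''nx''" using I1 by (simp add: DI_def unch_def wv_drain)
    have a0: "a1 \<noteq> 0" using b by (simp add: a1_def)
    have nxlt: "arr st1 ''nx'' a1 < a1" using pre a0 nx0 by (simp add: dpre_def stb_def)
    define rest where "rest = lst (arr st1 ''nx'') (arr st1 ''nx'' a1)"
    have l: "lst (arr st1 ''nx'') a1 = a1 # rest" using lst_step[of a1 "arr st1 ''nx''"] a0 nxlt by (simp add: rest_def)
    have adj: "adj x = (dn @ [a1]) @ rest" using dn(1) l by (simp add: a1_def)
    have n1: "R + Pot st1 + 50 * length rest + 57 \<le> n1" using dn(2) l by (simp add: scan_post_def a1_def)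
    have a1adj: "a1 \<in> set (adj x)" unfolding adj by simp
    have step: "1 \<le> n2 \<and> J (upds ''a'' (arr st2 ''nx'' a1) st2) (n2 - 1)"
      if P: "scan_post st0 X x (As st) R a1 rest (F (dn @ [a1])) N st2 n2" "R + Pot st2 + 50 * length rest + 8 \<le> n2" for st2 n2
    proof -
      have I2: "DI st0 X (F (dn @ [a1])) st2" using P by (simp add: scan_post_def)
      have nx2: "arr st2 ''nx'' = arr st1 ''nx''" using I2 nx0 by (simp add: DI_def unch_def wv_drain)
      have 1: "DI st0 X (F (dn @ [a1])) (upds ''a'' (arr st2 ''nx'' a1) st2)"
        by (rule DI_scalar[OF I2]) (auto simp: wv_drain)
      have 2: "As (upds ''a'' (arr st2 ''nx'' a1) st2) = As st2" by (simp add: As_scalar)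
      have 3: "Pot (upds ''a'' (arr st2 ''nx'' a1) st2) = Pot st2" by (simp add: Pot_scalar)
      show ?thesis unfolding J_def
        using P 1 2 3 adj nx2 by (auto intro!: exI[of _ "dn @ [a1]"] simp: scan_post_def rest_def)
    qed
    let ?Q = "\<lambda>st2 n2. scan_post st0 X x (As st) R a1 rest (F (dn @ [a1])) N st2 n2"
    define c1 where "c1 = Assign ''e'' (Sub (Div (Var ''a'') (Const 2)) (Const 1)) ;;
        Cond (Eq (Arr ''al'' (Var ''e'')) (Const 1))
          (Assign ''v'' (Arr ''dst'' (Var ''e'')) ;;
           Cond (passE (Var ''th'') (Var ''e''))
             (Cond (Eq (Arr ''asg'' (Var ''v'')) (Var ''rd'')) Skip (push_c ''v'' ''bi''))
             scan_fail_c)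
          Skip"
    have body: "scan_body_c = Cond (Eq (Mod (Var ''a'') (Const 2)) (Const 0)) c1 Skip ;; Assign ''a'' (Arr ''nx'' (Var ''a''))"
      by (simp add: scan_body_c_def c1_def)
    have fin: "wp M le (Assign ''a'' (Arr ''nx'' (Var ''a''))) J st2 n2"
      if P: "scan_post st0 X x (As st) (Suc R) a1 rest (F (dn @ [a1])) N st2 n2" for st2 n2
    proof -
      have "scan_post st0 X x (As st) R a1 rest (F (dn @ [a1])) N st2 n2" "R + Pot st2 + 50 * length rest + 8 \<le> n2"
        "scalar st2 ''a'' = a1" using P by (simp_all add: scan_post_def)
      with step[of st2 n2] show ?thesis by (simp add: wps)
    qed
    have odd: "scan_post st0 X x (As st) (Suc R) a1 rest (F (dn @ [a1])) N st1 (n1 - 4)" if "odd a1"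
    proof -
      have "F (dn @ [a1]) = F dn" using that by (auto simp: F_def)
      then show ?thesis using I1 As1 n1 nn1 by (simp add: scan_post_def a1_def) linarith
    qed
    have even: "wp M le c1 (scan_post st0 X x (As st) (Suc R) a1 rest (F (dn @ [a1])) N) st1 (n1 - 3)" if ev: "even a1"
    proof -
      define e where "e = a1 div 2 - 1"
      have e: "a1 = 2 * e + 2" "e \<in> A0" "src e = x" using a1adj ev by (auto simp: set_adj e_def)
      show ?thesis unfolding c1_def e(1)
      proof (rule wp_scan_edge[OF pre I1 As1(2) As1(1) _ _ e(2,3)])
        show "scalar st1 ''a'' = 2 * e + 2" using e by (simp add: a1_def)
        show "F (dn @ [2 * e + 2]) = F dn \<union> (if e \<in> Al st0 then {e} else {})" using e by (auto simp: F_def)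
        show "x \<in> As st - As st0" by fact
      qed (use n1 nn1 n in auto)
    qed
    show "1 \<le> n1 \<and> wp M le scan_body_c J st1 (n1 - 1)"
    proof (cases "even a1")
      case True
      have "wp M le c1 (wp M le (Assign ''a'' (Arr ''nx'' (Var ''a''))) J) st1 (n1 - 3)"
        using even[OF True] by (rule wp_mono) (rule fin)
      then show ?thesis using n1 True unfolding body by (simp add: wps a1_def[symmetric] mod_2_eq_odd numeral_2_eq_2[symmetric])
    next
      case False
      have "wp M le (Assign ''a'' (Arr ''nx'' (Var ''a''))) J st1 (n1 - 4)" by (rule fin[OF odd[OF False]])
      then show ?thesis using n1 False unfolding body
        by (simp add: wps a1_def[symmetric] mod_2_eq_odd numeral_2_eq_2[symmetric])
    qed
  next
    fix st1 n1 assume J1: "J st1 n1" and b: "\<not> bv M le st1 (Not (Eq (Var ''a'') (Const 0)))"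
    from J1 obtain dn where dn: "adj x = dn @ lst (arr st1 ''nx'') (scalar st1 ''a'')"
      "scan_post st0 X x (As st) R (scalar st1 ''a'') (lst (arr st1 ''nx'') (scalar st1 ''a'')) (F dn) N st1 n1"
      unfolding J_def by blast
    have "dn = adj x" using dn(1) b by simp
    have "2 * e + 2 \<in> set (adj x)" if "e \<in> Al st0" "src e = x" for e
      using that al0 by (auto simp: set_adj A0_def)
    then have "F dn = {e \<in> Al st0. src e \<in> As st - As st0}" using x by (auto simp: F_def \<open>dn = adj x\<close>)
    then show "1 \<le> n1 \<and> Q st1 (n1 - 1)" using dn(2) by (auto simp: scan_post_def intro!: Q)
  qed
qed

lemma As_upda[simp]: "A \<noteq> ''asg'' \<Longrightarrow> As (upda A i v st) = As st"
  "As (upda ''asg'' i (scalar st ''rd'') st) = insert i (As st)"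
  by (auto simp: As_def)

text \<open>A pop spends the 20 units of its entry. The first visit of \<open>x\<close> releases
  \<open>80 * (1 + length (adj x))\<close>, of which scanning takes 50 per code, including the 20
  units for a new entry.\<close>

lemma wp_drain:
  assumes pre: "dpre st0 X"
    and n: "R + Pot st0 + 1 \<le> n" "scalar st0 ''nn'' + n \<le> N" "N < M"
    and Q: "\<And>st' n'. DI st0 X {e \<in> Al st0. src e \<in> As st' - As st0} st' \<Longrightarrow> bkt st' (scalar st0 ''bi'') = {} \<Longrightarrow>
        R + Pot st' \<le> n' \<Longrightarrow> scalar st' ''nn'' + n' \<le> N \<Longrightarrow> Q st' n'"
  shows "wp M le drain_c Q st0 n"
proof -
  define J where "J = (\<lambda>st n. DI st0 X {e \<in> Al st0. src e \<in> As st - As st0} st \<and> R + Pot st + 1 \<le> n \<and> scalar st ''nn'' + n \<le> N)"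
  define i where "i = scalar st0 ''bi''"
  have ir: "i \<le> r" using pre by (simp add: dpre_def i_def)
  show ?thesis
    unfolding drain_c_def
  proof (rule wp_While[where I = J])
    have "prel (scalar st0 ''fin'') (scalar st0 ''Dn'') (arr st0 ''lo'') X (scalar st0 ''bi'')
       (rkc (scalar st0 ''th'')) (Al st0) (arr st0 ''h'') (As st0) (bkt st0) {} (Al st0) (arr st0 ''h'') (As st0) (bkt st0)"
      using pre by (intro prel_refl) (simp add: dpre_def)
    then show "J st0 n" using n pre by (simp add: J_def DI_def unch_def dpre_def)
  next
    fix st n assume J: "J st n" and b: "bv M le st (Not (Eq (Arr ''bh'' (Var ''bi'')) (Const 0)))"
    define F where "F = {e \<in> Al st0. src e \<in> As st - As st0}"
    have I: "DI st0 X F st" and nn: "R + Pot st + 1 \<le> n" "scalar st ''nn'' + n \<le> N"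
      using J by (simp_all add: J_def F_def)
    have u: "unch drain_c st0 st" using I by (simp add: DI_def)
    have bi: "scalar st ''bi'' = i" and rd: "scalar st ''rd'' = scalar st0 ''rd''"
      and nx: "arr st ''nx'' = arr st0 ''nx''" "arr st ''hd'' = arr st0 ''hd''"
      and th: "scalar st ''th'' = scalar st0 ''th''" "scalar st ''fin'' = scalar st0 ''fin''"
      using u by (simp_all add: unch_def wv_drain i_def)
    have bw: "bwf st" using I by (simp add: DI_def)
    define c where "c = arr st ''bh'' i"
    define x where "x = arr st ''bv'' c"
    have c0: "c \<noteq> 0" using b bi by (simp add: c_def)
    then have bn: "arr st ''bn'' c < c" using bw by (simp add: bwf_def)
    define st1 where "st1 = upda ''bh'' i (arr st ''bn'' c) (st\<lparr>scalar := (scalar st)(''c'' := c, ''x'' := x)\<rparr>)"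
    have l: "lst (arr st ''bn'') (arr st ''bh'' i) = c # lst (arr st ''bn'') (arr st1 ''bh'' i)"
      using lst_step[of c "arr st ''bn''"] c0 bn by (simp add: c_def[symmetric] st1_def)
    have ar1: "A \<noteq> ''bh'' \<Longrightarrow> arr st1 A = arr st A" for A by (simp add: st1_def)
    have sc1: "y \<noteq> ''c'' \<Longrightarrow> y \<noteq> ''x'' \<Longrightarrow> scalar st1 y = scalar st y" "scalar st1 ''x'' = x" for y by (simp_all add: st1_def)
    have bh1: "j \<noteq> i \<Longrightarrow> arr st1 ''bh'' j = arr st ''bh'' j" for j by (simp add: st1_def)
    have bk1: "bkt st i = insert x (bkt st1 i)" "j \<noteq> i \<Longrightarrow> bkt st1 j = bkt st j" for j
      using l bh1[of j] ar1 by (simp_all add: bkt_def x_def)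
    have bl1: "blen r st = blen r st1 + 1"
    proof -
      have "blen r st = (\<Sum>j\<le>r. length (lst (arr st1 ''bn'') (arr st1 ''bh'' j)) + (if j = i then 1 else 0))"
        unfolding blen_def using l bh1 ar1 by (intro sum.cong) auto
      then show ?thesis using ir by (simp add: blen_def sum.distrib)
    qed
    have bw1: "bwf st1"
    proof -
      have "arr st1 ''bh'' j \<le> scalar st ''nn''" for j
        using bw bn bh1[of j] by (cases "j = i") (auto simp: bwf_def st1_def c_def intro: le_trans less_imp_le)
      then show ?thesis using bw ar1 sc1 by (simp add: bwf_def)
    qed
    have pr: "prel (scalar st0 ''fin'') (scalar st0 ''Dn'') (arr st0 ''lo'') X i
       (rkc (scalar st0 ''th'')) (Al st0) (arr st0 ''h'') (As st0) (bkt st0) F (Al st) (arr st ''h'') (As st) (bkt st)"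
      using I by (simp add: DI_def i_def)
    have pr1: "prel (scalar st0 ''fin'') (scalar st0 ''Dn'') (arr st0 ''lo'') X i
       (rkc (scalar st0 ''th'')) (Al st0) (arr st0 ''h'') (As st0) (bkt st0) F (Al st) (arr st ''h'') (insert x (As st)) (bkt st1)"
      by (rule prel_pop[OF pr]) (use bk1 in auto)
    have As1: "As st1 = As st" "Al st1 = Al st" using ar1 sc1 by (simp_all add: As_def Al_def)
    have u1: "unch drain_c st0 st1"
      using u ar1 sc1 by (simp add: unch_def wv_drain)
    have Pot1: "Pot st1 + 20 = Pot st" using As1 bl1 by (simp add: Pot_def)
    have n20: "R + Pot st1 + 21 \<le> n" using nn Pot1 by simp
    have xas: "arr st1 ''asg'' x = scalar st1 ''rd'' \<longleftrightarrow> x \<in> As st" using As1 by (auto simp: As_def)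
    have red: "wp M le drain_body_c J st (n - 1)"
      if "wp M le (Cond (Eq (Arr ''asg'' (Var ''x'')) (Var ''rd'')) Skip visit_c) J st1 (n - 7)"
      using that n20 bi by (simp add: drain_body_c_def wps st1_def c_def[symmetric] x_def[symmetric] numeral_2_eq_2[symmetric])
    have "wp M le (Cond (Eq (Arr ''asg'' (Var ''x'')) (Var ''rd'')) Skip visit_c) J st1 (n - 7)"
    proof (cases "x \<in> As st")
      case True
      then have "insert x (As st) = As st" by auto
      with pr1 have "DI st0 X F st1" using I u1 ar1 bw1 As1 by (simp add: DI_def i_def)
      moreover have "scalar st1 ''nn'' + (n - 9) \<le> N" using sc1 nn by simp
      ultimately have "J st1 (n - 9)" using n20 As1 by (simp add: J_def F_def)
      then show ?thesis using True xas sc1 n20 by (simp add: wps numeral_2_eq_2[symmetric])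
    next
      case False
      have xS: "x \<notin> As st0" using False prelD(7)[OF pr] by auto
      have xX: "x \<in> X" using prelD(8)[OF pr1] xS by auto
      have xV: "x \<in> V" using pre xX by (auto simp: dpre_def)
      define st2 where "st2 = upds ''a'' (arr st ''hd'' x) (upda ''out'' x (scalar st0 ''th'' * scalar st0 ''fin'')
         (upda ''lo'' x i (upda ''asg'' x (scalar st0 ''rd'') st1)))"
      have As2: "As st2 = insert x (As st)" "Al st2 = Al st"
        using As1 rd sc1 by (auto simp: st2_def As_def Al_def)
      have bk2: "bkt st2 = bkt st1" "blen r st2 = blen r st1" "bwf st2"
        using bkt_cong[of st2 st1] bw1 by (auto simp: st2_def)
      have u2: "unch drain_c st0 st2" using u1 by (simp add: unch_def wv_drain st2_def)
      have sc2: "y \<noteq> ''a'' \<Longrightarrow> scalar st2 y = scalar st1 y" for y by (simp add: st2_def)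
      \<comment> \<open>\<open>x\<close> is stamped already while its edges are still unscanned;
        this is the state in which \<open>wp_scan\<close> starts.\<close>
      have F2: "F = {e \<in> Al st0. src e \<in> As st2 - As st0 - {x}}" using As2 False by (auto simp: F_def)
      have lo2: "arr st2 ''lo'' v = (if v \<in> As st2 - As st0 then i else arr st0 ''lo'' v)"
         "arr st2 ''out'' v = (if v \<in> As st2 - As st0 then scalar st0 ''th'' * scalar st0 ''fin'' else arr st0 ''out'' v)" for v
        using I As2 xS ar1 by (simp_all add: DI_def st2_def i_def)
      have I2: "DI st0 X {e \<in> Al st0. src e \<in> As st2 - As st0 - {x}} st2"
        using pr1 As2 bk2 u2 lo2 ar1 unfolding F2[symmetric] by (simp add: DI_def i_def) (simp add: st2_def ar1)
      have Pot2: "Pot st2 + 80 * (1 + length (adj x)) = Pot st1"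
      proof -
        have "V - As st1 = insert x (V - As st2)" using As1 As2 xV False by auto
        then have "(\<Sum>v\<in>V - As st1. 1 + length (adj v)) = (1 + length (adj x)) + (\<Sum>v\<in>V - As st2. 1 + length (adj v))"
          using As2 by simp
        then show ?thesis using bk2 As1 As2 by (simp add: Pot_def)
      qed
      have "wp M le scan_c J st2 (n - 16)"
      proof (rule wp_scan[OF pre _ _ I2])
        show "scalar st2 ''x'' = x" using sc1 sc2 by simp
        show "x \<in> As st2 - As st0" using As2 xS by simp
        show "lst (arr st2 ''nx'') (scalar st2 ''a'') = adj x"
          using pre nx ar1 by (simp add: st2_def dpre_def stb_def)
        show "Suc R + Pot st2 + 50 * length (adj x) + 7 \<le> n - 16" using n20 Pot2 by simp
        show "scalar st2 ''nn'' + (n - 16) \<le> N" using nn sc1 sc2 by simp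
        show "N < M" by fact
      qed (simp add: J_def)
      moreover have "scalar st0 ''th'' * scalar st0 ''fin'' < M"
      proof -
        have "scalar st0 ''th'' * scalar st0 ''fin'' \<le> m * 1" using pre by (intro mult_le_mono) (auto simp: dpre_def)
        then show ?thesis using M_T by simp
      qed
      ultimately have "wp M le visit_c J st1 (n - 8)"
        using n20 bi rd sc1 th ar1 Pot2 by (simp add: visit_c_def wps st2_def numeral_2_eq_2[symmetric])
      then show ?thesis using False xas sc1 n20 by (simp add: wps)
    qed
    then show "1 \<le> n \<and> wp M le drain_body_c J st (n - 1)" using red n20 by simp
  next
    fix st n assume J: "J st n" and b: "\<not> bv M le st (Not (Eq (Arr ''bh'' (Var ''bi'')) (Const 0)))"
    have "scalar st ''bi'' = i" using J by (simp add: J_def DI_def unch_def wv_drain i_def)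
    then have "bkt st i = {}" using b by (simp add: bkt_def)
    then show "1 \<le> n \<and> Q st (n - 1)" using J by (auto simp: J_def i_def intro!: Q)
  qed
qed

end

section \<open>One bucket pass\<close>

context ssbp_run
begin

lemma Lev_0[simp]: "Lev 0 = 0" using Lev_pos[of 0] by auto

text \<open>The value that \<open>lo\<close> has to take when intervals have length
  \<open>d\<close>; for \<open>d = 1\<close> it is the level itself.\<close>

definition tgt :: "nat \<Rightarrow> nat \<Rightarrow> nat" where "tgt d v = blk d (Lev (Bn v))"

lemma tgt_le_r: "tgt d v \<le> r" using blk_le Lev_le_r order_trans unfolding tgt_def by blast

text \<open>In a round \<open>C\<close> consists of the vertices outside small components. No live
  edge crosses its border, so the meaningless intervals elsewhere do no harm.\<close>

definition dctx :: "state \<Rightarrow> nat set \<Rightarrow> bool" where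
  "dctx st C \<longleftrightarrow> C \<subseteq> V \<and> (\<forall>e\<in>Al st. (src e \<in> C \<longleftrightarrow> dst e \<in> C) \<and> arr st ''lo'' (src e) = arr st ''lo'' (dst e)) \<and>
     (\<forall>v\<in>C. arr st ''lo'' v = tgt (scalar st ''D'') v) \<and> (\<forall>v. arr st ''lo'' v \<le> r) \<and> scalar st ''fin'' = 0 \<and>
     scalar st ''D'' = scalar st ''Dn'' * 2 ^ T \<and> 0 < scalar st ''Dn'' \<and> m + scalar st ''D'' < M"

text \<open>The buckets below \<open>ci\<close> are still to be drained. As in Dijkstra's algorithm,
  an entry may understate the target of its vertex but never overstates it, and vertices of positive
  value with target at least \<open>ci\<close> are settled.\<close>

definition dialinv :: "state \<Rightarrow> nat set \<Rightarrow> nat \<Rightarrow> state \<Rightarrow> bool" where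
  "dialinv st0 C ci st \<longleftrightarrow> stb st \<and> bwf st \<and> sinv (Al st) (arr st ''h'') \<and> Al st \<subseteq> Al st0 \<and> As st \<subseteq> C \<and>
     (\<forall>v. arr st ''lo'' v = (if v \<in> As st then tgt (scalar st0 ''Dn'') v else arr st0 ''lo'' v)) \<and>
     (\<forall>v. arr st ''out'' v = 0) \<and>
     (\<forall>j x. x \<in> bkt st j \<longrightarrow> j < ci \<and> x \<in> C \<and> j \<le> tgt (scalar st0 ''Dn'') x \<and> scalar st0 ''Dn'' dvd j) \<and>
     (\<forall>x\<in>C - As st. arr st ''h'' x \<noteq> 0 \<and> arr st0 ''lo'' x \<le> Lev (rkc (arr st ''h'' x)) \<longrightarrow>
        x \<in> bkt st (blk (scalar st0 ''Dn'') (Lev (rkc (arr st ''h'' x))))) \<and>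
     (\<forall>e\<in>Al st. src e \<in> As st \<longrightarrow> tgt (scalar st0 ''Dn'') (src e) \<le> Lev (rk e) \<and> dst e \<in> As st) \<and>
     (\<forall>v\<in>C. 0 < Bn v \<and> ci \<le> tgt (scalar st0 ''Dn'') v \<longrightarrow> v \<in> As st) \<and>
     (\<forall>v. arr st ''h'' v = arr st0 ''h'' v \<or> (\<exists>e\<in>Al st0 - Al st. arr st ''h'' v = Suc e \<and> dst e = v))"

lemma dialinvD:
  assumes "dialinv st0 C ci st"
  shows "stb st" "bwf st" "sinv (Al st) (arr st ''h'')" "Al st \<subseteq> Al st0" "As st \<subseteq> C"
     "arr st ''lo'' v = (if v \<in> As st then tgt (scalar st0 ''Dn'') v else arr st0 ''lo'' v)"
     "arr st ''out'' v = 0"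
     "x \<in> bkt st j \<Longrightarrow> j < ci \<and> x \<in> C \<and> j \<le> tgt (scalar st0 ''Dn'') x \<and> scalar st0 ''Dn'' dvd j"
     "x \<in> C \<Longrightarrow> x \<notin> As st \<Longrightarrow> arr st ''h'' x \<noteq> 0 \<Longrightarrow> arr st0 ''lo'' x \<le> Lev (rkc (arr st ''h'' x)) \<Longrightarrow>
        x \<in> bkt st (blk (scalar st0 ''Dn'') (Lev (rkc (arr st ''h'' x))))"
     "e \<in> Al st \<Longrightarrow> src e \<in> As st \<Longrightarrow> tgt (scalar st0 ''Dn'') (src e) \<le> Lev (rk e) \<and> dst e \<in> As st"
     "v \<in> C \<Longrightarrow> 0 < Bn v \<Longrightarrow> ci \<le> tgt (scalar st0 ''Dn'') v \<Longrightarrow> v \<in> As st"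
     "arr st ''h'' v = arr st0 ''h'' v \<or> (\<exists>e\<in>Al st0 - Al st. arr st ''h'' v = Suc e \<and> dst e = v)"
  using assms unfolding dialinv_def by blast+

lemma dialinv_scalar:
  assumes "dialinv st0 C ci st" "\<And>x. x \<notin> {''i'', ''bi'', ''th''} \<Longrightarrow> f x = scalar st x"
  shows "dialinv st0 C ci (st\<lparr>scalar := f\<rparr>)"
proof -
  have "stb (st\<lparr>scalar := f\<rparr>)" using assms by (simp add: dialinv_def stb_def thr_def)
  then show ?thesis using assms As_scalar[of f st] bwf_scalar[of f st] by (simp add: dialinv_def)
qed

text \<open>The a priori bound on what draining bucket \<open>i\<close> can settle. It is empty if
  \<open>i\<close> is no multiple of \<open>d\<close>; entries are only ever placed at
  multiples.\<close>

definition dset :: "nat \<Rightarrow> nat set \<Rightarrow> nat \<Rightarrow> nat set" where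
  "dset d C i = {v \<in> C. d dvd i \<and> i \<le> tgt d v}"

lemma th_iff: assumes "i \<le> r" "c = (if i = 0 then 0 else Suc (lam i))" shows "rkc c \<le> x \<longleftrightarrow> i \<le> Lev x"
  using Lev_ge_iff[of i x] assms by auto

lemma dial_dpre:
  assumes ctx: "dctx st0 C" and D: "dialinv st0 C (Suc i) st" and i: "i \<le> r"
    and sc: "scalar st ''bi'' = i" "scalar st ''th'' = (if i = 0 then 0 else Suc (lam i))"
      "scalar st ''fin'' = 0" "scalar st ''D'' = scalar st0 ''D''" "scalar st ''Dn'' = scalar st0 ''Dn''"
  shows "dpre st (dset (scalar st0 ''Dn'') C i)"
proof -
  let ?d = "scalar st0 ''Dn''"
  let ?X = "dset ?d C i"
  note DD = dialinvD[OF D]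
  have d0: "0 < ?d" using ctx by (simp add: dctx_def)
  have th: "rkc (scalar st ''th'') \<le> x \<longleftrightarrow> i \<le> Lev x" for x by (rule th_iff[OF i sc(2)])
  have thle: "scalar st ''th'' \<le> m" using sc(2) lam_m[of i] i by auto
  have ABn: "rk e \<le> Bn (dst e)" if "e \<in> Al st" "rk e \<le> Bn (src e)" for e
    using Bn_edge[of e "rk e"] sinvD(1-3)[OF DD(3), of e] that by simp
  have XB: "v \<in> ?X \<Longrightarrow> rkc (scalar st ''th'') \<le> Bn v" for v
    using th[of "Bn v"] blk_le[of ?d "Lev (Bn v)"] by (auto simp: dset_def tgt_def)
  have Xsound: "dst e \<in> ?X" if e: "e \<in> Al st" "src e \<in> ?X" "rkc (scalar st ''th'') \<le> rk e" for e
  proof -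
    have "dst e \<in> C" using e DD(4) ctx by (auto simp: dset_def dctx_def)
    moreover have "rkc (scalar st ''th'') \<le> Bn (dst e)"
      using Bn_edge[of e] sinvD(1-3)[OF DD(3), of e] e XB by auto
    then have "i \<le> Lev (Bn (dst e))" using th by simp
    then have "i \<le> tgt ?d (dst e)" using le_blk[of ?d i] e(2) d0 by (auto simp: dset_def tgt_def)
    ultimately show ?thesis using e(2) by (simp add: dset_def)
  qed
  have nonAs: "scalar st0 ''D'' dvd arr st ''lo'' (dst e) \<and>
      (rk e < rkc (scalar st ''th'') \<and> arr st ''lo'' (dst e) \<le> Lev (rk e) \<longrightarrow> Lev (rk e) < arr st ''lo'' (dst e) + scalar st0 ''D'')"
    if e: "e \<in> Al st" "src e \<in> ?X" "dst e \<notin> As st" for e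
  proof -
    have "dst e \<in> C" using e DD(4) ctx by (auto simp: dset_def dctx_def)
    then have lo: "arr st ''lo'' (dst e) = blk (scalar st0 ''D'') (Lev (Bn (dst e)))"
      using DD(6)[of "dst e"] e(3) ctx by (simp add: dctx_def tgt_def)
    have "Lev (rk e) < arr st ''lo'' (dst e) + scalar st0 ''D''" if "rk e < rkc (scalar st ''th'')"
    proof -
      \<comment> \<open>A failing edge ranks below the threshold, which the value of its tail
        reaches. Its rank is therefore a lower bound for the value of its head, and its level cannot
        lie beyond the head's interval.\<close>
      have "rk e \<le> Bn (dst e)" using ABn[OF e(1)] XB[OF e(2)] that by linarith
      then have "Lev (rk e) \<le> Lev (Bn (dst e))" by (rule Lev_mono)
      also have "\<dots> < arr st ''lo'' (dst e) + scalar st0 ''D''" unfolding lo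
        by (rule less_blk) (use ctx in \<open>simp add: dctx_def\<close>)
      finally show ?thesis .
    qed
    then show ?thesis using lo dvd_blk by simp
  qed
  have bX: "bkt st i \<subseteq> ?X" using DD(8)[of _ i] by (auto simp: dset_def)
  have hm: "arr st ''h'' v \<le> m" for v using sinvD(4)[OF DD(3), of v] by (cases "arr st ''h'' v = 0") auto
  have lor: "arr st ''lo'' v \<le> r" for v using DD(6)[of v] tgt_le_r[of ?d v] ctx by (simp add: dctx_def)
  have "Al st \<subseteq> A0" using sinvD(1-3)[OF DD(3)] by (auto simp: A0_def)
  moreover have "?X \<subseteq> V" using ctx by (auto simp: dctx_def dset_def)
  moreover have "\<forall>e<m. rk e < rkc (scalar st ''th'') \<longrightarrow> Lev (rk e) < i"
    using th by (simp add: not_le[symmetric])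
  ultimately show ?thesis
    unfolding dpre_def
  proof (intro conjI impI)
    show "stb st" "bwf st" by (rule DD)+
    show "scalar st ''bi'' \<le> r" "scalar st ''th'' \<le> m" "scalar st ''fin'' \<le> 1" using sc(1,3) i thle by simp_all
    show "\<forall>v. arr st ''h'' v \<le> m" "\<forall>v. arr st ''lo'' v \<le> r" using hm lor by blast+
    show "\<forall>e\<in>Al st. src e \<in> ?X \<and> rkc (scalar st ''th'') \<le> rk e \<longrightarrow> dst e \<in> ?X \<union> As st" using Xsound by blast
    show "bkt st (scalar st ''bi'') \<subseteq> ?X \<union> As st" using bX sc(1) by blast
    show "scalar st ''D'' = scalar st ''Dn'' * 2 ^ T" "0 < scalar st ''Dn''" "m + scalar st ''D'' < M"
      using ctx sc(4,5) by (simp_all add: dctx_def)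
    show "\<forall>e\<in>Al st. src e \<in> ?X \<and> dst e \<notin> As st \<longrightarrow> scalar st ''D'' dvd arr st ''lo'' (dst e) \<and>
        (rk e < rkc (scalar st ''th'') \<and> arr st ''lo'' (dst e) \<le> Lev (rk e) \<longrightarrow>
          Lev (rk e) < arr st ''lo'' (dst e) + scalar st ''D'')"
      unfolding sc(4) using nonAs by blast
  qed (simp_all add: sc(1))
qed

lemma dial_step:
  assumes ctx: "dctx st0 C" and D: "dialinv st0 C (Suc i) st" and i: "i \<le> r"
    and sc: "scalar st ''bi'' = i" "scalar st ''th'' = (if i = 0 then 0 else Suc (lam i))"
      "scalar st ''fin'' = 0" "scalar st ''D'' = scalar st0 ''D''" "scalar st ''Dn'' = scalar st0 ''Dn''"
    and I: "DI st (dset (scalar st0 ''Dn'') C i) {e \<in> Al st. src e \<in> As st' - As st} st'" and em: "bkt st' i = {}"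
  shows "dialinv st0 C i st'"
proof -
  let ?d = "scalar st0 ''Dn''"
  let ?X = "dset ?d C i"
  define F where "F = {e \<in> Al st. src e \<in> As st' - As st}"
  note DD = dialinvD[OF D]
  have d0: "0 < ?d" using ctx by (simp add: dctx_def)
  have th: "rkc (scalar st ''th'') \<le> x \<longleftrightarrow> i \<le> Lev x" for x by (rule th_iff[OF i sc(2)])
  have pr: "prel 0 ?d (arr st ''lo'') ?X i (rkc (scalar st ''th'')) (Al st) (arr st ''h'') (As st) (bkt st) F
      (Al st') (arr st' ''h'') (As st') (bkt st')"
    using I sc by (simp add: DI_def F_def)
  note P = prelD[OF pr]
  have XB: "v \<in> ?X \<Longrightarrow> rkc (scalar st ''th'') \<le> Bn v" for v
    using th[of "Bn v"] blk_le[of ?d "Lev (Bn v)"] by (auto simp: dset_def tgt_def)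
  have AA: "Al st' \<subseteq> Al st" using P(1) by blast
  \<comment> \<open>The tail lies in \<open>dset\<close>, so its value is at least the threshold and
    exceeds \<open>rk e\<close>: this is the situation of \<open>sinv_fail\<close>.\<close>
  have killed: "rk e \<le> Bn (src e)" "rk e \<le> Bn (dst e)" "dst e \<in> C" "Lev (rk e) < i" "e \<in> Al st"
    if "e \<in> Al st - Al st'" for e
  proof -
    have e: "e \<in> F" "rk e < rkc (scalar st ''th'')" "e \<in> Al st" using that P(1) by auto
    have sX: "src e \<in> ?X" using P(3)[OF e(1)] P(8) by blast
    show 1: "rk e \<le> Bn (src e)" using XB[OF sX] e(2) by linarith
    show "rk e \<le> Bn (dst e)" using Bn_edge[of e "rk e"] sinvD(1-3)[OF DD(3), of e] e(3) 1 by simp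
    show "dst e \<in> C" using sX e(3) DD(4) ctx by (auto simp: dset_def dctx_def)
    show "Lev (rk e) < i" using th[of "rk e"] e(2) by linarith
    show "e \<in> Al st" by fact
  qed
  have S: "sinv (Al st') (arr st' ''h'')"
    by (rule sinv_fail[OF DD(3) AA]) (use P(9,10,11) killed(1) in auto)
  \<comment> \<open>A vertex with a larger target would have been settled by an earlier bucket, and
    \<open>dset\<close> excludes smaller targets.\<close>
  have newt: "tgt ?d v = i" if "v \<in> As st' - As st" for v
  proof -
    have v: "v \<in> ?X" using that P(8) by blast
    have "\<not> Suc i \<le> tgt ?d v"
    proof
      assume c: "Suc i \<le> tgt ?d v"
      then have "0 < Lev (Bn v)" using blk_le[of ?d "Lev (Bn v)"] by (simp add: tgt_def)
      then have "v \<in> As st" using DD(11)[of v] v c Lev_pos by (simp add: dset_def)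
      then show False using that by simp
    qed
    then show ?thesis using v by (simp add: dset_def)
  qed
  have stb': "stb st'" by (rule stb_unch[of drain_c st]) (use I DD(1) in \<open>simp_all add: DI_def wv_drain\<close>)
  have As': "As st' \<subseteq> C" using P(8) DD(5) by (auto simp: dset_def)
  have lo': "arr st' ''lo'' v = (if v \<in> As st' then tgt ?d v else arr st0 ''lo'' v)" for v
    using I sc DD(6)[of v] newt[of v] P(7) by (auto simp: DI_def)
  have out': "arr st' ''out'' v = 0" for v using I sc DD(7) by (simp add: DI_def)
  have b': "j < i \<and> x \<in> C \<and> j \<le> tgt ?d x \<and> ?d dvd j" if x: "x \<in> bkt st' j" for j x
  proof -
    have ji: "j \<noteq> i" using em x by auto
    from P(13)[OF ji x] show ?thesis
    proof
      assume "x \<in> bkt st j"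
      with DD(8)[OF this] ji show ?thesis by auto
    next
      assume "(0::nat) = 0 \<and> (\<exists>e\<in>Al st - Al st'. dst e = x \<and> arr st ''lo'' x \<le> Lev (rk e) \<and> j = blk ?d (Lev (rk e)))"
      then obtain e where e: "e \<in> Al st - Al st'" "dst e = x" "j = blk ?d (Lev (rk e))" by blast
      note k = killed[OF e(1)]
      have "j \<le> tgt ?d x" unfolding e(3) tgt_def using k(2) e(2) by (intro blk_mono Lev_mono) simp
      then show ?thesis using k e blk_le[of ?d "Lev (rk e)"] dvd_blk by auto
    qed
  qed
  have h': "x \<in> bkt st' (blk ?d (Lev (rkc (arr st' ''h'' x))))"
    if x: "x \<in> C" "x \<notin> As st'" "arr st' ''h'' x \<noteq> 0" "arr st0 ''lo'' x \<le> Lev (rkc (arr st' ''h'' x))" for x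
  proof -
    have xA: "x \<notin> As st" using x P(7) by blast
    from P(9)[of x] show ?thesis
    proof
      assume hh: "arr st' ''h'' x = arr st ''h'' x"
      let ?j = "blk ?d (Lev (rkc (arr st ''h'' x)))"
      have xb: "x \<in> bkt st ?j" using DD(9)[of x] x xA hh by simp
      have "?j \<noteq> i"
      proof
        assume "?j = i"
        then have "x \<in> As st' \<union> bkt st' i" using xb P(5) by auto
        with em x show False by simp
      qed
      from P(12)[OF this] xb hh show ?thesis by auto
    next
      assume "\<exists>e\<in>Al st - Al st'. arr st' ''h'' x = Suc e \<and> dst e = x"
      then obtain e where e: "e \<in> Al st - Al st'" "arr st' ''h'' x = Suc e" "dst e = x" by blast
      have "arr st ''lo'' (dst e) \<le> Lev (rk e)" using DD(6)[of x] xA x(4) e by simp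
      from P(14)[OF refl e(1) this] show ?thesis using e x by simp
    qed
  qed
  have e': "tgt ?d (src e) \<le> Lev (rk e) \<and> dst e \<in> As st'" if e: "e \<in> Al st'" "src e \<in> As st'" for e
  proof (cases "src e \<in> As st")
    case True
    with DD(10)[of e] e AA P(7) show ?thesis by blast
  next
    case False
    then have eF: "e \<in> F" using e AA by (auto simp: F_def)
    have "rkc (scalar st ''th'') \<le> rk e" using e(1) P(1) eF by auto
    then show ?thesis using newt[of "src e"] False e(2) th[of "rk e"] P(4)[OF eF] em by auto
  qed
  have c': "v \<in> As st'" if v: "v \<in> C" "0 < Bn v" "i \<le> tgt ?d v" for v
  proof -
    define x where "x = Bn v"
    have fl: "flow (Al st') (arr st' ''h'') x v" using sinvD(7)[OF S, of v] v by (simp add: x_def)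
    \<comment> \<open>Follow the flow that realises \<open>Bn v\<close>. An unsettled origin would
      have its code queued in a bucket at or above \<open>i\<close>, but these are empty by now; and
      a settled tail settles the head of every edge that is still live.\<close>
    have "u \<in> C \<longrightarrow> arr st0 ''lo'' u \<le> Lev x \<longrightarrow> u \<in> As st'" if "flow (Al st') (arr st' ''h'') x u" for u
      using that
    proof induction
      case (flow_h u)
      show ?case
      proof (intro impI, rule ccontr)
        assume u: "u \<in> C" "arr st0 ''lo'' u \<le> Lev x" "u \<notin> As st'"
        have hx: "Lev x \<le> Lev (rkc (arr st' ''h'' u))" using flow_h by (rule Lev_mono)
        have "arr st' ''h'' u \<noteq> 0" using flow_h v by (intro notI) (simp add: x_def)
        then have "u \<in> bkt st' (blk ?d (Lev (rkc (arr st' ''h'' u))))" using h'[of u] u hx by simp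
        then have "blk ?d (Lev (rkc (arr st' ''h'' u))) < i" using b' by blast
        moreover have "i \<le> blk ?d (Lev (rkc (arr st' ''h'' u)))"
          using v(3) blk_mono[OF hx, of ?d] by (simp add: tgt_def x_def)
        ultimately show False by simp
      qed
    next
      case (flow_step e)
      have "(src e \<in> C \<longleftrightarrow> dst e \<in> C) \<and> arr st0 ''lo'' (src e) = arr st0 ''lo'' (dst e)"
        using flow_step(2) AA DD(4) ctx unfolding dctx_def by blast
      then show ?case using flow_step e'[of e] by auto
    qed
    moreover have "arr st0 ''lo'' v \<le> Lev x" using ctx v(1) blk_le by (simp add: dctx_def tgt_def x_def)
    ultimately show ?thesis using fl v by blast
  qed
  have hh': "arr st' ''h'' v = arr st0 ''h'' v \<or> (\<exists>e\<in>Al st0 - Al st'. arr st' ''h'' v = Suc e \<and> dst e = v)" for v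
    using P(9)[of v] DD(12)[of v] AA DD(4) by fastforce
  have "bwf st'" using I by (simp add: DI_def)
  moreover have "Al st' \<subseteq> Al st0" using AA DD(4) by blast
  ultimately show ?thesis unfolding dialinv_def
    by (intro conjI allI ballI impI stb' S As' lo' out' hh')
       (blast dest: b' h' e' intro: c')+
qed

lemma wp_dial:
  assumes ctx: "dctx st C" and D: "dialinv st C (Suc r) st"
    and n: "R + Pot st + 20 * r + 40 \<le> n" "scalar st ''nn'' + n \<le> N" "N < M"
    and Q: "\<And>st' n'. unch dial_c st st' \<Longrightarrow> dialinv st C 0 st' \<Longrightarrow> R + Pot st' \<le> n' \<Longrightarrow>
        scalar st' ''nn'' + n' \<le> N \<Longrightarrow> Q st' n'"
  shows "wp M le dial_c Q st n"
proof -
  define J where "J = (\<lambda>st' n'. dialinv st C (scalar st' ''i'') st' \<and> scalar st' ''i'' \<le> Suc r \<and> unch dial_c st st' \<and>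
     R + Pot st' + 20 * scalar st' ''i'' + 10 \<le> n' \<and> scalar st' ''nn'' + n' \<le> N)"
  define st0 where "st0 = upds ''i'' (Suc r) st"
  have D0: "dialinv st C (Suc r) st0" unfolding st0_def by (rule dialinv_scalar[OF D]) auto
  have "wp M le (While (Less (Const 0) (Var ''i'')) dial_body_c) Q st0 (n - 2)"
  proof (rule wp_While[where I = J])
    show "J st0 (n - 2)" using D0 n unfolding J_def by (simp add: unch_def wv_dial st0_def Pot_scalar) linarith
  next
    fix st1 n1 assume J: "J st1 n1" and b: "bv M le st1 (Less (Const 0) (Var ''i''))"
    define i where "i = scalar st1 ''i'' - 1"
    have i: "scalar st1 ''i'' = Suc i" "i \<le> r" using b J by (auto simp: i_def J_def)
    have D1: "dialinv st C (Suc i) st1" and u1: "unch dial_c st st1" using J i by (simp_all add: J_def)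
    have n1: "R + Pot st1 + 20 * i + 30 \<le> n1" "scalar st1 ''nn'' + n1 \<le> N" using J i by (simp_all add: J_def)
    define th where "th = (if i = 0 then 0 else Suc (lam i))"
    define st2 where "st2 = st1\<lparr>scalar := (scalar st1)(''i'' := i, ''bi'' := i, ''th'' := th)\<rparr>"
    have D2: "dialinv st C (Suc i) st2" unfolding st2_def by (rule dialinv_scalar[OF D1]) auto
    have sc: "scalar st2 ''bi'' = i" "scalar st2 ''th'' = (if i = 0 then 0 else Suc (lam i))"
      "scalar st2 ''fin'' = 0" "scalar st2 ''D'' = scalar st ''D''" "scalar st2 ''Dn'' = scalar st ''Dn''" "scalar st2 ''i'' = i"
      using u1 ctx by (simp_all add: st2_def th_def unch_def wv_dial dctx_def)
    have Pot2: "Pot st2 = Pot st1" by (simp add: st2_def Pot_scalar)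
    note pre = dial_dpre[OF ctx D2 i(2) sc(1-5)]
    have dr: "wp M le drain_c J st2 n2" if n2: "n1 \<le> n2 + 12" "n2 \<le> n1" for n2
    proof (rule wp_drain[OF pre])
      show "R + 20 * i + 10 + Pot st2 + 1 \<le> n2" using n1 n2 Pot2 by simp
      show "scalar st2 ''nn'' + n2 \<le> N" using n1 n2 by (simp add: st2_def)
      show "N < M" by fact
      fix st' n'
      assume I: "DI st2 (dset (scalar st ''Dn'') C i) {e \<in> Al st2. src e \<in> As st' - As st2} st'"
        and em: "bkt st' (scalar st2 ''bi'') = {}" and n': "R + 20 * i + 10 + Pot st' \<le> n'" "scalar st' ''nn'' + n' \<le> N"
      have "dialinv st C i st'" using dial_step[OF ctx D2 i(2) sc(1-5) I] em sc by simp
      moreover have u': "unch drain_c st2 st'" using I by (simp add: DI_def)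
      then have "scalar st' ''i'' = i" using sc by (simp add: unch_def wv_drain)
      moreover have "unch dial_c st st2" using u1 by (simp add: st2_def unch_def wv_dial)
      then have "unch dial_c st st'" by (rule unch_trans[OF _ u']) (auto simp: wv_dial wv_drain)
      ultimately show "J st' n'" using n' i by (simp add: J_def)
    qed
    have "i < M" using i r_m M_T by simp
    have thr: "thr (st1\<lparr>scalar := (scalar st1)(''i'' := i, ''bi'' := i)\<rparr>)"
      using dialinvD(1)[OF D1] by (simp add: stb_def thr_def)
    have "i \<noteq> 0 \<Longrightarrow> av M (st1\<lparr>scalar := (scalar st1)(''i'' := i, ''bi'' := i)\<rparr>) (lamE (Var ''i'')) = lam i"
      using av_lamE[OF thr, of "Var ''i''"] i by simp
    moreover have "i \<noteq> 0 \<Longrightarrow> Suc (lam i) < M" using lam_m[of i] i M_T by simp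
    ultimately have "wp M le dial_body_c J st1 (n1 - 1)"
      using n1 i dr by (cases "i = 0") (simp_all add: dial_body_c_def wps st2_def th_def)
    then show "1 \<le> n1 \<and> wp M le dial_body_c J st1 (n1 - 1)" using n1 by simp
  next
    fix st1 n1 assume J: "J st1 n1" and b: "\<not> bv M le st1 (Less (Const 0) (Var ''i''))"
    then have "Q st1 (n1 - 1)" by (intro Q) (auto simp: J_def)
    then show "1 \<le> n1 \<and> Q st1 (n1 - 1)" using J by (simp add: J_def)
  qed
  moreover have "Suc r < M" "scalar st ''r'' = r" using r_m M_T dialinvD(1)[OF D] by (simp_all add: stb_def thr_def)
  ultimately show ?thesis using n by (simp add: dial_c_def wps st0_def numeral_2_eq_2[symmetric])
qed

end

section \<open>Depth-first search\<close>

text \<open>Counts the changes of \<open>f\<close> along a list. Later \<open>f\<close> maps a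
  vertex to its new interval, and a change is what makes a remembered interval miss.\<close>

fun ch :: "('a \<Rightarrow> 'b) \<Rightarrow> 'a list \<Rightarrow> nat" where
  "ch f [] = 0"
| "ch f [x] = 0"
| "ch f (x # y # zs) = of_bool (f x \<noteq> f y) + ch f (y # zs)"

lemma ch_snoc: "xs \<noteq> [] \<Longrightarrow> ch f (xs @ [y]) = ch f xs + of_bool (f (last xs) \<noteq> f y)"
  by (induction f xs rule: ch.induct) auto

fun parc :: "(nat \<Rightarrow> nat) \<Rightarrow> nat list \<Rightarrow> bool" where
  "parc p [] \<longleftrightarrow> True"
| "parc p [x] \<longleftrightarrow> p x = 0"
| "parc p (x # y # zs) \<longleftrightarrow> p x = Suc y \<and> parc p (y # zs)"

lemma parc_upd: "x \<notin> set stk \<Longrightarrow> parc (p(x := y)) stk = parc p stk"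
  by (induction p stk rule: parc.induct) auto

context ssbp_run
begin

definition Vis :: "state \<Rightarrow> nat set" where "Vis st = {v. arr st ''vis'' v = scalar st ''rd''}"

definition other :: "nat \<Rightarrow> nat" where
  "other c = (if even c then dst (c div 2 - 1) else src (c div 2 - 1))"

definition cutl :: "nat set \<Rightarrow> (nat \<Rightarrow> nat) \<Rightarrow> nat list \<Rightarrow> nat" where
  "cutl A f cs = length (filter (\<lambda>c. c div 2 - 1 \<in> A \<and> f (src (c div 2 - 1)) \<noteq> f (dst (c div 2 - 1))) cs)"

text \<open>The closed sets are the unions of connected components of the undirected graph formed by
  the edges in \<open>A\<close>.\<close>

definition eclosed :: "nat set \<Rightarrow> nat set \<Rightarrow> bool" where
  "eclosed A C \<longleftrightarrow> (\<forall>e\<in>A. src e \<in> C \<longleftrightarrow> dst e \<in> C)"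

abbreviation deg1 :: "nat \<Rightarrow> nat" where "deg1 v \<equiv> 1 + length (adj v)"

definition dfs_post :: "state \<Rightarrow> nat \<Rightarrow> nat list \<Rightarrow> state \<Rightarrow> bool" where
  "dfs_post st0 v0 L st \<longleftrightarrow> L \<noteq> [] \<and> hd L = v0 \<and> distinct L \<and> scalar st ''k'' = length L \<and>
     (\<forall>t<length L. arr st ''L'' t = L ! t) \<and> Vis st = Vis st0 \<union> set L \<and> set L \<inter> Vis st0 = {} \<and> set L \<subseteq> V \<and>
     (\<forall>C. v0 \<in> C \<longrightarrow> eclosed (Al st0) C \<longrightarrow> set L \<subseteq> C)"

text \<open>The quantified inequality pays for the changes of \<open>f\<close> along the discovery
  order. From the last discovered vertex the walk goes up the stack and then down one tree edge to
  the next, so a tree edge on which \<open>f\<close> changes is used at most once in each direction;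
  reading its incidence provides 2 units. The term \<open>ch f stk\<close> keeps what the way back
  will need.\<close>

definition dfsinv :: "state \<Rightarrow> nat \<Rightarrow> nat \<Rightarrow> nat list \<Rightarrow> nat list \<Rightarrow> state \<Rightarrow> nat \<Rightarrow> bool" where
  "dfsinv st0 v0 n0 L stk st n \<longleftrightarrow> dfs_post st0 v0 L st \<and> set stk \<subseteq> set L \<and> distinct stk \<and> parc (arr st ''par'') stk \<and>
     scalar st ''u'' = (if stk = [] then 0 else Suc (hd stk)) \<and>
     (\<forall>v\<in>set L. \<exists>dn. adj v = dn @ lst (arr st ''nx'') (arr st ''pt'' v) \<and>
         (\<forall>c\<in>set dn. c div 2 - 1 \<in> Al st0 \<longrightarrow> other c \<in> Vis st)) \<and>
     (\<forall>v\<in>set L - set stk. arr st ''pt'' v = 0) \<and>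
     (\<forall>f. ch f L + (if stk = [] then 0 else of_bool (f (last L) \<noteq> f (hd stk))) + ch f stk +
         2 * (\<Sum>v\<in>set L. cutl (Al st0) f (lst (arr st ''nx'') (arr st ''pt'' v))) \<le> 2 * (\<Sum>v\<in>set L. cutl (Al st0) f (adj v))) \<and>
     n0 + 20 * (\<Sum>v\<in>set L. length (lst (arr st ''nx'') (arr st ''pt'' v))) + 10 * length stk + 5 \<le> n + 40 * (\<Sum>v\<in>set L. deg1 v) \<and>
     n \<le> n0"

lemma finL: "finite (set (L :: nat list))" by simp

lemma V_M: "v \<in> V \<Longrightarrow> Suc v < M"
  using M_src M_dst by (auto simp: V_def src_def dst_def)

lemma card_V: "card V \<le> 2 * m"
proof -
  have "card V \<le> card (src ` {..<m}) + card (dst ` {..<m})" unfolding V_def by (rule card_Un_le)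
  also have "\<dots> \<le> card {..<m} + card {..<m}" by (intro add_mono card_image_le) auto
  finally show ?thesis by simp
qed

lemma dfs_pop:
  assumes I: "dfsinv st0 v0 n0 L (x # stk) st n" and a: "arr st ''pt'' x = 0" and n: "5 \<le> n"
  shows "dfsinv st0 v0 n0 L stk (st\<lparr>scalar := (scalar st)(''a'' := 0, ''u'' := arr st ''par'' x)\<rparr>) (n - 5)"
proof -
  define rm where "rm = (\<lambda>v. lst (arr st ''nx'') (arr st ''pt'' v))"
  define st' where "st' = st\<lparr>scalar := (scalar st)(''a'' := 0, ''u'' := arr st ''par'' x)\<rparr>"
  have ar: "arr st' = arr st" by (simp add: st'_def)
  have Vis: "Vis st' = Vis st" by (simp add: st'_def Vis_def)
  have 1: "\<forall>v\<in>set L. \<exists>dn. adj v = dn @ rm v \<and> (\<forall>c\<in>set dn. c div 2 - 1 \<in> Al st0 \<longrightarrow> other c \<in> Vis st)"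
    using I unfolding dfsinv_def rm_def by blast
  have 2: "ch f L + (if stk = [] then 0 else of_bool (f (last L) \<noteq> f (hd stk))) + ch f stk + 2 * (\<Sum>v\<in>set L. cutl (Al st0) f (rm v))
      \<le> 2 * (\<Sum>v\<in>set L. cutl (Al st0) f (adj v))" for f
  proof -
    \<comment> \<open>Popping moves the reference point from \<open>x\<close> to the next vertex of
      the stack. By the triangle inequality the mismatch grows by at most the change that the stack
      loses.\<close>
    have "(if stk = [] then 0 else of_bool (f (last L) \<noteq> f (hd stk))) + ch f stk \<le> of_bool (f (last L) \<noteq> f x) + ch f (x # stk)"
      by (cases stk) auto
    moreover have "ch f L + of_bool (f (last L) \<noteq> f x) + ch f (x # stk) + 2 * (\<Sum>v\<in>set L. cutl (Al st0) f (rm v))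
       \<le> 2 * (\<Sum>v\<in>set L. cutl (Al st0) f (adj v))"
      using I[unfolded dfsinv_def] unfolding rm_def by simp
    ultimately show ?thesis by linarith
  qed
  have 3: "n0 + 20 * (\<Sum>v\<in>set L. length (rm v)) + 10 * length stk + 5 \<le> n - 5 + 40 * (\<Sum>v\<in>set L. deg1 v)"
  proof -
    have "n0 + 20 * (\<Sum>v\<in>set L. length (rm v)) + 10 * length (x # stk) + 5 \<le> n + 40 * (\<Sum>v\<in>set L. deg1 v)"
      using I[unfolded dfsinv_def] unfolding rm_def by simp
    then show ?thesis using n by simp
  qed
  have 4: "arr st ''pt'' v = 0" if "v \<in> set L - set stk" for v using I that a by (auto simp: dfsinv_def)
  have 5: "dfs_post st0 v0 L st'" using I Vis by (simp add: dfsinv_def dfs_post_def) (simp add: st'_def)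
  have 6: "set stk \<subseteq> set L" "distinct stk" "parc (arr st ''par'') stk" "scalar st' ''u'' = (if stk = [] then 0 else Suc (hd stk))"
    using I by (cases stk; simp add: dfsinv_def st'_def)+
  have 7: "n - 5 \<le> n0" using I by (simp add: dfsinv_def) linarith
  show ?thesis unfolding st'_def[symmetric] dfsinv_def using 1 2 3 4 5 6 7 unfolding rm_def ar Vis by simp
qed

lemma dfs_skip:
  assumes I: "dfsinv st0 v0 n0 L (x # stk) st n" and stk: "stb st" and a: "arr st ''pt'' x = a" "a \<noteq> 0"
    and o: "a div 2 - 1 \<in> Al st0 \<Longrightarrow> other a \<in> Vis st" and n: "n \<le> n' + 20" "n' \<le> n"
    and s: "scalar st' ''u'' = scalar st ''u''" "scalar st' ''k'' = scalar st ''k''" "scalar st' ''rd'' = scalar st ''rd''"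
      "arr st' = (arr st)(''pt'' := (arr st ''pt'')(x := arr st ''nx'' a))"
  shows "dfsinv st0 v0 n0 L (x # stk) st' n'"
proof -
  have rem: "lst (arr st ''nx'') a = a # lst (arr st ''nx'') (arr st ''nx'' a)"
    using lst_step[of a "arr st ''nx''"] stk a by (simp add: stb_def)
  have xL: "x \<in> set L" using I by (simp add: dfsinv_def)
  have A: "arr st' ''pt'' = (arr st ''pt'')(x := arr st ''nx'' a)" "A \<noteq> ''pt'' \<Longrightarrow> arr st' A = arr st A" for A using s by simp_all
  have Vis: "Vis st' = Vis st" using A(2)[of "''vis''"] s by (simp add: Vis_def)
  define rm where "rm = (\<lambda>v. lst (arr st ''nx'') (arr st ''pt'' v))"
  define rm' where "rm' = (\<lambda>v. lst (arr st' ''nx'') (arr st' ''pt'' v))"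
  have rm': "rm' v = rm v" if "v \<noteq> x" for v using that A by (simp add: rm_def rm'_def)
  have rmx: "rm x = a # rm' x" using rem a A by (simp add: rm_def rm'_def)
  have sum: "(\<Sum>v\<in>set L. g (rm v)) = g (a # rm' x) + (\<Sum>v\<in>set L - {x}. g (rm' v))"
     "(\<Sum>v\<in>set L. g (rm' v)) = g (rm' x) + (\<Sum>v\<in>set L - {x}. g (rm' v))" for g :: "nat list \<Rightarrow> nat"
  proof -
    have "(\<Sum>v\<in>set L. g (rm v)) = g (rm x) + (\<Sum>v\<in>set L - {x}. g (rm v))" by (rule sum.remove) (use xL in auto)
    also have "(\<Sum>v\<in>set L - {x}. g (rm v)) = (\<Sum>v\<in>set L - {x}. g (rm' v))" by (intro sum.cong) (auto simp: rm')
    finally show "(\<Sum>v\<in>set L. g (rm v)) = g (a # rm' x) + (\<Sum>v\<in>set L - {x}. g (rm' v))" by (simp add: rmx)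
    show "(\<Sum>v\<in>set L. g (rm' v)) = g (rm' x) + (\<Sum>v\<in>set L - {x}. g (rm' v))" by (rule sum.remove) (use xL in auto)
  qed
  note I' = I[unfolded dfsinv_def, folded rm_def]
  have 1: "\<exists>dn. adj v = dn @ rm' v \<and> (\<forall>c\<in>set dn. c div 2 - 1 \<in> Al st0 \<longrightarrow> other c \<in> Vis st')" if v: "v \<in> set L" for v
  proof -
    obtain dn where dn: "adj v = dn @ rm v" "\<forall>c\<in>set dn. c div 2 - 1 \<in> Al st0 \<longrightarrow> other c \<in> Vis st"
      using I' v unfolding rm_def by blast
    show ?thesis
    proof (cases "v = x")
      case True
      then show ?thesis using dn rmx o Vis by (intro exI[of _ "dn @ [a]"]) auto
    next
      case False
      then show ?thesis using dn Vis rm' by auto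
    qed
  qed
  have 2: "ch f L + of_bool (f (last L) \<noteq> f x) + ch f (x # stk) + 2 * (\<Sum>v\<in>set L. cutl (Al st0) f (rm' v))
       \<le> 2 * (\<Sum>v\<in>set L. cutl (Al st0) f (adj v))" for f
  proof -
    have "cutl (Al st0) f (rm' x) \<le> cutl (Al st0) f (a # rm' x)" by (simp add: cutl_def)
    then have "(\<Sum>v\<in>set L. cutl (Al st0) f (rm' v)) \<le> (\<Sum>v\<in>set L. cutl (Al st0) f (rm v))" unfolding sum by simp
    moreover have "ch f L + of_bool (f (last L) \<noteq> f x) + ch f (x # stk) + 2 * (\<Sum>v\<in>set L. cutl (Al st0) f (rm v))
       \<le> 2 * (\<Sum>v\<in>set L. cutl (Al st0) f (adj v))"
      using I[unfolded dfsinv_def] unfolding rm_def by simp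
    ultimately show ?thesis by linarith
  qed
  have 3: "n0 + 20 * (\<Sum>v\<in>set L. length (rm' v)) + 10 * length (x # stk) + 5 \<le> n' + 40 * (\<Sum>v\<in>set L. deg1 v)"
  proof -
    have "(\<Sum>v\<in>set L. length (rm v)) = Suc (\<Sum>v\<in>set L. length (rm' v))" using sum[of length] by simp
    moreover have "n0 + 20 * (\<Sum>v\<in>set L. length (rm v)) + 10 * length (x # stk) + 5 \<le> n + 40 * (\<Sum>v\<in>set L. deg1 v)"
      using I[unfolded dfsinv_def] unfolding rm_def by simp
    ultimately show ?thesis using n by linarith
  qed
  have 4: "arr st' ''pt'' v = 0" if "v \<in> set L - set (x # stk)" for v using I that A by (auto simp: dfsinv_def)
  have 5: "dfs_post st0 v0 L st'" using I A(2)[of "''L''"] s Vis by (simp add: dfsinv_def dfs_post_def)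
  have 6: "set (x # stk) \<subseteq> set L" "distinct (x # stk)" "parc (arr st' ''par'') (x # stk)" "scalar st' ''u'' = Suc x"
    using I A(2)[of "''par''"] s by (simp_all add: dfsinv_def)
  have 7: "n' \<le> n0" using I n by (simp add: dfsinv_def)
  show ?thesis unfolding dfsinv_def using 1 2 3 4 5 6 7 unfolding rm'_def by simp
qed

lemma dfs_disc:
  assumes I: "dfsinv st0 v0 n0 L (x # stk) st n" and stk: "stb st" and a: "arr st ''pt'' x = a" "a \<noteq> 0"
    and e: "a div 2 - 1 \<in> Al st0" "a \<in> set (adj x)" and o: "other a = y" "y \<notin> Vis st" and n: "n \<le> n' + 40" "n' \<le> n"
    and s: "scalar st' ''u'' = Suc y" "scalar st' ''k'' = Suc (scalar st ''k'')" "scalar st' ''rd'' = scalar st ''rd''"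
      "arr st' = (arr st)(''vis'' := (arr st ''vis'')(y := scalar st ''rd''),
          ''pt'' := (arr st ''pt'')(x := arr st ''nx'' a, y := arr st ''hd'' y), ''par'' := (arr st ''par'')(y := Suc x),
          ''L'' := (arr st ''L'')(scalar st ''k'' := y))"
  shows "dfsinv st0 v0 n0 (L @ [y]) (y # x # stk) st' n'"
proof -
  have rem: "lst (arr st ''nx'') a = a # lst (arr st ''nx'') (arr st ''nx'' a)"
    using lst_step[of a "arr st ''nx''"] stk a by (simp add: stb_def)
  have xL: "x \<in> set L" using I by (simp add: dfsinv_def)
  have post: "dfs_post st0 v0 L st" using I by (simp add: dfsinv_def)
  have yL: "y \<notin> set L" using post o by (auto simp: dfs_post_def)
  have xy: "x \<noteq> y" using xL yL by auto
  have A: "arr st' ''pt'' = (arr st ''pt'')(x := arr st ''nx'' a, y := arr st ''hd'' y)" "arr st' ''nx'' = arr st ''nx''"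
    "arr st' ''par'' = (arr st ''par'')(y := Suc x)" using s by simp_all
  have Vis: "Vis st' = insert y (Vis st)" using s by (auto simp: Vis_def)
  have exy: "a div 2 - 1 < m" "src (a div 2 - 1) = x \<and> dst (a div 2 - 1) = y \<or> src (a div 2 - 1) = y \<and> dst (a div 2 - 1) = x"
    using e(2) o(1) by (auto simp: set_adj other_def A0_def split: if_splits)
  have yV: "y \<in> V" using exy by (auto simp: V_def)
  define rm where "rm = (\<lambda>v. lst (arr st ''nx'') (arr st ''pt'' v))"
  define rm' where "rm' = (\<lambda>v. lst (arr st' ''nx'') (arr st' ''pt'' v))"
  have rm': "rm' v = rm v" if "v \<noteq> x" "v \<noteq> y" for v using that A by (simp add: rm_def rm'_def)
  have rmx: "rm x = a # rm' x" using rem a A xy by (simp add: rm_def rm'_def)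
  have rmy: "rm' y = adj y" using stk A xy by (simp add: rm'_def stb_def)
  have sum: "(\<Sum>v\<in>set L. g (rm v)) = g (a # rm' x) + (\<Sum>v\<in>set L - {x}. g (rm' v))"
     "(\<Sum>v\<in>set (L @ [y]). g (rm' v)) = g (adj y) + g (rm' x) + (\<Sum>v\<in>set L - {x}. g (rm' v))" for g :: "nat list \<Rightarrow> nat"
  proof -
    have "(\<Sum>v\<in>set L. g (rm v)) = g (rm x) + (\<Sum>v\<in>set L - {x}. g (rm v))" by (rule sum.remove) (use xL in auto)
    also have "(\<Sum>v\<in>set L - {x}. g (rm v)) = (\<Sum>v\<in>set L - {x}. g (rm' v))" 
    proof (rule sum.cong[OF refl])
      fix v assume "v \<in> set L - {x}"
      then have "rm' v = rm v" using yL by (intro rm') auto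
      then show "g (rm v) = g (rm' v)" by simp
    qed
    finally show "(\<Sum>v\<in>set L. g (rm v)) = g (a # rm' x) + (\<Sum>v\<in>set L - {x}. g (rm' v))" by (simp add: rmx)
    have "(\<Sum>v\<in>set (L @ [y]). g (rm' v)) = g (rm' y) + (\<Sum>v\<in>set L. g (rm' v))" using yL by simp
    also have "(\<Sum>v\<in>set L. g (rm' v)) = g (rm' x) + (\<Sum>v\<in>set L - {x}. g (rm' v))" by (rule sum.remove) (use xL in auto)
    finally show "(\<Sum>v\<in>set (L @ [y]). g (rm' v)) = g (adj y) + g (rm' x) + (\<Sum>v\<in>set L - {x}. g (rm' v))" by (simp add: rmy)
  qed
  have sumy: "(\<Sum>v\<in>set (L @ [y]). g v) = g y + (\<Sum>v\<in>set L. g v)" for g :: "nat \<Rightarrow> nat" using yL by simp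
  have 1: "\<exists>dn. adj v = dn @ rm' v \<and> (\<forall>c\<in>set dn. c div 2 - 1 \<in> Al st0 \<longrightarrow> other c \<in> Vis st')" if v: "v \<in> set (L @ [y])" for v
  proof (cases "v = y")
    case True
    then show ?thesis using rmy by (intro exI[of _ "[]"]) simp
  next
    case False
    then have "v \<in> set L" using v by simp
    then obtain dn where dn: "adj v = dn @ rm v" "\<forall>c\<in>set dn. c div 2 - 1 \<in> Al st0 \<longrightarrow> other c \<in> Vis st"
      using I[unfolded dfsinv_def] unfolding rm_def by blast
    show ?thesis
    proof (cases "v = x")
      case True
      then show ?thesis using dn rmx o Vis by (intro exI[of _ "dn @ [a]"]) auto
    next
      case False
      then show ?thesis using dn Vis rm' \<open>v \<noteq> y\<close> by auto
    qed
  qed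
  have Lne: "L \<noteq> []" using post by (simp add: dfs_post_def)
  have 2: "ch f (L @ [y]) + ch f (y # x # stk) + 2 * (\<Sum>v\<in>set (L @ [y]). cutl (Al st0) f (rm' v))
       \<le> 2 * (\<Sum>v\<in>set (L @ [y]). cutl (Al st0) f (adj v))" for f
  proof -
    \<comment> \<open>If \<open>f\<close> differs at \<open>x\<close> and \<open>y\<close>, reading
      the code \<open>a\<close> frees two units: one for a change in the discovery order, one for
      the change on the stack.\<close>
    have c1: "cutl (Al st0) f (a # rm' x) = of_bool (f x \<noteq> f y) + cutl (Al st0) f (rm' x)"
      using exy(2) e(1) by (auto simp: cutl_def)
    define p q u :: nat where "p = of_bool (f (last L) \<noteq> f x)" and "q = of_bool (f x \<noteq> f y)"
      and "u = of_bool (f (last L) \<noteq> f y)"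
    have "ch f L + p + ch f (x # stk) + 2 * (\<Sum>v\<in>set L. cutl (Al st0) f (rm v))
       \<le> 2 * (\<Sum>v\<in>set L. cutl (Al st0) f (adj v))"
      using I[unfolded dfsinv_def] unfolding rm_def p_def by simp
    moreover have "u \<le> p + q" by (auto simp: p_def q_def u_def)
    moreover have "ch f (y # x # stk) = q + ch f (x # stk)" by (auto simp: q_def)
    ultimately show ?thesis 
      using sum(1)[of "cutl (Al st0) f"] sum(2)[of "cutl (Al st0) f"] sumy[of "\<lambda>v. cutl (Al st0) f (adj v)"]
        ch_snoc[OF Lne, of f y] c1 unfolding u_def[symmetric] q_def[symmetric] by linarith
  qed
  have 3: "n0 + 20 * (\<Sum>v\<in>set (L @ [y]). length (rm' v)) + 10 * length (y # x # stk) + 5 \<le> n' + 40 * (\<Sum>v\<in>set (L @ [y]). deg1 v)"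
  proof -
    have "n0 + 20 * (\<Sum>v\<in>set L. length (rm v)) + 10 * length (x # stk) + 5 \<le> n + 40 * (\<Sum>v\<in>set L. deg1 v)"
      using I[unfolded dfsinv_def] unfolding rm_def by simp
    then show ?thesis using n unfolding sum[of length] sumy[of deg1] by simp
  qed
  have 4: "arr st' ''pt'' v = 0" if "v \<in> set (L @ [y]) - set (y # x # stk)" for v using I that A by (auto simp: dfsinv_def)
  have 5: "dfs_post st0 v0 (L @ [y]) st'"
  proof -
    note pp = post[unfolded dfs_post_def]
    show ?thesis
      unfolding dfs_post_def
    proof (intro conjI allI impI)
      show "L @ [y] \<noteq> []" "hd (L @ [y]) = v0" "distinct (L @ [y])" "scalar st' ''k'' = length (L @ [y])"
        "set (L @ [y]) \<subseteq> V" using pp yL yV s(2) by simp_all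
      show "Vis st' = Vis st0 \<union> set (L @ [y])" using pp Vis by simp
      show "set (L @ [y]) \<inter> Vis st0 = {}" using pp o(2) by simp
    next
      fix t assume "t < length (L @ [y])"
      then show "arr st' ''L'' t = (L @ [y]) ! t" using pp s(4) by (cases "t = length L") (simp_all add: nth_append)
    next
      fix C assume C: "v0 \<in> C" "eclosed (Al st0) C"
      have LC: "set L \<subseteq> C" using pp C by simp
      then have "src (a div 2 - 1) \<in> C \<longleftrightarrow> dst (a div 2 - 1) \<in> C" using C(2) e(1) unfolding eclosed_def by blast
      then have "y \<in> C" using LC xL exy(2) by auto
      with LC show "set (L @ [y]) \<subseteq> C" by simp
    qed
  qed
  have 6: "set (y # x # stk) \<subseteq> set (L @ [y])" "distinct (y # x # stk)" "parc (arr st' ''par'') (y # x # stk)"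
  proof -
    have xs: "set (x # stk) \<subseteq> set L" "distinct (x # stk)" "parc (arr st ''par'') (x # stk)" using I by (simp_all add: dfsinv_def)
    then have "y \<notin> set (x # stk)" using yL by blast
    with xs show "distinct (y # x # stk)" "parc (arr st' ''par'') (y # x # stk)" "set (y # x # stk) \<subseteq> set (L @ [y])"
      using parc_upd[of y "x # stk" "arr st ''par''"] A by auto
  qed
  have 7: "n' \<le> n0" using I n by (simp add: dfsinv_def)
  show ?thesis unfolding dfsinv_def using 1 2 3 4 5 6 7 s(1) unfolding rm'_def by simp
qed

text \<open>The bound on \<open>ch\<close> holds for all \<open>f\<close> at once, because the walk
  is fixed while the refined intervals are still unknown to the program.\<close>

lemma wp_dfs:
  assumes stk: "stb st" and v0: "scalar st ''v'' = v0" "v0 \<in> V" "v0 \<notin> Vis st"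
    and A: "Al st \<subseteq> A0" and cl: "eclosed (Al st) (Vis st)"
    and n: "40 * (\<Sum>v\<in>V - Vis st. deg1 v) + 20 \<le> n"
    and Q: "\<And>st' n' L. unch dfs_c st st' \<Longrightarrow> dfs_post st v0 L st' \<Longrightarrow> eclosed (Al st) (set L) \<Longrightarrow>
        (\<And>f. ch f L \<le> 2 * (\<Sum>v\<in>set L. cutl (Al st) f (adj v))) \<Longrightarrow> n \<le> n' + 40 * (\<Sum>v\<in>set L. deg1 v) \<Longrightarrow> n' \<le> n \<Longrightarrow> Q st' n'"
  shows "wp M le dfs_c Q st n"
proof -
  define J where "J = (\<lambda>st' n'. unch dfs_c st st' \<and> (\<exists>L stk. dfsinv st v0 n L stk st' n'))"
  define st0 where "st0 = st\<lparr>arr := (arr st)(''vis'' := (arr st ''vis'')(v0 := scalar st ''rd''),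
       ''pt'' := (arr st ''pt'')(v0 := arr st ''hd'' v0), ''par'' := (arr st ''par'')(v0 := 0), ''L'' := (arr st ''L'')(0 := v0)),
     scalar := (scalar st)(''k'' := 1, ''u'' := Suc v0)\<rparr>"
  have bound: "20 * (\<Sum>v\<in>set L. length (lst (arr st' ''nx'') (arr st' ''pt'' v))) + 10 * length stk + 20 \<le> n'"
    "length L \<le> 2 * m"
    if D: "dfsinv st v0 n L stk st' n'" for L stk st' n'
  proof -
    have p: "set L \<subseteq> V" "set L \<inter> Vis st = {}" "distinct L" using D by (auto simp: dfsinv_def dfs_post_def)
    have "(\<Sum>v\<in>set L. deg1 v) \<le> (\<Sum>v\<in>V - Vis st. deg1 v)" by (rule sum_mono2) (use p in auto)
    moreover have "n + 20 * (\<Sum>v\<in>set L. length (lst (arr st' ''nx'') (arr st' ''pt'' v))) + 10 * length stk + 5 \<le> n' + 40 * (\<Sum>v\<in>set L. deg1 v)"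
      using D by (simp add: dfsinv_def)
    ultimately show "20 * (\<Sum>v\<in>set L. length (lst (arr st' ''nx'') (arr st' ''pt'' v))) + 10 * length stk + 20 \<le> n'"
      using n by linarith
    have "length L = card (set L)" using p(3) by (simp add: distinct_card)
    also have "\<dots> \<le> card V" by (rule card_mono) (use p in auto)
    finally show "length L \<le> 2 * m" using card_V by simp
  qed
  have init: "dfsinv st v0 n [v0] [v0] st0 n1" if n1: "n = n1 + 12" for n1
  proof -
    have "Vis st0 = Vis st \<union> {v0}" by (auto simp: Vis_def st0_def)
    moreover have "lst (arr st0 ''nx'') (arr st0 ''pt'' v0) = adj v0" using stk by (simp add: st0_def stb_def)
    ultimately show ?thesis using v0 n1 unfolding dfsinv_def dfs_post_def by (simp add: st0_def)
  qed
  have "wp M le (While (Not (Eq (Var ''u'') (Const 0))) dfs_body_c) Q st0 n1" if n1: "n = n1 + 12" for n1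
  proof (rule wp_While[where I = J])
    show "J st0 n1" unfolding J_def using init[OF n1] by (auto simp: unch_def wv_dfs st0_def)
  next
    fix st1 n1 assume J: "J st1 n1" and b: "bv M le st1 (Not (Eq (Var ''u'') (Const 0)))"
    then obtain L stk' where D': "dfsinv st v0 n L stk' st1 n1" and u1: "unch dfs_c st st1" unfolding J_def by blast
    have "stk' \<noteq> []" using D' b by (auto simp: dfsinv_def)
    then obtain x stk where D: "dfsinv st v0 n L (x # stk) st1 n1" using D' by (cases stk') auto
    have u: "scalar st1 ''u'' = Suc x" and xL: "x \<in> set L" using D by (simp_all add: dfsinv_def)
    have stb1: "stb st1" by (rule stb_unch[OF u1 stk]) (simp_all add: wv_dfs)
    have al1: "arr st1 ''al'' = arr st ''al''" using u1 by (simp add: unch_def wv_dfs)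
    define a where "a = arr st1 ''pt'' x"
    note bnd = bound[OF D]
    have n30: "30 \<le> n1" using bnd by simp
    show "1 \<le> n1 \<and> wp M le dfs_body_c J st1 (n1 - 1)"
    proof (cases "a = 0")
      case True
      have "dfsinv st v0 n L stk (st1\<lparr>scalar := (scalar st1)(''a'' := 0, ''u'' := arr st1 ''par'' x)\<rparr>) (n1 - 5)"
        using dfs_pop[OF D] True n30 by (simp add: a_def)
      then have "J (st1\<lparr>scalar := (scalar st1)(''a'' := 0, ''u'' := arr st1 ''par'' x)\<rparr>) (n1 - 5)"
        using u1 unfolding J_def by (auto simp: unch_def wv_dfs)
      then show ?thesis using True u n30
        by (simp add: dfs_body_c_def wps a_def[symmetric] numeral_2_eq_2[symmetric])
    next
      case False
      have rem: "lst (arr st1 ''nx'') a = a # lst (arr st1 ''nx'') (arr st1 ''nx'' a)"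
        using lst_step[of a "arr st1 ''nx''"] stb1 False by (simp add: stb_def)
      have aadj: "a \<in> set (adj x)"
      proof -
        obtain dn where "adj x = dn @ lst (arr st1 ''nx'') (arr st1 ''pt'' x)" using D xL unfolding dfsinv_def by blast
        then show ?thesis using rem by (simp add: a_def[symmetric])
      qed
      define e where "e = a div 2 - 1"
      have e_eq: "a div 2 - Suc 0 = e" by (simp add: e_def)
      have e: "e \<in> A0" "e < m" using aadj by (auto simp: set_adj e_def A0_def)
      have n50: "50 \<le> n1"
      proof -
        have "length (lst (arr st1 ''nx'') (arr st1 ''pt'' x)) \<le> (\<Sum>v\<in>set L. length (lst (arr st1 ''nx'') (arr st1 ''pt'' v)))"
          by (rule member_le_sum) (use xL in auto)
        then show ?thesis using bnd rem by (simp add: a_def[symmetric])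
      qed
      have al: "arr st1 ''al'' e = Suc 0 \<longleftrightarrow> e \<in> Al st" using e al1 by (simp add: Al_def)
      have nxM: "arr st1 ''dst'' e = dst e" "arr st1 ''src'' e = src e" using stb1 e by (simp_all add: stb_def)
      show ?thesis
      proof (cases "e \<in> Al st \<and> other a \<notin> Vis st1")
        case False
        define st2 where "st2 = upds ''e'' e (upda ''pt'' x (arr st1 ''nx'' a) (upds ''a'' a st1))"
        define st3 where "st3 = upds ''v'' (other a) st2"
        have J2: "J st2 n2" if "n1 \<le> n2 + 20" "n2 \<le> n1" "e \<notin> Al st" for n2
        proof -
          have "dfsinv st v0 n L (x # stk) st2 n2"
            by (rule dfs_skip[OF D stb1]) (use that \<open>a \<noteq> 0\<close> False in \<open>auto simp: st2_def a_def[symmetric] e_def\<close>)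
          then show ?thesis using u1 unfolding J_def by (auto simp: unch_def wv_dfs st2_def)
        qed
        have J3: "J st3 n2" if "n1 \<le> n2 + 20" "n2 \<le> n1" for n2
        proof -
          have "dfsinv st v0 n L (x # stk) st3 n2"
            by (rule dfs_skip[OF D stb1]) (use that \<open>a \<noteq> 0\<close> False in \<open>auto simp: st3_def st2_def a_def[symmetric] e_def\<close>)
          then show ?thesis using u1 unfolding J_def by (auto simp: unch_def wv_dfs st3_def st2_def)
        qed
        have vis: "e \<in> Al st \<Longrightarrow> arr st1 ''vis'' (other a) = scalar st1 ''rd''" using False by (simp add: Vis_def)
        show ?thesis
        proof (cases "e \<in> Al st")
          case True
          then show ?thesis using u n50 \<open>a \<noteq> 0\<close> al vis J3 nxM
            by (cases "even a") (simp_all add: dfs_body_c_def wps a_def[symmetric] e_eq st3_def st2_def other_def mod_2_eq_odd)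
        next
          case False
          then show ?thesis using u n50 \<open>a \<noteq> 0\<close> al J2
            by (simp add: dfs_body_c_def wps a_def[symmetric] e_eq st2_def)
        qed
      next
        case True
        define y where "y = other a"
        have yV: "y \<in> V" using e by (auto simp: y_def other_def e_eq V_def)
        have kM: "Suc (scalar st1 ''k'') < M" using D bnd(2) M_small by (simp add: dfsinv_def dfs_post_def)
        define st2 where "st2 = st1\<lparr>arr := (arr st1)(''vis'' := (arr st1 ''vis'')(y := scalar st1 ''rd''),
            ''pt'' := (arr st1 ''pt'')(x := arr st1 ''nx'' a, y := arr st1 ''hd'' y), ''par'' := (arr st1 ''par'')(y := Suc x),
            ''L'' := (arr st1 ''L'')(scalar st1 ''k'' := y)),
          scalar := (scalar st1)(''a'' := a, ''e'' := e, ''v'' := y, ''k'' := Suc (scalar st1 ''k''), ''u'' := Suc y)\<rparr>"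
        have J2: "J st2 n2" if "n1 \<le> n2 + 40" "n2 \<le> n1" for n2
        proof -
          have "dfsinv st v0 n (L @ [y]) (y # x # stk) st2 n2"
            by (rule dfs_disc[OF D stb1, of a]) (use that \<open>a \<noteq> 0\<close> True aadj in \<open>auto simp: st2_def a_def[symmetric] e_def y_def\<close>)
          then show ?thesis using u1 unfolding J_def by (auto simp: unch_def wv_dfs st2_def)
        qed
        have vis: "arr st1 ''vis'' y \<noteq> scalar st1 ''rd''" using True by (simp add: Vis_def y_def)
        have ey: "even a \<Longrightarrow> dst e = y" "odd a \<Longrightarrow> src e = y" by (simp_all add: y_def other_def e_eq)
        show ?thesis
        proof (cases "even a")
          case ev: True
          show ?thesis using u n50 \<open>a \<noteq> 0\<close> al True vis nxM ey ev
            by (simp add: dfs_body_c_def wps a_def[symmetric] e_eq mod_2_eq_odd)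
              (simp only: mod_less[OF kM] mod_less[OF V_M[OF yV]], rule J2[unfolded st2_def]; simp)
        next
          case ev: False
          show ?thesis using u n50 \<open>a \<noteq> 0\<close> al True vis nxM ey ev
            by (simp add: dfs_body_c_def wps a_def[symmetric] e_eq mod_2_eq_odd)
              (simp only: mod_less[OF kM] mod_less[OF V_M[OF yV]], rule J2[unfolded st2_def]; simp)
        qed
      qed
    qed
  next
    fix st1 n1 assume J: "J st1 n1" and b: "\<not> bv M le st1 (Not (Eq (Var ''u'') (Const 0)))"
    then obtain L stk' where D': "dfsinv st v0 n L stk' st1 n1" and u1: "unch dfs_c st st1" unfolding J_def by blast
    have "stk' = []" using D' b by (auto simp: dfsinv_def split: if_splits)
    then have D: "dfsinv st v0 n L [] st1 n1" using D' by simp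
    have post: "dfs_post st v0 L st1" using D by (simp add: dfsinv_def)
    have pt: "arr st1 ''pt'' v = 0" if "v \<in> set L" for v using D that by (simp add: dfsinv_def)
    have dnx: "\<forall>v\<in>set L. \<exists>dn. adj v = dn @ lst (arr st1 ''nx'') (arr st1 ''pt'' v) \<and>
        (\<forall>c\<in>set dn. c div 2 - 1 \<in> Al st \<longrightarrow> other c \<in> Vis st1)"
      using D unfolding dfsinv_def by (elim conjE) assumption
    have all: "other c \<in> Vis st \<union> set L" if "v \<in> set L" "c \<in> set (adj v)" "c div 2 - 1 \<in> Al st" for v c
    proof -
      from bspec[OF dnx that(1)] obtain dn where dn: "adj v = dn @ lst (arr st1 ''nx'') (arr st1 ''pt'' v)"
          "\<forall>c\<in>set dn. c div 2 - 1 \<in> Al st \<longrightarrow> other c \<in> Vis st1"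
        by (elim exE conjE)
      then show ?thesis using pt that post by (simp add: dfs_post_def)
    qed
    \<comment> \<open>All incidences of \<open>L\<close> have been read, so live edges join
      \<open>L\<close> to visited vertices only. Those visited before this search form a closed set
      and cannot be adjacent to \<open>L\<close>.\<close>
    have "eclosed (Al st) (set L)"
      unfolding eclosed_def
    proof (intro ballI iffI)
      fix e assume e: "e \<in> Al st" "src e \<in> set L"
      have "e \<in> A0" using e A by blast
      then have "2 * e + 2 \<in> set (adj (src e))" by (auto simp: set_adj A0_def)
      from all[OF e(2) this] e have "dst e \<in> Vis st \<union> set L" by (simp add: other_def)
      moreover have "src e \<notin> Vis st" using post e by (auto simp: dfs_post_def)
      ultimately show "dst e \<in> set L" using cl e unfolding eclosed_def by blast
    next
      fix e assume e: "e \<in> Al st" "dst e \<in> set L"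
      have "e \<in> A0" using e A by blast
      then have "2 * e + 3 \<in> set (adj (dst e))" by (auto simp: set_adj A0_def)
      from all[OF e(2) this] e have "src e \<in> Vis st \<union> set L" by (simp add: other_def)
      moreover have "dst e \<notin> Vis st" using post e by (auto simp: dfs_post_def)
      ultimately show "src e \<in> set L" using cl e unfolding eclosed_def by blast
    qed
    moreover have "ch f L \<le> 2 * (\<Sum>v\<in>set L. cutl (Al st) f (adj v))" for f
    proof -
      have "ch f L + 0 + ch f [] + 2 * (\<Sum>v\<in>set L. cutl (Al st) f (lst (arr st1 ''nx'') (arr st1 ''pt'' v)))
          \<le> 2 * (\<Sum>v\<in>set L. cutl (Al st) f (adj v))"
        using D unfolding dfsinv_def by (elim conjE allE[of _ f]) simp
      then show ?thesis by linarith
    qed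
    moreover have "n + 5 \<le> n1 + 40 * (\<Sum>v\<in>set L. deg1 v)" "n1 \<le> n"
      using D by (simp_all add: dfsinv_def)
    moreover have "20 \<le> n1" using bound[OF D] by simp
    ultimately have "Q st1 (n1 - 1)" by (intro Q[OF u1 post]) auto
    then show "1 \<le> n1 \<and> Q st1 (n1 - 1)" using \<open>20 \<le> n1\<close> by simp
  qed
  from this[of "n - 12"] show ?thesis using n v0 V_M[OF v0(2)] by (simp add: dfs_c_def wps st0_def numeral_2_eq_2[symmetric])
qed

end

section \<open>Locating source values\<close>

lemma ch_take_le: "ch f (take t L) \<le> ch f L"
proof (induction f L arbitrary: t rule: ch.induct)
  case (2 f x)
  then show ?case by (cases t) auto
next
  case (3 f x y zs)
  show ?case
  proof (cases t)
    case (Suc u)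
    then show ?thesis using 3[of u] by (cases u) auto
  qed simp
qed simp

lemma ch_take_Suc: "0 < t \<Longrightarrow> t < length L \<Longrightarrow>
   ch f (take (Suc t) L) = ch f (take t L) + of_bool (f (L ! (t - 1)) \<noteq> f (L ! t))"
proof -
  assume t: "0 < t" "t < length L"
  have ne: "take t L \<noteq> []" using t by auto
  have "last (take t L) = L ! (t - 1)" using t by (cases t) (simp_all add: take_Suc_conv_app_nth)
  then show ?thesis using t ch_snoc[OF ne, of f "L ! t"] by (simp add: take_Suc_conv_app_nth)
qed

context ssbp_run
begin

text \<open>A code below the interval of its vertex cannot determine the value any more;
  \<open>val\<close> marks the codes that still can.\<close>

definition val :: "state \<Rightarrow> nat \<Rightarrow> bool" where
  "val st v \<longleftrightarrow> arr st ''h'' v \<noteq> 0 \<and> arr st ''lo'' v \<le> Lev (rkc (arr st ''h'' v))"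

definition hl :: "state \<Rightarrow> nat \<Rightarrow> nat" where
  "hl st v = blk (scalar st ''Dn'') (Lev (rkc (arr st ''h'' v)))"

text \<open>Codes never exceed the values, so a code located away from the target lies below the
  refined interval: it is useful now and useless after the round. This is what pays for the search
  that it causes.\<close>

definition Lost :: "state \<Rightarrow> nat set \<Rightarrow> nat set" where
  "Lost st B = {v \<in> B. val st v \<and> hl st v \<noteq> tgt (scalar st ''Dn'') v}"

text \<open>A search at \<open>x\<close> happens only if \<open>g\<close> misses the interval of its
  code. Unless the code is lost, that interval is the target of \<open>x\<close>, so a miss means
  that targets have changed since \<open>g\<close> was set or that \<open>g\<close> stems from a
  lost code. This gives one initial search, one per change of \<open>tgt\<close> and two per lost
  code.\<close>

lemma wp_locate:
  assumes st: "stb st" "bwf st" and k: "scalar st ''k'' = length L" "\<And>t. t < length L \<Longrightarrow> arr st ''L'' t = L ! t"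
      "distinct L" "L \<noteq> []" "length L < M"
    and h: "\<And>v. arr st ''h'' v \<le> m" "\<And>v. rkc (arr st ''h'' v) \<le> Bn v"
    and D: "scalar st ''D'' = scalar st ''Dn'' * 2 ^ T" "0 < scalar st ''Dn''" "m + scalar st ''D'' < M"
    and lo: "\<And>v. v \<in> set L \<Longrightarrow> arr st ''lo'' v = tgt (scalar st ''D'') v"
    and n: "40 * length L + (6 * T + 20) * (1 + ch (tgt (scalar st ''Dn'')) L + 2 * card (Lost st (set L))) + 20 \<le> n"
      "scalar st ''nn'' + n \<le> N" "N < M"
    and Q: "\<And>st' n'. unch locate_c st st' \<Longrightarrow> bwf st' \<Longrightarrow>
       (\<And>j. bkt st' j = bkt st j \<union> {x \<in> set L. val st x \<and> j = hl st x}) \<Longrightarrow> blen r st' \<le> blen r st + length L \<Longrightarrow>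
       n \<le> n' + 40 * length L + (6 * T + 20) * (1 + ch (tgt (scalar st ''Dn'')) L + 2 * card (Lost st (set L))) + 20 \<Longrightarrow>
       scalar st' ''nn'' + n' \<le> N \<Longrightarrow> Q st' n'"
  shows "wp M le locate_c Q st n"
proof -
  define d where "d = scalar st ''Dn''"
  define f where "f = tgt d"
  define lost where "lost = (\<lambda>t. card (Lost st (set (take t L))))"
  define tot where "tot = 1 + ch f L + 2 * card (Lost st (set L))"
  \<comment> \<open>A search that is still owed: \<open>g\<close> is not the target of the vertex
    before position \<open>t\<close>. The debt is carried across vertices without a useful code,
    which leave \<open>g\<close> alone.\<close>
  define bad where "bad = (\<lambda>t g. if t = 0 then 1 else of_bool (g \<noteq> f (L ! (t - 1))) :: nat)"
  have d0: "0 < d" "d \<le> scalar st ''D''" using D by (simp_all add: d_def)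
  have totb: "1 + ch f (take t L) + 2 * lost t \<le> tot" for t
  proof -
    have "Lost st (set (take t L)) \<subseteq> Lost st (set L)" by (auto simp: Lost_def dest: in_set_takeD)
    then have "lost t \<le> card (Lost st (set L))" unfolding lost_def by (rule card_mono[rotated]) (auto simp: Lost_def)
    then show ?thesis using ch_take_le[of f t L] by (simp add: tot_def)
  qed
  define J where "J = (\<lambda>st' n'. \<exists>t mis. unch locate_c st st' \<and> bwf st' \<and> scalar st' ''t'' = t \<and> t \<le> length L \<and>
     (\<forall>j. bkt st' j = bkt st j \<union> {x \<in> set (take t L). val st x \<and> j = hl st x}) \<and> blen r st' \<le> blen r st + t \<and>
     d dvd scalar st' ''g'' \<and> scalar st' ''g'' \<le> r \<and>
     mis + bad t (scalar st' ''g'') \<le> 1 + ch f (take t L) + 2 * lost t \<and>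
     n \<le> n' + 30 * t + (6 * T + 20) * mis + 5 \<and> scalar st' ''nn'' + n' \<le> N)"
  define st0 where "st0 = st\<lparr>scalar := (scalar st)(''g'' := arr st ''lo'' (L ! 0), ''t'' := 0)\<rparr>"
  have "wp M le (While (Less (Var ''t'') (Var ''k'')) locate_body_c) Q st0 (n - 4)"
  proof (rule wp_While[where I = J])
    have "unch locate_c st st0" by (simp add: unch_def wv_locate st0_def)
    moreover have "bwf st0" using st(2) by (simp add: st0_def bwf_scalar)
    moreover have "arr st ''lo'' (L ! 0) = blk (scalar st ''D'') (Lev (Bn (L ! 0)))" using lo[of "L ! 0"] k(4) by (simp add: tgt_def)
    then have "scalar st ''D'' dvd arr st ''lo'' (L ! 0)" "arr st ''lo'' (L ! 0) \<le> r" using dvd_blk tgt_le_r by (simp_all add: tgt_def)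
    then have "d dvd arr st ''lo'' (L ! 0)" "arr st ''lo'' (L ! 0) \<le> r" using D by (simp_all add: d_def) (metis dvd_mult_left)
    ultimately show "J st0 (n - 4)" unfolding J_def using n
      by (intro exI[of _ 0]) (auto simp: st0_def bad_def lost_def)
  next
    fix st1 n1 assume J: "J st1 n1" and b: "bv M le st1 (Less (Var ''t'') (Var ''k''))"
    from J obtain t mis where J1: "unch locate_c st st1" "bwf st1" "scalar st1 ''t'' = t" "t \<le> length L"
      "\<forall>j. bkt st1 j = bkt st j \<union> {x \<in> set (take t L). val st x \<and> j = hl st x}" "blen r st1 \<le> blen r st + t"
      "d dvd scalar st1 ''g''" "scalar st1 ''g'' \<le> r"
      "mis + bad t (scalar st1 ''g'') \<le> 1 + ch f (take t L) + 2 * lost t"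
      "n \<le> n1 + 30 * t + (6 * T + 20) * mis + 5" "scalar st1 ''nn'' + n1 \<le> N"
      unfolding J_def by blast
    have fr: "\<And>x. x \<notin> {''g'', ''p'', ''nn'', ''t'', ''x'', ''e'', ''y''} \<Longrightarrow> scalar st1 x = scalar st x"
      "\<And>A. A \<notin> {''bv'', ''bn'', ''bh''} \<Longrightarrow> arr st1 A = arr st A"
      using J1(1) unfolding unch_def wv_locate by blast+
    have tl: "t < length L" using b J1(3) k(1) fr(1)[of "''k''"] by simp
    define x where "x = L ! t"
    define g where "g = scalar st1 ''g''"
    have xL: "x \<in> set L" using tl by (simp add: x_def)
    have takeS: "set (take (Suc t) L) = insert x (set (take t L))" using tl by (simp add: take_Suc_conv_app_nth x_def)
    have xnt: "x \<notin> set (take t L)" using k(3) tl by (auto simp: x_def in_set_conv_nth nth_eq_iff_index_eq)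
    have chS: "ch f (take (Suc t) L) \<ge> ch f (take t L)"
      using ch_take_Suc[of t L f] tl by (cases "t = 0") auto
    have badS: "of_bool (g' \<noteq> f x) + ch f (take t L) \<le> bad t g' + ch f (take (Suc t) L)" for g'
      using ch_take_Suc[of t L f] tl by (cases "t = 0") (auto simp: bad_def x_def)
    have badx: "bad (Suc t) g' = of_bool (g' \<noteq> f x)" for g' by (simp add: bad_def x_def)
    have lostS: "lost (Suc t) = lost t + of_bool (val st x \<and> hl st x \<noteq> f x)"
    proof -
      have "Lost st (set (take (Suc t) L)) = (if val st x \<and> hl st x \<noteq> f x then insert x (Lost st (set (take t L))) else Lost st (set (take t L)))"
        unfolding takeS by (auto simp: Lost_def f_def d_def)
      moreover have "x \<notin> Lost st (set (take t L))" using xnt by (simp add: Lost_def)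
      moreover have "finite (Lost st (set (take t L)))" by (simp add: Lost_def)
      ultimately show ?thesis by (simp add: lost_def)
    qed
    have stb1: "stb st1" by (rule stb_unch[OF J1(1) st(1)]) (simp_all add: wv_locate)
    have nbig: "n1 + 30 * t + (6 * T + 20) * mis + 5 \<ge> 40 * length L + (6 * T + 20) * tot + 20"
      using n(1) J1(10) unfolding tot_def f_def d_def by linarith
    have mist: "mis \<le> tot" using J1(9) totb[of t] by linarith
    have "(6 * T + 20) * mis \<le> (6 * T + 20) * tot" by (rule mult_le_mono2[OF mist])
    then have n45: "45 \<le> n1" using nbig tl by linarith
    have kM: "Suc t < M" using k(5) tl by simp
    have finish: "1 \<le> n1 \<and> wp M le locate_body_c J st1 (n1 - 1)"
      if "wp M le (Cond (Eq (Arr ''h'' (Var ''x'')) (Const 0)) Skip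
          (Assign ''e'' (Sub (Arr ''h'' (Var ''x'')) (Const 1)) ;;
           Assign ''y'' (Arr ''lo'' (Var ''x'')) ;;
           Cond (levE (Var ''y'') (Var ''e''))
             (Cond (And (levE (Var ''g'') (Var ''e'')) (Not (aboveE (Add (Var ''g'') (Var ''Dn'')) (Var ''e''))))
                Skip loc_c ;;
              push_c ''x'' ''g'')
             Skip)) (\<lambda>st' n'. 1 \<le> n' \<and> scalar st' ''t'' = t \<and> J (upds ''t'' (Suc t) st') (n' - 1)) (upds ''x'' x st1) (n1 - 4)"
        (is "wp M le ?C _ _ _")
    proof -
      have "scalar st1 ''t'' = t" "arr st1 ''L'' t = x" using J1(3) fr k(2) tl by (simp_all add: x_def)
      moreover have "wp M le ?C (wp M le (Assign ''t'' (Add (Var ''t'') (Const 1))) J) (upds ''x'' x st1) (n1 - 4)"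
        by (rule wp_mono[OF that]) (use kM in \<open>simp add: wps\<close>)
      ultimately have "wp M le locate_body_c J st1 (n1 - 1)"
        using n45 by (simp add: locate_body_c_def wp_Seq wp_Assign credit_le numeral_2_eq_2[symmetric])
      then show ?thesis using n45 by simp
    qed
    show "1 \<le> n1 \<and> wp M le locate_body_c J st1 (n1 - 1)"
    proof (rule finish)
      define st2 where "st2 = upds ''x'' x st1"
      have skip: "1 \<le> n' \<and> scalar st' ''t'' = t \<and> J (upds ''t'' (Suc t) st') (n' - 1)"
        if nv: "\<not> val st x" and s': "arr st' = arr st1" "\<And>y. y \<notin> {''x'', ''e'', ''y''} \<Longrightarrow> scalar st' y = scalar st1 y"
          and n': "n1 \<le> n' + 20" "n' \<le> n1" for st' n'
      proof -
        define st'' where "st'' = upds ''t'' (Suc t) st'"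
        have "unch locate_c st st''" using J1(1) s' by (simp add: unch_def wv_locate st''_def)
        moreover have "bwf st''" using J1(2) s' by (simp add: bwf_def st''_def)
        moreover have "bkt st'' = bkt st1" "blen r st'' = blen r st1" using bkt_cong[of st'' st1] s' by (simp_all add: st''_def)
        moreover have "{x \<in> set (take (Suc t) L). val st x \<and> j = hl st x} = {x \<in> set (take t L). val st x \<and> j = hl st x}" for j
          unfolding takeS using nv by auto
        moreover have "mis + bad (Suc t) g \<le> 1 + ch f (take (Suc t) L) + 2 * lost (Suc t)"
          using J1(9) badS[of g] chS lostS badx[of g] unfolding g_def by linarith
        moreover have "scalar st'' ''g'' = g" "scalar st'' ''nn'' = scalar st1 ''nn''" "scalar st'' ''t'' = Suc t"
          using s' by (simp_all add: st''_def g_def)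
        moreover have "n1 \<le> n' - 1 + 21" using n' n45 by linarith
        then have "n \<le> n' - 1 + 30 * Suc t + (6 * T + 20) * mis + 5" using J1(10) by simp
        moreover have "scalar st1 ''nn'' + (n' - 1) \<le> N" using J1(10,11) n' n45 by linarith
        moreover have "1 \<le> n'" using n' n45 by linarith
        ultimately have "J st'' (n' - 1)"
          unfolding J_def using J1(5,6,7,8) tl by (intro exI[of _ "Suc t"] exI[of _ mis]) (simp add: g_def)
        then show ?thesis using \<open>1 \<le> n'\<close> s' J1(3) by (simp add: st''_def)
      qed
      let ?Q = "\<lambda>st' n'. 1 \<le> n' \<and> scalar st' ''t'' = t \<and> J (upds ''t'' (Suc t) st') (n' - 1)"
      have hx: "arr st1 ''h'' x = arr st ''h'' x" "arr st1 ''lo'' x = arr st ''lo'' x" using fr by simp_all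
      show "wp M le (Cond (Eq (Arr ''h'' (Var ''x'')) (Const 0)) Skip
          (Assign ''e'' (Sub (Arr ''h'' (Var ''x'')) (Const 1)) ;;
           Assign ''y'' (Arr ''lo'' (Var ''x'')) ;;
           Cond (levE (Var ''y'') (Var ''e''))
             (Cond (And (levE (Var ''g'') (Var ''e'')) (Not (aboveE (Add (Var ''g'') (Var ''Dn'')) (Var ''e''))))
                Skip loc_c ;;
              push_c ''x'' ''g'')
             Skip)) ?Q (upds ''x'' x st1) (n1 - 4)"
      proof (cases "arr st ''h'' x = 0")
        case True
        have "?Q st2 (n1 - 6)" by (rule skip) (use True n45 in \<open>auto simp: val_def st2_def\<close>)
        then show ?thesis using True hx n45 by (simp add: wps st2_def numeral_2_eq_2[symmetric])
      next
        case hx0: False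
        define e where "e = arr st ''h'' x - 1"
        define y where "y = arr st ''lo'' x"
        define lv where "lv = Lev (rk e)"
        have em: "e < m" using h(1)[of x] hx0 by (simp add: e_def)
        have rkx: "rkc (arr st ''h'' x) = rk e" using hx0 by (simp add: rkc_def e_def)
        have ylo: "y = blk (scalar st ''D'') (Lev (Bn x))" using lo[OF xL] by (simp add: y_def tgt_def)
        have yr: "y \<le> r" using tgt_le_r ylo by (simp add: tgt_def)
        define st3 where "st3 = st1\<lparr>scalar := (scalar st1)(''x'' := x, ''e'' := e, ''y'' := y)\<rparr>"
        have thr3: "thr st3" using stb_thr[OF stb1] by (simp add: thr_def st3_def)
        have vb: "bv M le st3 (levE (Var ''y'') (Var ''e'')) \<longleftrightarrow> val st x"
          using bv_levE[OF thr3, of "Var ''y''" "Var ''e''"] yr em hx0 by (simp add: st3_def val_def rkx y_def)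
        have red: ?thesis if "wp M le (Cond (levE (Var ''y'') (Var ''e''))
             (Cond (And (levE (Var ''g'') (Var ''e'')) (Not (aboveE (Add (Var ''g'') (Var ''Dn'')) (Var ''e''))))
                Skip loc_c ;; push_c ''x'' ''g'') Skip) ?Q st3 (n1 - 9)"
          using that hx0 hx n45 by (simp add: wps st3_def e_def y_def numeral_2_eq_2[symmetric])
        show ?thesis
        proof (rule red, cases "val st x")
          case nv: False
          have "?Q st3 (n1 - 11)" by (rule skip[OF nv]) (use n45 in \<open>auto simp: st3_def\<close>)
          then show "wp M le (Cond (levE (Var ''y'') (Var ''e''))
             (Cond (And (levE (Var ''g'') (Var ''e'')) (Not (aboveE (Add (Var ''g'') (Var ''Dn'')) (Var ''e''))))
                Skip loc_c ;; push_c ''x'' ''g'') Skip) ?Q st3 (n1 - 9)"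
            using nv vb n45 by (simp add: wps numeral_2_eq_2[symmetric])
        next
          case v: True
          have lvy: "y \<le> lv" using v by (simp add: val_def y_def lv_def rkx)
          have "lv \<le> Lev (Bn x)" unfolding lv_def using h(2)[of x] rkx by (intro Lev_mono) simp
          also have "\<dots> < y + scalar st ''D''" unfolding ylo by (rule less_blk) (use D in simp)
          finally have lvD: "lv < y + scalar st ''D''" .
          have hlx: "hl st x = blk d lv" by (simp add: hl_def d_def lv_def rkx)
          have gdM: "g + d < M" using J1(8) r_m D(3) d0 by (simp add: g_def)
          have mb: "bv M le st3 (And (levE (Var ''g'') (Var ''e'')) (Not (aboveE (Add (Var ''g'') (Var ''Dn'')) (Var ''e'')))) \<longleftrightarrow>
             g = hl st x"
          proof -
            have "bv M le st3 (levE (Var ''g'') (Var ''e'')) \<longleftrightarrow> g \<le> lv"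
              using bv_levE[OF thr3, of "Var ''g''" "Var ''e''"] J1(8) em by (simp add: st3_def g_def lv_def)
            moreover have "bv M le st3 (aboveE (Add (Var ''g'') (Var ''Dn'')) (Var ''e'')) \<longleftrightarrow> g + d \<le> lv"
              using bv_aboveE[OF thr3, of "Add (Var ''g'') (Var ''Dn'')" "Var ''e''"] gdM d0 em fr(1)[of "''Dn''"]
              by (simp add: st3_def g_def[symmetric] d_def[symmetric] lv_def)
            moreover have "g \<le> lv \<and> \<not> g + d \<le> lv \<longleftrightarrow> g = blk d lv"
              using blk_eqI[of d g lv] J1(7) blk_le[of d lv] less_blk[OF d0(1), of lv] by (auto simp: g_def)
            ultimately show ?thesis using hlx by simp
          qed
          have push: "wp M le (push_c ''x'' ''g'') ?Q st4 n4"
            if s4: "arr st4 = arr st1" "scalar st4 ''g'' = hl st x" "\<And>y. y \<notin> {''x'', ''e'', ''y'', ''g'', ''p''} \<Longrightarrow> scalar st4 y = scalar st1 y"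
              "scalar st4 ''x'' = x"
              and n4: "n1 \<le> n4 + 13 + (6 * T + 15) * mi" "n4 \<le> n1" "mi = of_bool (g \<noteq> hl st x)" "15 \<le> n4" for st4 n4 mi
          proof (rule wp_push[where r = r])
            have bk4: "bwf st4 = bwf st1" "bkt st4 = bkt st1" "blen r st4 = blen r st1"
              using bkt_cong[of st4 st1] s4 by simp_all
            show "bwf st4" using bk4 J1(2) by simp
            show "scalar st4 ''nn'' + 1 < M" using s4 J1(11) n45 n by simp
            show "scalar st4 ''g'' \<le> r" unfolding s4 hlx lv_def using blk_le Lev_le_r order_trans by blast
            show "7 \<le> n4" using n4 by simp
            fix st5
            assume u5: "unch (push_c ''x'' ''g'') st4 st5" and b5: "bwf st5" "scalar st5 ''nn'' = scalar st4 ''nn'' + 1"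
              "bkt st5 = (bkt st4)(scalar st4 ''g'' := insert (scalar st4 ''x'') (bkt st4 (scalar st4 ''g'')))"
              "blen r st5 = blen r st4 + 1"
            have fr5: "\<And>A. A \<notin> {''bv'', ''bn'', ''bh''} \<Longrightarrow> arr st5 A = arr st1 A"
              "\<And>y. y \<noteq> ''nn'' \<Longrightarrow> scalar st5 y = scalar st4 y"
              using u5 s4(1) by (auto simp: unch_def wv_push)
            define st6 where "st6 = upds ''t'' (Suc t) st5"
            have "unch locate_c st st6"
              using J1(1) fr5 s4 by (simp add: unch_def wv_locate st6_def)
            moreover have "bwf st6" using b5(1) by (simp add: st6_def bwf_scalar)
            moreover have "bkt st6 j = bkt st j \<union> {x \<in> set (take (Suc t) L). val st x \<and> j = hl st x}" for j
              unfolding takeS st6_def using b5(3) bk4(2) s4(2,4) J1(5) v by auto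
            moreover have "blen r st6 \<le> blen r st + Suc t" using b5(4) bk4 J1(6) by (simp add: st6_def)
            moreover have "scalar st6 ''g'' = hl st x" "scalar st6 ''nn'' = scalar st1 ''nn'' + 1" "scalar st6 ''t'' = Suc t"
              using s4 fr5 b5 by (simp_all add: st6_def)
            moreover have "d dvd hl st x" "hl st x \<le> r" using hlx dvd_blk blk_le Lev_le_r order_trans unfolding lv_def by metis+
            moreover have "mis + mi + bad (Suc t) (hl st x) \<le> 1 + ch f (take (Suc t) L) + 2 * lost (Suc t)"
            proof (cases "hl st x = f x")
              case True
              have "bad (Suc t) (hl st x) = 0" "lost (Suc t) = lost t" using badx lostS True by auto
              moreover have "mi + ch f (take t L) \<le> bad t g + ch f (take (Suc t) L)" using badS[of g] n4(3) True by auto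
              ultimately show ?thesis using J1(9) unfolding g_def by linarith
            next
              case False
              \<comment> \<open>The two units of a lost code: one for the search made here, one for
                the wrong interval that it leaves in \<open>g\<close>.\<close>
              have "lost (Suc t) = lost t + 1" using lostS False v by simp
              moreover have "bad (Suc t) (hl st x) \<le> 1" "mi \<le> 1" unfolding badx using n4(3) by auto
              ultimately show ?thesis using J1(9) chS by linarith
            qed
            moreover have "n \<le> n4 - 8 + 30 * Suc t + (6 * T + 20) * (mis + mi) + 5"
              using J1(10) n4 by (simp add: algebra_simps)
            moreover have "scalar st1 ''nn'' + 1 + (n4 - 8) \<le> N" using J1(11) n4 by linarith
            ultimately have "J st6 (n4 - 8)"
              unfolding J_def using tl by (intro exI[of _ "Suc t"] exI[of _ "mis + mi"]) simp
            moreover have "scalar st5 ''t'' = t" using fr5 s4 J1(3) by simp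
            ultimately show "?Q st5 (n4 - 7)" using n4 by (simp add: st6_def)
          qed simp_all
          have inner: "wp M le (Cond (And (levE (Var ''g'') (Var ''e'')) (Not (aboveE (Add (Var ''g'') (Var ''Dn'')) (Var ''e''))))
                Skip loc_c) (wp M le (push_c ''x'' ''g'') ?Q) st3 (n1 - 11)"
          proof (cases "g = hl st x")
            case True
            have "wp M le (push_c ''x'' ''g'') ?Q st3 (n1 - 13)"
              by (rule push[where mi = 0]) (use True n45 in \<open>auto simp: st3_def g_def\<close>)
            then show ?thesis using True mb n45 by (simp add: wps numeral_2_eq_2[symmetric])
          next
            case False
            have "mis + 1 \<le> tot"
            proof (cases "hl st x = f x")
              case True
              have "1 + ch f (take t L) \<le> bad t g + ch f (take (Suc t) L)" using badS[of g] True False by auto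
              moreover have "lost t \<le> lost (Suc t)" using lostS by simp
              ultimately show ?thesis using J1(9) totb[of "Suc t"] unfolding g_def by linarith
            next
              case c: False
              have "lost (Suc t) = lost t + 1" using lostS c v by simp
              then show ?thesis using J1(9) chS totb[of "Suc t"] by linarith
            qed
            then have "(6 * T + 20) * (mis + 1) \<le> (6 * T + 20) * tot" by (rule mult_le_mono2)
            then have nT: "6 * T + 20 + 45 \<le> n1" using nbig tl by (simp add: algebra_simps)
            have "wp M le loc_c (wp M le (push_c ''x'' ''g'') ?Q) st3 (n1 - 12)"
            proof (rule wp_loc[where k = T])
              show "thr st3" by fact
              show "scalar st3 ''e'' < m" using em by (simp add: st3_def)
              show "scalar st3 ''D'' = scalar st3 ''Dn'' * 2 ^ T" "0 < scalar st3 ''Dn''" "m + scalar st3 ''D'' < M"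
                using D fr by (simp_all add: st3_def)
              show "scalar st3 ''D'' dvd scalar st3 ''y''" using fr ylo dvd_blk by (simp add: st3_def)
              show "scalar st3 ''y'' \<le> Lev (rk (scalar st3 ''e''))" using lvy by (simp add: st3_def lv_def)
              show "Lev (rk (scalar st3 ''e'')) < scalar st3 ''y'' + scalar st3 ''D''" using lvD fr by (simp add: st3_def lv_def)
              show "6 * T + 10 \<le> n1 - 12" using nT by simp
              fix st4 n4
              assume u4: "unch loc_c st3 st4" and n4: "n1 - 12 \<le> n4 + (6 * T + 10)" "n4 \<le> n1 - 12"
                and g4: "scalar st4 ''g'' = blk (scalar st3 ''Dn'') (Lev (rk (scalar st3 ''e'')))"
              show "wp M le (push_c ''x'' ''g'') ?Q st4 n4"
              proof (rule push[where mi = 1])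
                show "arr st4 = arr st1" "\<And>y. y \<notin> {''x'', ''e'', ''y'', ''g'', ''p''} \<Longrightarrow> scalar st4 y = scalar st1 y" "scalar st4 ''x'' = x"
                  using u4 by (auto simp: unch_def wv_loc st3_def)
                show "scalar st4 ''g'' = hl st x" using g4 hlx fr by (simp add: st3_def lv_def d_def)
              qed (use n4 nT False in auto)
            qed
            then show ?thesis using False mb n45 by (auto simp: wps numeral_2_eq_2[symmetric])
          qed
          then show "wp M le (Cond (levE (Var ''y'') (Var ''e''))
             (Cond (And (levE (Var ''g'') (Var ''e'')) (Not (aboveE (Add (Var ''g'') (Var ''Dn'')) (Var ''e''))))
                Skip loc_c ;; push_c ''x'' ''g'') Skip) ?Q st3 (n1 - 9)"
            using vb v n45 wp_Cond[of M le "levE (Var ''y'') (Var ''e'')"] wp_Seq[of M le _ "push_c ''x'' ''g''"]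
            by (simp add: credit_le numeral_2_eq_2[symmetric])
        qed
      qed
    qed
  next
    fix st1 n1 assume J: "J st1 n1" and b: "\<not> bv M le st1 (Less (Var ''t'') (Var ''k''))"
    from J obtain t mis where J1: "unch locate_c st st1" "bwf st1" "scalar st1 ''t'' = t" "t \<le> length L"
      "\<forall>j. bkt st1 j = bkt st j \<union> {x \<in> set (take t L). val st x \<and> j = hl st x}" "blen r st1 \<le> blen r st + t"
      "mis + bad t (scalar st1 ''g'') \<le> 1 + ch f (take t L) + 2 * lost t"
      "n \<le> n1 + 30 * t + (6 * T + 20) * mis + 5" "scalar st1 ''nn'' + n1 \<le> N"
      unfolding J_def by blast
    have t: "t = length L" using b J1(1,3,4) k(1) by (simp add: unch_def wv_locate)
    have "mis \<le> tot" using J1(7) totb[of t] by linarith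
    then have ms: "(6 * T + 20) * mis \<le> (6 * T + 20) * tot" by (rule mult_le_mono2)
    have n1: "1 \<le> n1" using n(1) J1(8) ms t unfolding tot_def f_def d_def by linarith
    have "Q st1 (n1 - 1)"
    proof (rule Q[OF J1(1,2)])
      show "n \<le> n1 - 1 + 40 * length L + (6 * T + 20) * (1 + ch (tgt (scalar st ''Dn'')) L + 2 * card (Lost st (set L))) + 20"
        using J1(8) ms t n1 unfolding tot_def f_def d_def by linarith
    qed (use J1 t in auto)
    then show "1 \<le> n1 \<and> Q st1 (n1 - 1)" using n1 by simp
  qed
  then show ?thesis using n k by (simp add: locate_c_def wps st0_def numeral_2_eq_2[symmetric])
qed

end

section \<open>Loops over components\<close>

context ssbp_run
begin

section \<open>Sums over adjacency lists\<close>

lemma distinct_adj: "distinct (adj v)" by (simp add: adj_def)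

lemma sum_deg: "(\<Sum>v\<in>V. length (adj v)) \<le> 2 * m"
proof -
  have "(\<Sum>v\<in>V. length (adj v)) = (\<Sum>v\<in>V. card (set (adj v)))" using distinct_adj by (simp add: distinct_card)
  also have "\<dots> = card (\<Union>v\<in>V. set (adj v))"
    by (rule card_UN_disjoint[symmetric]) (auto simp: set_adj)
  also have "\<dots> \<le> card {2..<2 * m + 2}" by (rule card_mono) (auto simp: set_adj)
  finally show ?thesis by simp
qed

lemma sum_deg1: "(\<Sum>v\<in>V. deg1 v) \<le> 4 * m"
proof -
  have "(\<Sum>v\<in>V. deg1 v) = card V + (\<Sum>v\<in>V. length (adj v))" by (simp only: sum.distrib) simp
  then show ?thesis using card_V sum_deg by simp
qed

text \<open>Every edge is listed exactly under \<open>2 * e + 2\<close> at its tail and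
  \<open>2 * e + 3\<close> at its head, which gives the factor 2.\<close>

lemma sum_cutl:
  assumes A: "A \<subseteq> A0" and B: "eclosed A B" "finite B"
  shows "(\<Sum>v\<in>B. cutl A f (adj v)) \<le> 2 * card {e \<in> A. src e \<in> B \<and> f (src e) \<noteq> f (dst e)}"
proof -
  define P where "P = (\<lambda>c. c div 2 - 1 \<in> A \<and> f (src (c div 2 - 1)) \<noteq> f (dst (c div 2 - 1)))"
  define K where "K = {e \<in> A. src e \<in> B \<and> f (src e) \<noteq> f (dst e)}"
  have finK: "finite K" using A by (auto simp: K_def A0_def intro: finite_subset[of _ "{..<m}"])
  have "(\<Sum>v\<in>B. cutl A f (adj v)) = (\<Sum>v\<in>B. card {c \<in> set (adj v). P c})"
    using distinct_adj by (intro sum.cong) (auto simp: cutl_def P_def distinct_card[symmetric])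
  also have "\<dots> = card (\<Union>v\<in>B. {c \<in> set (adj v). P c})"
    by (rule card_UN_disjoint[symmetric]) (auto simp: set_adj B)
  also have "\<dots> \<le> card ((\<lambda>e. 2 * e + 2) ` K \<union> (\<lambda>e. 2 * e + 3) ` K)"
  proof (rule card_mono)
    show "finite ((\<lambda>e. 2 * e + 2) ` K \<union> (\<lambda>e. 2 * e + 3) ` K)" using finK by simp
    show "(\<Union>v\<in>B. {c \<in> set (adj v). P c}) \<subseteq> (\<lambda>e. 2 * e + 2) ` K \<union> (\<lambda>e. 2 * e + 3) ` K"
    proof
      fix c assume "c \<in> (\<Union>v\<in>B. {c \<in> set (adj v). P c})"
      then obtain v where v: "v \<in> B" "c \<in> set (adj v)" "P c" by auto
      define e where "e = c div 2 - 1"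
      have e: "e \<in> A" "f (src e) \<noteq> f (dst e)" using v(3) by (auto simp: P_def e_def)
      have "src e \<in> B"
        using v e B(1) by (cases "even c") (auto simp: set_adj e_def eclosed_def)
      then have "e \<in> K" using e by (simp add: K_def)
      moreover have "c = 2 * e + 2 \<or> c = 2 * e + 3" using v(2) by (auto simp: set_adj e_def)
      ultimately show "c \<in> (\<lambda>e. 2 * e + 2) ` K \<union> (\<lambda>e. 2 * e + 3) ` K" by blast
    qed
  qed
  also have "\<dots> \<le> card ((\<lambda>e. 2 * e + 2) ` K) + card ((\<lambda>e. 2 * e + 3) ` K)" by (rule card_Un_le)
  also have "\<dots> \<le> card K + card K" by (intro add_mono card_image_le finK)
  finally show ?thesis by (simp add: K_def)
qed

text \<open>Explorations start at heads of edges only, which misses no vertex with a positive value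
  or a nonzero code. \<open>Pf\<close> is a potential that the body \<open>b\<close> may consume,
  \<open>bc\<close> a fixed allowance per vertex; \<open>robust\<close> says that the invariant
  ignores the scratch memory of the search.\<close>

lemma wp_comps:
  fixes I :: "nat set \<Rightarrow> state \<Rightarrow> bool" and Pf :: "state \<Rightarrow> nat" and bc :: "nat \<Rightarrow> nat"
  assumes I0: "I {} st" and V0: "Vis st = {}"
    and robust: "\<And>W st st'. I W st \<Longrightarrow> (\<And>x. x \<notin> {''i'', ''a'', ''u'', ''e'', ''v'', ''k''} \<Longrightarrow> scalar st' x = scalar st x) \<Longrightarrow>
        (\<And>A. A \<notin> {''pt'', ''vis'', ''par'', ''L''} \<Longrightarrow> arr st' A = arr st A) \<Longrightarrow> I W st' \<and> Pf st' = Pf st"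
    and Istb: "\<And>W st. I W st \<Longrightarrow> stb st \<and> Al st \<subseteq> A0 \<and> eclosed (Al st) W"
    and wvb: "''i'' \<notin> wvars b" "''rd'' \<notin> wvars b" "''vis'' \<notin> warrs b"
    and body: "\<And>W L st1 n1 R. I W st1 \<Longrightarrow> W \<inter> set L = {} \<Longrightarrow> set L \<subseteq> V \<Longrightarrow> L \<noteq> [] \<Longrightarrow> distinct L \<Longrightarrow>
        scalar st1 ''k'' = length L \<Longrightarrow> (\<And>t. t < length L \<Longrightarrow> arr st1 ''L'' t = L ! t) \<Longrightarrow>
        (\<And>C. hd L \<in> C \<Longrightarrow> eclosed (Al st1) C \<Longrightarrow> set L \<subseteq> C) \<Longrightarrow> eclosed (Al st1) (set L) \<Longrightarrow>
        (\<And>f. ch f L \<le> 2 * (\<Sum>v\<in>set L. cutl (Al st1) f (adj v))) \<Longrightarrow>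
        R + Pf st1 + (\<Sum>v\<in>set L. bc v) + 20 \<le> n1 \<Longrightarrow> scalar st1 ''nn'' + n1 \<le> N \<Longrightarrow>
        wp M le b (\<lambda>st' n'. I (W \<union> set L) st' \<and> R + Pf st' \<le> n' \<and> scalar st' ''nn'' + n' \<le> N) st1 n1"
    and n: "R + Pf st + (\<Sum>v\<in>V. 40 * deg1 v + 60 + bc v) + 30 * m + 20 \<le> n" "scalar st ''nn'' + n \<le> N"
    and Q: "\<And>st' n' W. unch (comps_c b) st st' \<Longrightarrow> I W st' \<Longrightarrow> W \<subseteq> V \<Longrightarrow> (\<forall>e<m. dst e \<in> W) \<Longrightarrow> R + Pf st' \<le> n' \<Longrightarrow>
        scalar st' ''nn'' + n' \<le> N \<Longrightarrow> Q st' n'"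
  shows "wp M le (comps_c b) Q st n"
proof -
  define U where "U = (\<lambda>W. \<Sum>v\<in>W. 40 * deg1 v + 60 + bc v)"
  define J where "J = (\<lambda>st' n'. unch (comps_c b) st st' \<and> I (Vis st') st' \<and> Vis st' \<subseteq> V \<and> (\<forall>e<scalar st' ''i''. dst e \<in> Vis st') \<and>
     scalar st' ''i'' \<le> m \<and> R + Pf st' + U (V - Vis st') + 30 * (m - scalar st' ''i'') + 5 \<le> n' \<and> scalar st' ''nn'' + n' \<le> N)"
  define st0 where "st0 = upds ''i'' 0 st"
  have "wp M le (While (Less (Var ''i'') (Var ''m'')) (comps_body_c b)) Q st0 (n - 2)"
  proof (rule wp_While[where I = J])
    have "I {} st0 \<and> Pf st0 = Pf st" by (rule robust[OF I0]) (auto simp: st0_def)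
    moreover have "Vis st0 = {}" using V0 by (simp add: Vis_def st0_def)
    moreover have "unch (comps_c b) st st0" by (simp add: unch_def wv_comps st0_def)
    ultimately show "J st0 (n - 2)" using n unfolding J_def U_def by (auto simp: st0_def)
  next
    fix st1 n1 assume J: "J st1 n1" and bb: "bv M le st1 (Less (Var ''i'') (Var ''m''))"
    define i where "i = scalar st1 ''i''"
    define W where "W = Vis st1"
    have J1: "unch (comps_c b) st st1" "I W st1" "W \<subseteq> V" "\<And>e. e < i \<Longrightarrow> dst e \<in> W" "i \<le> m"
      "R + Pf st1 + U (V - W) + 30 * (m - i) + 5 \<le> n1" "scalar st1 ''nn'' + n1 \<le> N"
      using J by (auto simp: J_def W_def i_def)
    have st: "stb st1" "Al st1 \<subseteq> A0" "eclosed (Al st1) W" using Istb[OF J1(2)] by auto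
    have im: "i < m" using bb st(1) by (simp add: stb_def i_def)
    have n30: "R + Pf st1 + U (V - W) + 30 * (m - Suc i) + 35 \<le> n1" using J1(6) im by (simp add: Suc_diff_Suc[symmetric])
    define v where "v = dst i"
    have dv: "arr st1 ''dst'' i = v" using st(1) im by (simp add: stb_def v_def)
    have vV: "v \<in> V" using im by (auto simp: v_def V_def)
    have iM: "Suc i < M" using im M_T by simp
    define st2 where "st2 = upds ''v'' v st1"
    have Vis2: "Vis st2 = W" by (simp add: Vis_def W_def st2_def)
    have I2: "I W st2" "Pf st2 = Pf st1" using robust[OF J1(2), of st2] by (auto simp: st2_def)
    have stb2: "stb st2" using Istb[OF I2(1)] by simp
    define Q1 where "Q1 = (\<lambda>st' n'. 1 \<le> n' \<and> scalar st' ''i'' = i \<and> J (upds ''i'' (Suc i) st') (n' - 1))"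
    have fin: "Q1 st' n'" if I': "I W' st'" "Vis st' = W'" "W' \<subseteq> V" "W \<subseteq> W'" "v \<in> W'" "scalar st' ''i'' = i" "unch (comps_c b) st st'"
      and n': "R + U (V - W') + 30 * (m - Suc i) + 6 + Pf st' \<le> n'" "scalar st' ''nn'' + n' \<le> N" for st' n' W'
    proof -
      define st'' where "st'' = upds ''i'' (Suc i) st'"
      have "I W' st'' \<and> Pf st'' = Pf st'" by (rule robust[OF I'(1)]) (auto simp: st''_def)
      moreover have "Vis st'' = W'" using I'(2) by (simp add: Vis_def st''_def)
      moreover have "unch (comps_c b) st st''" using I'(7) by (simp add: unch_def wv_comps st''_def)
      moreover have "dst e \<in> W'" if "e < Suc i" for e
        using that J1(4)[of e] I'(4,5) by (cases "e = i") (auto simp: v_def)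
      moreover have "scalar st'' ''i'' = Suc i" "scalar st'' ''nn'' = scalar st' ''nn''" by (simp_all add: st''_def)
      moreover have "R + Pf st' + U (V - W') + 30 * (m - Suc i) + 5 \<le> n' - 1" "scalar st' ''nn'' + (n' - 1) \<le> N" using n' by auto
      ultimately have "J st'' (n' - 1)" unfolding J_def using I'(3) im by simp
      then show ?thesis using n'(1) I'(6) by (simp add: Q1_def st''_def)
    qed
    have red: "wp M le (comps_body_c b) J st1 (n1 - 1)"
      if w: "wp M le (Cond (Eq (Arr ''vis'' (Var ''v'')) (Var ''rd'')) Skip (dfs_c ;; b)) Q1 st2 (n1 - 4)"
    proof -
      have "wp M le (Cond (Eq (Arr ''vis'' (Var ''v'')) (Var ''rd'')) Skip (dfs_c ;; b))
          (wp M le (Assign ''i'' (Add (Var ''i'') (Const 1))) J) st2 (n1 - 4)"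
        by (rule wp_mono[OF w]) (use iM in \<open>simp add: wps Q1_def\<close>)
      then show ?thesis using n30 dv by (simp add: comps_body_c_def wp_Seq wp_Assign credit_le numeral_2_eq_2[symmetric] st2_def i_def)
    qed
    have vb: "arr st2 ''vis'' (scalar st2 ''v'') = scalar st2 ''rd'' \<longleftrightarrow> v \<in> W" using Vis2 by (auto simp: Vis_def st2_def)
    have u2: "unch (comps_c b) st st2" using J1(1) by (simp add: unch_def wv_comps st2_def)
    have "wp M le (Cond (Eq (Arr ''vis'' (Var ''v'')) (Var ''rd'')) Skip (dfs_c ;; b)) Q1 st2 (n1 - 4)"
    proof (cases "v \<in> W")
      case True
      have "Q1 st2 (n1 - 6)"
        by (rule fin[OF I2(1) Vis2 J1(3) subset_refl True _ u2]) (use n30 I2(2) J1(7) in \<open>auto simp: st2_def i_def\<close>)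
      then show ?thesis using True vb n30 by (simp add: wps numeral_2_eq_2[symmetric])
    next
      case False
      have UW: "U (V - W) = (\<Sum>v\<in>V - W. 40 * deg1 v) + (\<Sum>v\<in>V - W. 60 + bc v)"
        unfolding U_def by (simp add: sum.distrib[symmetric] add.assoc)
      have U40: "40 * (\<Sum>v\<in>V - W. deg1 v) + 60 \<le> U (V - W)"
      proof -
        have "60 + bc v \<le> (\<Sum>v\<in>V - W. 60 + bc v)" by (rule member_le_sum[of v "V - W" "\<lambda>v. 60 + bc v"]) (use vV False in auto)
        then show ?thesis unfolding UW sum_distrib_left by linarith
      qed
      have "wp M le dfs_c (wp M le b Q1) st2 (n1 - 6)"
      proof (rule wp_dfs[OF stb2])
        show "scalar st2 ''v'' = v" by (simp add: st2_def)
        show "v \<in> V" "v \<notin> Vis st2" using vV False Vis2 by auto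
        show "Al st2 \<subseteq> A0" "eclosed (Al st2) (Vis st2)" using Istb[OF I2(1)] Vis2 by auto
        show "40 * (\<Sum>v\<in>V - Vis st2. deg1 v) + 20 \<le> n1 - 6" unfolding Vis2 using U40 n30 by linarith
        fix st3 n3 L
        assume u3: "unch dfs_c st2 st3" and post: "dfs_post st2 v L st3" and cl: "eclosed (Al st2) (set L)"
          and chL: "\<And>f. ch f L \<le> 2 * (\<Sum>v\<in>set L. cutl (Al st2) f (adj v))"
          and n3: "n1 - 6 \<le> n3 + 40 * (\<Sum>v\<in>set L. deg1 v)" "n3 \<le> n1 - 6"
        have fr3: "\<And>x. x \<notin> {''i'', ''a'', ''u'', ''e'', ''v'', ''k''} \<Longrightarrow> scalar st3 x = scalar st2 x"
            "\<And>A. A \<notin> {''pt'', ''vis'', ''par'', ''L''} \<Longrightarrow> arr st3 A = arr st2 A" "scalar st3 ''i'' = i"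
          using u3 by (auto simp: unch_def wv_dfs st2_def i_def)
        have I3: "I W st3" "Pf st3 = Pf st1" using robust[OF I2(1) fr3(1,2)] I2(2) by auto
        have Al3: "Al st3 = Al st2" using fr3(2)[of "''al''"] by (simp add: Al_def)
        have pL: "L \<noteq> []" "hd L = v" "distinct L" "scalar st3 ''k'' = length L" "\<And>t. t < length L \<Longrightarrow> arr st3 ''L'' t = L ! t"
          "Vis st3 = W \<union> set L" "set L \<inter> W = {}" "set L \<subseteq> V" "\<And>C. v \<in> C \<Longrightarrow> eclosed (Al st2) C \<Longrightarrow> set L \<subseteq> C"
          using post unfolding dfs_post_def Vis2 by auto
        have VL: "V - W = set L \<union> (V - (W \<union> set L))" "set L \<inter> (V - (W \<union> set L)) = {}" using pL(7,8) by auto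
        have Usplit: "U (V - W) = U (set L) + U (V - (W \<union> set L))"
          unfolding U_def by (subst VL(1), rule sum.union_disjoint) (use VL(2) in auto)
        have UL: "40 * (\<Sum>v\<in>set L. deg1 v) + (\<Sum>v\<in>set L. bc v) + 60 \<le> U (set L)"
        proof -
          have "U (set L) = 40 * (\<Sum>v\<in>set L. deg1 v) + 60 * card (set L) + (\<Sum>v\<in>set L. bc v)"
            unfolding U_def by (simp only: sum.distrib sum_distrib_left[symmetric] sum_constant) simp
          moreover have "card (set L) \<noteq> 0" using pL(1) by simp
          then have "60 * 1 \<le> 60 * card (set L)" by (intro mult_le_mono2) linarith
          ultimately show ?thesis by linarith
        qed
        have "wp M le b (\<lambda>st' n'. I (W \<union> set L) st' \<and> R + U (V - (W \<union> set L)) + 30 * (m - Suc i) + 6 + Pf st' \<le> n' \<and> scalar st' ''nn'' + n' \<le> N) st3 n3"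
        proof (rule body)
          show "I W st3" by fact
          show "W \<inter> set L = {}" "set L \<subseteq> V" "L \<noteq> []" "distinct L" "scalar st3 ''k'' = length L"
            "\<And>t. t < length L \<Longrightarrow> arr st3 ''L'' t = L ! t" using pL by auto
          show "\<And>C. hd L \<in> C \<Longrightarrow> eclosed (Al st3) C \<Longrightarrow> set L \<subseteq> C" "eclosed (Al st3) (set L)"
            "\<And>f. ch f L \<le> 2 * (\<Sum>v\<in>set L. cutl (Al st3) f (adj v))"
            unfolding Al3 using pL(2,9) cl chL by auto
          show "R + U (V - (W \<union> set L)) + 30 * (m - Suc i) + 6 + Pf st3 + (\<Sum>v\<in>set L. bc v) + 20 \<le> n3"
            using n3 n30 UL Usplit I3(2) by linarith
          show "scalar st3 ''nn'' + n3 \<le> N" using fr3(1)[of "''nn''"] J1(7) n3 by (simp add: st2_def)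
        qed
        then show "wp M le b Q1 st3 n3"
        proof (rule wp_frame)
          fix st' n'
          assume P: "I (W \<union> set L) st' \<and> R + U (V - (W \<union> set L)) + 30 * (m - Suc i) + 6 + Pf st' \<le> n' \<and> scalar st' ''nn'' + n' \<le> N"
            and ub: "unch b st3 st'"
          have V': "Vis st' = W \<union> set L" using ub wvb pL(6) by (simp add: Vis_def unch_def)
          have "unch (comps_c b) st st3" by (rule unch_trans[OF u2 u3]) (auto simp: wv_comps wv_dfs)
          then have "unch (comps_c b) st st'" by (rule unch_trans[OF _ ub]) (auto simp: wv_comps)
          then show "Q1 st' n'"
            using P V' pL J1(3) fr3(3) ub wvb by (intro fin[of "W \<union> set L"]) (auto simp: unch_def)
        qed
      qed
      then show ?thesis using False vb n30 by (simp add: wps numeral_2_eq_2[symmetric])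
    qed
    then show "1 \<le> n1 \<and> wp M le (comps_body_c b) J st1 (n1 - 1)" using red n30 by simp
  next
    fix st1 n1 assume J: "J st1 n1" and bb: "\<not> bv M le st1 (Less (Var ''i'') (Var ''m''))"
    have "stb st1" using J Istb unfolding J_def by blast
    then have "scalar st1 ''i'' = m" using J bb by (simp add: J_def stb_def)
    then have "Q st1 (n1 - 1)" using J by (intro Q[of _ "Vis st1"]) (auto simp: J_def)
    then show "1 \<le> n1 \<and> Q st1 (n1 - 1)" using J by (simp add: J_def)
  qed
  then show ?thesis using n by (simp add: comps_c_def wps st0_def numeral_2_eq_2[symmetric])
qed

lemma wp_kill:
  assumes st: "stb st" and n: "10 * m + 10 \<le> n"
    and Q: "\<And>st' n'. unch kill_c st st' \<Longrightarrow> Al st' = {e \<in> Al st. arr st ''lo'' (src e) = arr st ''lo'' (dst e)} \<Longrightarrow>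
       n \<le> n' + 10 * m + 10 \<Longrightarrow> n' \<le> n \<Longrightarrow> Q st' n'"
  shows "wp M le kill_c Q st n"
proof -
  define P where "P = (\<lambda>e. arr st ''lo'' (src e) = arr st ''lo'' (dst e))"
  define J where "J = (\<lambda>st' n'. unch kill_c st st' \<and> scalar st' ''i'' \<le> m \<and>
     Al st' = {e \<in> Al st. e < scalar st' ''i'' \<longrightarrow> P e} \<and> n \<le> n' + 10 * scalar st' ''i'' + 5 \<and> n' \<le> n)"
  define st0 where "st0 = upds ''i'' 0 st"
  have "wp M le (While (Less (Var ''i'') (Var ''m'')) kill_body_c) Q st0 (n - 2)"
  proof (rule wp_While[where I = J])
    show "J st0 (n - 2)" using n by (auto simp: J_def st0_def unch_def wv_kill)
  next
    fix st1 n1 assume J: "J st1 n1" and b: "bv M le st1 (Less (Var ''i'') (Var ''m''))"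
    define i where "i = scalar st1 ''i''"
    have u: "unch kill_c st st1" using J by (simp add: J_def)
    have stb1: "stb st1" by (rule stb_unch[OF u st]) (simp_all add: wv_kill)
    have im: "i < m" using b stb1 by (simp add: stb_def i_def)
    have n1: "10 * (m - i) + 5 \<le> n1" using J n by (auto simp: J_def i_def)
    have n15: "15 \<le> n1" using n1 im by linarith
    have sd: "arr st1 ''src'' i = src i" "arr st1 ''dst'' i = dst i" "arr st1 ''lo'' = arr st ''lo''" "Suc i < M"
      using stb1 im u M_T by (simp_all add: stb_def unch_def wv_kill)
    define st2 where "st2 = (if P i then st1 else upda ''al'' i 0 st1)"
    have Al2: "Al st2 = {e \<in> Al st. e < Suc i \<longrightarrow> P e}"
    proof -
      have 1: "Al st1 = {e \<in> Al st. e < i \<longrightarrow> P e}" using J by (simp add: J_def i_def)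
      have "Al st2 = (if P i then Al st1 else Al st1 - {i})" by (auto simp: st2_def Al_def)
      then show ?thesis using 1 by (auto simp: less_Suc_eq)
    qed
    define st3 where "st3 = upds ''i'' (Suc i) st2"
    have "unch kill_c st st3" using u by (simp add: st3_def st2_def unch_def wv_kill)
    then have J3: "J st3 n3" if "n1 \<le> n3 + 10" "n3 \<le> n1" for n3
      using Al2 J im that by (simp add: J_def st3_def i_def)
    have "wp M le kill_body_c J st1 (n1 - 1)"
      using n15 sd J3[unfolded st3_def st2_def] by (cases "P i") (simp_all add: kill_body_c_def wps i_def[symmetric] P_def)
    then show "1 \<le> n1 \<and> wp M le kill_body_c J st1 (n1 - 1)" using n15 by simp
  next
    fix st1 n1 assume J: "J st1 n1" and b: "\<not> bv M le st1 (Less (Var ''i'') (Var ''m''))"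
    have u: "unch kill_c st st1" using J by (simp add: J_def)
    have "stb st1" by (rule stb_unch[OF u st]) (simp_all add: wv_kill)
    then have "scalar st1 ''i'' = m" using J b by (simp add: J_def stb_def)
    moreover have "Al st \<subseteq> {..<m}" by (auto simp: Al_def)
    ultimately have "Q st1 (n1 - 1)" using J n by (intro Q) (auto simp: J_def P_def)
    then show "1 \<le> n1 \<and> Q st1 (n1 - 1)" using J n \<open>scalar st1 ''i'' = m\<close> by (simp add: J_def)
  qed
  then show ?thesis using n by (simp add: kill_c_def wps st0_def numeral_2_eq_2[symmetric])
qed

end

section \<open>Rounds\<close>

text \<open>A syntactic guarantee that the array \<open>A\<close> receives only the current value of
  \<open>x\<close>. Applied to the stamps, it shows that none exceeds the round number, so
  increasing that number makes all of them stale.\<close>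

primrec stores :: "string \<Rightarrow> string \<Rightarrow> com \<Rightarrow> bool" where
  "stores A x Skip \<longleftrightarrow> True"
| "stores A x (Assign y a) \<longleftrightarrow> x \<noteq> y"
| "stores A x (Store B i a) \<longleftrightarrow> A = B \<longrightarrow> a = Var x"
| "stores A x (Random y a) \<longleftrightarrow> x \<noteq> y"
| "stores A x (Seq c d) \<longleftrightarrow> stores A x c \<and> stores A x d"
| "stores A x (Cond b c d) \<longleftrightarrow> stores A x c \<and> stores A x d"
| "stores A x (While b c) \<longleftrightarrow> stores A x c"

lemma exec_stores:
  "exec M le c st t st' \<Longrightarrow> stores A x c \<Longrightarrow>
    scalar st' x = scalar st x \<and> (\<forall>v. arr st' A v = arr st A v \<or> arr st' A v = scalar st x)"
proof (induction rule: exec.induct)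
  case (exec_Seq c st t st' d u st'')
  then show ?case by (metis stores.simps(5))
next
  case (exec_WhileT st b c t st' u st'')
  then show ?case by (metis stores.simps(7))
qed auto

lemma wp_stores:
  assumes "wp M le c Q st n" "stores A x c" "\<forall>v. arr st A v \<le> scalar st x"
  shows "wp M le c (\<lambda>st' n'. Q st' n' \<and> (\<forall>v. arr st' A v \<le> scalar st x)) st n"
proof -
  obtain t st' where t: "exec M le c st t st'" "t \<le> n" "Q st' (n - t)" using assms(1) unfolding wp_def by blast
  have "arr st' A v \<le> scalar st x" for v
    using exec_stores[OF t(1) assms(2)] assms(3) by (metis order_refl)
  with t show ?thesis unfolding wp_def by blast
qed

context ssbp_run
begin

text \<open>Vertices in components of at most \<open>T\<close> vertices drop out of the rounds; their \<open>lo\<close> is meaningless.\<close>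

definition small :: "nat set \<Rightarrow> nat \<Rightarrow> bool" where
  "small A v \<longleftrightarrow> (\<exists>C. v \<in> C \<and> eclosed A C \<and> finite C \<and> card C \<le> T)"

lemma small_mono: "small A v \<Longrightarrow> A' \<subseteq> A \<Longrightarrow> small A' v"
  unfolding small_def eclosed_def by blast

lemma small_edge: "e \<in> A \<Longrightarrow> small A (src e) \<longleftrightarrow> small A (dst e)"
  unfolding small_def eclosed_def by blast

text \<open>If a small closed set contained \<open>x\<close> but not \<open>v\<close>, its
  complement would be a closed set around \<open>v\<close>, which must contain all of
  \<open>L\<close> and hence \<open>x\<close>. So it contains \<open>v\<close>, hence the whole of
  \<open>L\<close>, and is too large.\<close>

lemma big_component:
  assumes L: "\<And>C. v \<in> C \<Longrightarrow> eclosed A C \<Longrightarrow> set L \<subseteq> C" and v: "v \<in> set L" and d: "distinct L" "T < length L" and x: "x \<in> set L"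
  shows "\<not> small A x"
proof
  assume "small A x"
  then obtain C where C: "x \<in> C" "eclosed A C" "finite C" "card C \<le> T" unfolding small_def by blast
  have "v \<in> C"
  proof (rule ccontr)
    assume "v \<notin> C"
    then have "set L \<subseteq> - C" using C(2) by (intro L) (auto simp: eclosed_def)
    with x C(1) show False by auto
  qed
  then have "set L \<subseteq> C" using C(2) by (rule L)
  then have "card (set L) \<le> card C" by (rule card_mono[OF C(3)])
  with C(4) d show False by (simp add: distinct_card)
qed

text \<open>Each round removes \<open>T\<close> from the exponent of \<open>D\<close>. Initially one
  interval contains all levels, and after \<open>T\<close> rounds the intervals have length
  1.\<close>

definition rinv :: "state \<Rightarrow> bool" where
  "rinv st \<longleftrightarrow> stb st \<and> bwf st \<and> sinv (Al st) (arr st ''h'') \<and> (\<forall>j. bkt st j = {}) \<and>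
     (\<forall>v. arr st ''vis'' v \<le> scalar st ''rd'') \<and> (\<forall>v. arr st ''asg'' v \<le> scalar st ''rd'') \<and>
     (\<forall>v. arr st ''out'' v = 0) \<and> (\<forall>v. arr st ''lo'' v \<le> r) \<and> scalar st ''fin'' = 0 \<and>
     (\<forall>e\<in>Al st. arr st ''lo'' (src e) = arr st ''lo'' (dst e)) \<and>
     (\<forall>v\<in>V. arr st ''lo'' v = tgt (scalar st ''D'') v \<or> small (Al st) v) \<and>
     scalar st ''rd'' \<le> T \<and> scalar st ''D'' = 2 ^ (T * (T - scalar st ''rd''))"

lemma rinvD:
  assumes "rinv st"
  shows "stb st" "bwf st" "sinv (Al st) (arr st ''h'')" "bkt st j = {}" "arr st ''vis'' v \<le> scalar st ''rd''"
    "arr st ''asg'' v \<le> scalar st ''rd''" "arr st ''out'' v = 0" "arr st ''lo'' v \<le> r" "scalar st ''fin'' = 0"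
    "e \<in> Al st \<Longrightarrow> arr st ''lo'' (src e) = arr st ''lo'' (dst e)"
    "v \<in> V \<Longrightarrow> \<not> small (Al st) v \<Longrightarrow> arr st ''lo'' v = tgt (scalar st ''D'') v"
    "scalar st ''rd'' \<le> T" "scalar st ''D'' = 2 ^ (T * (T - scalar st ''rd''))"
  using assms unfolding rinv_def by blast+

definition Vals :: "state \<Rightarrow> nat set" where "Vals st = {v \<in> V. val st v}"
text \<open>A useful code weighs 2, for the two searches that it can cause when it is lost; a live
  edge weighs more because it can be cut and can also turn into a code.\<close>

definition XP :: "state \<Rightarrow> nat" where "XP st = 8 * card (Al st) + 2 * card (Vals st)"

lemma blen_0: assumes "\<And>j. bkt st j = {}" shows "blen r st = 0"
proof -
  have "lst (arr st ''bn'') (arr st ''bh'' j) = []" for j using assms[of j] by (simp add: bkt_def)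
  then show ?thesis by (simp add: blen_def)
qed

definition rc :: com where "rc = Cond (Less (Var ''T'') (Var ''k'')) locate_c Skip"

definition Big :: "state \<Rightarrow> nat set" where "Big st = {v \<in> V. \<not> small (Al st) v}"

definition roundI :: "state \<Rightarrow> nat set \<Rightarrow> state \<Rightarrow> bool" where
  "roundI st1 W st \<longleftrightarrow> stb st \<and> bwf st \<and> (\<forall>A\<in>{''al'', ''h'', ''lo'', ''asg'', ''out''}. arr st A = arr st1 A) \<and>
     (\<forall>x\<in>{''rd'', ''D'', ''Dn'', ''fin''}. scalar st x = scalar st1 x) \<and>
     (\<forall>j. bkt st j = {x \<in> W \<inter> Big st1. val st1 x \<and> j = hl st1 x}) \<and> blen r st \<le> card W \<and> W \<subseteq> V \<and> eclosed (Al st1) W"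

definition rcost :: "state \<Rightarrow> nat" where
  "rcost st1 = (\<Sum>v\<in>V. 40 * deg1 v + 60 + (96 + (if v \<in> Big st1 then (6 * T + 20) *
      (2 * cutl (Al st1) (tgt (scalar st1 ''Dn'')) (adj v) + 2 * of_bool (v \<in> Lost st1 (Big st1))) else 0)))"

lemma wp_comps_round:
  assumes st: "stb st1" "bwf st1" and em: "\<And>j. bkt st1 j = {}" and S: "sinv (Al st1) (arr st1 ''h'')" and V0: "Vis st1 = {}"
    and D: "scalar st1 ''D'' = scalar st1 ''Dn'' * 2 ^ T" "0 < scalar st1 ''Dn''" "m + scalar st1 ''D'' < M"
    and lo: "\<And>v. v \<in> Big st1 \<Longrightarrow> arr st1 ''lo'' v = tgt (scalar st1 ''D'') v"
    and n: "R + rcost st1 + 30 * m + 20 \<le> n" "scalar st1 ''nn'' + n \<le> N" "N < M"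
  shows "wp M le (comps_c rc) (\<lambda>st' n'. unch (comps_c rc) st1 st' \<and> (\<exists>W. roundI st1 W st' \<and> (\<forall>e<m. dst e \<in> W)) \<and> R \<le> n' \<and>
     scalar st' ''nn'' + n' \<le> N) st1 n"
proof -
  define f where "f = tgt (scalar st1 ''Dn'')"
  define B where "B = Big st1"
  define q where "q = 6 * T + 20"
  define bc where "bc = (\<lambda>v. 96 + (if v \<in> B then q * (2 * cutl (Al st1) f (adj v) + 2 * of_bool (v \<in> Lost st1 B)) else 0))"
  have rc: "rcost st1 = (\<Sum>v\<in>V. 40 * deg1 v + 60 + bc v)" unfolding rcost_def bc_def f_def B_def q_def ..
  have AlA0: "Al st1 \<subseteq> A0" using sinvD(1-3)[OF S] by (auto simp: A0_def)
  have Ieq: "Al st = Al st1" if "roundI st1 W st" for st W using that by (simp add: roundI_def Al_def)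
  have wvr: "wvars rc = {''g'', ''p'', ''nn'', ''t'', ''x'', ''e'', ''y''}" "warrs rc = {''bv'', ''bn'', ''bh''}"
    by (simp_all add: rc_def wv_locate)
  show ?thesis
  proof (rule wp_comps[where I = "roundI st1" and Pf = "\<lambda>_. 0" and bc = bc])
    show "roundI st1 {} st1" using st em blen_0[OF em] by (simp add: roundI_def eclosed_def)
    show "Vis st1 = {}" by fact
  next
    fix W and st st' :: state
    assume I: "roundI st1 W st" and s: "\<And>x. x \<notin> {''i'', ''a'', ''u'', ''e'', ''v'', ''k''} \<Longrightarrow> scalar st' x = scalar st x"
      "\<And>A. A \<notin> {''pt'', ''vis'', ''par'', ''L''} \<Longrightarrow> arr st' A = arr st A"
    have "stb st'" using I s by (simp add: roundI_def stb_def thr_def)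
    moreover have "bkt st' = bkt st" "blen r st' = blen r st" "bwf st' = bwf st" using bkt_cong[of st' st] s by simp_all
    ultimately show "roundI st1 W st' \<and> (0::nat) = 0" using I s by (simp add: roundI_def)
  next
    fix W st assume I: "roundI st1 W st"
    then show "stb st \<and> Al st \<subseteq> A0 \<and> eclosed (Al st) W" using Ieq[OF I] AlA0 by (simp add: roundI_def)
  next
    show "''i'' \<notin> wvars rc" "''rd'' \<notin> wvars rc" "''vis'' \<notin> warrs rc" by (simp_all add: wvr)
  next
    fix W L st n1 R
    assume I: "roundI st1 W st" and dj: "W \<inter> set L = {}" and LV: "set L \<subseteq> V" and Lne: "L \<noteq> []" and dL: "distinct L"
      and k: "scalar st ''k'' = length L" and aL: "\<And>t. t < length L \<Longrightarrow> arr st ''L'' t = L ! t"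
      and mn: "\<And>C. hd L \<in> C \<Longrightarrow> eclosed (Al st) C \<Longrightarrow> set L \<subseteq> C" and cl: "eclosed (Al st) (set L)"
      and chL: "\<And>f. ch f L \<le> 2 * (\<Sum>v\<in>set L. cutl (Al st) f (adj v))"
      and n1: "R + 0 + (\<Sum>v\<in>set L. bc v) + 20 \<le> n1" "scalar st ''nn'' + n1 \<le> N"
    have Al: "Al st = Al st1" by (rule Ieq[OF I])
    have eqs: "val st = val st1" "hl st = hl st1" using I by (simp_all add: roundI_def val_def[abs_def] hl_def[abs_def])
    have TT: "scalar st ''T'' = T" using I by (simp add: roundI_def stb_def)
    have clW: "eclosed (Al st1) (W \<union> set L)" using I cl unfolding Al by (auto simp: roundI_def eclosed_def)
    have k1: "1 \<le> length L" using Lne by (cases L) auto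
    have cardW: "card (W \<union> set L) = card W + length L"
    proof -
      have "finite W" using I finite_subset[OF _ fin_V] by (auto simp: roundI_def)
      then show ?thesis using dj dL by (simp add: card_Un_disjoint distinct_card)
    qed
    show "wp M le rc (\<lambda>st' n'. roundI st1 (W \<union> set L) st' \<and> R + 0 \<le> n' \<and> scalar st' ''nn'' + n' \<le> N) st n1"
    proof (cases "T < length L")
      case False
      have "small (Al st1) x" if "x \<in> set L" for x
        unfolding small_def by (rule exI[of _ "set L"]) (use that cl Al dL False in \<open>simp add: distinct_card\<close>)
      then have "set L \<inter> B = {}" by (auto simp: B_def Big_def)
      then have "(W \<union> set L) \<inter> Big st1 = W \<inter> Big st1" by (auto simp: B_def)
      then have "roundI st1 (W \<union> set L) st" using I LV clW cardW by (simp add: roundI_def)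
      then show ?thesis using False k TT n1 by (auto simp: rc_def wps)
    next
      case True
      have LB: "set L \<subseteq> B"
      proof
        fix x assume x: "x \<in> set L"
        have "\<not> small (Al st1) x" by (rule big_component[of "hd L"]) (use mn Al Lne dL True x in auto)
        then show "x \<in> B" using x LV by (auto simp: B_def Big_def)
      qed
      have lostL: "Lost st1 (set L) = {v \<in> set L. v \<in> Lost st1 B}" using LB by (auto simp: Lost_def)
      have lostc: "card (Lost st1 (set L)) = (\<Sum>v\<in>set L. of_bool (v \<in> Lost st1 B))"
        unfolding lostL by (simp add: sum.If_cases of_bool_def Int_def)
      have sumbc: "(\<Sum>v\<in>set L. bc v) = 96 * length L + q * (2 * (\<Sum>v\<in>set L. cutl (Al st1) f (adj v)) + 2 * card (Lost st1 (set L)))"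
      proof -
        have "(\<Sum>v\<in>set L. bc v) = (\<Sum>v\<in>set L. 96 + q * (2 * cutl (Al st1) f (adj v) + 2 * of_bool (v \<in> Lost st1 B)))"
          using LB by (intro sum.cong) (auto simp: bc_def)
        also have "\<dots> = 96 * length L + q * (\<Sum>v\<in>set L. 2 * cutl (Al st1) f (adj v) + 2 * of_bool (v \<in> Lost st1 B))"
          using dL by (simp only: sum.distrib sum_constant sum_distrib_left[symmetric] distinct_card) simp
        also have "(\<Sum>v\<in>set L. 2 * cutl (Al st1) f (adj v) + 2 * of_bool (v \<in> Lost st1 B)) =
           2 * (\<Sum>v\<in>set L. cutl (Al st1) f (adj v)) + 2 * card (Lost st1 (set L))"
          unfolding lostc by (simp only: sum.distrib sum_distrib_left[symmetric])
        finally show ?thesis .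
      qed
      have Lost: "Lost st (set L) = Lost st1 (set L)" using I eqs by (simp add: Lost_def roundI_def)
      have Dn: "scalar st ''Dn'' = scalar st1 ''Dn''" "scalar st ''D'' = scalar st1 ''D''"
        "arr st ''h'' = arr st1 ''h''" "arr st ''lo'' = arr st1 ''lo''" using I by (simp_all add: roundI_def)
      have cost: "40 * length L + q * (1 + ch f L + 2 * card (Lost st1 (set L))) + 22 \<le> (\<Sum>v\<in>set L. bc v)"
      proof -
        \<comment> \<open>The size of the component pays for its first search, since
          \<open>6 * T + 20 < 26 * length L\<close>. The sum \<open>40 + 26 + 22\<close> stays below
          the 96 of \<open>bc\<close>.\<close>
        have "q \<le> 26 * length L" using True unfolding q_def by simp
        moreover have "q * (ch f L + 2 * card (Lost st1 (set L))) \<le>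
            q * (2 * (\<Sum>v\<in>set L. cutl (Al st1) f (adj v)) + 2 * card (Lost st1 (set L)))"
          using chL[of f] Al by (intro mult_le_mono2) simp
        moreover have "q * (1 + ch f L + 2 * card (Lost st1 (set L))) = q + q * (ch f L + 2 * card (Lost st1 (set L)))"
          by (simp add: algebra_simps)
        ultimately show ?thesis unfolding sumbc using k1 by linarith
      qed
      have "length L \<le> 2 * m"
      proof -
        have "length L = card (set L)" using dL by (simp add: distinct_card)
        also have "\<dots> \<le> card V" by (rule card_mono) (use LV in auto)
        finally show ?thesis using card_V by simp
      qed
      then have LM: "length L < M" using M_small by linarith
      have hm: "arr st1 ''h'' v \<le> m" for v using sinvD(4)[OF S, of v] by (cases "arr st1 ''h'' v = 0") auto
      have "wp M le locate_c (\<lambda>st' n'. roundI st1 (W \<union> set L) st' \<and> R + 0 \<le> n' \<and> scalar st' ''nn'' + n' \<le> N) st (n1 - 1)"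
      proof (rule wp_locate)
        show "stb st" "bwf st" using I by (simp_all add: roundI_def)
        show "scalar st ''k'' = length L" "\<And>t. t < length L \<Longrightarrow> arr st ''L'' t = L ! t" "distinct L" "L \<noteq> []" "length L < M"
          by fact+
        show "\<And>v. arr st ''h'' v \<le> m" "\<And>v. rkc (arr st ''h'' v) \<le> Bn v" using hm sinvD(6)[OF S] Dn by simp_all
        show "scalar st ''D'' = scalar st ''Dn'' * 2 ^ T" "0 < scalar st ''Dn''" "m + scalar st ''D'' < M" using D Dn by simp_all
        show "\<And>v. v \<in> set L \<Longrightarrow> arr st ''lo'' v = tgt (scalar st ''D'') v" using lo LB Dn by (auto simp: B_def)
        show "40 * length L + (6 * T + 20) * (1 + ch (tgt (scalar st ''Dn'')) L + 2 * card (Lost st (set L))) + 20 \<le> n1 - 1"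
          using cost n1 unfolding Lost Dn f_def q_def by linarith
        show "scalar st ''nn'' + (n1 - 1) \<le> N" "N < M" using n1 n by auto
        fix st' n'
        assume u: "unch locate_c st st'" and b': "bwf st'" "\<And>j. bkt st' j = bkt st j \<union> {x \<in> set L. val st x \<and> j = hl st x}"
          "blen r st' \<le> blen r st + length L"
          and n': "n1 - 1 \<le> n' + 40 * length L + (6 * T + 20) * (1 + ch (tgt (scalar st ''Dn'')) L + 2 * card (Lost st (set L))) + 20"
            "scalar st' ''nn'' + n' \<le> N"
        have "stb st'" by (rule stb_unch[OF u]) (use I in \<open>simp_all add: roundI_def wv_locate\<close>)
        moreover have "bkt st' j = {x \<in> (W \<union> set L) \<inter> Big st1. val st1 x \<and> j = hl st1 x}" for j
          using b'(2)[of j] I eqs LB by (auto simp: roundI_def B_def)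
        ultimately have "roundI st1 (W \<union> set L) st'"
          using I u b' clW LV cardW by (simp add: roundI_def unch_def wv_locate)
        moreover have "R \<le> n'" using n' n1 cost unfolding Lost Dn f_def q_def by linarith
        ultimately show "roundI st1 (W \<union> set L) st' \<and> R + 0 \<le> n' \<and> scalar st' ''nn'' + n' \<le> N" using n' by simp
      qed
      then show ?thesis using True k TT n1 by (simp add: rc_def wp_Cond)
    qed
  next
    show "R + 0 + (\<Sum>v\<in>V. 40 * deg1 v + 60 + bc v) + 30 * m + 20 \<le> n" using n(1) rc by simp
    show "scalar st1 ''nn'' + n \<le> N" by fact
  qed auto
qed

section \<open>Cost and potential of a round\<close>

definition cutE :: "state \<Rightarrow> nat set" where
  "cutE st = {e \<in> Al st. src e \<in> Big st \<and> tgt (scalar st ''Dn'') (src e) \<noteq> tgt (scalar st ''Dn'') (dst e)}"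

lemma eclosed_Big: "eclosed (Al st) (Big st)"
proof -
  have "src e \<in> V \<and> dst e \<in> V" if "e \<in> Al st" for e using that by (auto simp: Al_def V_def)
  then show ?thesis using small_edge by (auto simp: eclosed_def Big_def)
qed

text \<open>Changes along a component are at most twice its cut incidences, and an edge has two
  incidences: hence 4 searches per cut edge, besides 2 per lost code.\<close>

lemma rcost_le:
  assumes S: "sinv (Al st1) (arr st1 ''h'')"
  shows "rcost st1 \<le> 472 * m + (6 * T + 20) * (4 * card (cutE st1) + 2 * card (Lost st1 (Big st1)))"
proof -
  define f where "f = tgt (scalar st1 ''Dn'')"
  define B where "B = Big st1"
  define q where "q = 6 * T + 20"
  have AlA0: "Al st1 \<subseteq> A0" using sinvD(1-3)[OF S] by (auto simp: A0_def)
  have BV: "B \<subseteq> V" by (auto simp: B_def Big_def)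
  have clB: "eclosed (Al st1) B" using eclosed_Big by (simp add: B_def)
  have finB: "finite B" by (rule finite_subset[OF BV fin_V])
  have "rcost st1 = (\<Sum>v\<in>V. 40 * deg1 v) + 156 * card V +
     (\<Sum>v\<in>V. if v \<in> B then q * (2 * cutl (Al st1) f (adj v) + 2 * of_bool (v \<in> Lost st1 B)) else 0)"
    unfolding rcost_def f_def[symmetric] B_def[symmetric] q_def[symmetric] by (simp only: sum.distrib sum_constant) simp
  also have "(\<Sum>v\<in>V. if v \<in> B then q * (2 * cutl (Al st1) f (adj v) + 2 * of_bool (v \<in> Lost st1 B)) else 0) =
     (\<Sum>v\<in>B. q * (2 * cutl (Al st1) f (adj v) + 2 * of_bool (v \<in> Lost st1 B)))"
    using BV by (simp add: sum.If_cases Int_absorb1)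
  also have "\<dots> = q * (2 * (\<Sum>v\<in>B. cutl (Al st1) f (adj v)) + 2 * (\<Sum>v\<in>B. of_bool (v \<in> Lost st1 B)))"
    by (simp only: sum.distrib sum_distrib_left[symmetric])
  also have "(\<Sum>v\<in>B. of_bool (v \<in> Lost st1 B)) = card (Lost st1 B)"
  proof -
    have "Lost st1 B = {v \<in> B. v \<in> Lost st1 B}" by (auto simp: Lost_def)
    then show ?thesis using finB by (simp add: sum.If_cases of_bool_def Int_def)
  qed
  also have "(\<Sum>v\<in>V. 40 * deg1 v) \<le> 160 * m" using sum_deg1 by (simp only: sum_distrib_left[symmetric])
  also have "156 * card V \<le> 312 * m" using card_V by simp
  also have "q * (2 * (\<Sum>v\<in>B. cutl (Al st1) f (adj v)) + 2 * card (Lost st1 B)) \<le> q * (4 * card (cutE st1) + 2 * card (Lost st1 B))"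
    using sum_cutl[OF AlA0 clB finB, of f] by (intro mult_le_mono2) (simp add: cutE_def f_def B_def)
  finally show ?thesis by (simp add: q_def B_def)
qed

text \<open>Vanished edges were turned into codes or cut. The two kinds may overlap, so only the
  size of their union is available, and it bounds each of them. Weight 8 then covers 4 per cut edge,
  and for a turned edge 2 for the useful code that it may create and 1 for the search at its
  death.\<close>

lemma round_potential:
  assumes A3: "Al st3 \<subseteq> Al st1" and A': "Al st' \<subseteq> Al st3" and cut: "cutE st1 \<inter> Al st' = {}"
    and V': "Vals st' \<subseteq> (Vals st1 - Lost st1 (Big st1)) \<union> dst ` (Al st1 - Al st3)"
  shows "XP st' + 4 * card (cutE st1) + 2 * card (Lost st1 (Big st1)) + (card (Al st1) - card (Al st3)) \<le> XP st1"
proof -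
  define F where "F = Al st1 - Al st3"
  have fin: "finite F" "finite (cutE st1)" "finite (Vals st1)" by (simp_all add: F_def cutE_def Vals_def)
  have cF: "card F = card (Al st1) - card (Al st3)" unfolding F_def by (rule card_Diff_subset) (use A3 in auto)
  have "card (Al st') + card (F \<union> cutE st1) = card (Al st' \<union> (F \<union> cutE st1))"
    by (rule card_Un_disjoint[symmetric]) (use fin A' cut in \<open>auto simp: F_def\<close>)
  also have "\<dots> \<le> card (Al st1)" by (rule card_mono) (use A3 A' in \<open>auto simp: F_def cutE_def\<close>)
  finally have 1: "card (Al st') + card (F \<union> cutE st1) \<le> card (Al st1)" .
  have 2: "card F \<le> card (F \<union> cutE st1)" "card (cutE st1) \<le> card (F \<union> cutE st1)"
    using fin by (auto intro!: card_mono)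
  have LV: "Lost st1 (Big st1) \<subseteq> Vals st1" by (auto simp: Lost_def Vals_def Big_def)
  have finL: "finite (Lost st1 (Big st1))" using LV fin(3) by (rule finite_subset)
  have "card (Vals st') \<le> card ((Vals st1 - Lost st1 (Big st1)) \<union> dst ` F)" by (rule card_mono) (use V' fin in \<open>auto simp: F_def\<close>)
  also have "\<dots> \<le> card (Vals st1 - Lost st1 (Big st1)) + card (dst ` F)" by (rule card_Un_le)
  also have "\<dots> \<le> (card (Vals st1) - card (Lost st1 (Big st1))) + card F"
    using card_Diff_subset[OF finL LV] card_image_le[OF fin(1), of dst] by linarith
  finally have 3: "card (Vals st') + card (Lost st1 (Big st1)) \<le> card (Vals st1) + card F"
    using card_mono[OF fin(3) LV] by linarith
  show ?thesis unfolding XP_def using 1 2 3 cF by linarith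
qed

lemma stores_rc: "stores ''asg'' ''rd'' (comps_c rc)" "stores ''vis'' ''rd'' (comps_c rc)" "stores ''asg'' ''rd'' dial_c"
  by (simp_all add: comps_c_def comps_body_c_def rc_def dfs_c_def dfs_body_c_def locate_c_def locate_body_c_def loc_c_def
      loc_body_c_def push_c_def dial_c_def dial_body_c_def drain_c_def drain_body_c_def visit_c_def scan_c_def scan_body_c_def
      scan_fail_c_def relax_c_def)

text \<open>The price of one unit of \<open>XP\<close> in steps: the weight of a live edge in
  \<open>Pot\<close>, and more than the \<open>6 * T + 20\<close> steps of a search while
  locating.\<close>

definition qq :: nat where "qq = 10 * T + 100"

lemma wp_round:
  assumes I: "rinv st" and rd: "scalar st ''rd'' < T"
    and n: "R + qq * XP st + 1500 * m + 200 \<le> n" "scalar st ''nn'' + n \<le> N" "N < M"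
    and Q: "\<And>st' n'. rinv st' \<Longrightarrow> scalar st' ''rd'' = Suc (scalar st ''rd'') \<Longrightarrow> R + qq * XP st' \<le> n' \<Longrightarrow>
       scalar st' ''nn'' + n' \<le> N \<Longrightarrow> Q st' n'"
  shows "wp M le round_c Q st n"
proof -
  note RI = rinvD[OF I]
  define d where "d = (2::nat) ^ (T * (T - Suc (scalar st ''rd'')))"
  have Dd: "scalar st ''D'' = d * 2 ^ T"
  proof -
    have "T - scalar st ''rd'' = Suc (T - Suc (scalar st ''rd''))" using rd by simp
    then show ?thesis unfolding RI(13) d_def by (simp add: power_add)
  qed
  have d0: "0 < d" by (simp add: d_def)
  have DM: "m + scalar st ''D'' < M"
  proof -
    have "scalar st ''D'' \<le> 2 ^ (T * T)" unfolding RI(13) by (intro power_increasing mult_le_mono2) auto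
    then show ?thesis using M_T by linarith
  qed
  define st1 where "st1 = st\<lparr>scalar := (scalar st)(''rd'' := Suc (scalar st ''rd''), ''Dn'' := d)\<rparr>"
  have sc1: "scalar st1 ''rd'' = Suc (scalar st ''rd'')" "scalar st1 ''Dn'' = d" "scalar st1 ''D'' = scalar st ''D''"
     "scalar st1 ''fin'' = 0" "scalar st1 ''nn'' = scalar st ''nn''" "arr st1 = arr st" using RI(9) by (simp_all add: st1_def)
  have st1: "stb st1" using RI(1) by (simp add: stb_def thr_def st1_def)
  have bw1: "bwf st1" using RI(2) by (simp add: st1_def bwf_scalar)
  have bk1: "bkt st1 j = {}" for j using RI(4) by (simp add: st1_def)
  have Al1: "Al st1 = Al st" by (simp add: st1_def)
  have S1: "sinv (Al st1) (arr st1 ''h'')" using RI(3) Al1 sc1 by simp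
  have asg_lt: "arr st1 ''asg'' v < scalar st1 ''rd''" "arr st1 ''vis'' v < scalar st1 ''rd''" for v
    using RI(5)[of v] RI(6)[of v] sc1 by simp_all
  have As1: "As st1 = {}" "Vis st1 = {}" using asg_lt by (auto simp: As_def Vis_def simp del: Collect_empty_eq) (metis less_irrefl)+
  have asg_le: "\<forall>v. arr st1 ''asg'' v \<le> scalar st1 ''rd''" "\<forall>v. arr st1 ''vis'' v \<le> scalar st1 ''rd''"
    using asg_lt less_imp_le by blast+
  have XP1: "XP st1 = XP st" "Vals st1 = Vals st" by (simp_all add: XP_def Vals_def val_def st1_def)
  define B where "B = Big st1"
  have lo1: "arr st1 ''lo'' v = tgt (scalar st1 ''D'') v" if "v \<in> B" for v
    using RI(11)[of v] that sc1 Al1 by (simp add: B_def Big_def)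
  define c where "c = card (cutE st1)"
  define l where "l = card (Lost st1 B)"
  have rc: "rcost st1 \<le> 472 * m + (6 * T + 20) * (4 * c + 2 * l)"
    using rcost_le[OF S1] by (simp add: c_def l_def B_def)
  have clX: "c \<le> card (Al st1)" "l \<le> card (Vals st1)"
    unfolding c_def l_def by (auto intro!: card_mono simp: cutE_def Vals_def Lost_def B_def Big_def)
  have q1: "(6 * T + 20) * (4 * c + 2 * l) \<le> qq * (4 * c + 2 * l)" by (rule mult_le_mono1) (simp add: qq_def)
  have q2: "qq * (4 * c + 2 * l) + 4 * (qq * card (Al st1)) \<le> qq * XP st"
  proof -
    have "4 * c + 2 * l + 4 * card (Al st1) \<le> XP st1" using clX by (simp add: XP_def)
    then have "qq * (4 * c + 2 * l + 4 * card (Al st1)) \<le> qq * XP st1" by (rule mult_le_mono2)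
    then show ?thesis using XP1(1) by (simp add: algebra_simps)
  qed
  define n1 where "n1 = n - 5"
  define R1 where "R1 = n1 - rcost st1 - 30 * m - 20"
  have n5: "n = n1 + 5" using n(1) unfolding n1_def by linarith
  have R1': "n1 = R1 + rcost st1 + 30 * m + 20"
    using n5 n(1) rc q1 q2 XP1 unfolding R1_def by linarith
  note R1 = R1' n5
  have r_le: "r \<le> m" by (rule r_m)
  have R1b: "qq * card (Al st1) + 600 * m + 100 \<le> R1"
    using R1 n(1) rc q1 q2 XP1 by linarith
  let ?post1 = "\<lambda>st' n'. unch (comps_c rc) st1 st' \<and> (\<exists>W. roundI st1 W st' \<and> (\<forall>e<m. dst e \<in> W)) \<and> R1 \<le> n' \<and> scalar st' ''nn'' + n' \<le> N"
  have w1: "wp M le (comps_c rc) ?post1 st1 n1"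
  proof (rule wp_comps_round[OF st1 bw1 bk1 S1 As1(2)])
    show "scalar st1 ''D'' = scalar st1 ''Dn'' * 2 ^ T" "0 < scalar st1 ''Dn''" "m + scalar st1 ''D'' < M" using sc1 Dd d0 DM by simp_all
    show "\<And>v. v \<in> Big st1 \<Longrightarrow> arr st1 ''lo'' v = tgt (scalar st1 ''D'') v" using lo1 by (simp add: B_def)
    show "R1 + rcost st1 + 30 * m + 20 \<le> n1" using R1 by simp
    show "scalar st1 ''nn'' + n1 \<le> N" "N < M" using sc1 n R1 by auto
  qed
  note w1' = wp_stores[OF wp_stores[OF w1 stores_rc(1) asg_le(1)] stores_rc(2) asg_le(2)]
  have main: "wp M le (dial_c ;; kill_c ;; Assign ''D'' (Var ''Dn'')) Q st2 n2"
    if P: "?post1 st2 (n2 + 0)" "\<forall>v. arr st2 ''vis'' v \<le> scalar st1 ''rd''" for st2 n2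
  proof -
    obtain W where W: "roundI st1 W st2" "\<forall>e<m. dst e \<in> W" using P by blast
    have n2: "R1 \<le> n2" "scalar st2 ''nn'' + n2 \<le> N" and u2: "unch (comps_c rc) st1 st2" using P by simp_all
    have st2: "stb st2" "bwf st2" using W by (simp_all add: roundI_def)
    have fr2: "arr st2 ''h'' = arr st1 ''h''" "arr st2 ''lo'' = arr st1 ''lo''" "arr st2 ''asg'' = arr st1 ''asg''" "arr st2 ''out'' = arr st1 ''out''"
       "scalar st2 ''rd'' = scalar st1 ''rd''" "scalar st2 ''D'' = scalar st1 ''D''" "scalar st2 ''Dn'' = d" "scalar st2 ''fin'' = 0"
       and Al2: "Al st2 = Al st1"
      using W sc1 by (simp_all add: roundI_def Al_def)
    have bk2: "bkt st2 j = {x \<in> W \<inter> B. val st1 x \<and> j = hl st1 x}" for j using W by (simp add: roundI_def B_def)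
    have hl1: "hl st1 x = blk d (Lev (rkc (arr st1 ''h'' x)))" for x by (simp add: hl_def sc1)
    have bl2: "blen r st2 \<le> 2 * m"
    proof -
      have "blen r st2 \<le> card W" "W \<subseteq> V" using W by (simp_all add: roundI_def)
      then have "blen r st2 \<le> card V" using card_mono[OF fin_V] by (metis le_trans)
      then show ?thesis using card_V by linarith
    qed
    have As2: "As st2 = {}" using As1 fr2 by (simp add: As_def)
    have ctx: "dctx st2 B"
      unfolding dctx_def Al2 fr2 using eclosed_Big[of st1] lo1 RI(8,10) sc1 Al1 Dd d0 DM
      by (auto simp: B_def Big_def eclosed_def)
    have di: "dialinv st2 B (Suc r) st2"
    proof -
      have b: "j < Suc r \<and> x \<in> B \<and> j \<le> tgt d x \<and> d dvd j" if "x \<in> bkt st2 j" for x j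
      proof -
        have xj: "x \<in> B" "j = blk d (Lev (rkc (arr st1 ''h'' x)))" using that unfolding bk2 hl1 by auto
        have "j \<le> tgt d x" unfolding xj(2) tgt_def using sinvD(6)[OF S1, of x] by (intro blk_mono Lev_mono)
        then show ?thesis using xj dvd_blk tgt_le_r[of d x] by simp
      qed
      have h: "x \<in> bkt st2 (blk d (Lev (rkc (arr st1 ''h'' x))))"
        if "x \<in> B" "arr st1 ''h'' x \<noteq> 0" "arr st1 ''lo'' x \<le> Lev (rkc (arr st1 ''h'' x))" for x
      proof -
        have "dst (arr st1 ''h'' x - 1) = x" "arr st1 ''h'' x - 1 < m" using sinvD(4,5)[OF S1 that(2)] that(2) by auto
        then have "x \<in> W" using W(2) by metis
        then show ?thesis unfolding bk2 hl1 using that by (simp add: val_def)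
      qed
      have t: "\<not> Suc r \<le> tgt d v" for v using tgt_le_r[of d v] by simp
      show ?thesis
        unfolding dialinv_def As2 Al2 fr2
      proof (intro conjI allI ballI impI)
        show "stb st2" "bwf st2" "sinv (Al st1) (arr st1 ''h'')" by fact+
        show "arr st1 ''out'' v = 0" for v using RI(7) sc1 by simp
      qed (use b h t in auto)
    qed
    have Pot2: "Pot st2 \<le> 360 * m + qq * card (Al st1)"
    proof -
      have "(\<Sum>v\<in>V - {}. deg1 v) \<le> 4 * m" using sum_deg1 by simp
      then show ?thesis unfolding Pot_def As2 Al2 qq_def[symmetric] using bl2 by linarith
    qed
    define R2 where "R2 = n2 - (Pot st2 + 20 * r + 40) - 1"
    have R2: "n2 = Suc (R2 + Pot st2 + 20 * r + 40)"
      using n2 R1b Pot2 r_le unfolding R2_def by linarith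
    have w3: "wp M le dial_c (\<lambda>st' n'. unch dial_c st2 st' \<and> dialinv st2 B 0 st' \<and> R2 + Pot st' \<le> n' \<and> scalar st' ''nn'' + n' \<le> N) st2 (n2 - 1)"
      by (rule wp_dial[OF ctx di]) (use R2 n2 n in auto)
    have "\<forall>v. arr st2 ''asg'' v \<le> scalar st2 ''rd''" using asg_le fr2 by simp
    note w3' = wp_stores[OF w3 stores_rc(3) this]
    have fin: "wp M le (kill_c ;; Assign ''D'' (Var ''Dn'')) Q st3 n3"
      if P3: "unch dial_c st2 st3" "dialinv st2 B 0 st3" "R2 + Pot st3 \<le> n3" "scalar st3 ''nn'' + n3 \<le> N"
         "\<forall>v. arr st3 ''asg'' v \<le> scalar st2 ''rd''" for st3 n3
    proof -
      note D3 = dialinvD[OF P3(2), unfolded fr2 Al2]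
      have Pot3: "qq * card (Al st3) \<le> Pot st3" by (simp add: Pot_def qq_def)
      have fr3: "scalar st3 ''rd'' = scalar st1 ''rd''" "scalar st3 ''Dn'' = d" "scalar st3 ''fin'' = 0" "arr st3 ''vis'' = arr st2 ''vis''"
        using P3(1) fr2 by (simp_all add: unch_def wv_dial)
      \<comment> \<open>A vertex of \<open>B\<close> that no bucket has settled has value 0; its old
        and its new interval both start at 0.\<close>
      have lo3: "arr st3 ''lo'' v = tgt d v" if "v \<in> B" for v
      proof (cases "v \<in> As st3")
        case True then show ?thesis using D3(6)[of v] by simp
      next
        case False
        then have "Bn v = 0" using D3(11)[OF that] by auto
        then show ?thesis using D3(6)[of v] False lo1[OF that] by (simp add: tgt_def blk_def)
      qed
      have lo3': "arr st3 ''lo'' v = arr st1 ''lo'' v" if "v \<notin> B" for v using D3(5) D3(6)[of v] that by auto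
      have n3big: "10 * m + 30 \<le> n3"
        using P3(3) R2 n2 R1b Pot2 r_le by linarith
      show ?thesis
      proof -
        have "wp M le kill_c (wp M le (Assign ''D'' (Var ''Dn'')) Q) st3 (n3 - 1)"
        proof (rule wp_kill[OF D3(1)])
          show "10 * m + 10 \<le> n3 - 1" using n3big by simp
          fix st4 n4
          assume u4: "unch kill_c st3 st4" and A4: "Al st4 = {e \<in> Al st3. arr st3 ''lo'' (src e) = arr st3 ''lo'' (dst e)}"
            and n4: "n3 - 1 \<le> n4 + 10 * m + 10" "n4 \<le> n3 - 1"
          have fr4: "\<And>x. x \<noteq> ''i'' \<Longrightarrow> scalar st4 x = scalar st3 x" "\<And>A. A \<noteq> ''al'' \<Longrightarrow> arr st4 A = arr st3 A"
            using u4 by (simp_all add: unch_def wv_kill)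
          define st5 where "st5 = upds ''D'' d st4"
          have Al5: "Al st5 = Al st4" by (simp add: st5_def)
          have ar5: "A \<noteq> ''al'' \<Longrightarrow> arr st5 A = arr st3 A" for A using fr4 by (simp add: st5_def)
          have A43: "Al st4 \<subseteq> Al st3" and A31: "Al st3 \<subseteq> Al st1" using A4 D3(4) by auto
          have Bedge: "src e \<in> B \<longleftrightarrow> dst e \<in> B" "arr st1 ''lo'' (src e) = arr st1 ''lo'' (dst e)" if "e \<in> Al st1" for e
            using eclosed_Big[of st1] that RI(10) Al1 sc1 by (auto simp: B_def eclosed_def)
          have S5: "sinv (Al st5) (arr st5 ''h'')"
            unfolding Al5 ar5[of "''h''", simplified]
          proof (rule sinv_kill[OF D3(3) A43])
            fix e assume e: "e \<in> Al st3 - Al st4"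
            then have ne: "arr st3 ''lo'' (src e) \<noteq> arr st3 ''lo'' (dst e)" and e1: "e \<in> Al st1" using A4 A31 by auto
            have sB: "src e \<in> B" using ne lo3'[of "src e"] lo3'[of "dst e"] Bedge[OF e1] by metis
            then have dB: "dst e \<in> B" using Bedge[OF e1] by simp
            \<comment> \<open>The live edges of a settled tail have at least its target level, so
              they carry that level to the head. Different intervals therefore mean that the head's
              is strictly higher, and \<open>sinv_kill\<close> applies.\<close>
            have "tgt d (src e) \<le> tgt d (dst e)"
            proof (cases "src e \<in> As st3")
              case False
              then have "Bn (src e) = 0" using D3(11)[OF sB] by auto
              then show ?thesis by (simp add: tgt_def blk_def)
            next
              case True
              have t: "tgt d (src e) \<le> Lev (rk e)" using D3(10)[of e] e True by simp
              have "tgt d (src e) \<le> Lev (Bn (src e))" using blk_le by (simp add: tgt_def)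
              then have "tgt d (src e) \<le> Lev (min (Bn (src e)) (rk e))" using t by (simp add: min_def)
              also have "\<dots> \<le> Lev (Bn (dst e))"
                using Bn_edge[of e "min (Bn (src e)) (rk e)"] sinvD(1-3)[OF S1 e1] by (intro Lev_mono) simp
              finally show ?thesis using le_blk[of d "tgt d (src e)"] d0 dvd_blk by (simp add: tgt_def)
            qed
            then have lt: "tgt d (src e) < tgt d (dst e)" using ne lo3[OF sB] lo3[OF dB] by simp
            show "Bn (src e) < Bn (dst e)"
            proof (rule ccontr)
              assume "\<not> Bn (src e) < Bn (dst e)"
              then have "tgt d (dst e) \<le> tgt d (src e)" unfolding tgt_def by (intro blk_mono Lev_mono) simp
              with lt show False by simp
            qed
          qed
          have bk5: "bkt st5 = bkt st3" "bwf st5" using bkt_cong[of st5 st3] ar5 fr4 D3(2) by (simp_all add: st5_def)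
          have bk0: "bkt st3 j = {}" for j using D3(8)[of _ j] by auto
          have st5: "stb st5"
          proof -
            have "stb st4" by (rule stb_unch[OF u4 D3(1)]) (simp_all add: wv_kill)
            then show ?thesis by (simp add: st5_def stb_def thr_def)
          qed
          have sc5: "scalar st5 ''rd'' = Suc (scalar st ''rd'')" "scalar st5 ''D'' = d" "scalar st5 ''fin'' = 0" "scalar st5 ''nn'' = scalar st3 ''nn''"
            using fr4 fr3 sc1 by (simp_all add: st5_def)
          have lor: "arr st3 ''lo'' v \<le> r" for v
            using lo3[of v] lo3'[of v] tgt_le_r[of d v] RI(8)[of v] sc1 by (cases "v \<in> B") simp_all
          have los: "arr st3 ''lo'' v = tgt d v \<or> small (Al st5) v" if "v \<in> V" for v
          proof (cases "v \<in> B")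
            case False
            then have "small (Al st1) v" using that by (simp add: B_def Big_def)
            then show ?thesis using small_mono A43 A31 Al5 by blast
          qed (simp add: lo3)
          have R5: "rinv st5"
            unfolding rinv_def
          proof (intro conjI allI ballI)
            show "stb st5" "bwf st5" "sinv (Al st5) (arr st5 ''h'')" by fact+
            show "bkt st5 j = {}" for j using bk5 bk0 by simp
            show "arr st5 ''vis'' v \<le> scalar st5 ''rd''" "arr st5 ''asg'' v \<le> scalar st5 ''rd''" for v
              using P(2) P3(5) fr3 fr2 ar5 sc5 sc1 by simp_all
            show "arr st5 ''out'' v = 0" "arr st5 ''lo'' v \<le> r" for v using ar5 D3(7) lor by simp_all
            show "scalar st5 ''fin'' = 0" by (rule sc5)
            show "arr st5 ''lo'' (src e) = arr st5 ''lo'' (dst e)" if "e \<in> Al st5" for e using that A4 Al5 ar5 by simp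
            show "arr st5 ''lo'' v = tgt (scalar st5 ''D'') v \<or> small (Al st5) v" if "v \<in> V" for v using los[OF that] ar5 sc5 by simp
            show "scalar st5 ''rd'' \<le> T" "scalar st5 ''D'' = 2 ^ (T * (T - scalar st5 ''rd''))" using sc5 rd by (simp_all add: d_def)
          qed
          have cutd: "cutE st1 \<inter> Al st5 = {}"
          proof -
            have "e \<notin> Al st4" if e: "e \<in> cutE st1" for e
            proof
              assume e4: "e \<in> Al st4"
              have "src e \<in> B" "e \<in> Al st1" "tgt d (src e) \<noteq> tgt d (dst e)" using e sc1 by (simp_all add: cutE_def B_def)
              then show False using e4 A4 lo3[of "src e"] lo3[of "dst e"] Bedge(1)[of e] by simp
            qed
            then show ?thesis unfolding Al5 by blast
          qed
          \<comment> \<open>An unchanged code that is at or above the refined interval start was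
            useful before. As it does not exceed the value, it was located exactly at the target,
            hence was not lost.\<close>
          have Vals5: "Vals st5 \<subseteq> (Vals st1 - Lost st1 (Big st1)) \<union> dst ` (Al st1 - Al st3)"
          proof
            fix v assume "v \<in> Vals st5"
            then have v: "v \<in> V" "arr st3 ''h'' v \<noteq> 0" "arr st3 ''lo'' v \<le> Lev (rkc (arr st3 ''h'' v))"
              using ar5 by (simp_all add: Vals_def val_def)
            show "v \<in> (Vals st1 - Lost st1 (Big st1)) \<union> dst ` (Al st1 - Al st3)"
            proof (cases "arr st3 ''h'' v = arr st1 ''h'' v")
              case False
              then show ?thesis using D3(12)[of v] by auto
            next
              case h: True
              show ?thesis
              proof (cases "v \<in> B")
                case False
                then show ?thesis using v h lo3' by (auto simp: Vals_def val_def Lost_def B_def)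
              next
                case True
                have t: "tgt d v \<le> Lev (rkc (arr st1 ''h'' v))" using v(3) lo3[OF True] h by simp
                have "arr st1 ''lo'' v \<le> tgt d v"
                  using lo1[OF True] le_blk[of d "blk (scalar st ''D'') (Lev (Bn v))" "Lev (Bn v)"] dvd_blk[of "scalar st ''D''"] d0 blk_le Dd sc1
                  by (simp add: tgt_def) (metis dvd_mult_left)
                then have "val st1 v" using t v(2) h by (simp add: val_def)
                moreover have "hl st1 v = tgt d v"
                proof (rule antisym)
                  show "hl st1 v \<le> tgt d v" unfolding hl1 tgt_def using sinvD(6)[OF S1] by (intro blk_mono Lev_mono)
                  show "tgt d v \<le> hl st1 v" unfolding hl1 using t d0 dvd_blk by (intro le_blk) (auto simp: tgt_def)
                qed
                ultimately show ?thesis using v(1) sc1 by (simp add: Vals_def Lost_def)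
              qed
            qed
          qed
          have key: "XP st5 + 4 * c + 2 * l + (card (Al st1) - card (Al st3)) \<le> XP st1"
            unfolding c_def l_def B_def by (rule round_potential[OF A31 _ cutd Vals5]) (use A43 Al5 in simp)
          have "qq * (XP st5 + (4 * c + 2 * l) + card (Al st1)) \<le> qq * (XP st1 + card (Al st3))"
            using key card_mono[OF fin_Al A31] by (intro mult_le_mono2) linarith
          then have keyq: "qq * XP st5 + qq * (4 * c + 2 * l) + qq * card (Al st1) \<le> qq * XP st + qq * card (Al st3)"
            unfolding XP1(1) by (simp only: distrib_left)
          have nfin: "R + qq * XP st5 + 1 \<le> n4"
            using keyq n(1) XP1(1) R1 rc q1 n2(1) R2 Pot2 P3(3) Pot3 n4 r_le by linarith
          have "Q st5 (n4 - 1)"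
            by (rule Q[OF R5 sc5(1)]) (use nfin sc5 P3(4) n4 in auto)
          then show "wp M le (Assign ''D'' (Var ''Dn'')) Q st4 n4" using nfin fr4 fr3 by (simp add: wps st5_def)
        qed
        then show ?thesis using n3big by (simp add: wp_Seq)
      qed
    qed
    have "wp M le dial_c (wp M le (kill_c ;; Assign ''D'' (Var ''Dn'')) Q) st2 (n2 - 1)"
      by (rule wp_mono[OF w3']) (use fin in blast)
    then show ?thesis using R2 by (simp add: wp_Seq)
  qed
  have "wp M le (comps_c rc) (wp M le (dial_c ;; kill_c ;; Assign ''D'' (Var ''Dn'')) Q) st1 n1"
    by (rule wp_mono[OF w1']) (use main in simp)
  moreover have "Suc (scalar st ''rd'') < M" using rd M_T by simp
  moreover have "scalar st ''z'' = 2 ^ T" using RI(1) by (simp add: stb_def)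
  ultimately show ?thesis using n5 Dd unfolding round_c_def rc_def[symmetric]
    by (simp add: wp_Seq wp_Assign credit_le st1_def numeral_2_eq_2[symmetric])
qed

lemma wp_rounds:
  assumes I: "rinv st"
    and n: "R + qq * XP st + T * (1500 * m + 210) + 10 \<le> n" "scalar st ''nn'' + n \<le> N" "N < M"
    and Q: "\<And>st' n'. rinv st' \<Longrightarrow> scalar st' ''rd'' = T \<Longrightarrow> R + qq * XP st' \<le> n' \<Longrightarrow>
       scalar st' ''nn'' + n' \<le> N \<Longrightarrow> Q st' n'"
  shows "wp M le (While (Less (Var ''rd'') (Var ''T'')) round_c) Q st n"
proof (rule wp_While[where I = "\<lambda>st' n'. rinv st' \<and> R + qq * XP st' + (T - scalar st' ''rd'') * (1500 * m + 210) + 5 \<le> n' \<and>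
     scalar st' ''nn'' + n' \<le> N"], goal_cases)
  case 1
  have "(T - scalar st ''rd'') * (1500 * m + 210) \<le> T * (1500 * m + 210)" by (rule mult_le_mono1) simp
  then have "R + qq * XP st + (T - scalar st ''rd'') * (1500 * m + 210) + 5 \<le> n" using n(1) by linarith
  then show ?case using I n by blast
next
  case (2 st' n')
  then have I': "rinv st'" and nn: "scalar st' ''nn'' + n' \<le> N" by auto
  have T': "scalar st' ''T'' = T" using rinvD(1)[OF I'] by (simp add: stb_def)
  then have rd: "scalar st' ''rd'' < T" using 2(3) by simp
  then have "T - scalar st' ''rd'' = Suc (T - Suc (scalar st' ''rd''))" by simp
  then have n': "R + qq * XP st' + ((T - Suc (scalar st' ''rd'')) * (1500 * m + 210) + (1500 * m + 210)) + 5 \<le> n'" using 2(1) by simp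
  have "wp M le round_c (\<lambda>st' n'. rinv st' \<and> R + qq * XP st' + (T - scalar st' ''rd'') * (1500 * m + 210) + 5 \<le> n' \<and>
     scalar st' ''nn'' + n' \<le> N) st' (n' - 1)"
    by (rule wp_round[OF I' rd, where R = "R + (T - Suc (scalar st' ''rd'')) * (1500 * m + 210) + 5"]) (use n' nn n in auto)
  then show ?case using n' by simp
next
  case (3 st' n')
  then have I': "rinv st'" by auto
  have "scalar st' ''T'' = T" using rinvD(1)[OF I'] by (simp add: stb_def)
  then have "scalar st' ''rd'' = T" using 3(3) rinvD(12)[OF I'] by simp
  then have "Q st' (n' - 1)" using 3(1) by (intro Q) auto
  then show ?case using 3(1) by auto
qed

end

section \<open>Finishing the components\<close>

context ssbp_run
begin

lemma rkc_eq_0: assumes "c \<le> m" shows "rkc c = 0 \<longleftrightarrow> c = 0"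
proof (cases c)
  case (Suc e)
  then show ?thesis using rk_pos[of e] assms by simp
qed simp

lemma rkc_inj: assumes "c \<le> m" "c' \<le> m" "rkc c = rkc c'" shows "c = c'"
  using assms rkc_eq_0 rk_inj by (cases c; cases c') force+

lemma wp_best:
  assumes k: "scalar st ''k'' = length L" "\<And>t. t < length L \<Longrightarrow> arr st ''L'' t = L ! t" "length L < M"
    and h: "\<And>v. arr st ''h'' v \<le> m"
    and n: "25 * length L + 10 \<le> n"
    and Q: "\<And>st' n'. unch best_c st st' \<Longrightarrow> scalar st' ''b'' = 0 \<or> (\<exists>x\<in>set L - As st. arr st ''h'' x = scalar st' ''b'') \<Longrightarrow>
       (\<forall>x\<in>set L - As st. rkc (arr st ''h'' x) \<le> rkc (scalar st' ''b'')) \<Longrightarrow> n \<le> n' + 25 * length L + 10 \<Longrightarrow> n' \<le> n \<Longrightarrow> Q st' n'"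
  shows "wp M le best_c Q st n"
proof -
  define J where "J = (\<lambda>st' n'. unch best_c st st' \<and> scalar st' ''t'' \<le> length L \<and>
     (scalar st' ''b'' = 0 \<or> (\<exists>x\<in>set (take (scalar st' ''t'') L) - As st. arr st ''h'' x = scalar st' ''b'')) \<and>
     (\<forall>x\<in>set (take (scalar st' ''t'') L) - As st. rkc (arr st ''h'' x) \<le> rkc (scalar st' ''b'')) \<and>
     n \<le> n' + 25 * scalar st' ''t'' + 5 \<and> n' \<le> n)"
  define st0 where "st0 = st\<lparr>scalar := (scalar st)(''b'' := 0, ''t'' := 0)\<rparr>"
  have "wp M le (While (Less (Var ''t'') (Var ''k'')) best_body_c) Q st0 (n - 4)"
  proof (rule wp_While[where I = J])
    show "J st0 (n - 4)" using n by (auto simp: J_def st0_def unch_def wv_best)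
  next
    fix st1 n1 assume J: "J st1 n1" and b: "bv M le st1 (Less (Var ''t'') (Var ''k''))"
    define t where "t = scalar st1 ''t''"
    define bb where "bb = scalar st1 ''b''"
    have u: "unch best_c st st1" using J by (simp add: J_def)
    have ar: "arr st1 = arr st" and sc: "\<And>x. x \<notin> {''b'', ''t'', ''x''} \<Longrightarrow> scalar st1 x = scalar st x"
      using u by (auto simp: unch_def wv_best)
    have tl: "t < length L" using b sc k by (simp add: t_def)
    define x where "x = L ! t"
    have takeS: "set (take (Suc t) L) = insert x (set (take t L))" using tl by (simp add: take_Suc_conv_app_nth x_def)
    have I1: "bb = 0 \<or> (\<exists>x\<in>set (take t L) - As st. arr st ''h'' x = bb)"
      "\<And>x. x \<in> set (take t L) - As st \<Longrightarrow> rkc (arr st ''h'' x) \<le> rkc bb" "n \<le> n1 + 25 * t + 5" "n1 \<le> n"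
      using J by (auto simp: J_def t_def bb_def)
    have bm: "bb \<le> m" using I1(1) h by auto
    have n30: "30 \<le> n1" using I1(3) n tl by linarith
    have tM: "Suc t < M" using tl k(3) by simp
    define hx where "hx = arr st ''h'' x"
    define st2 where "st2 = upds ''x'' x st1"
    define P where "P \<longleftrightarrow> x \<notin> As st \<and> hx \<noteq> 0 \<and> rkc bb \<le> rk (hx - 1)"
    have hxm: "hx \<le> m" using h by (simp add: hx_def)
    have pb: "bv M le st2 (passE (Var ''b'') (Sub (Arr ''h'' (Var ''x'')) (Const 1))) \<longleftrightarrow> rkc bb \<le> rk (hx - 1)" if "hx \<noteq> 0"
      using bv_passE[of st2 "Var ''b''" "Sub (Arr ''h'' (Var ''x'')) (Const 1)"] bm that hxm ar
      by (simp add: st2_def hx_def bb_def)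
    define cond where "cond = And (And (Not (Eq (Arr ''asg'' (Var ''x'')) (Var ''rd''))) (Not (Eq (Arr ''h'' (Var ''x'')) (Const 0))))
            (passE (Var ''b'') (Sub (Arr ''h'' (Var ''x'')) (Const 1)))"
    have cb: "bv M le st2 cond \<longleftrightarrow> P"
      using pb ar sc[of "''rd''"] by (auto simp: cond_def P_def st2_def As_def hx_def)
    define st3 where "st3 = (if P then upds ''b'' hx st2 else st2)"
    define st4 where "st4 = upds ''t'' (Suc t) st3"
    have b4: "scalar st4 ''b'' = (if P then hx else bb)" "scalar st4 ''t'' = Suc t"
      by (simp_all add: st4_def st3_def st2_def bb_def)
    have u4: "unch best_c st st4" using u by (simp add: st4_def st3_def st2_def unch_def wv_best)
    have A: "scalar st4 ''b'' = 0 \<or> (\<exists>x\<in>set (take (Suc t) L) - As st. arr st ''h'' x = scalar st4 ''b'')"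
      unfolding b4 takeS using I1(1) by (auto simp: P_def hx_def)
    have Bd: "rkc (arr st ''h'' y) \<le> rkc (scalar st4 ''b'')" if y: "y \<in> set (take (Suc t) L) - As st" for y
    proof (cases P)
      case True
      have hb: "rkc bb \<le> rkc hx" using True by (simp add: P_def rkc_def)
      show ?thesis
      proof (cases "y = x")
        case True
        then show ?thesis using \<open>P\<close> b4 by (simp add: hx_def)
      next
        case False
        then have "y \<in> set (take t L) - As st" using y takeS by auto
        from I1(2)[OF this] hb True show ?thesis by (simp add: b4)
      qed
    next
      case False
      show ?thesis
      proof (cases "y = x")
        case True
        then have "hx = 0 \<or> \<not> rkc bb \<le> rk (hx - 1)" using False y by (auto simp: P_def)
        then show ?thesis using True False by (auto simp: b4 hx_def[symmetric] rkc_def)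
      next
        case ne: False
        then have "y \<in> set (take t L) - As st" using y takeS by auto
        from I1(2)[OF this] False show ?thesis by (simp add: b4)
      qed
    qed
    have J4: "J st4 n4" if "n1 \<le> n4 + 20" "n4 \<le> n1" for n4
      using A Bd u4 tl that I1 b4(2) by (simp add: J_def)
    have "wp M le (Cond cond (Assign ''b'' (Arr ''h'' (Var ''x''))) Skip) (wp M le (Assign ''t'' (Add (Var ''t'') (Const 1))) J) st2 (n1 - 4)"
    proof (cases P)
      case True
      have "J st4 (n1 - 7)" by (rule J4) (use n30 in auto)
      then show ?thesis using True cb n30 tM ar
        by (simp add: wp_Cond wp_Assign credit_le numeral_2_eq_2[symmetric] st4_def st3_def st2_def hx_def t_def)
    next
      case False
      have "J st4 (n1 - 7)" by (rule J4) (use n30 in auto)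
      then show ?thesis using False cb n30 tM ar
        by (simp add: wp_Cond wp_Assign wp_Skip credit_le numeral_2_eq_2[symmetric] st4_def st3_def st2_def t_def)
    qed
    moreover have "arr st1 ''L'' t = x" using ar k tl by (simp add: x_def)
    ultimately show "1 \<le> n1 \<and> wp M le best_body_c J st1 (n1 - 1)"
      unfolding best_body_c_def cond_def[symmetric] using n30
      by (simp add: wp_Seq wp_Assign credit_le numeral_2_eq_2[symmetric] st2_def t_def[symmetric])
  next
    fix st1 n1 assume J: "J st1 n1" and b: "\<not> bv M le st1 (Less (Var ''t'') (Var ''k''))"
    have "scalar st1 ''k'' = length L" using J k by (simp add: J_def unch_def wv_best)
    then have t: "scalar st1 ''t'' = length L" using J b by (simp add: J_def)
    have "Q st1 (n1 - 1)" by (rule Q) (use J t in \<open>auto simp: J_def\<close>)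
    then show "1 \<le> n1 \<and> Q st1 (n1 - 1)" using J t n by (simp add: J_def)
  qed
  then show ?thesis using n by (simp add: best_c_def wps st0_def numeral_2_eq_2[symmetric])
qed

text \<open>\<open>y\<close> exceeds the ranks of all codes left in the component; it starts at
  \<open>Suc m\<close>, above every rank, and drops with each pass. \<open>As st1\<close> holds the
  vertices settled in earlier components.\<close>

definition pinv :: "state \<Rightarrow> nat list \<Rightarrow> nat \<Rightarrow> state \<Rightarrow> bool" where
  "pinv st1 L y st \<longleftrightarrow> stb st \<and> bwf st \<and> sinv (Al st) (arr st ''h'') \<and> (\<forall>j. bkt st j = {}) \<and> scalar st ''fin'' = 1 \<and>
     (\<forall>v. arr st ''lo'' v \<le> r) \<and> Al st \<subseteq> Al st1 \<and> As st1 \<subseteq> As st \<and> As st - As st1 \<subseteq> set L \<and>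
     (\<forall>v\<in>As st - As st1. rkc (arr st ''out'' v) = Bn v \<and> arr st ''out'' v \<le> m) \<and>
     (\<forall>v. v \<notin> As st - As st1 \<longrightarrow> arr st ''out'' v = arr st1 ''out'' v \<and> arr st ''lo'' v = arr st1 ''lo'' v) \<and>
     (\<forall>e\<in>Al st. src e \<in> As st - As st1 \<longrightarrow> dst e \<in> As st) \<and>
     (\<forall>v\<in>set L - As st. rkc (arr st ''h'' v) < y)"

lemma pinvD:
  assumes "pinv st1 L y st"
  shows "stb st" "bwf st" "sinv (Al st) (arr st ''h'')" "bkt st j = {}" "scalar st ''fin'' = 1" "arr st ''lo'' v \<le> r"
    "Al st \<subseteq> Al st1" "As st1 \<subseteq> As st" "As st - As st1 \<subseteq> set L"
    "v \<in> As st - As st1 \<Longrightarrow> rkc (arr st ''out'' v) = Bn v \<and> arr st ''out'' v \<le> m"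
    "v \<notin> As st - As st1 \<Longrightarrow> arr st ''out'' v = arr st1 ''out'' v \<and> arr st ''lo'' v = arr st1 ''lo'' v"
    "e \<in> Al st \<Longrightarrow> src e \<in> As st - As st1 \<Longrightarrow> dst e \<in> As st"
    "v \<in> set L \<Longrightarrow> v \<notin> As st \<Longrightarrow> rkc (arr st ''h'' v) < y"
  using assms unfolding pinv_def by blast+

lemma pinv_scalar:
  assumes "pinv st1 L y st" "arr st' = arr st" "\<And>x. x \<notin> {''b'', ''t'', ''x'', ''go'', ''th'', ''bi'', ''v''} \<Longrightarrow> scalar st' x = scalar st x"
  shows "pinv st1 L y st'"
proof -
  have "stb st'" using assms by (simp add: pinv_def stb_def thr_def)
  moreover have "Al st' = Al st" "As st' = As st" using assms(2,3) by (simp_all add: Al_def As_def)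
  moreover have "bkt st' = bkt st" "bwf st' = bwf st" using bkt_cong[of st' st] assms(2,3) by simp_all
  ultimately show ?thesis using assms by (simp add: pinv_def)
qed

text \<open>No live edge leads from a settled vertex of the component to an unsettled one, so the
  flow that realises \<open>Bn v\<close> starts at an unsettled vertex, whose code is at least as
  good.\<close>

lemma pinv_source:
  assumes P: "pinv st1 L y st" and cl: "eclosed (Al st1) (set L)" and d: "set L \<inter> As st1 = {}"
    and v: "v \<in> set L" "v \<notin> As st" "0 < Bn v"
  shows "\<exists>u\<in>set L - As st. Bn v \<le> rkc (arr st ''h'' u)"
proof -
  note PD = pinvD[OF P]
  have "flow (Al st) (arr st ''h'') (Bn v) v" using sinvD(7)[OF PD(3)] v by simp
  moreover have "v' \<in> set L - As st \<longrightarrow> (\<exists>u\<in>set L - As st. x \<le> rkc (arr st ''h'' u))"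
    if "flow (Al st) (arr st ''h'') x v'" for x v'
    using that
  proof induction
    case (flow_step e)
    show ?case
    proof
      assume e: "dst e \<in> set L - As st"
      then have "src e \<in> set L" using flow_step(2) PD(7) cl by (auto simp: eclosed_def)
      moreover have "src e \<notin> As st" using PD(12)[of e] flow_step(2) e d \<open>src e \<in> set L\<close> by auto
      ultimately show "\<exists>u\<in>set L - As st. x \<le> rkc (arr st ''h'' u)" using flow_step by blast
    qed
  qed auto
  ultimately show ?thesis using v by blast
qed

text \<open>By \<open>pinv_source\<close> no unsettled vertex exceeds the greatest code
  \<open>b\<close>, so whatever draining at this threshold settles has exactly that value. The codes
  left behind are smaller: new ones come from edges below the threshold, and an equal old one would
  belong to \<open>x\<close>.\<close>

lemma pinv_step:
  assumes P: "pinv st1 L y st" and cl: "eclosed (Al st1) (set L)" and d: "set L \<inter> As st1 = {}" and LV: "set L \<subseteq> V"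
    and b: "b = arr st ''h'' x" "x \<in> set L" "x \<notin> As st" "b \<noteq> 0" "\<And>u. u \<in> set L - As st \<Longrightarrow> rkc (arr st ''h'' u) \<le> rkc b"
    and s2: "bwf st2" "stb st2" "\<And>A. A \<notin> {''bv'', ''bn'', ''bh''} \<Longrightarrow> arr st2 A = arr st A" "bkt st2 = (\<lambda>j. if j = 0 then {x} else {})"
      "scalar st2 ''th'' = b" "scalar st2 ''bi'' = 0" "scalar st2 ''fin'' = 1" "scalar st2 ''rd'' = scalar st ''rd''"
  defines "X \<equiv> {v \<in> set L. rkc b \<le> Bn v}"
  shows "dpre st2 X"
    and "DI st2 X {e \<in> Al st2. src e \<in> As st3 - As st2} st3 \<Longrightarrow> bkt st3 0 = {} \<Longrightarrow> pinv st1 L (rkc b) st3"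
    and "rkc b \<in> Bn ` set L" "0 < rkc b" "rkc b < y"
proof -
  note PD = pinvD[OF P]
  have Al2: "Al st2 = Al st" "As st2 = As st" using s2(3,8) by (simp_all add: Al_def As_def)
  have bm: "b \<le> m" "dst (b - 1) = x" using sinvD(4,5)[OF PD(3), of x] b by simp_all
  have hm: "arr st ''h'' v \<le> m" for v using sinvD(4)[OF PD(3), of v] by (cases "arr st ''h'' v = 0") auto
  have xB: "rkc b \<le> Bn x" using sinvD(6)[OF PD(3), of x] b(1) by simp
  have xX: "x \<in> X" using xB b by (simp add: X_def)
  have ub: "Bn v \<le> rkc b" if "v \<in> set L" "v \<notin> As st" for v
    using pinv_source[OF P cl d that] b(5) by (cases "Bn v = 0") (auto intro: order_trans)
  show "0 < rkc b" using rkc_eq_0[OF bm(1)] b(4) by simp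
  show "rkc b < y" using PD(13)[OF b(2,3)] b(1) by simp
  have "Bn x = rkc b" using ub[OF b(2,3)] xB by simp
  then show "rkc b \<in> Bn ` set L" using b(2) by force
  have clA: "src e \<in> set L \<longleftrightarrow> dst e \<in> set L" if "e \<in> Al st" for e using that PD(7) cl by (auto simp: eclosed_def)
  have sound: "dst e \<in> X" if "e \<in> Al st" "src e \<in> X" "rkc b \<le> rk e" for e
    using Bn_edge[of e "rkc b"] sinvD(1-3)[OF PD(3) that(1)] that clA[OF that(1)] by (simp add: X_def)
  have A0: "Al st \<subseteq> A0" using sinvD(1-3)[OF PD(3)] by (auto simp: A0_def)
  show "dpre st2 X"
    unfolding dpre_def Al2 s2(4-7)
  proof (intro conjI)
    show "stb st2" "bwf st2" "Al st \<subseteq> A0" "b \<le> m" by fact+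
    show "X \<subseteq> V" using LV by (auto simp: X_def)
    show "\<forall>v. arr st2 ''h'' v \<le> m" "\<forall>v. arr st2 ''lo'' v \<le> r" using hm PD(6) s2(3) by simp_all
    show "\<forall>e\<in>Al st. src e \<in> X \<and> rkc b \<le> rk e \<longrightarrow> dst e \<in> X \<union> As st" using sound by blast
    show "(if (0::nat) = 0 then {x} else {}) \<subseteq> X \<union> As st" using xX by simp
  qed simp_all
  assume I: "DI st2 X {e \<in> Al st2. src e \<in> As st3 - As st2} st3" and em: "bkt st3 0 = {}"
  define F where "F = {e \<in> Al st. src e \<in> As st3 - As st}"
  have pr: "prel 1 (scalar st2 ''Dn'') (arr st2 ''lo'') X 0 (rkc b) (Al st) (arr st ''h'') (As st) (bkt st2) F
      (Al st3) (arr st3 ''h'') (As st3) (bkt st3)"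
    using I s2 by (simp add: DI_def F_def Al2)
  note PR = prelD[OF pr]
  have AA: "Al st3 \<subseteq> Al st" using PR(1) by blast
  have killed: "rk e < rkc b \<and> rk e \<le> Bn (src e)" if e: "e \<in> Al st - Al st3" for e
  proof -
    have "e \<in> F" "rk e < rkc b" using e PR(1) by auto
    moreover have "src e \<in> X" using PR(3)[OF \<open>e \<in> F\<close>] PR(8) by blast
    ultimately show ?thesis by (auto simp: X_def)
  qed
  have S3: "sinv (Al st3) (arr st3 ''h'')"
    by (rule sinv_fail[OF PD(3) AA]) (use PR(9,10,11) killed in auto)
  have newB: "Bn v = rkc b" "v \<in> set L" if v: "v \<in> As st3 - As st" for v
  proof -
    have vX: "v \<in> X" using v PR(8) by blast
    then show "v \<in> set L" by (simp add: X_def)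
    then show "Bn v = rkc b" using ub[of v] v vX by (simp add: X_def)
  qed
  have xA: "x \<in> As st3" using PR(5) em s2(4) by auto
  have out3: "arr st3 ''out'' v = (if v \<in> As st3 - As st then b else arr st ''out'' v)"
    and lo3: "arr st3 ''lo'' v = (if v \<in> As st3 - As st then 0 else arr st ''lo'' v)" for v
    using I s2 Al2 by (simp_all add: DI_def)
  show "pinv st1 L (rkc b) st3"
    unfolding pinv_def
  proof (intro conjI allI ballI impI)
    show "stb st3" by (rule stb_unch[of drain_c st2]) (use I s2 in \<open>simp_all add: DI_def wv_drain\<close>)
    show "bwf st3" using I by (simp add: DI_def)
    show "sinv (Al st3) (arr st3 ''h'')" by fact
    show "bkt st3 j = {}" for j using PR(13)[of j] em s2(4) by (cases "j = 0") auto
    show "scalar st3 ''fin'' = 1" using I s2 by (simp add: DI_def unch_def wv_drain)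
    show "arr st3 ''lo'' v \<le> r" for v using lo3[of v] PD(6)[of v] by simp
    show "Al st3 \<subseteq> Al st1" "As st1 \<subseteq> As st3" using AA PD(7,8) PR(7) by blast+
    show "As st3 - As st1 \<subseteq> set L" using newB(2) PD(9) by blast
    show "rkc (arr st3 ''out'' v) = Bn v" "arr st3 ''out'' v \<le> m" if "v \<in> As st3 - As st1" for v
      using that newB(1)[of v] PD(10)[of v] out3[of v] bm by (cases "v \<in> As st"; simp)+
    show "arr st3 ''out'' v = arr st1 ''out'' v" "arr st3 ''lo'' v = arr st1 ''lo'' v" if "v \<notin> As st3 - As st1" for v
      using that PD(8) PD(11)[of v] out3[of v] lo3[of v] PR(7) by auto
    show "dst e \<in> As st3" if e: "e \<in> Al st3" "src e \<in> As st3 - As st1" for e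
    proof (cases "src e \<in> As st")
      case True
      then show ?thesis using PD(12)[of e] e AA PR(7) by blast
    next
      case False
      then have eF: "e \<in> F" using e AA by (auto simp: F_def)
      then have "rkc b \<le> rk e" using e(1) PR(1) by auto
      then show ?thesis using PR(4)[OF eF] em by simp
    qed
    show "rkc (arr st3 ''h'' v) < rkc b" if v: "v \<in> set L - As st3" for v
    proof -
      have vA: "v \<in> set L - As st" using v PR(7) by blast
      from PR(9)[of v] show ?thesis
      proof
        assume h: "arr st3 ''h'' v = arr st ''h'' v"
        \<comment> \<open>A code determines its vertex, as the head of the edge it names.\<close>
        have "arr st ''h'' v \<noteq> b"
        proof
          assume "arr st ''h'' v = b"
          then have "v = x" using sinvD(5)[OF PD(3), of v] bm b(4) by simp
          then show False using v xA by simp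
        qed
        then have "rkc (arr st ''h'' v) \<noteq> rkc b" using rkc_inj[OF hm bm(1)] by blast
        then show ?thesis using b(5)[OF vA] h by simp
      next
        assume "\<exists>e\<in>Al st - Al st3. arr st3 ''h'' v = Suc e \<and> dst e = v"
        then show ?thesis using killed by auto
      qed
    qed
  qed
qed

text \<open>A bound on the passes to come: every pass finishes one value that occurs in the
  component.\<close>

definition passes :: "nat list \<Rightarrow> nat \<Rightarrow> nat" where
  "passes L y = card {z \<in> Bn ` set L. 0 < z \<and> z < y}"

lemma passes_less: "z \<in> Bn ` set L \<Longrightarrow> 0 < z \<Longrightarrow> z < y \<Longrightarrow> passes L z < passes L y"
  unfolding passes_def by (rule psubset_card_mono) auto

text \<open>There is one pass more than there are values; it merely discovers that no code is
  left.\<close>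

lemma wp_peel:
  assumes P: "pinv st L (Suc m) st" and cl: "eclosed (Al st) (set L)" and d: "set L \<inter> As st = {}" and LV: "set L \<subseteq> V"
    and k: "scalar st ''k'' = length L" "\<And>t. t < length L \<Longrightarrow> arr st ''L'' t = L ! t" "length L < M"
    and n: "R + Pot st + (passes L (Suc m) + 1) * (25 * length L + 60) + 10 \<le> n" "scalar st ''nn'' + n \<le> N" "N < M"
    and Q: "\<And>st' n' y. pinv st L y st' \<Longrightarrow> unch peel_c st st' \<Longrightarrow> (\<forall>v\<in>set L - As st'. Bn v = 0) \<Longrightarrow> R + Pot st' \<le> n' \<Longrightarrow>
       scalar st' ''nn'' + n' \<le> N \<Longrightarrow> Q st' n'"
  shows "wp M le peel_c Q st n"
proof -
  define c where "c = 25 * length L + 60"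
  define J where "J = (\<lambda>st' n'. \<exists>y. pinv st L y st' \<and> unch peel_c st st' \<and> scalar st' ''nn'' + n' \<le> N \<and>
     (if scalar st' ''go'' = 1 then R + Pot st' + (passes L y + 1) * c + 5 \<le> n'
      else R + Pot st' + 5 \<le> n' \<and> (\<forall>v\<in>set L - As st'. Bn v = 0)))"
  define st0 where "st0 = upds ''go'' 1 st"
  have "wp M le (While (Eq (Var ''go'') (Const 1)) peel_body_c) Q st0 (n - 2)"
  proof (rule wp_While[where I = J])
    have "pinv st L (Suc m) st0" by (rule pinv_scalar[OF P]) (simp_all add: st0_def)
    moreover have "unch peel_c st st0" by (simp add: unch_def wv_peel st0_def)
    ultimately show "J st0 (n - 2)"
      using n unfolding J_def c_def by (intro exI[of _ "Suc m"]) (simp add: st0_def Pot_scalar; linarith)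
  next
    fix st1 n1 assume J: "J st1 n1" and b: "bv M le st1 (Eq (Var ''go'') (Const 1))"
    then obtain y where P1: "pinv st L y st1" and u1: "unch peel_c st st1" and nn1: "scalar st1 ''nn'' + n1 \<le> N"
      and n1: "R + Pot st1 + (passes L y + 1) * c + 5 \<le> n1"
      unfolding J_def by auto
    note PD = pinvD[OF P1]
    have fr1: "scalar st1 ''k'' = length L" "\<And>t. t < length L \<Longrightarrow> arr st1 ''L'' t = L ! t" "scalar st1 ''rd'' = scalar st ''rd''"
      using u1 k by (simp_all add: unch_def wv_peel)
    have hm: "arr st1 ''h'' v \<le> m" for v using sinvD(4)[OF PD(3), of v] by (cases "arr st1 ''h'' v = 0") auto
    have nc: "c + 5 \<le> n1" using n1 by simp
    define rest where "rest = Cond (Eq (Var ''b'') (Const 0)) (Assign ''go'' (Const 0))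
          (Assign ''th'' (Var ''b'') ;; Assign ''bi'' (Const 0) ;;
           Assign ''v'' (Arr ''dst'' (Sub (Var ''b'') (Const 1))) ;;
           push_c ''v'' ''bi'' ;; drain_c)"
    have "wp M le best_c (wp M le rest J) st1 (n1 - 2)"
    proof (rule wp_best[OF fr1(1,2) k(3) hm])
      show "25 * length L + 10 \<le> n1 - 2" using nc by (simp add: c_def)
      fix st2 n2
      assume u2: "unch best_c st1 st2" and bx: "scalar st2 ''b'' = 0 \<or> (\<exists>x\<in>set L - As st1. arr st1 ''h'' x = scalar st2 ''b'')"
        and mx: "\<forall>x\<in>set L - As st1. rkc (arr st1 ''h'' x) \<le> rkc (scalar st2 ''b'')"
        and n2: "n1 - 2 \<le> n2 + 25 * length L + 10" "n2 \<le> n1 - 2"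
      have fr2: "arr st2 = arr st1" "\<And>x. x \<notin> {''b'', ''t'', ''x''} \<Longrightarrow> scalar st2 x = scalar st1 x"
        using u2 by (auto simp: unch_def wv_best)
      have P2: "pinv st L y st2" by (rule pinv_scalar[OF P1]) (use fr2 in auto)
      have As2: "As st2 = As st1" "Al st2 = Al st1" "blen r st2 = blen r st1" "bwf st2"
        using fr2 bkt_cong[of st2 st1] PD(2) by (simp_all add: As_def Al_def)
      have Pot2: "Pot st2 = Pot st1" using As2 by (simp add: Pot_def)
      have u2': "unch peel_c st st2" by (rule unch_trans[OF u1 u2]) (auto simp: wv_peel wv_best)
      have n2': "R + Pot st1 + passes L y * c + 52 \<le> n2" using n1 n2 by (simp add: c_def)
      show "wp M le rest J st2 n2"
      proof (cases "scalar st2 ''b'' = 0")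
        case True
        define st3 where "st3 = upds ''go'' 0 st2"
        have "Bn v = 0" if v: "v \<in> set L" "v \<notin> As st1" for v
        proof (rule ccontr)
          assume "Bn v \<noteq> 0"
          then obtain u where "u \<in> set L - As st1" "Bn v \<le> rkc (arr st1 ''h'' u)" using pinv_source[OF P1 cl d v] by auto
          then show False using mx True \<open>Bn v \<noteq> 0\<close> by fastforce
        qed
        moreover have "pinv st L y st3" by (rule pinv_scalar[OF P2]) (auto simp: st3_def)
        moreover have "As st3 = As st1" "Pot st3 = Pot st1" using As2 Pot2 by (simp_all add: st3_def As_scalar Pot_scalar)
        moreover have "unch peel_c st st3" using u2' by (simp add: unch_def wv_peel st3_def)
        moreover have "scalar st3 ''nn'' = scalar st1 ''nn''" "scalar st3 ''go'' = 0" using fr2 by (simp_all add: st3_def)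
        ultimately have "J st3 (n2 - 2)" unfolding J_def using nn1 n2 n2' by (intro exI[of _ y]) auto
        then show ?thesis using True n2' by (simp add: rest_def wps st3_def numeral_2_eq_2[symmetric])
      next
        case False
        define b where "b = scalar st2 ''b''"
        obtain x where x: "x \<in> set L" "x \<notin> As st1" "arr st1 ''h'' x = b" using bx False by (auto simp: b_def)
        have bm: "b \<noteq> 0" "b \<le> m" "dst (b - 1) = x" using False sinvD(4,5)[OF PD(3), of x] x by (auto simp: b_def)
        define st3 where "st3 = st2\<lparr>scalar := (scalar st2)(''th'' := b, ''bi'' := 0, ''v'' := x)\<rparr>"
        have dx: "arr st2 ''dst'' (b - 1) = x"
        proof -
          have "b - 1 < m" using bm by simp
          then show ?thesis using pinvD(1)[OF P2] bm(3) by (simp add: stb_def)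
        qed
        have P3: "pinv st L y st3" by (rule pinv_scalar[OF P2]) (auto simp: st3_def)
        have st3: "stb st3" "bwf st3" "\<And>j. bkt st3 j = {}" using pinvD(1,2,4)[OF P3] by auto
        have As3: "As st3 = As st1" "Al st3 = Al st1" "Pot st3 = Pot st1" using As2 Pot2 by (simp_all add: st3_def As_scalar Pot_scalar)
        have sc3: "scalar st3 ''th'' = b" "scalar st3 ''bi'' = 0" "scalar st3 ''v'' = x" "scalar st3 ''fin'' = 1" "scalar st3 ''nn'' = scalar st1 ''nn''"
          "scalar st3 ''rd'' = scalar st ''rd''" "arr st3 = arr st1"
          using pinvD(5)[OF P3] fr2 fr1(3) by (auto simp: st3_def)
        have "wp M le (push_c ''v'' ''bi'') (wp M le drain_c J) st3 (n2 - 8)"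
        proof (rule wp_push[where r = r])
          show "bwf st3" by fact
          show "scalar st3 ''nn'' + 1 < M" using sc3 nn1 n nc by simp
          show "scalar st3 ''bi'' \<le> r" using sc3 by simp
          show "7 \<le> n2 - 8" using n2' by simp
          fix st4
          assume u4: "unch (push_c ''v'' ''bi'') st3 st4" and b4: "bwf st4" "scalar st4 ''nn'' = scalar st3 ''nn'' + 1"
            "bkt st4 = (bkt st3)(scalar st3 ''bi'' := insert (scalar st3 ''v'') (bkt st3 (scalar st3 ''bi'')))"
            "blen r st4 = blen r st3 + 1"
          have fr4: "\<And>A. A \<notin> {''bv'', ''bn'', ''bh''} \<Longrightarrow> arr st4 A = arr st3 A" "\<And>y. y \<noteq> ''nn'' \<Longrightarrow> scalar st4 y = scalar st3 y"
            using u4 by (auto simp: unch_def wv_push)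
          have st4: "stb st4" by (rule stb_unch[OF u4 st3(1)]) (auto simp: wv_push)
          have bk4: "bkt st4 = (\<lambda>j. if j = 0 then {x} else {})" using b4(3) st3(3) sc3 by (simp add: fun_eq_iff)
          have As4: "As st4 = As st1" "Al st4 = Al st1" using As3 fr4 by (simp_all add: As_def Al_def)
          have Pot4: "Pot st4 = Pot st1 + 20" using As3 As4 b4(4) by (simp add: Pot_def)
          note step = pinv_step[OF P3 cl d LV, of b x st4]
          have hyp: "b = arr st3 ''h'' x" "x \<in> set L" "x \<notin> As st3" "b \<noteq> 0" "\<And>u. u \<in> set L - As st3 \<Longrightarrow> rkc (arr st3 ''h'' u) \<le> rkc b"
            "scalar st4 ''th'' = b" "scalar st4 ''bi'' = 0" "scalar st4 ''fin'' = 1" "scalar st4 ''rd'' = scalar st3 ''rd''"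
            using x bm As3 sc3 mx fr4 by (auto simp: b_def)
          note st = step[OF hyp(1-5) b4(1) st4 fr4(1) bk4 hyp(6-9)]
          have pl: "passes L (rkc b) + 1 \<le> passes L y" using passes_less[OF st(3,4,5)] by simp
          have ny: "(passes L (rkc b) + 1) * c \<le> passes L y * c" by (rule mult_le_mono1[OF pl])
          show "wp M le drain_c J st4 (n2 - 8 - 7)"
          proof (rule wp_drain[OF st(1)])
            show "R + (passes L (rkc b) + 1) * c + 5 + Pot st4 + 1 \<le> n2 - 8 - 7" using n2' ny Pot4 by linarith
            show "scalar st4 ''nn'' + (n2 - 8 - 7) \<le> N" using b4(2) sc3 nn1 n2 n2' by linarith
            show "N < M" by fact
            fix st5 n5
            assume I5: "DI st4 {v \<in> set L. rkc b \<le> Bn v} {e \<in> Al st4. src e \<in> As st5 - As st4} st5" and em: "bkt st5 (scalar st4 ''bi'') = {}"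
              and n5: "R + (passes L (rkc b) + 1) * c + 5 + Pot st5 \<le> n5" "scalar st5 ''nn'' + n5 \<le> N"
            have P5: "pinv st L (rkc b) st5" by (rule st(2)) (use I5 em hyp(7) in simp_all)
            have u5: "unch drain_c st4 st5" using I5 by (simp add: DI_def)
            have "unch peel_c st st3" using u2' by (simp add: unch_def wv_peel st3_def)
            then have "unch peel_c st st4" by (rule unch_trans[OF _ u4]) (auto simp: wv_peel wv_push)
            then have u5': "unch peel_c st st5" by (rule unch_trans[OF _ u5]) (auto simp: wv_peel wv_drain)
            have "scalar st1 ''go'' = 1" using b by simp
            then have "scalar st5 ''go'' = 1" using u5 fr4 fr2 by (simp add: unch_def wv_drain st3_def)
            then show "J st5 n5" unfolding J_def using P5 u5' n5 by (intro exI[of _ "rkc b"]) auto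
          qed
        qed simp_all
        then show ?thesis using False n2' dx unfolding rest_def
          by (simp add: wp_Cond wp_Seq wp_Assign credit_le numeral_2_eq_2[symmetric] st3_def b_def)
      qed
    qed
    then show "1 \<le> n1 \<and> wp M le peel_body_c J st1 (n1 - 1)"
      using nc unfolding peel_body_c_def rest_def[symmetric] by (simp add: wp_Seq credit_le numeral_2_eq_2[symmetric])
  next
    fix st1 n1 assume J: "J st1 n1" and b: "\<not> bv M le st1 (Eq (Var ''go'') (Const 1))"
    then obtain y where P1: "pinv st L y st1" "unch peel_c st st1" "scalar st1 ''nn'' + n1 \<le> N"
      "R + Pot st1 + 5 \<le> n1" "\<forall>v\<in>set L - As st1. Bn v = 0"
      unfolding J_def by auto
    have "Q st1 (n1 - 1)" by (rule Q[OF P1(1,2,5)]) (use P1 in auto)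
    then show "1 \<le> n1 \<and> Q st1 (n1 - 1)" using P1(4) by simp
  qed
  then show ?thesis using n by (simp add: peel_c_def wps st0_def numeral_2_eq_2[symmetric])
qed

text \<open>The quantity through which the sample enters the cost of the final phase. Its
  expectation over the random sample is linear in \<open>T\<close>.\<close>

definition gp :: "nat \<Rightarrow> nat" where
  "gp v = card {e. e < m \<and> Lev (rk e) = Lev (Bn v)}"

text \<open>Positive values are ranks of edges by \<open>Bn_attained\<close>, and here all these
  edges share one level.\<close>

lemma passes_gp:
  assumes "\<And>x. x \<in> set L \<Longrightarrow> Lev (Bn x) = Lev (Bn v)"
  shows "passes L y \<le> gp v"
proof -
  have "{z \<in> Bn ` set L. 0 < z \<and> z < y} \<subseteq> rk ` {e. e < m \<and> Lev (rk e) = Lev (Bn v)}"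
  proof
    fix z assume "z \<in> {z \<in> Bn ` set L. 0 < z \<and> z < y}"
    then obtain x where x: "x \<in> set L" "z = Bn x" "Bn x \<noteq> 0" by auto
    then obtain e where "e < m" "Bn x = rk e" using Bn_attained[of x] by (metis Bn_s)
    then show "z \<in> rk ` {e. e < m \<and> Lev (rk e) = Lev (Bn v)}" using x assms[OF x(1)] by auto
  qed
  then have "passes L y \<le> card (rk ` {e. e < m \<and> Lev (rk e) = Lev (Bn v)})"
    unfolding passes_def by (intro card_mono) auto
  also have "\<dots> \<le> gp v" unfolding gp_def by (rule card_image_le) simp
  finally show ?thesis .
qed

lemma passes_length: "passes L y \<le> length L"
proof -
  have "passes L y \<le> card (Bn ` set L)" unfolding passes_def by (intro card_mono) auto
  also have "\<dots> \<le> card (set L)" by (rule card_image_le) simp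
  also have "\<dots> \<le> length L" by (rule card_length)
  finally show ?thesis .
qed

section \<open>Peeling all components\<close>

definition finI :: "state \<Rightarrow> nat set \<Rightarrow> state \<Rightarrow> bool" where
  "finI st0 W st \<longleftrightarrow> stb st \<and> bwf st \<and> sinv (Al st) (arr st ''h'') \<and> (\<forall>j. bkt st j = {}) \<and> scalar st ''fin'' = 1 \<and>
     (\<forall>v. arr st ''lo'' v \<le> r) \<and> eclosed (Al st) W \<and> Al st \<subseteq> Al st0 \<and>
     (\<forall>v\<in>W. rkc (arr st ''out'' v) = Bn v \<and> arr st ''out'' v \<le> m) \<and> (\<forall>v. v \<notin> W \<longrightarrow> arr st ''out'' v = 0 \<and> v \<notin> As st)"

lemma finID:
  assumes "finI st0 W st"
  shows "stb st" "bwf st" "sinv (Al st) (arr st ''h'')" "bkt st j = {}" "scalar st ''fin'' = 1" "arr st ''lo'' v \<le> r"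
    "eclosed (Al st) W" "Al st \<subseteq> Al st0" "v \<in> W \<Longrightarrow> rkc (arr st ''out'' v) = Bn v \<and> arr st ''out'' v \<le> m"
    "v \<notin> W \<Longrightarrow> arr st ''out'' v = 0 \<and> v \<notin> As st"
  using assms unfolding finI_def by blast+

text \<open>Vertices that no pass settles have value 0, and their entry of \<open>out\<close> is
  still the code 0.\<close>

lemma finI_peel:
  assumes F: "finI st0 W st1" and d: "W \<inter> set L = {}" and cl: "eclosed (Al st1) (set L)"
    and P: "pinv st1 L y st" and z: "\<forall>v\<in>set L - As st. Bn v = 0"
  shows "finI st0 (W \<union> set L) st"
proof -
  note FD = finID[OF F] and PD = pinvD[OF P]
  have dL: "v \<notin> As st1" if "v \<in> set L" for v using that d FD(10) by blast
  show ?thesis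
    unfolding finI_def
  proof (intro conjI allI ballI impI)
    show "stb st" "bwf st" "sinv (Al st) (arr st ''h'')" "scalar st ''fin'' = 1" by (fact PD)+
    show "bkt st j = {}" "arr st ''lo'' v \<le> r" for j v by (fact PD)+
    show "eclosed (Al st) (W \<union> set L)" using PD(7) FD(7) cl unfolding eclosed_def by blast
    show "Al st \<subseteq> Al st0" using PD(7) FD(8) by blast
    show "rkc (arr st ''out'' v) = Bn v" "arr st ''out'' v \<le> m" if v: "v \<in> W \<union> set L" for v
    proof -
      have "rkc (arr st ''out'' v) = Bn v \<and> arr st ''out'' v \<le> m"
      proof (cases "v \<in> As st - As st1")
        case True
        then show ?thesis by (rule PD(10))
      next
        case False
        then have o: "arr st ''out'' v = arr st1 ''out'' v" using PD(11) by blast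
        show ?thesis
        proof (cases "v \<in> W")
          case True
          then show ?thesis using FD(9) o by simp
        next
          case vW: False
          then have "v \<in> set L" using v by blast
          then have "Bn v = 0" using False z dL[of v] by auto
          then show ?thesis using o FD(10)[OF vW] by simp
        qed
      qed
      then show "rkc (arr st ''out'' v) = Bn v" "arr st ''out'' v \<le> m" by blast+
    qed
    show "arr st ''out'' v = 0" "v \<notin> As st" if v: "v \<notin> W \<union> set L" for v
      using v PD(9) PD(11)[of v] FD(10)[of v] by auto
  qed
qed

definition finset :: "state \<Rightarrow> bool" where
  "finset st \<longleftrightarrow> (\<forall>e\<in>Al st. arr st ''lo'' (src e) = arr st ''lo'' (dst e)) \<and>
     (\<forall>v\<in>V. arr st ''lo'' v = Lev (Bn v) \<or> small (Al st) v)"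

text \<open>A component with at most \<open>T\<close> vertices has at most \<open>T\<close> values.
  In a larger one \<open>lo\<close> is the true level, and it is constant because live edges
  preserve it and the component is a minimal closed set.\<close>

lemma finI_passes:
  assumes S: "finset st0" and A: "A \<subseteq> Al st0" and L: "\<And>C. hd L \<in> C \<Longrightarrow> eclosed A C \<Longrightarrow> set L \<subseteq> C" "L \<noteq> []" "distinct L" "set L \<subseteq> V"
    and v: "v \<in> set L"
  shows "passes L y \<le> T + gp v"
proof (cases "length L \<le> T")
  case True
  then show ?thesis using passes_length[of L y] by linarith
next
  case False
  have lev: "arr st0 ''lo'' x = Lev (Bn x)" if x: "x \<in> set L" for x
  proof -
    have "\<not> small A x" by (rule big_component[of "hd L"]) (use L False x in auto)
    then have "\<not> small (Al st0) x" using small_mono[OF _ A] by blast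
    then show ?thesis using S L(4) x by (auto simp: finset_def)
  qed
  have h: "set L \<subseteq> {x. arr st0 ''lo'' x = arr st0 ''lo'' (hd L)}"
    by (rule L(1)) (use S A in \<open>auto simp: finset_def eclosed_def\<close>)
  then have "Lev (Bn x) = Lev (Bn v)" if x: "x \<in> set L" for x
  proof -
    have "arr st0 ''lo'' x = arr st0 ''lo'' v" using subsetD[OF h x] subsetD[OF h v] by simp
    then show ?thesis unfolding lev[OF x] lev[OF v] .
  qed
  then show ?thesis using passes_gp[of L v y] by (simp add: trans_le_add2)
qed

definition fcost :: nat where
  "fcost = (\<Sum>v\<in>V. 85 * (1 + T + gp v))"

lemma wp_finish:
  assumes F: "finI st {} st" and S: "finset st" and V0: "Vis st = {}"
    and n: "Pot st + fcost + 310 * m + 40 \<le> n" "scalar st ''nn'' + n \<le> N" "N < M"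
    and Q: "\<And>st' n'. unch (comps_c peel_c) st st' \<Longrightarrow>
      (\<forall>v. rkc (arr st' ''out'' v) = Bn v \<and> arr st' ''out'' v \<le> m) \<Longrightarrow> 20 \<le> n' \<Longrightarrow> Q st' n'"
  shows "wp M le (comps_c peel_c) Q st n"
proof (rule wp_comps[where I = "finI st" and Pf = Pot and bc = "\<lambda>v. 85 * (1 + T + gp v)" and R = 20])
  show "finI st {} st" "Vis st = {}" by fact+
next
  fix W and st1 st' :: state
  assume I: "finI st W st1" and s: "\<And>x. x \<notin> {''i'', ''a'', ''u'', ''e'', ''v'', ''k''} \<Longrightarrow> scalar st' x = scalar st1 x"
    "\<And>A. A \<notin> {''pt'', ''vis'', ''par'', ''L''} \<Longrightarrow> arr st' A = arr st1 A"
  have "stb st'" using finID(1)[OF I] s by (simp add: stb_def thr_def)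
  moreover have b: "bkt st' = bkt st1" "blen r st' = blen r st1" "bwf st' = bwf st1" using bkt_cong[of st' st1] s by simp_all
  moreover have "As st' = As st1" "Al st' = Al st1" using s by (simp_all add: As_def Al_def)
  ultimately show "finI st W st' \<and> Pot st' = Pot st1" using I s by (simp add: finI_def Pot_def)
next
  fix W st1 assume I: "finI st W st1"
  show "stb st1 \<and> Al st1 \<subseteq> A0 \<and> eclosed (Al st1) W"
    using finID(1,7)[OF I] sinvD(1-3)[OF finID(3)[OF I]] by (auto simp: A0_def)
next
  show "''i'' \<notin> wvars peel_c" "''rd'' \<notin> wvars peel_c" "''vis'' \<notin> warrs peel_c" by (simp_all add: wv_peel)
next
  fix W L st1 n1 R
  assume I: "finI st W st1" and dj: "W \<inter> set L = {}" and LV: "set L \<subseteq> V" and Lne: "L \<noteq> []" and dL: "distinct L"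
    and k: "scalar st1 ''k'' = length L" and aL: "\<And>t. t < length L \<Longrightarrow> arr st1 ''L'' t = L ! t"
    and mn: "\<And>C. hd L \<in> C \<Longrightarrow> eclosed (Al st1) C \<Longrightarrow> set L \<subseteq> C" and cl: "eclosed (Al st1) (set L)"
    and n1: "R + Pot st1 + (\<Sum>v\<in>set L. 85 * (1 + T + gp v)) + 20 \<le> n1" "scalar st1 ''nn'' + n1 \<le> N"
  note FD = finID[OF I]
  have "length L = card (set L)" using dL by (simp add: distinct_card)
  also have "\<dots> \<le> card V" by (rule card_mono) (use LV in auto)
  finally have LM: "length L < M" using card_V M_small by linarith
  have d: "set L \<inter> As st1 = {}" using FD(10) dj by blast
  have P: "pinv st1 L (Suc m) st1"
    using FD(1-6) rkc_le_m by (simp add: pinv_def less_Suc_eq_le)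
  have cost: "(passes L (Suc m) + 1) * (25 * length L + 60) \<le> (\<Sum>v\<in>set L. 85 * (1 + T + gp v))"
  proof -
    \<comment> \<open>\<open>85 = 25 + 60\<close>, since \<open>L\<close> is nonempty; the product
      is then spread evenly over the vertices of the component.\<close>
    have "(passes L (Suc m) + 1) * (25 * length L + 60) \<le> (passes L (Suc m) + 1) * (85 * length L)"
      using Lne by (intro mult_le_mono2) (cases L; simp)
    also have "\<dots> = (\<Sum>v\<in>set L. 85 * (1 + passes L (Suc m)))" using dL by (simp add: distinct_card algebra_simps)
    also have "\<dots> \<le> (\<Sum>v\<in>set L. 85 * (1 + T + gp v))"
      using finI_passes[OF S FD(8) mn Lne dL LV] by (intro sum_mono mult_le_mono2) (simp add: add.assoc)
    finally show ?thesis .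
  qed
  show "wp M le peel_c (\<lambda>st' n'. finI st (W \<union> set L) st' \<and> R + Pot st' \<le> n' \<and> scalar st' ''nn'' + n' \<le> N) st1 n1"
  proof (rule wp_peel[OF P cl d LV k aL LM _ n1(2) n(3)])
    show "R + Pot st1 + (passes L (Suc m) + 1) * (25 * length L + 60) + 10 \<le> n1" using n1 cost by linarith
  qed (use finI_peel[OF I dj cl] in blast)+
next
  have "(\<Sum>v\<in>V. 40 * deg1 v + 60 + c v) = 40 * (\<Sum>v\<in>V. deg1 v) + 60 * card V + (\<Sum>v\<in>V. c v)" for c :: "nat \<Rightarrow> nat"
    unfolding sum_distrib_left by (simp only: sum.distrib sum_constant) simp
  then have "(\<Sum>v\<in>V. 40 * deg1 v + 60 + 85 * (1 + T + gp v)) = 40 * (\<Sum>v\<in>V. deg1 v) + 60 * card V + fcost"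
    unfolding fcost_def .
  then show "20 + Pot st + (\<Sum>v\<in>V. 40 * deg1 v + 60 + 85 * (1 + T + gp v)) + 30 * m + 20 \<le> n"
    using n(1) sum_deg1 card_V by linarith
next
  fix st' n' W
  assume u: "unch (comps_c peel_c) st st'" and I: "finI st W st'" and W: "\<forall>e<m. dst e \<in> W" and n': "20 + Pot st' \<le> n'"
  have "rkc (arr st' ''out'' v) = Bn v \<and> arr st' ''out'' v \<le> m" for v
  proof (cases "v \<in> W")
    case True
    then show ?thesis by (rule finID(9)[OF I])
  next
    case False
    then have "Bn v = 0" using Bn_pos_dst[of v] W by auto
    then show ?thesis using finID(10)[OF I False] by simp
  qed
  then show "Q st' n'" using n' by (intro Q[OF u]) auto
qed (use n in auto)

definition scost :: "nat \<Rightarrow> nat" where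
  "scost x = qq * x + T * (1500 * m + 210) + fcost + 700 * m + 100"

lemma wp_search:
  assumes I: "rinv st" and sc: "scalar st ''s'' = s" and sM: "s < M"
    and n: "scost (XP st) \<le> n" "scalar st ''nn'' + n \<le> N" "N < M"
    and Q: "\<And>st' n'. (\<And>v. v \<noteq> s \<Longrightarrow> rkc (arr st' ''out'' v) = Bn v \<and> arr st' ''out'' v \<le> m) \<Longrightarrow>
       arr st' ''out'' s = Suc m \<Longrightarrow> Q st' n'"
  shows "wp M le search_c Q st n"
proof -
  define R where "R = fcost + 700 * m + 80"
  define rest where "rest = Assign ''fin'' (Const 1) ;; Assign ''rd'' (Add (Var ''rd'') (Const 1)) ;;
     comps_c peel_c ;; Store ''out'' (Var ''s'') (Add (Var ''m'') (Const 1))"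
  have "wp M le (While (Less (Var ''rd'') (Var ''T'')) round_c) (\<lambda>st' n'. rinv st' \<and> scalar st' ''rd'' = T \<and>
      R + qq * XP st' \<le> n' \<and> scalar st' ''nn'' + n' \<le> N) st (n - 1)"
    by (rule wp_rounds[OF I, where R = R]) (use n in \<open>auto simp: R_def scost_def\<close>)
  then have "wp M le (While (Less (Var ''rd'') (Var ''T'')) round_c) (wp M le rest Q) st (n - 1)"
  proof (rule wp_frame)
    fix st1 n1
    assume A: "rinv st1 \<and> scalar st1 ''rd'' = T \<and> R + qq * XP st1 \<le> n1 \<and> scalar st1 ''nn'' + n1 \<le> N"
      and u: "unch (While (Less (Var ''rd'') (Var ''T'')) round_c) st st1"
    then have R1: "rinv st1" "scalar st1 ''rd'' = T" "R + qq * XP st1 \<le> n1" "scalar st1 ''nn'' + n1 \<le> N" by blast+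
    note RI = rinvD[OF R1(1)]
    have s1: "scalar st1 ''s'' = s"
      using u sc by (simp add: unch_def round_c_def wv_comps wv_locate wv_dial wv_kill)
    define st2 where "st2 = st1\<lparr>scalar := (scalar st1)(''fin'' := 1, ''rd'' := Suc T)\<rparr>"
    have Vis2: "Vis st2 = {}" "As st2 = {}"
      unfolding Vis_def As_def st2_def using RI(5,6) R1(2) by (simp_all add: Suc_n_not_le_n) (metis Suc_n_not_le_n)+
    have Al2: "Al st2 = Al st1" by (simp add: Al_def st2_def)
    have bk2: "bkt st2 = bkt st1" "blen r st2 = blen r st1" "bwf st2 = bwf st1" using bkt_cong[of st2 st1] by (simp_all add: st2_def)
    have "stb st2" using RI(1) by (simp add: st2_def stb_def thr_def)
    then have F: "finI st2 {} st2" using RI Al2 bk2 Vis2 by (simp add: finI_def eclosed_def st2_def)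
    have S: "finset st2"
      using RI(10,11,13) R1(2) Al2 by (auto simp: finset_def st2_def tgt_def blk_def)
    have "Pot st2 \<le> 320 * m + qq * XP st1"
    proof -
      have "qq * card (Al st1) \<le> qq * XP st1" by (intro mult_le_mono2) (simp add: XP_def)
      then show ?thesis
        using sum_deg1 unfolding Pot_def qq_def[symmetric] bk2 Al2 Vis2 blen_0[OF RI(4)] Diff_empty by linarith
    qed
    then have n2: "Pot st2 + fcost + 310 * m + 40 \<le> n1 - 5" using R1(3) by (simp add: R_def)
    have "wp M le (comps_c peel_c) (wp M le (Store ''out'' (Var ''s'') (Add (Var ''m'') (Const 1))) Q) st2 (n1 - 5)"
    proof (rule wp_finish[OF F S Vis2(1) n2 _ n(3)])
      show "scalar st2 ''nn'' + (n1 - 5) \<le> N" using R1(4) by (simp add: st2_def)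
      fix st3 :: state and n3 :: nat
      assume u3: "unch (comps_c peel_c) st2 st3" and o: "\<forall>v. rkc (arr st3 ''out'' v) = Bn v \<and> arr st3 ''out'' v \<le> m" and n3: "20 \<le> n3"
      have "scalar st3 ''s'' = s" "scalar st3 ''m'' = m"
        using u3 s1 RI(1) by (simp_all add: unch_def wv_comps wv_peel st2_def stb_def)
      moreover have "Suc m < M" using M_small by linarith
      ultimately show "wp M le (Store ''out'' (Var ''s'') (Add (Var ''m'') (Const 1))) Q st3 n3"
        using n3 o by (auto simp: wp_Store intro!: Q)
    qed
    moreover have "Suc T < M" using M_T by linarith
    moreover have "10 \<le> n1" using R1(3) by (simp add: R_def)
    ultimately show "wp M le rest Q st1 n1"
      using R1(2) by (simp add: rest_def wp_Seq wp_Assign credit_le numeral_2_eq_2[symmetric] numeral_3_eq_3[symmetric] st2_def)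
  qed
  then show ?thesis using n(1) unfolding search_c_def rest_def[symmetric] by (simp add: wp_Seq scost_def)
qed

end

section \<open>Preparations\<close>

text \<open>With \<open>z = 2 ^ t\<close>, the factor \<open>z * z * 2\<close> takes
  \<open>2 ^ (t * t)\<close> to the next square exponent, so neither roots nor logarithms are
  computed.\<close>

definition size_body_c :: com where
  "size_body_c = Assign ''D'' (Mul (Mul (Mul (Var ''D'') (Var ''z'')) (Var ''z'')) (Const 2)) ;;
     Assign ''z'' (Mul (Const 2) (Var ''z'')) ;; Assign ''T'' (Add (Var ''T'') (Const 1))"

definition size_c :: com where
  "size_c = Assign ''T'' (Const 1) ;; Assign ''D'' (Const 2) ;; Assign ''z'' (Const 2) ;;
     While (Less (Var ''D'') (Add (Var ''m'') (Const 1))) size_body_c"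

definition link_c :: "string \<Rightarrow> com" where
  "link_c X = Store ''nx'' (Var ''a'') (Arr ''hd'' (Var X)) ;; Store ''hd'' (Var X) (Var ''a'')"

definition init_body_c :: com where
  "init_body_c = Assign ''u'' (Arr ''src'' (Var ''i'')) ;; Assign ''v'' (Arr ''dst'' (Var ''i'')) ;;
     Assign ''e'' (Var ''i'') ;;
     Cond (Eq (Var ''v'') (Var ''s'')) Skip
       (Cond (Eq (Var ''u'') (Var ''s'')) relax_c
         (Store ''al'' (Var ''i'') (Const 1) ;; Assign ''a'' (Add (Mul (Const 2) (Var ''i'')) (Const 2)) ;;
          link_c ''u'' ;; Assign ''a'' (Add (Var ''a'') (Const 1)) ;; link_c ''v'')) ;;
     Assign ''i'' (Add (Var ''i'') (Const 1))"

definition init_c :: com where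
  "init_c = Assign ''i'' (Const 0) ;; While (Less (Var ''i'') (Var ''m'')) init_body_c"

lemma wv_init: "wvars init_body_c = {''u'', ''v'', ''e'', ''a'', ''i''}" "warrs init_body_c = {''al'', ''nx'', ''hd'', ''h''}"
  "wvars init_c = {''u'', ''v'', ''e'', ''a'', ''i''}" "warrs init_c = {''al'', ''nx'', ''hd'', ''h''}"
  by (auto simp: init_c_def init_body_c_def link_c_def wv_relax)

lemma wv_size: "wvars size_c = {''T'', ''D'', ''z''}" "warrs size_c = {}"
  by (auto simp: size_c_def size_body_c_def)

lemma lst_link:
  assumes "\<And>c. c \<noteq> 0 \<Longrightarrow> nx c < c" "\<And>v. hh v < q" "0 < q"
  shows "lst (nx(q := hh u)) ((hh(u := q)) v) = (if v = u then q # lst nx (hh u) else lst nx (hh v))"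
  using lst_step[of q "nx(q := hh u)"] lst_upd[OF assms(2)] assms by auto

text \<open>The single polynomial bound \<open>M_big\<close> replaces all word-size conditions:
  \<open>2 ^ (T * T)\<close>, the memory of the sort and the whole step budget are polynomial in
  \<open>m\<close> and fit below it.\<close>

locale ssbp_pre = ssbp_graph +
  fixes M T :: nat
  assumes T_pos: "1 \<le> T" and m_T: "m < 2 ^ (T * T)" and T_min: "\<And>t. 1 \<le> t \<Longrightarrow> t < T \<Longrightarrow> 2 ^ (t * t) \<le> m"
    and M_big: "10000 * (m + 2) ^ 6 < M" and M_src: "\<And>e. e < m \<Longrightarrow> fst (es ! e) + 1 < M"
    and M_dst: "\<And>e. e < m \<Longrightarrow> snd (es ! e) + 1 < M" and M_s: "s < M"
begin

abbreviation le :: "nat \<Rightarrow> nat \<Rightarrow> bool" where "le \<equiv> edge_le es w"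

lemma T_le: "T \<le> m + 1"
proof (cases "T = 1")
  case False
  then have t: "1 \<le> T - 1" "T - 1 < T" using T_pos False by (simp_all add: Suc_le_eq)
  have "T - 1 < 2 ^ (T - 1)" by (rule less_exp)
  also have "\<dots> \<le> (2::nat) ^ ((T - 1) * (T - 1))" using t by (intro power_increasing) simp_all
  finally show ?thesis using T_min[OF t] by linarith
qed simp

text \<open>For \<open>T\<close> at least 2, \<open>T * T\<close> is at most four times the square
  of \<open>T - 1\<close>, and minimality of \<open>T\<close> bounds the corresponding power of 2 by
  \<open>m\<close>.\<close>

lemma qT_le: "2 ^ (T * T) \<le> m ^ 4 + 2"
proof (cases "T = 1")
  case False
  then have t: "1 \<le> T - 1" "T - 1 < T" using T_pos False by (simp_all add: Suc_le_eq)
  obtain k where k: "T = Suc (Suc k)" using t by (metis One_nat_def Suc_le_D Suc_diff_1 T_pos less_eq_Suc_le)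
  have "T * T \<le> ((T - 1) * (T - 1)) * 4" by (simp add: k)
  then have "(2::nat) ^ (T * T) \<le> 2 ^ (((T - 1) * (T - 1)) * 4)" by (intro power_increasing) simp_all
  also have "\<dots> = (2 ^ ((T - 1) * (T - 1))) ^ 4" by (simp add: power_mult)
  also have "\<dots> \<le> m ^ 4" by (intro power_mono T_min[OF t]) simp
  finally show ?thesis by simp
qed simp

lemma poly_le: assumes "i \<le> 6" shows "(m + 2) ^ i \<le> (m + 2) ^ 6"
  using assms by (intro power_increasing) auto

lemma M_poly: "m + 2 \<le> (m + 2) ^ 6" "2 ^ (T * T) \<le> 2 * (m + 2) ^ 6" "64 \<le> (m + 2) ^ 6"
proof -
  show a: "m + 2 \<le> (m + 2) ^ 6" using poly_le[of 1] by simp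
  have "m ^ 4 \<le> (m + 2) ^ 4" by (intro power_mono) auto
  then show "2 ^ (T * T) \<le> 2 * (m + 2) ^ 6" using qT_le poly_le[of 4] a by linarith
  have "(2::nat) ^ 6 \<le> (m + 2) ^ 6" by (intro power_mono) auto
  then show "64 \<le> (m + 2) ^ 6" by simp
qed

lemma M_T: "2 * m + 2 ^ (T * T) + T + 10 < M"
  using M_poly M_big T_le by linarith

text \<open>The instance with an empty sample provides the facts about comparisons and vertices
  before any sample exists.\<close>

interpretation triv: ssbp_run es w s M T 0 0 "\<lambda>_. 0"
proof
  show "0 + 0 + 1 < M" using M_T by linarith
qed (use T_pos m_T M_T M_src M_dst in auto)

lemma wp_size:
  assumes sm: "scalar st ''m'' = m" and n: "10 * m + 30 \<le> n"
    and Q: "\<And>st' n'. unch size_c st st' \<Longrightarrow> scalar st' ''T'' = T \<Longrightarrow> scalar st' ''D'' = 2 ^ (T * T) \<Longrightarrow> scalar st' ''z'' = 2 ^ T \<Longrightarrow>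
       n \<le> n' + 10 * m + 30 \<Longrightarrow> Q st' n'"
  shows "wp M le size_c Q st n"
proof -
  define J where "J = (\<lambda>st' n'. \<exists>t. unch size_c st st' \<and> 1 \<le> t \<and> t \<le> T \<and> scalar st' ''T'' = t \<and> scalar st' ''D'' = 2 ^ (t * t) \<and>
     scalar st' ''z'' = 2 ^ t \<and> n + 10 * 1 \<le> n' + 20 + 10 * t)"
  define st0 where "st0 = st\<lparr>scalar := (scalar st)(''T'' := 1, ''D'' := 2, ''z'' := 2)\<rparr>"
  have "wp M le (While (Less (Var ''D'') (Add (Var ''m'') (Const 1))) size_body_c) Q st0 (n - 6)"
  proof (rule wp_While[where I = J])
    show "J st0 (n - 6)" unfolding J_def using n T_pos
      by (intro exI[of _ 1]) (auto simp: st0_def unch_def wv_size)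
  next
    fix st1 n1 assume J: "J st1 n1" and b: "bv M le st1 (Less (Var ''D'') (Add (Var ''m'') (Const 1)))"
    then obtain t where t: "unch size_c st st1" "1 \<le> t" "t \<le> T" "scalar st1 ''T'' = t" "scalar st1 ''D'' = 2 ^ (t * t)"
      "scalar st1 ''z'' = 2 ^ t" "n + 10 * 1 \<le> n1 + 20 + 10 * t"
      unfolding J_def by blast
    have m1: "scalar st1 ''m'' = m" "Suc m < M" using t(1) sm M_T by (simp_all add: unch_def wv_size)
    have "2 ^ (t * t) \<le> m" using b m1 t(5) by simp
    then have "t \<noteq> T" using m_T by auto
    then have tT: "t < T" using t(3) by simp
    have e: "2 ^ (t * t) * 2 ^ t * 2 ^ t * 2 = (2::nat) ^ (Suc t * Suc t)"
      by (simp only: power_add[symmetric] power_Suc2[symmetric]) (rule arg_cong[of _ _ "power 2"], simp)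
    have "Suc t * Suc t \<le> T * T" using tT by (intro mult_le_mono) auto
    then have le: "(2::nat) ^ (Suc t * Suc t) \<le> 2 ^ (T * T)" by (intro power_increasing) simp_all
    have big: "(2::nat) ^ (Suc t * Suc t) < M" using le M_T by linarith
    have "(2::nat) ^ (t * t) * 2 ^ t * 2 ^ t * 1 \<le> 2 ^ (t * t) * 2 ^ t * 2 ^ t * 2" by (intro mult_le_mono2) simp
    then have s3: "(2::nat) ^ (t * t) * 2 ^ t * 2 ^ t < M" using e big by simp
    have s2: "(2::nat) ^ (t * t) * 2 ^ t < M" by (rule le_less_trans[OF _ s3]) simp
    have "(2::nat) ^ Suc t \<le> 2 ^ (Suc t * Suc t)" by (intro power_increasing) simp_all
    from le_less_trans[OF this big] have s1: "2 * 2 ^ t < M" unfolding power_Suc .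
    define st2 where "st2 = st1\<lparr>scalar := (scalar st1)(''D'' := 2 ^ (t * t) * 2 ^ t * 2 ^ t * 2, ''z'' := 2 * 2 ^ t, ''T'' := Suc t)\<rparr>"
    have n1: "10 \<le> n1" using t(7) n tT T_le by linarith
    have e2: "scalar st2 ''D'' = 2 ^ (Suc t * Suc t)" unfolding e[symmetric] by (simp add: st2_def)
    have "unch size_c st st2" using t(1) by (simp add: st2_def unch_def wv_size)
    moreover have "scalar st2 ''T'' = Suc t" "scalar st2 ''z'' = 2 ^ Suc t" by (simp_all add: st2_def)
    moreover have "1 \<le> Suc t" "Suc t \<le> T" "n + 10 * 1 \<le> n1 - 6 + 20 + 10 * Suc t" using tT t(7) n1 by auto
    ultimately have J2: "J st2 (n1 - 6)" unfolding J_def using e2 by blast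
    have big': "2 ^ (t * t) * 2 ^ t * 2 ^ t * 2 < M" unfolding e by (rule big)
    have "Suc t < M" using tT M_T by linarith
    then show "1 \<le> n1 \<and> wp M le size_body_c J st1 (n1 - 1)"
      using n1 t s1 s2 s3 big' J2 unfolding size_body_c_def st2_def
      by (simp add: wp_Seq wp_Assign credit_le numeral_2_eq_2[symmetric])
  next
    fix st1 n1 assume J: "J st1 n1" and b: "\<not> bv M le st1 (Less (Var ''D'') (Add (Var ''m'') (Const 1)))"
    then obtain t where t: "unch size_c st st1" "1 \<le> t" "t \<le> T" "scalar st1 ''T'' = t" "scalar st1 ''D'' = 2 ^ (t * t)"
      "scalar st1 ''z'' = 2 ^ t" "n + 10 * 1 \<le> n1 + 20 + 10 * t"
      unfolding J_def by blast
    have m1: "scalar st1 ''m'' = m" "Suc m < M" using t(1) sm M_T by (simp_all add: unch_def wv_size)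
    have "m < 2 ^ (t * t)" using b m1 t(5) by simp
    then have tT: "t = T" using T_min[OF t(2)] t(3) by (metis le_neq_implies_less not_le)
    have "Q st1 (n1 - 1)" by (rule Q) (use t tT T_le in auto)
    then show "1 \<le> n1 \<and> Q st1 (n1 - 1)" using t(7) n tT T_le by auto
  qed
  then show ?thesis using n M_T by (simp add: size_c_def wp_Seq wp_Assign credit_le numeral_2_eq_2[symmetric] st0_def)
qed

definition A0s :: "nat set" where "A0s = {e. e < m \<and> src e \<noteq> s \<and> dst e \<noteq> s}"

text \<open>The part of \<open>adj\<close> that stems from the first \<open>k\<close> edges, as
  linked when edge \<open>k\<close> is about to be read.\<close>

definition adjn :: "nat \<Rightarrow> nat \<Rightarrow> nat list" where
  "adjn k v = rev (filter (\<lambda>c. 2 \<le> c \<and> c div 2 - 1 \<in> A0s \<and>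
     (if even c then src (c div 2 - 1) else dst (c div 2 - 1)) = v) [0..<2 * k + 2])"

lemma adjn_0: "adjn 0 v = []" by (simp add: adjn_def upt_rec)

lemma adjn_Suc: "adjn (Suc k) v = (if k \<in> A0s then (if dst k = v then [2 * k + 3] else []) @
    (if src k = v then [2 * k + 2] else []) else []) @ adjn k v"
proof -
  have "[0..<2 * Suc k + 2] = [0..<2 * k + 2] @ [2 * k + 2, 2 * k + 3]" by (simp add: numeral_3_eq_3)
  moreover have "(2 * k + 2) div 2 - 1 = k" "(2 * k + 3) div 2 - 1 = k" by simp_all
  ultimately show ?thesis unfolding adjn_def by (simp only: filter_append rev_append) auto
qed

definition lnk :: "nat \<Rightarrow> state \<Rightarrow> bool" where
  "lnk k st \<longleftrightarrow> {e. e < m \<and> arr st ''al'' e = 1} = {e \<in> A0s. e < k} \<and> (\<forall>c. c \<noteq> 0 \<longrightarrow> arr st ''nx'' c < c) \<and>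
     (\<forall>v. arr st ''hd'' v < 2 * k + 2) \<and> (\<forall>v. lst (arr st ''nx'') (arr st ''hd'' v) = adjn k v) \<and>
     (\<forall>v. arr st ''h'' v \<noteq> 0 \<longrightarrow> arr st ''h'' v \<le> m \<and> dst (arr st ''h'' v - 1) = v \<and> src (arr st ''h'' v - 1) = s \<and> v \<noteq> s) \<and>
     (\<forall>e<k. src e = s \<longrightarrow> dst e \<noteq> s \<longrightarrow> rk e \<le> rkc (arr st ''h'' (dst e)))"

lemma wp_init:
  assumes sc: "scalar st ''m'' = m" "scalar st ''s'' = s" and ar: "\<And>e. e < m \<Longrightarrow> arr st ''src'' e = src e \<and> arr st ''dst'' e = dst e"
    and z: "\<And>A i. A \<in> {''al'', ''nx'', ''hd'', ''h''} \<Longrightarrow> arr st A i = 0" and n: "50 * m + 10 \<le> n"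
    and Q: "\<And>st' n'. unch init_c st st' \<Longrightarrow> lnk m st' \<Longrightarrow> n \<le> n' + 50 * m + 10 \<Longrightarrow> Q st' n'"
  shows "wp M le init_c Q st n"
proof -
  define J where "J = (\<lambda>st' n'. unch init_c st st' \<and> scalar st' ''i'' \<le> m \<and> lnk (scalar st' ''i'') st' \<and>
     n \<le> n' + 50 * scalar st' ''i'' + 5)"
  define st0 where "st0 = upds ''i'' 0 st"
  have "wp M le (While (Less (Var ''i'') (Var ''m'')) init_body_c) Q st0 (n - 2)"
  proof (rule wp_While[where I = J])
    have "lnk 0 st0" using z by (auto simp: lnk_def adjn_0 st0_def)
    then show "J st0 (n - 2)" using n by (simp add: J_def unch_def wv_init st0_def)
  next
    fix st1 n1 assume J: "J st1 n1" and b: "bv M le st1 (Less (Var ''i'') (Var ''m''))"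
    define i where "i = scalar st1 ''i''"
    have u: "unch init_c st st1" and L: "lnk i st1" and n1: "n \<le> n1 + 50 * i + 5" using J by (auto simp: J_def i_def)
    have fr: "scalar st1 ''m'' = m" "scalar st1 ''s'' = s" "arr st1 ''src'' = arr st ''src''" "arr st1 ''dst'' = arr st ''dst''"
      using u sc by (simp_all add: unch_def wv_init)
    have im: "i < m" using b fr by (simp add: i_def)
    have n50: "50 \<le> n1" using n1 im n by linarith
    have sd: "arr st1 ''src'' i = src i" "arr st1 ''dst'' i = dst i" using ar[OF im] fr by simp_all
    define st2 where "st2 = st1\<lparr>scalar := (scalar st1)(''u'' := src i, ''v'' := dst i, ''e'' := i)\<rparr>"
    have iM: "2 * i + 3 < M" "Suc i < M" using im M_T by simp_all
    have L1: "{e. e < m \<and> arr st1 ''al'' e = 1} = {e \<in> A0s. e < i}" "\<And>c. c \<noteq> 0 \<Longrightarrow> arr st1 ''nx'' c < c"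
      "\<And>v. arr st1 ''hd'' v < 2 * i + 2" "\<And>v. lst (arr st1 ''nx'') (arr st1 ''hd'' v) = adjn i v"
      "\<And>v. arr st1 ''h'' v \<noteq> 0 \<Longrightarrow> arr st1 ''h'' v \<le> m \<and> dst (arr st1 ''h'' v - 1) = v \<and> src (arr st1 ''h'' v - 1) = s \<and> v \<noteq> s"
      "\<And>e. e < i \<Longrightarrow> src e = s \<Longrightarrow> dst e \<noteq> s \<Longrightarrow> rk e \<le> rkc (arr st1 ''h'' (dst e))"
      using L unfolding lnk_def by blast+
    have A0i: "i \<in> A0s \<longleftrightarrow> src i \<noteq> s \<and> dst i \<noteq> s" using im by (simp add: A0s_def)
    have hd': "arr st1 ''hd'' v < 2 * Suc i + 2" for v using L1(3)[of v] by simp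
    have Js: "J (upds ''i'' (Suc i) st') n'" if "lnk (Suc i) st'" "unch init_c st1 st'" "n1 \<le> n' + 45" for st' n'
      using that u n1 im by (simp add: J_def lnk_def unch_def wv_init)
    have split: "{e \<in> A0s. e < Suc i} = (if i \<in> A0s then insert i {e \<in> A0s. e < i} else {e \<in> A0s. e < i})"
      by (auto simp: less_Suc_eq)
    have "wp M le init_body_c J st1 (n1 - 1)"
    proof (cases "dst i = s")
      case True
      have "lnk (Suc i) st2" using L1 True A0i hd' unfolding lnk_def split
        by (auto simp: st2_def adjn_Suc less_Suc_eq)
      then have "J (upds ''i'' (Suc i) st2) (n1 - 11)" by (rule Js) (use n50 in \<open>auto simp: st2_def unch_def wv_init\<close>)
      then show ?thesis using n50 sd fr iM True
        by (simp add: init_body_c_def wp_Seq wp_Assign wp_Cond wp_Skip credit_le numeral_2_eq_2[symmetric] numeral_3_eq_3[symmetric] st2_def i_def)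
    next
      case d: False
      show ?thesis
      proof (cases "src i = s")
        case True
        define P where "P \<longleftrightarrow> rkc (arr st1 ''h'' (dst i)) \<le> rk i"
        define st3 where "st3 = (if P then upda ''h'' (dst i) (Suc i) st2 else st2)"
        have "arr st1 ''h'' (dst i) \<le> m" using L1(5)[of "dst i"] by (cases "arr st1 ''h'' (dst i) = 0") auto
        then have pb: "bv M le st2 (passE (Arr ''h'' (Var ''v'')) (Var ''e'')) \<longleftrightarrow> P"
          using triv.bv_passE[of st2 "Arr ''h'' (Var ''v'')" "Var ''e''"] im by (simp add: st2_def P_def)
        have "lnk (Suc i) st3" unfolding lnk_def
        proof (intro conjI allI impI)
          fix e assume e: "e < Suc i" "src e = s" "dst e \<noteq> s"
          show "rk e \<le> rkc (arr st3 ''h'' (dst e))"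
          proof (cases "e = i")
            case True
            then show ?thesis by (auto simp: st3_def st2_def P_def)
          next
            case False
            then have "rk e \<le> rkc (arr st1 ''h'' (dst e))" using L1(6)[of e] e by simp
            then show ?thesis by (auto simp: st3_def st2_def P_def)
          qed
        next
          fix v assume "arr st3 ''h'' v \<noteq> 0"
          then show "arr st3 ''h'' v \<le> m" "dst (arr st3 ''h'' v - 1) = v" "src (arr st3 ''h'' v - 1) = s" "v \<noteq> s"
            using L1(5)[of v] True d im by (auto simp: st3_def st2_def split: if_splits)
        next
          show "{e. e < m \<and> arr st3 ''al'' e = 1} = {e \<in> A0s. e < Suc i}" unfolding split using A0i True L1(1)
            by (simp add: st3_def st2_def)
        qed (use L1 hd' A0i True in \<open>simp_all add: st3_def st2_def adjn_Suc\<close>)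
        moreover have "unch init_c st1 st3" by (simp add: st3_def st2_def unch_def wv_init)
        ultimately have J3: "J (upds ''i'' (Suc i) st3) n'" if "n1 \<le> n' + 45" for n' by (rule Js) (rule that)
        show ?thesis
        proof (cases P)
          case p: True
          show ?thesis using n50 sd fr iM True d p pb J3
            by (simp add: init_body_c_def relax_c_def wp_Seq wp_Assign wp_Cond wp_Store credit_le numeral_2_eq_2[symmetric] numeral_3_eq_3[symmetric] st3_def st2_def i_def)
        next
          case p: False
          show ?thesis using n50 sd fr iM True d p pb J3
            by (simp add: init_body_c_def relax_c_def wp_Seq wp_Assign wp_Cond wp_Skip credit_le numeral_2_eq_2[symmetric] numeral_3_eq_3[symmetric] st3_def st2_def i_def)
        qed
      next
        case su: False
        define nx where "nx = arr st1 ''nx''"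
        define hd where "hd = arr st1 ''hd''"
        define q where "q = 2 * i + 2"
        define nx1 where "nx1 = nx(q := hd (src i))"
        define hd1 where "hd1 = hd(src i := q)"
        \<comment> \<open>The second insertion reads the list heads after the first one, so a
          self-loop is linked twice into the same list.\<close>
        define nx2 where "nx2 = nx1(Suc q := hd1 (dst i))"
        define hd2 where "hd2 = hd1(dst i := Suc q)"
        define st3 where "st3 = st2\<lparr>scalar := (scalar st2)(''a'' := Suc q),
           arr := (arr st2)(''al'' := (arr st2 ''al'')(i := 1), ''nx'' := nx2, ''hd'' := hd2)\<rparr>"
        have nxl: "\<And>c. c \<noteq> 0 \<Longrightarrow> nx c < c" and hdl: "\<And>v. hd v < q" using L1(2,3) by (auto simp: nx_def hd_def q_def)
        have nxl1: "\<And>c. c \<noteq> 0 \<Longrightarrow> nx1 c < c" and hdl1: "\<And>v. hd1 v < Suc q"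
          using nxl hdl by (auto simp: nx1_def hd1_def less_Suc_eq)
        have nxl2: "\<And>c. c \<noteq> 0 \<Longrightarrow> nx2 c < c" and hdl2: "\<And>v. hd2 v < 2 * Suc i + 2"
          using nxl1 hdl1 by (auto simp: nx2_def hd2_def q_def less_Suc_eq)
        have l1: "lst nx1 (hd1 v) = (if v = src i then q # adjn i (src i) else adjn i v)" for v
          using lst_link[of nx hd q "src i" v] nxl hdl L1(4) by (simp add: nx1_def hd1_def nx_def hd_def q_def)
        have l2: "lst nx2 (hd2 v) = (if v = dst i then Suc q # lst nx1 (hd1 (dst i)) else lst nx1 (hd1 v))" for v
          using lst_link[of nx1 hd1 "Suc q" "dst i" v] nxl1 hdl1 by (simp add: nx2_def hd2_def)
        have ia: "i \<in> A0s" using A0i d su by simp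
        have "lnk (Suc i) st3" unfolding lnk_def
        proof (intro conjI allI impI)
          have "{e. e < m \<and> arr st3 ''al'' e = 1} = insert i {e. e < m \<and> arr st1 ''al'' e = 1}"
            using im by (auto simp: st3_def st2_def)
          then show "{e. e < m \<and> arr st3 ''al'' e = 1} = {e \<in> A0s. e < Suc i}" unfolding split using ia L1(1) by simp
          show "arr st3 ''nx'' c < c" if "c \<noteq> 0" for c using nxl2[OF that] by (simp add: st3_def)
          show "arr st3 ''hd'' v < 2 * Suc i + 2" for v using hdl2[of v] by (simp add: st3_def)
          show "lst (arr st3 ''nx'') (arr st3 ''hd'' v) = adjn (Suc i) v" for v
            using ia by (auto simp: st3_def adjn_Suc l2 l1 q_def)
          show "arr st3 ''h'' v \<le> m" "dst (arr st3 ''h'' v - 1) = v" "src (arr st3 ''h'' v - 1) = s" "v \<noteq> s" if "arr st3 ''h'' v \<noteq> 0" for v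
            using L1(5)[of v] that by (simp_all add: st3_def st2_def)
          show "rk e \<le> rkc (arr st3 ''h'' (dst e))" if "e < Suc i" "src e = s" "dst e \<noteq> s" for e
            using L1(6)[of e] that su by (cases "e = i") (auto simp: st3_def st2_def)
        qed
        moreover have "unch init_c st1 st3" by (simp add: st3_def st2_def unch_def wv_init)
        ultimately have J3: "J (upds ''i'' (Suc i) st3) (n1 - 28)" by (rule Js) (use n50 in simp)
        have u3: "upda ''hd'' (dst i) (Suc q) (upda ''nx'' (Suc q) (hd1 (dst i)) (upds ''a'' (Suc q)
           (upda ''hd'' (src i) q (upda ''nx'' q (hd (src i)) (upds ''a'' q (upda ''al'' i 1 st2)))))) = st3"
          by (simp add: st3_def st2_def nx2_def nx1_def hd2_def hd1_def nx_def hd_def fun_upd_twist)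
        have qM: "q < M" "Suc q < M" "(2 * i) mod M = 2 * i" "2 * i + 2 = q" using iM by (simp_all add: q_def)
        define lc where "lc = (Store ''al'' (Var ''i'') (Const 1) ;; Assign ''a'' (Add (Mul (Const 2) (Var ''i'')) (Const 2)) ;;
          link_c ''u'' ;; Assign ''a'' (Add (Var ''a'') (Const 1)) ;; link_c ''v'')"
        have "wp M le lc (\<lambda>st' n'. st' = st3 \<and> n1 \<le> n' + 26 \<and> n' \<le> n1) st2 (n1 - 10)"
          using n50 qM unfolding u3[symmetric] link_c_def lc_def
          by (simp add: wp_Seq wp_Assign wp_Store credit_le numeral_2_eq_2[symmetric] numeral_3_eq_3[symmetric] st2_def i_def[symmetric] hd1_def hd_def)
        then have "wp M le lc (wp M le (Assign ''i'' (Add (Var ''i'') (Const 1))) J) st2 (n1 - 10)"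
        proof (rule wp_mono)
          fix st' n' assume a: "st' = st3 \<and> n1 \<le> n' + 26 \<and> n' \<le> n1"
          have "J (upds ''i'' (Suc i) st3) (n' - 1)"
            by (rule Js) (use \<open>lnk (Suc i) st3\<close> \<open>unch init_c st1 st3\<close> a in auto)
          moreover have "scalar st3 ''i'' = i" by (simp add: st3_def st2_def i_def)
          ultimately show "wp M le (Assign ''i'' (Add (Var ''i'') (Const 1))) J st' n'"
            using a iM n50 by (simp add: wp_Assign)
        qed
        then show ?thesis using n50 sd fr iM su d unfolding init_body_c_def lc_def[symmetric]
          by (simp add: wp_Seq wp_Assign wp_Cond credit_le numeral_2_eq_2[symmetric] numeral_3_eq_3[symmetric] st2_def i_def[symmetric])
      qed
    qed
    then show "1 \<le> n1 \<and> wp M le init_body_c J st1 (n1 - 1)" using n50 by simp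
  next
    fix st1 n1 assume J: "J st1 n1" and b: "\<not> bv M le st1 (Less (Var ''i'') (Var ''m''))"
    have u: "unch init_c st st1" using J by (simp add: J_def)
    then have "scalar st1 ''m'' = m" using sc by (simp add: unch_def wv_init)
    then have i: "scalar st1 ''i'' = m" using J b by (simp add: J_def)
    have "Q st1 (n1 - 1)" by (rule Q[OF u]) (use J i in \<open>auto simp: J_def\<close>)
    then show "1 \<le> n1 \<and> Q st1 (n1 - 1)" using J i n by (simp add: J_def)
  qed
  then show ?thesis using n by (simp add: init_c_def wps st0_def numeral_2_eq_2[symmetric])
qed

definition prep :: "state \<Rightarrow> bool" where
  "prep st \<longleftrightarrow> (\<forall>e<m. arr st ''src'' e = src e \<and> arr st ''dst'' e = dst e) \<and> scalar st ''m'' = m \<and> scalar st ''s'' = s \<and>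
     scalar st ''T'' = T \<and> scalar st ''z'' = 2 ^ T \<and> scalar st ''D'' = 2 ^ (T * T) \<and>
     (\<forall>x\<in>{''nn'', ''rd'', ''fin''}. scalar st x = 0) \<and>
     (\<forall>A\<in>{''vis'', ''asg'', ''lo'', ''out'', ''bh'', ''bn''}. \<forall>i. arr st A i = 0) \<and>
     (\<forall>c. c \<noteq> 0 \<longrightarrow> arr st ''nx'' c < c) \<and> (\<forall>v. lst (arr st ''nx'') (arr st ''hd'' v) = adjn m v) \<and>
     {e. e < m \<and> arr st ''al'' e = 1} = A0s \<and> sinv A0s (arr st ''h'')"

lemma prep_unch: "prep st \<Longrightarrow> (\<And>x. x \<notin> {''x'', ''r'', ''i'', ''j'', ''p'', ''mi'', ''hi'', ''d'', ''o''} \<Longrightarrow> scalar st' x = scalar st x) \<Longrightarrow>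
   (\<And>A. A \<noteq> ''S'' \<Longrightarrow> arr st' A = arr st A) \<Longrightarrow> prep st'"
  by (simp add: prep_def)

lemma wp_prep:
  assumes n: "60 * m + 50 \<le> n"
    and Q: "\<And>st n'. prep st \<Longrightarrow> scalar st ''r'' = 0 \<Longrightarrow> scalar st ''o'' = 0 \<Longrightarrow> Q st n'"
  shows "wp M le (size_c ;; init_c) Q (initial_state N es s) n"
proof -
  define st where "st = initial_state N es s"
  have z: "arr st A i = 0" if "A \<notin> {''src'', ''dst''}" for A i using that by (auto simp: st_def initial_state_def)
  have sc: "scalar st x = 0" if "x \<notin> {''n'', ''m'', ''s''}" for x using that by (auto simp: st_def initial_state_def)
  have i: "scalar st ''m'' = m" "scalar st ''s'' = s" "\<And>e. e < m \<Longrightarrow> arr st ''src'' e = src e \<and> arr st ''dst'' e = dst e"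
    by (simp_all add: st_def initial_state_def src_def dst_def)
  have "wp M le size_c (wp M le init_c Q) st (n - 1)"
  proof (rule wp_size)
    show "scalar st ''m'' = m" "10 * m + 30 \<le> n - 1" using i n by auto
    fix st1 n1
    assume u1: "unch size_c st st1" and T1: "scalar st1 ''T'' = T" "scalar st1 ''D'' = 2 ^ (T * T)" "scalar st1 ''z'' = 2 ^ T"
      and n1: "n - 1 \<le> n1 + 10 * m + 30"
    have a1: "arr st1 = arr st" "\<And>x. x \<notin> {''T'', ''D'', ''z''} \<Longrightarrow> scalar st1 x = scalar st x" using u1 by (auto simp: unch_def wv_size)
    show "wp M le init_c Q st1 n1"
    proof (rule wp_init)
      show "scalar st1 ''m'' = m" "scalar st1 ''s'' = s" by (simp_all add: a1(2) i)
      show "arr st1 ''src'' e = src e \<and> arr st1 ''dst'' e = dst e" if "e < m" for e unfolding a1(1) by (rule i(3)[OF that])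
      show "arr st1 A i = 0" if "A \<in> {''al'', ''nx'', ''hd'', ''h''}" for A i unfolding a1(1) by (rule z) (use that in auto)
      show "50 * m + 10 \<le> n1" using n n1 by linarith
      fix st2 n2 assume u2: "unch init_c st1 st2" and L: "lnk m st2"
      have a2: "\<And>x. x \<notin> {''T'', ''D'', ''z'', ''u'', ''v'', ''e'', ''a'', ''i''} \<Longrightarrow> scalar st2 x = scalar st x"
         "\<And>A. A \<notin> {''al'', ''nx'', ''hd'', ''h''} \<Longrightarrow> arr st2 A = arr st A"
         "scalar st2 ''T'' = T" "scalar st2 ''D'' = 2 ^ (T * T)" "scalar st2 ''z'' = 2 ^ T"
        using u2 a1 T1 by (auto simp: unch_def wv_init)
      have "A0s = {e \<in> A0s. e < m}" by (auto simp: A0s_def)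
      moreover have "sinv A0s (arr st2 ''h'')" by (rule sinv_init) (use L in \<open>auto simp: A0s_def lnk_def\<close>)
      ultimately have "prep st2" using L a2 i z sc by (simp add: prep_def lnk_def)
      then show "Q st2 n2" by (rule Q) (use a2 sc in auto)
    qed
  qed
  then show ?thesis using n unfolding st_def by (simp add: wp_Seq)
qed

end

section \<open>Sorting the sample\<close>

definition sE :: "string \<Rightarrow> aexp" where
  "sE x = Arr ''S'' (Add (Var ''o'') (Add (Var x) (Const 1)))"

definition pick_c :: "string \<Rightarrow> com" where
  "pick_c x = Store ''S'' (Add (Var ''o'') (Add (Var ''r'') (Add (Var ''p'') (Const 1)))) (sE x) ;;
     Assign x (Add (Var x) (Const 1))"

definition block_c :: com where
  "block_c = Assign ''i'' (Var ''p'') ;; Assign ''mi'' (Add (Var ''p'') (Var ''d'')) ;;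
     Assign ''j'' (Var ''mi'') ;; Assign ''hi'' (Add (Var ''mi'') (Var ''d''))"

definition firstE :: bexp where
  "firstE = And (Less (Var ''i'') (Var ''mi''))
     (Not (And (And (Less (Var ''j'') (Var ''hi'')) (Less (Var ''j'') (Var ''r'')))
       (Not (leqE (sE ''i'') (sE ''j'')))))"

definition merge_body_c :: com where
  "merge_body_c = Cond (Eq (Var ''p'') (Var ''hi'')) block_c Skip ;;
     Cond firstE (pick_c ''i'') (pick_c ''j'') ;; Assign ''p'' (Add (Var ''p'') (Const 1))"

definition merge_c :: com where
  "merge_c = Assign ''p'' (Const 0) ;; Assign ''hi'' (Const 0) ;; Assign ''i'' (Const 0) ;;
     Assign ''mi'' (Const 0) ;; Assign ''j'' (Const 0) ;;
     While (Less (Var ''p'') (Var ''r'')) merge_body_c"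

text \<open>Each pass writes the merged runs directly behind its input, which avoids a second array
  and copying back; \<open>sort_M\<close> bounds the cells consumed.\<close>

definition sort_body_c :: com where
  "sort_body_c = merge_c ;; Assign ''o'' (Add (Var ''o'') (Var ''r'')) ;; Assign ''d'' (Add (Var ''d'') (Var ''d''))"

definition sort_c :: com where
  "sort_c = Assign ''d'' (Const 1) ;; While (Less (Var ''d'') (Var ''r'')) sort_body_c"

lemma wv_merge: "wvars merge_body_c = {''i'', ''mi'', ''j'', ''hi'', ''p''}" "warrs merge_body_c = {''S''}"
  "wvars merge_c = {''i'', ''mi'', ''j'', ''hi'', ''p''}" "warrs merge_c = {''S''}"
  by (auto simp: merge_c_def merge_body_c_def block_c_def pick_c_def)

lemma wv_sort: "wvars sort_c = {''i'', ''mi'', ''j'', ''hi'', ''p'', ''o'', ''d''}" "warrs sort_c = {''S''}"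
  by (auto simp: sort_c_def sort_body_c_def wv_merge)

section \<open>Invariants of bottom-up merging\<close>

context ssbp_graph
begin

text \<open>Blocks are identified by division, so that an incomplete last block needs no special
  treatment.\<close>

definition runs :: "nat \<Rightarrow> (nat \<Rightarrow> nat) \<Rightarrow> nat \<Rightarrow> bool" where
  "runs d a n \<longleftrightarrow> (\<forall>q q'. q < q' \<longrightarrow> q' < n \<longrightarrow> q div d = q' div d \<longrightarrow> rk (a q) < rk (a q'))"

text \<open>The block \<open>{hi - 2 * d..<hi}\<close> is being merged from the runs that start at \<open>hi - 2 * d\<close> and \<open>mi\<close>;
  their remaining parts start at \<open>i\<close> and \<open>j\<close>. All numbers are zero before the first block.\<close>

definition mst :: "nat \<Rightarrow> nat \<Rightarrow> (nat \<Rightarrow> nat) \<Rightarrow> (nat \<Rightarrow> nat) \<Rightarrow> nat \<Rightarrow> nat \<Rightarrow> nat \<Rightarrow> nat \<Rightarrow> nat \<Rightarrow> bool" where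
  "mst n d a b p i j mi hi \<longleftrightarrow> 2 * d dvd hi \<and> p \<le> hi \<and> p \<le> n \<and> b ` {..<p} = a ` ({..<i} \<union> {mi..<j}) \<and>
     runs (2 * d) b p \<and> i \<le> mi \<and> mi \<le> j \<and> j \<le> hi \<and> i + j = p + mi \<and> (j \<le> mi \<or> j \<le> n) \<and>
     (hi = 0 \<or> mi + d = hi \<and> hi \<le> i + 2 * d) \<and>
     (\<forall>q x. hi \<le> q + 2 * d \<longrightarrow> q < p \<longrightarrow> x < n \<longrightarrow> i \<le> x \<and> x < mi \<or> j \<le> x \<and> x < hi \<longrightarrow> rk (b q) < rk (a x))"

lemma mst_0: "mst n d a b 0 0 0 0 0"
  by (simp add: mst_def runs_def)

lemma mst_block:
  assumes "mst n d a b p i j mi p"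
  shows "mst n d a b p p (p + d) (p + d) (p + d + d)"
proof -
  have e: "i = mi" "j = p" using assms by (auto simp: mst_def)
  then have "{..<i} \<union> {mi..<j} = {..<p}" using assms by (auto simp: mst_def)
  then have "b ` {..<p} = a ` {..<p}" using assms by (simp add: mst_def)
  moreover have "2 * d dvd p + d + d" using assms by (simp add: mst_def add.assoc mult_2[symmetric])
  ultimately show ?thesis using assms by (simp add: mst_def)
qed

lemma runs_less:
  assumes "runs d a n" "c dvd B" "d = c" "B \<le> x" "x < y" "y < B + d" "y < n"
  shows "rk (a x) < rk (a y)"
proof -
  obtain k where k: "B = d * k" using assms(2,3) by (auto elim: dvdE)
  have "x div d = k" "y div d = k" by (rule div_nat_eqI; use assms k in simp)+
  then show ?thesis using assms by (simp add: runs_def)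
qed

text \<open>\<open>low\<close> makes \<open>y\<close> the least remaining element of the block, and
  the last clause of \<open>mst\<close> puts all earlier outputs of the block below it, so the
  output run extends by one.\<close>

lemma mst_pick:
  assumes M: "mst n d a b p i j mi hi" and pn: "p < n" "p < hi" and y: "rk (b' p) \<le> rk (a y)" "b' p = a y"
    and b': "\<And>q. q \<noteq> p \<Longrightarrow> b' q = b q"
    and yr: "i \<le> y \<and> y < mi \<or> j \<le> y \<and> y < hi" "y < n"
    and ij: "i' = Suc i \<and> j' = j \<and> y = i \<and> i < mi \<or> i' = i \<and> j' = Suc j \<and> y = j \<and> j < hi"
    and low: "\<And>x. x < n \<Longrightarrow> i' \<le> x \<and> x < mi \<or> j' \<le> x \<and> x < hi \<Longrightarrow> rk (a y) < rk (a x)"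
  shows "mst n d a b' (Suc p) i' j' mi hi"
proof -
  have D: "2 * d dvd hi" "b ` {..<p} = a ` ({..<i} \<union> {mi..<j})" "runs (2 * d) b p" "i \<le> mi" "mi \<le> j" "j \<le> hi"
    "i + j = p + mi" "j \<le> mi \<or> j \<le> n" "mi + d = hi" "hi \<le> i + 2 * d"
    "\<And>q x. hi \<le> q + 2 * d \<Longrightarrow> q < p \<Longrightarrow> x < n \<Longrightarrow> i \<le> x \<and> x < mi \<or> j \<le> x \<and> x < hi \<Longrightarrow> rk (b q) < rk (a x)"
    using M pn unfolding mst_def by auto
  have im: "b' ` {..<Suc p} = insert (a y) (b ` {..<p})" using b' y(2) by (auto simp: lessThan_Suc image_iff)
  have set: "b' ` {..<Suc p} = a ` ({..<i'} \<union> {mi..<j'})"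
    using ij
  proof
    assume "i' = Suc i \<and> j' = j \<and> y = i \<and> i < mi"
    then show ?thesis unfolding im D(2) by (auto simp: lessThan_Suc)
  next
    assume "i' = i \<and> j' = Suc j \<and> y = j \<and> j < hi"
    then show ?thesis unfolding im D(2) using D(5) by (auto simp: atLeastLessThanSuc)
  qed
  have new: "rk (b' q) < rk (a y)" if q: "hi \<le> q + 2 * d" "q < p" for q
    using D(11)[OF q yr(2) yr(1)] b'[of q] q by simp
  have "runs (2 * d) b' (Suc p)"
    unfolding runs_def
  proof (intro allI impI)
    fix q q' assume q: "q < q'" "q' < Suc p" "q div (2 * d) = q' div (2 * d)"
    show "rk (b' q) < rk (b' q')"
    proof (cases "q' = p")
      case False
      then have "rk (b q) < rk (b q')" using D(3) q by (simp add: runs_def)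
      then show ?thesis using b' q False by simp
    next
      case True
      obtain k where k: "hi = 2 * d * Suc k"
        using D(1) pn(2) by (metis dvdE less_nat_zero_code mult_0_right not0_implies_Suc)
      have "p div (2 * d) = k" by (rule div_nat_eqI) (use k pn D(4-10) in auto)
      then have "2 * d * k \<le> q" using q True times_div_less_eq_dividend[of "2 * d" q] by simp
      then show ?thesis using new[of q] q True k y by simp
    qed
  qed
  moreover have "rk (b' q) < rk (a x)"
    if x: "hi \<le> q + 2 * d" "q < Suc p" "x < n" "i' \<le> x \<and> x < mi \<or> j' \<le> x \<and> x < hi" for q x
    using new[of q] low[OF x(3,4)] x(1,2) y by (cases "q = p") auto
  ultimately show ?thesis unfolding mst_def using D pn ij set yr(2) by auto
qed

lemma mst_first:
  assumes M: "mst n d a b p i j mi hi" and pn: "p < n" "p < hi" and a: "runs d a n" "inj_on a {..<n}" "a ` {..<n} \<subseteq> {..<m}"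
    and i: "i < mi" "j < hi \<Longrightarrow> j < n \<Longrightarrow> rk (a i) \<le> rk (a j)"
    and b': "b' p = a i" "\<And>q. q \<noteq> p \<Longrightarrow> b' q = b q"
  shows "mst n d a b' (Suc p) (Suc i) j mi hi"
proof (rule mst_pick[OF M pn _ b'(1) b'(2)])
  have D: "2 * d dvd hi" "mi \<le> j" "i + j = p + mi" "mi + d = hi" "hi \<le> i + 2 * d" using M pn by (auto simp: mst_def)
  show "i < n" using D pn by simp
  have dm: "d dvd mi" using D(1,4) by (metis dvd_add_left_iff dvd_mult_right dvd_refl mult.commute)
  have dB: "d dvd mi - d" using dm by simp
  have d: "d \<le> mi" using D pn i(1) dm by (auto intro: dvd_imp_le)
  fix x assume x: "x < n" "Suc i \<le> x \<and> x < mi \<or> j \<le> x \<and> x < hi"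
  show "rk (a i) < rk (a x)"
  proof (cases "x < mi")
    case True
    then show ?thesis by (intro runs_less[OF a(1) dB refl]) (use x D d in auto)
  next
    case False
    then have xj: "j \<le> x" "x < hi" using x(2) by auto
    have "rk (a i) \<le> rk (a j)" using i(2) xj x by simp
    \<comment> \<open>Distinct edges have distinct ranks, which makes the weak comparison of the
      program strict.\<close>
    moreover have "rk (a i) \<noteq> rk (a j)"
    proof -
      have ij: "i < n" "j < n" "i \<noteq> j" using D i(1) pn xj x(1) by auto
      then have "a i \<noteq> a j" "a i < m" "a j < m" using a(2,3) by (auto simp: inj_on_def)
      then show ?thesis using rk_inj by simp
    qed
    moreover have "rk (a j) \<le> rk (a x)"
    proof (cases "j = x")
      case False
      then have "rk (a j) < rk (a x)" by (intro runs_less[OF a(1) dm refl]) (use x xj D in auto)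
      then show ?thesis by simp
    qed simp
    ultimately show ?thesis by simp
  qed
qed (use i b' M in \<open>auto simp: mst_def\<close>)

lemma mst_second:
  assumes M: "mst n d a b p i j mi hi" and pn: "p < n" "p < hi" and a: "runs d a n"
    and i: "i < mi \<Longrightarrow> j < hi \<and> j < n \<and> rk (a j) < rk (a i)"
    and b': "b' p = a j" "\<And>q. q \<noteq> p \<Longrightarrow> b' q = b q"
  shows "mst n d a b' (Suc p) i (Suc j) mi hi"
proof -
  have D: "2 * d dvd hi" "mi \<le> j" "i \<le> mi" "i + j = p + mi" "mi + d = hi" "hi \<le> i + 2 * d" using M pn by (auto simp: mst_def)
  have j: "j < hi" "j < n"
  proof -
    have "j < hi \<and> j < n"
    proof (cases "i < mi")
      case False
      then have "j = p" using D(3,4) by simp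
      then show ?thesis using pn by simp
    qed (use i in simp)
    then show "j < hi" "j < n" by auto
  qed
  have dm: "d dvd mi" using D(1,5) by (metis dvd_add_left_iff dvd_mult_right dvd_refl mult.commute)
  show ?thesis
  proof (rule mst_pick[OF M pn _ b'(1) b'(2)])
    fix x assume x: "x < n" "i \<le> x \<and> x < mi \<or> Suc j \<le> x \<and> x < hi"
    show "rk (a j) < rk (a x)"
    proof (cases "x < mi")
      case False
      then show ?thesis by (intro runs_less[OF a(1) dm refl]) (use x D in auto)
    next
      case True
      then have ix: "i \<le> x" "i < mi" using x D by auto
      have dB: "d dvd mi - d" using dm by simp
      have d: "d \<le> mi" using D ix dm by (auto intro: dvd_imp_le)
      have "rk (a i) \<le> rk (a x)"
      proof (cases "i = x")
        case False
        then have "rk (a i) < rk (a x)" by (intro runs_less[OF a(1) dB refl]) (use x True ix D d in auto)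
        then show ?thesis by simp
      qed simp
      then show ?thesis using i ix by simp
    qed
  qed (use j b' D in auto)
qed

lemma mst_end:
  assumes "mst n d a b n i j mi hi"
  shows "b ` {..<n} = a ` {..<n}" "runs (2 * d) b n"
proof -
  have "{..<i} \<union> {mi..<j} = {..<n}" using assms by (auto simp: mst_def)
  then show "b ` {..<n} = a ` {..<n}" "runs (2 * d) b n" using assms by (auto simp: mst_def)
qed

end

section \<open>Correctness and cost of the sort\<close>

context ssbp_pre
begin

interpretation triv: ssbp_run es w s M T 0 0 "\<lambda>_. 0"
proof
  show "0 + 0 + 1 < M" using M_T by linarith
qed (use T_pos m_T M_T M_src M_dst in auto)

lemma wp_merge:
  assumes sc: "scalar st ''r'' = r" "scalar st ''o'' = off" "scalar st ''d'' = d" and d: "0 < d" "d < r"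
    and a: "runs d a r" "inj_on a {..<r}" "a ` {..<r} \<subseteq> {..<m}" "\<And>q. q < r \<Longrightarrow> arr st ''S'' (off + q + 1) = a q"
    and M: "off + 4 * r + 10 < M" and n: "60 * r + 20 \<le> n"
    and Q: "\<And>st' n' b. unch merge_c st st' \<Longrightarrow> b ` {..<r} = a ` {..<r} \<Longrightarrow> runs (2 * d) b r \<Longrightarrow>
       (\<forall>q<r. arr st' ''S'' (off + r + q + 1) = b q) \<Longrightarrow> n \<le> n' + 60 * r + 20 \<Longrightarrow> Q st' n'"
  shows "wp M le merge_c Q st n"
proof -
  define J where "J = (\<lambda>st' n'. unch merge_c st st' \<and> (\<forall>q<r. arr st' ''S'' (off + q + 1) = a q) \<and>
     mst r d a (\<lambda>q. arr st' ''S'' (off + r + q + 1)) (scalar st' ''p'') (scalar st' ''i'') (scalar st' ''j'') (scalar st' ''mi'') (scalar st' ''hi'') \<and>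
     n \<le> n' + 60 * scalar st' ''p'' + 15)"
  define st0 where "st0 = st\<lparr>scalar := (scalar st)(''p'' := 0, ''hi'' := 0, ''i'' := 0, ''mi'' := 0, ''j'' := 0)\<rparr>"
  have "wp M le (While (Less (Var ''p'') (Var ''r'')) merge_body_c) Q st0 (n - 10)"
  proof (rule wp_While[where I = J])
    have "unch merge_c st st0" by (simp add: unch_def wv_merge st0_def)
    then show "J st0 (n - 10)" using a(4) n mst_0 by (simp add: J_def st0_def)
  next
    fix st1 n1 assume J: "J st1 n1" and b: "bv M le st1 (Less (Var ''p'') (Var ''r''))"
    define p where "p = scalar st1 ''p''"
    have u1: "unch merge_c st st1" and a1: "\<And>q. q < r \<Longrightarrow> arr st1 ''S'' (off + q + 1) = a q" and n1: "n \<le> n1 + 60 * p + 15"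
      and ms1: "mst r d a (\<lambda>q. arr st1 ''S'' (off + r + q + 1)) p (scalar st1 ''i'') (scalar st1 ''j'') (scalar st1 ''mi'') (scalar st1 ''hi'')"
      using J by (auto simp: J_def p_def)
    have fr: "scalar st1 ''r'' = r" "scalar st1 ''o'' = off" "scalar st1 ''d'' = d" using u1 sc by (simp_all add: unch_def wv_merge)
    have pr: "p < r" using b fr by (simp add: p_def)
    have n60: "60 \<le> n1" using n1 pr n by linarith
    define st2 where "st2 = (if p = scalar st1 ''hi'' then st1\<lparr>scalar := (scalar st1)(''i'' := p, ''mi'' := p + d, ''j'' := p + d, ''hi'' := p + d + d)\<rparr> else st1)"
    have pM: "p + d < M" "p + d + d < M" "p < M" using pr d M by simp_all
    define i where "i = scalar st2 ''i''" define j where "j = scalar st2 ''j''"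
    define mi where "mi = scalar st2 ''mi''" define hi where "hi = scalar st2 ''hi''"
    define bb where "bb = (\<lambda>q. arr st2 ''S'' (off + r + q + 1))"
    have ar2: "arr st2 = arr st1" and sc2: "\<And>x. x \<notin> {''i'', ''mi'', ''j'', ''hi''} \<Longrightarrow> scalar st2 x = scalar st1 x"
      by (auto simp: st2_def)
    have ms2: "mst r d a bb p i j mi hi"
    proof (cases "p = scalar st1 ''hi''")
      case True
      then show ?thesis using mst_block[of r d a bb p "scalar st1 ''i''" "scalar st1 ''j''" "scalar st1 ''mi''"] ms1
        by (simp add: i_def j_def mi_def hi_def st2_def bb_def)
    next
      case False
      then show ?thesis using ms1 by (simp add: i_def j_def mi_def hi_def st2_def bb_def)
    qed
    have phi: "p < hi"
    proof (cases "p = scalar st1 ''hi''")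
      case False
      then show ?thesis using ms1 by (simp add: hi_def st2_def mst_def)
    qed (use d in \<open>simp add: hi_def st2_def\<close>)
    have bnd: "i \<le> p" "j \<le> hi" "hi \<le> i + 2 * d" "mi \<le> j" "i + j = p + mi" "mi + d = hi" using ms2 phi by (auto simp: mst_def)
    have jM: "off + j + 1 < M" "off + i + 1 < M" "i + 1 < M" "j + 1 < M" "off + (r + (p + 1)) < M" "p + 1 < M"
      "r + (p + 1) < M" "Suc (r + p) < M" "Suc (off + (r + p)) < M"
      using bnd pr d M by simp_all
    have "wp M le (Cond (Eq (Var ''p'') (Var ''hi'')) block_c Skip) (\<lambda>st' n'. st' = st2 \<and> n1 \<le> n' + 20 \<and> n' \<le> n1) st1 (n1 - 2)"
      using n60 pM fr by (simp add: block_c_def wps st2_def p_def[symmetric] numeral_2_eq_2[symmetric] numeral_3_eq_3[symmetric])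
    then have "wp M le (Cond (Eq (Var ''p'') (Var ''hi'')) block_c Skip)
       (wp M le (Cond firstE (pick_c ''i'') (pick_c ''j'') ;; Assign ''p'' (Add (Var ''p'') (Const 1))) J) st1 (n1 - 2)"
    proof (rule wp_mono)
      fix st' n' assume e: "st' = st2 \<and> n1 \<le> n' + 20 \<and> n' \<le> n1"
      have sE: "av M st2 (sE ''i'') = arr st2 ''S'' (off + i + 1)" "av M st2 (sE ''j'') = arr st2 ''S'' (off + j + 1)"
        using jM fr sc2 by (simp_all add: sE_def i_def j_def)
      have am: "a x < m" if "x < r" for x using subsetD[OF a(3), of "a x"] that by simp
      have ai: "arr st2 ''S'' (off + i + 1) = a i" "a i < m" using a1[of i] am[of i] bnd(1) pr ar2 by auto
      have aj: "arr st2 ''S'' (off + j + 1) = a j \<and> a j < m" if "j < r" using a1[of j] am[of j] that ar2 by auto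
      define F where "F \<longleftrightarrow> i < mi \<and> (j < hi \<longrightarrow> j < r \<longrightarrow> rk (a i) \<le> rk (a j))"
      have bF: "bv M le st2 firstE \<longleftrightarrow> F"
      proof (cases "j < hi \<and> j < r")
        case True
        then have "bv M le st2 (leqE (sE ''i'') (sE ''j'')) \<longleftrightarrow> rk (a i) \<le> rk (a j)"
          using triv.bv_leqE[of st2 "sE ''i''" "sE ''j''"] sE ai aj by simp
        then show ?thesis using True sc2[of "''r''"] fr by (simp add: firstE_def F_def i_def j_def mi_def hi_def)
      next
        case False
        then show ?thesis using sc2[of "''r''"] fr by (auto simp add: firstE_def F_def i_def j_def mi_def hi_def)
      qed
      define y where "y = (if F then i else j)"
      have jr: "y < r"
      proof (cases F)
        case False
        then have "\<not> i < mi \<or> j < r" by (auto simp: F_def)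
        then show ?thesis using False bnd(5) pr ms2 by (auto simp: y_def mst_def)
      qed (use bnd pr in \<open>simp add: y_def\<close>)
      have ay: "arr st2 ''S'' (Suc (off + y)) = a y" using jr aj ai by (auto simp: y_def)
      define st3 where "st3 = (let t = upda ''S'' (Suc (off + (r + p))) (a y) st2 in
          if F then upds ''i'' (Suc i) t else upds ''j'' (Suc j) t)"
      define st4 where "st4 = upds ''p'' (Suc p) st3"
      define b' where "b' = (\<lambda>q. arr st4 ''S'' (off + r + q + 1))"
      have b4: "b' p = a y" "\<And>q. q \<noteq> p \<Longrightarrow> b' q = bb q" by (simp_all add: b'_def st4_def st3_def bb_def Let_def add.assoc)
      have "mst r d a b' (scalar st4 ''p'') (scalar st4 ''i'') (scalar st4 ''j'') (scalar st4 ''mi'') (scalar st4 ''hi'')"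
      proof (cases F)
        case True
        have "mst r d a b' (Suc p) (Suc i) j mi hi"
          by (rule mst_first[OF ms2 pr phi a(1-3)]) (use True b4 in \<open>auto simp: F_def y_def\<close>)
        then show ?thesis using True by (simp add: st4_def st3_def Let_def i_def j_def mi_def hi_def)
      next
        case False
        have "mst r d a b' (Suc p) i (Suc j) mi hi"
          by (rule mst_second[OF ms2 pr phi a(1)]) (use False b4 in \<open>auto simp: F_def y_def\<close>)
        then show ?thesis using False by (simp add: st4_def st3_def Let_def i_def j_def mi_def hi_def)
      qed
      moreover have "arr st4 ''S'' (off + q + 1) = a q" if "q < r" for q
        using a1[OF that] that ar2 by (simp add: st4_def st3_def Let_def)
      moreover have "unch merge_c st st4" using u1 ar2 sc2 by (simp add: unch_def wv_merge st4_def st3_def Let_def)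
      moreover have "scalar st4 ''p'' = Suc p" by (simp add: st4_def)
      ultimately have J4: "J st4 n4" if "n1 \<le> n4 + 50" for n4 using that n1 by (simp add: J_def b'_def)
      have sc2': "scalar st2 ''p'' = p" "scalar st2 ''r'' = r" "scalar st2 ''o'' = off" using sc2 fr by (simp_all add: p_def)
      have "wp M le (Cond firstE (pick_c ''i'') (pick_c ''j'') ;; Assign ''p'' (Add (Var ''p'') (Const 1))) J st2 n'"
      proof (cases F)
        case True
        then show ?thesis using e n60 bF jM sc2' ay J4 unfolding st4_def st3_def
          by (simp add: wps pick_c_def sE_def y_def i_def[symmetric] numeral_2_eq_2[symmetric] numeral_3_eq_3[symmetric])
      next
        case False
        then show ?thesis using e n60 bF jM sc2' ay J4 unfolding st4_def st3_def
          by (simp add: wps pick_c_def sE_def y_def j_def[symmetric] numeral_2_eq_2[symmetric] numeral_3_eq_3[symmetric])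
      qed
      then show "wp M le (Cond firstE (pick_c ''i'') (pick_c ''j'') ;; Assign ''p'' (Add (Var ''p'') (Const 1))) J st' n'"
        using e by simp
    qed
    then show "1 \<le> n1 \<and> wp M le merge_body_c J st1 (n1 - 1)"
      unfolding merge_body_c_def using n60 by (subst wp_Seq) (simp add: numeral_2_eq_2)
  next
    fix st1 n1 assume J: "J st1 n1" and b: "\<not> bv M le st1 (Less (Var ''p'') (Var ''r''))"
    have u: "unch merge_c st st1" using J by (simp add: J_def)
    then have "scalar st1 ''r'' = r" using sc by (simp add: unch_def wv_merge)
    then have p: "scalar st1 ''p'' = r" using J b by (simp add: J_def mst_def)
    have E: "mst r d a (\<lambda>q. arr st1 ''S'' (off + r + q + 1)) r (scalar st1 ''i'') (scalar st1 ''j'') (scalar st1 ''mi'') (scalar st1 ''hi'')"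
      and n1: "n \<le> n1 + 60 * r + 15" using J p by (simp_all add: J_def)
    have "Q st1 (n1 - 1)" by (rule Q[OF u mst_end[OF E]]) (use n1 in auto)
    then show "1 \<le> n1 \<and> Q st1 (n1 - 1)" using n1 n by simp
  qed
  then show ?thesis using n M by (simp add: merge_c_def wps st0_def numeral_2_eq_2[symmetric] numeral_3_eq_3[symmetric])
qed

lemma sort_M: assumes "r \<le> m" "t \<le> T * T" shows "t * r + 4 * r + 10 < M"
proof -
  have "t * r \<le> (m + 2) * (m + 2) * (m + 2)"
    using assms T_le by (intro mult_le_mono order_trans[OF assms(2)]) auto
  also have "\<dots> = (m + 2) ^ 3" by (simp add: power3_eq_cube)
  also have "\<dots> \<le> (m + 2) ^ 6" by (rule poly_le) simp
  finally show ?thesis using assms(1) M_poly M_big by linarith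
qed

lemma wp_sort:
  assumes sc: "scalar st ''r'' = card X" "scalar st ''o'' = 0" and X: "X \<subseteq> {..<m}" "(\<lambda>q. arr st ''S'' (q + 1)) ` {..<card X} = X"
    and n: "80 * (T * T * card X) + 20 \<le> n"
    and Q: "\<And>st' n' off lam. unch sort_c st st' \<Longrightarrow> scalar st' ''o'' = off \<Longrightarrow> off + card X + 1 < M \<Longrightarrow>
      (\<And>i. 1 \<le> i \<Longrightarrow> i \<le> card X \<Longrightarrow> arr st' ''S'' (off + i) = lam i) \<Longrightarrow> lam ` {1..card X} = X \<Longrightarrow>
      (\<And>i j. 1 \<le> i \<Longrightarrow> i < j \<Longrightarrow> j \<le> card X \<Longrightarrow> rk (lam i) < rk (lam j)) \<Longrightarrow>
      n \<le> n' + 80 * (T * T * card X) + 20 \<Longrightarrow> Q st' n'"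
  shows "wp M le sort_c Q st n"
proof -
  define r where "r = card X"
  have rm: "r \<le> m" using card_mono[OF _ X(1)] by (simp add: r_def)
  define J where "J = (\<lambda>st' n'. \<exists>t a. unch sort_c st st' \<and> scalar st' ''o'' = t * r \<and> scalar st' ''d'' = 2 ^ t \<and> t \<le> T * T \<and>
     runs (2 ^ t) a r \<and> a ` {..<r} = X \<and> (\<forall>q<r. arr st' ''S'' (t * r + q + 1) = a q) \<and>
     n \<le> n' + 80 * (t * r) + 10)"
  have tb: "80 * (t * r) \<le> 80 * (T * T * card X)" if "t \<le> T * T" for t
    using that unfolding r_def by (intro mult_le_mono) auto
  define st0 where "st0 = upds ''d'' 1 st"
  have "wp M le (While (Less (Var ''d'') (Var ''r'')) sort_body_c) Q st0 (n - 2)"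
  proof (rule wp_While[where I = J])
    have "unch sort_c st st0" by (simp add: unch_def wv_sort st0_def)
    then show "J st0 (n - 2)" using X(2) n sc unfolding J_def
      by (intro exI[of _ 0] exI[of _ "\<lambda>q. arr st ''S'' (q + 1)"]) (simp add: st0_def runs_def r_def)
  next
    fix st1 n1 assume J: "J st1 n1" and b: "bv M le st1 (Less (Var ''d'') (Var ''r''))"
    then obtain t a where t: "unch sort_c st st1" "scalar st1 ''o'' = t * r" "scalar st1 ''d'' = 2 ^ t" "t \<le> T * T"
      "runs (2 ^ t) a r" "a ` {..<r} = X" "\<forall>q<r. arr st1 ''S'' (t * r + q + 1) = a q" "n \<le> n1 + 80 * (t * r) + 10"
      unfolding J_def by blast
    have r1: "scalar st1 ''r'' = r" using t(1) sc by (simp add: unch_def wv_sort r_def)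
    have dr: "2 ^ t < r" using b t(3) r1 by simp
    \<comment> \<open>The run length doubles up to the sample size, which is at most
      \<open>m\<close>; this limits the number of passes to \<open>T * T\<close>.\<close>
    have "(2::nat) ^ t < 2 ^ (T * T)" using dr rm m_T by linarith
    then have tT: "Suc t \<le> T * T" by (simp add: Suc_le_eq)
    have "1 \<le> (2::nat) ^ t" by simp
    then have r2: "2 \<le> r" using dr by linarith
    have n80: "80 * r + 10 \<le> n1" using t(8) tb[OF tT] n by simp
    have inj: "inj_on a {..<r}" using t(6) by (intro eq_card_imp_inj_on) (auto simp: r_def)
    note Mb = sort_M[OF rm t(4)]
    have "wp M le merge_c (wp M le (Assign ''o'' (Add (Var ''o'') (Var ''r'')) ;; Assign ''d'' (Add (Var ''d'') (Var ''d''))) J) st1 (n1 - 2)"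
    proof (rule wp_merge[OF r1 t(2,3) _ dr t(5) inj _ _ Mb])
      show "a ` {..<r} \<subseteq> {..<m}" using t(6) X by simp
      show "60 * r + 20 \<le> n1 - 2" using n80 r2 by simp
      fix st2 n2 b
      assume u2: "unch merge_c st1 st2" and b: "b ` {..<r} = a ` {..<r}" "runs (2 * 2 ^ t) b r"
        "\<forall>q<r. arr st2 ''S'' (t * r + r + q + 1) = b q" and n2: "n1 - 2 \<le> n2 + 60 * r + 20"
      define st3 where "st3 = st2\<lparr>scalar := (scalar st2)(''o'' := t * r + r, ''d'' := 2 ^ t + 2 ^ t)\<rparr>"
      have s2: "scalar st2 ''o'' = t * r" "scalar st2 ''d'' = 2 ^ t" "scalar st2 ''r'' = r" using u2 t r1 by (simp_all add: unch_def wv_merge)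
      have "unch sort_c st st3" using t(1) u2 by (simp add: unch_def wv_merge wv_sort st3_def)
      then have J3: "J st3 n3" if "n2 \<le> n3 + 5" for n3
        unfolding J_def using that n2 n80 r2 b t tT
        by (intro exI[of _ "Suc t"] exI[of _ b]) (simp add: st3_def add.commute add.left_commute, linarith?)
      have "2 ^ t + 2 ^ t < M" "t * r + r < M" using dr Mb by linarith+
      moreover have "20 \<le> n2" using n2 n80 r2 by linarith
      ultimately show "wp M le (Assign ''o'' (Add (Var ''o'') (Var ''r'')) ;; Assign ''d'' (Add (Var ''d'') (Var ''d''))) J st2 n2"
        using s2 J3 unfolding st3_def by (simp add: wps numeral_2_eq_2[symmetric] numeral_3_eq_3[symmetric])
    qed (use t in auto)
    then show "1 \<le> n1 \<and> wp M le sort_body_c J st1 (n1 - 1)"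
      unfolding sort_body_c_def using n80 by (subst wp_Seq) (simp add: numeral_2_eq_2)
  next
    fix st1 n1 assume J: "J st1 n1" and b: "\<not> bv M le st1 (Less (Var ''d'') (Var ''r''))"
    then obtain t a where t: "unch sort_c st st1" "scalar st1 ''o'' = t * r" "scalar st1 ''d'' = 2 ^ t" "t \<le> T * T"
      "runs (2 ^ t) a r" "a ` {..<r} = X" "\<forall>q<r. arr st1 ''S'' (t * r + q + 1) = a q" "n \<le> n1 + 80 * (t * r) + 10"
      unfolding J_def by blast
    have r1: "scalar st1 ''r'' = r" using t(1) sc by (simp add: unch_def wv_sort r_def)
    have dr: "r \<le> 2 ^ t" using b t(3) r1 by simp
    have "Q st1 (n1 - 1)"
    proof (rule Q[OF t(1,2), of "\<lambda>i. a (i - 1)"])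
      show "t * r + card X + 1 < M" using sort_M[OF rm t(4)] by (simp add: r_def)
      show "arr st1 ''S'' (t * r + i) = a (i - 1)" if "1 \<le> i" "i \<le> card X" for i
        using t(7)[rule_format, of "i - 1"] that by (simp add: r_def)
      have "{..<r} = (\<lambda>i. i - 1) ` {1..card X}"
      proof
        show "{..<r} \<subseteq> (\<lambda>i. i - 1) ` {1..card X}"
        proof
          fix q assume "q \<in> {..<r}"
          then show "q \<in> (\<lambda>i. i - 1) ` {1..card X}" by (intro image_eqI[of _ _ "Suc q"]) (auto simp: r_def)
        qed
      qed (auto simp: r_def)
      then show "(\<lambda>i. a (i - 1)) ` {1..card X} = X" using t(6) by (simp add: image_image)
      show "rk (a (i - 1)) < rk (a (j - 1))" if "1 \<le> i" "i < j" "j \<le> card X" for i j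
        using t(5) dr that by (simp add: runs_def r_def)
      show "n \<le> n1 - 1 + 80 * (T * T * card X) + 20" using t(8) tb[OF t(4)] by linarith
    qed
    then show "1 \<le> n1 \<and> Q st1 (n1 - 1)" using t(8) tb[OF t(4)] n by simp
  qed
  then show ?thesis using n triv.M_small by (simp add: sort_c_def wps st0_def numeral_2_eq_2[symmetric])
qed

section \<open>Cost of a run with a given sample\<close>

definition LevX :: "nat set \<Rightarrow> nat \<Rightarrow> nat" where "LevX X x = card {e \<in> X. rk e \<le> x}"
text \<open>Depends on the sampled set alone and not on its sorted listing, the form in which the
  sample can be averaged.\<close>

definition gpX :: "nat set \<Rightarrow> nat \<Rightarrow> nat" where "gpX X v = card {e. e < m \<and> LevX X (rk e) = LevX X (Bn v)}"

text \<open>The factor \<open>12 * m\<close> bounds the initial \<open>XP\<close>: 8 per edge and 2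
  for each of at most \<open>2 * m\<close> vertices.\<close>

definition pcost :: "nat set \<Rightarrow> nat" where
  "pcost X = 80 * (T * T * card X) + (10 * T + 100) * (12 * m) + T * (1500 * m + 210) +
     (\<Sum>v\<in>ssbp_run.V es. 85 * (1 + T + gpX X v)) + 700 * m + 200"

lemma card_V': "card (ssbp_run.V es) \<le> 2 * m" by (rule triv.card_V)

text \<open>The budget itself has to fit into a word, because it serves as the bound
  \<open>N\<close> on the node numbers.\<close>

lemma pcost_M: assumes "X \<subseteq> {..<m}" shows "pcost X < M"
proof -
  define k where "k = m + 2"
  have b: "T \<le> k" "card X \<le> k" "m \<le> k" "card (ssbp_run.V es) \<le> 2 * k" "\<And>v. gpX X v \<le> k"
  proof -
    show "T \<le> k" "m \<le> k" "card (ssbp_run.V es) \<le> 2 * k" using T_le triv.card_V by (simp_all add: k_def)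
    show "card X \<le> k" using card_mono[OF _ assms] by (simp add: k_def)
    show "gpX X v \<le> k" for v
      using card_mono[of "{..<m}" "{e. e < m \<and> LevX X (rk e) = LevX X (Bn v)}"] unfolding gpX_def k_def by fastforce
  qed
  have k: "k ^ i \<le> k ^ 6" if "i \<le> 6" for i unfolding k_def by (rule poly_le[OF that])
  have "T * T * card X \<le> k * k * k" using b by (intro mult_le_mono) auto
  then have 1: "T * T * card X \<le> k ^ 6" using k[of 3] by (simp add: power3_eq_cube)
  have kk: "k * k \<le> k ^ 6" "k \<le> k ^ 6" "1 \<le> k ^ 6" using k[of 2] k[of 1] k[of 0] by (simp_all add: power2_eq_square)
  have "(10 * T + 100) * (12 * m) \<le> (10 * k + 100) * (12 * k)" using b by (intro mult_le_mono add_mono) auto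
  then have 2: "(10 * T + 100) * (12 * m) \<le> 120 * (k * k) + 1200 * k" by (simp add: algebra_simps)
  have "T * (1500 * m + 210) \<le> k * (1500 * k + 210)" using b by (intro mult_le_mono add_mono) auto
  then have 3: "T * (1500 * m + 210) \<le> 1500 * (k * k) + 210 * k" by (simp add: algebra_simps)
  have "(\<Sum>v\<in>ssbp_run.V es. 85 * (1 + T + gpX X v)) \<le> (\<Sum>v\<in>ssbp_run.V es. 85 * (1 + k + k))"
    using b by (intro sum_mono mult_le_mono add_mono) auto
  also have "\<dots> \<le> 2 * k * (85 * (1 + k + k))" using b(4) by simp
  finally have 4: "(\<Sum>v\<in>ssbp_run.V es. 85 * (1 + T + gpX X v)) \<le> 340 * (k * k) + 170 * k" by (simp add: algebra_simps)
  have "pcost X \<le> 80 * k ^ 6 + (120 * (k * k) + 1200 * k) + (1500 * (k * k) + 210 * k) + (340 * (k * k) + 170 * k) + 700 * k + 200"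
    using 1 2 3 4 b(3) unfolding pcost_def by linarith
  also have "\<dots> \<le> 10000 * k ^ 6" using kk by linarith
  finally show ?thesis using M_big by (simp add: k_def)
qed

lemma wp_bound: "wp M le c (\<lambda>st' n'. n' \<le> n \<longrightarrow> Q st' n') st n \<Longrightarrow> wp M le c Q st n"
  by (erule wp_frame) blast

definition solved :: "state \<Rightarrow> bool" where
  "solved st \<longleftrightarrow> (\<forall>v. v \<noteq> s \<longrightarrow> rkc (arr st ''out'' v) = Bn v \<and> arr st ''out'' v \<le> m) \<and> arr st ''out'' s = Suc m"

lemma wp_solve:
  assumes p: "prep st" and sc: "scalar st ''r'' = card X" "scalar st ''o'' = 0"
    and X: "X \<subseteq> {..<m}" "(\<lambda>q. arr st ''S'' (q + 1)) ` {..<card X} = X"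
  shows "wp M le (sort_c ;; search_c) (\<lambda>st' _. solved st') st (pcost X)"
proof -
  have "wp M le sort_c (wp M le search_c (\<lambda>st' _. solved st')) st (pcost X - 1)"
  proof (rule wp_bound, rule wp_sort[OF sc X], goal_cases)
    case 1
    show "80 * (T * T * card X) + 20 \<le> pcost X - 1" by (simp add: pcost_def)
  next
    case prems: (2 st1 n1 off lam)
    have u: "unch sort_c st st1" and o: "scalar st1 ''o'' = off" "off + card X + 1 < M"
      and S: "\<And>i. 1 \<le> i \<Longrightarrow> i \<le> card X \<Longrightarrow> arr st1 ''S'' (off + i) = lam i" and lam: "lam ` {1..card X} = X"
      and mono: "\<And>i j. 1 \<le> i \<Longrightarrow> i < j \<Longrightarrow> j \<le> card X \<Longrightarrow> rk (lam i) < rk (lam j)"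
      and n1: "pcost X - 1 \<le> n1 + 80 * (T * T * card X) + 20"
      using prems by simp_all
    have rm: "card X \<le> m" using card_mono[OF _ X(1)] by simp
    interpret R: ssbp_run es w s M T "card X" off lam
    proof
      show "lam i < m" if "1 \<le> i" "i \<le> card X" for i
      proof -
        have "lam i \<in> X" using lam that by auto
        then show ?thesis using X(1) by auto
      qed
    qed (use mono T_pos m_T rm o M_T M_src M_dst in auto)
    have p1: "prep st1" by (rule prep_unch[OF p]) (use u in \<open>auto simp: unch_def wv_sort\<close>)
    have r1: "scalar st1 ''r'' = card X" using u sc by (simp add: unch_def wv_sort)
    have P: "\<And>e. e < m \<Longrightarrow> arr st1 ''src'' e = src e \<and> arr st1 ''dst'' e = dst e" "scalar st1 ''m'' = m" "scalar st1 ''s'' = s"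
      "scalar st1 ''T'' = T" "scalar st1 ''z'' = 2 ^ T" "scalar st1 ''D'' = 2 ^ (T * T)"
      "scalar st1 ''nn'' = 0" "scalar st1 ''rd'' = 0" "scalar st1 ''fin'' = 0"
      "\<And>A i. A \<in> {''vis'', ''asg'', ''lo'', ''out'', ''bh'', ''bn''} \<Longrightarrow> arr st1 A i = 0"
      "\<And>c. c \<noteq> 0 \<Longrightarrow> arr st1 ''nx'' c < c" "\<And>v. lst (arr st1 ''nx'') (arr st1 ''hd'' v) = adjn m v"
      "{e. e < m \<and> arr st1 ''al'' e = 1} = A0s" "sinv A0s (arr st1 ''h'')"
      using p1 unfolding prep_def by auto
    have adj: "adjn m v = R.adj v" for v unfolding adjn_def A0s_def R.adj_def R.A0_def ..
    have Al: "R.Al st1 = A0s" using P(13) by (simp add: R.Al_def)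
    \<comment> \<open>All levels are below \<open>2 ^ (T * T)\<close>, so the first interval
      contains everything and the initial zeros in \<open>lo\<close> are correct.\<close>
    have D0: "R.tgt (2 ^ (T * T)) v = 0" for v
    proof -
      have "R.Lev (Bn v) < 2 ^ (T * T)" using R.Lev_le_r[of "Bn v"] rm m_T by linarith
      then show ?thesis by (simp add: R.tgt_def blk_def)
    qed
    have "R.rinv st1"
      unfolding R.rinv_def
    proof (intro conjI)
      show "R.stb st1" using P r1 o S adj by (simp add: R.stb_def R.thr_def)
      show "bwf st1" using P(10) by (simp add: bwf_def)
      show "sinv (R.Al st1) (arr st1 ''h'')" unfolding Al by (rule P)
      show "\<forall>j. bkt st1 j = {}" using P(10) by (simp add: bkt_def)
      show "\<forall>v\<in>R.V. arr st1 ''lo'' v = R.tgt (scalar st1 ''D'') v \<or> R.small (R.Al st1) v" using P(6,10) D0 by simp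
    qed (use P in simp_all)
    then have search: "wp M le search_c (\<lambda>st' _. solved st') st1 n1" if "n1 \<le> pcost X - 1"
    proof (rule R.wp_search[where N = "pcost X", OF _ P(3) M_s])
      have "R.Lev x = LevX X x" for x
      proof -
        have "inj_on lam {1..card X}" by (rule eq_card_imp_inj_on) (simp_all add: lam[simplified One_nat_def])
        then have "card (lam ` {i \<in> {1..card X}. rk (lam i) \<le> x}) = R.Lev x"
          unfolding R.Lev_def by (rule card_image[OF inj_on_subset]) auto
        moreover have "lam ` {i \<in> {1..card X}. rk (lam i) \<le> x} = {e \<in> lam ` {1..card X}. rk e \<le> x}" by (rule Compr_image_eq[symmetric])
        ultimately show ?thesis unfolding lam by (simp add: LevX_def)
      qed
      then have gp: "R.gp v = gpX X v" for v by (simp add: R.gp_def gpX_def)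
      have fc: "R.fcost = (\<Sum>v\<in>R.V. 85 * (1 + T + gpX X v))" unfolding R.fcost_def gp ..
      have "card A0s \<le> m" using card_mono[of "{..<m}" A0s] by (auto simp: A0s_def)
      moreover have "card (R.Vals st1) \<le> card R.V" by (rule card_mono) (auto simp: R.Vals_def)
      ultimately have "R.XP st1 \<le> 12 * m" using R.card_V unfolding R.XP_def Al by linarith
      then have "R.qq * R.XP st1 \<le> (10 * T + 100) * (12 * m)" unfolding R.qq_def by (rule mult_le_mono2)
      then show "R.scost (R.XP st1) \<le> n1" using n1 unfolding R.scost_def fc pcost_def by linarith
      show "scalar st1 ''nn'' + n1 \<le> pcost X" using that P(7) by simp
      show "pcost X < M" by (rule pcost_M[OF X(1)])
    qed (simp add: solved_def)
    then show ?case by blast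
  qed
  then show ?thesis by (subst wp_Seq) (simp add: pcost_def)
qed

end

section \<open>Random thresholds\<close>

definition samp_body_c :: com where
  "samp_body_c = Random ''x'' (Var ''T'') ;;
     (Cond (Eq (Var ''x'') (Const 0))
        (Assign ''r'' (Add (Var ''r'') (Const 1)) ;; Store ''S'' (Var ''r'') (Var ''i'')) Skip ;;
      Assign ''i'' (Add (Var ''i'') (Const 1)))"

definition samp_c :: com where
  "samp_c = While (Less (Var ''i'') (Var ''m'')) samp_body_c"

definition ssbp_c :: com where
  "ssbp_c = (size_c ;; init_c) ;; Assign ''i'' (Const 0) ;; samp_c ;; sort_c ;; search_c"

lemma geometric_le: assumes "1 \<le> T" shows "(\<Sum>k<n. (1 - 1 / real T) ^ k) \<le> real T"
proof -
  define x where "x = 1 - 1 / real T"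
  have x: "x \<noteq> 1" "0 \<le> x" using assms by (auto simp: x_def)
  have "(\<Sum>k<n. x ^ k) = (1 - x ^ n) * real T"
    using geometric_sum[OF x(1), of n] assms by (simp add: x_def field_simps)
  also have "\<dots> \<le> 1 * real T" using x(2) by (intro mult_right_mono) auto
  finally show ?thesis by (simp add: x_def)
qed

section \<open>Expected number of edges at the level of a vertex\<close>

context ssbp_pre
begin

text \<open>The edges whose sampling would separate \<open>e\<close> from the value of
  \<open>v\<close>. The rank intervals are open below and closed above because a sampled edge
  belongs to the level that it starts.\<close>

definition btw :: "nat \<Rightarrow> nat \<Rightarrow> nat set" where
  "btw v e = {e'. e' < m \<and> (rk e < rk e' \<and> rk e' \<le> Bn v \<or> Bn v < rk e' \<and> rk e' \<le> rk e)}"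

lemma fin_btw[simp]: "finite (btw v e)" by (simp add: btw_def)

lemma card_le_eq:
  assumes "finite X" "x \<le> y"
  shows "card {e \<in> X. rk e \<le> x} = card {e \<in> X. rk e \<le> y} \<longleftrightarrow> X \<inter> {e. x < rk e \<and> rk e \<le> y} = {}"
proof
  assume c: "card {e \<in> X. rk e \<le> x} = card {e \<in> X. rk e \<le> y}"
  have "{e \<in> X. rk e \<le> x} = {e \<in> X. rk e \<le> y}"
    by (rule card_subset_eq) (use assms c in auto)
  then show "X \<inter> {e. x < rk e \<and> rk e \<le> y} = {}" by (auto simp: set_eq_iff not_le[symmetric])
next
  assume "X \<inter> {e. x < rk e \<and> rk e \<le> y} = {}"
  then have "{e \<in> X. rk e \<le> x} = {e \<in> X. rk e \<le> y}" using assms(2) by (auto simp: not_le[symmetric])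
  then show "card {e \<in> X. rk e \<le> x} = card {e \<in> X. rk e \<le> y}" by simp
qed

lemma LevX_eq_iff: assumes "X \<subseteq> {..<m}" shows "LevX X (rk e) = LevX X (Bn v) \<longleftrightarrow> X \<inter> btw v e = {}"
proof -
  have fin: "finite X" using assms finite_subset by blast
  show ?thesis
  proof (cases "rk e \<le> Bn v")
    case True
    have "X \<inter> btw v e = X \<inter> {e'. rk e < rk e' \<and> rk e' \<le> Bn v}" using assms True by (auto simp: btw_def)
    then show ?thesis using card_le_eq[OF fin True] by (simp add: LevX_def)
  next
    case False
    then have le: "Bn v \<le> rk e" by simp
    have "X \<inter> btw v e = X \<inter> {e'. Bn v < rk e' \<and> rk e' \<le> rk e}" using assms le by (auto simp: btw_def)
    then show ?thesis using card_le_eq[OF fin le] by (simp add: LevX_def eq_commute)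
  qed
qed

lemma rk_bij: "bij_betw rk {..<m} {1..m}"
proof -
  have inj: "inj_on rk {..<m}" using rk_inj by (auto simp: inj_on_def)
  have "rk ` {..<m} = {1..m}"
  proof (rule card_subset_eq)
    show "card (rk ` {..<m}) = card {1..m}" using inj by (simp add: card_image)
  qed (use rk_pos rk_le_m in auto)
  then show ?thesis using inj by (simp add: bij_betw_def)
qed

lemma card_btw: assumes "e < m" shows "card (btw v e) = (if rk e \<le> Bn v then Bn v - rk e else rk e - Bn v)"
proof -
  have inj: "inj_on rk (btw v e)" using rk_bij by (auto simp: bij_betw_def btw_def inj_on_def)
  have img: "rk ` btw v e = (if rk e \<le> Bn v then {rk e<..Bn v} else {Bn v<..rk e})"
  proof -
    have "x \<in> rk ` btw v e" if "rk e < x \<and> x \<le> Bn v \<or> Bn v < x \<and> x \<le> rk e" for x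
    proof -
      have "x \<in> {1..m}" using that Bn_le_m[of v] rk_le_m[of e] by auto
      then have "x \<in> rk ` {..<m}" using rk_bij by (simp only: bij_betw_def)
      then obtain e' where "e' < m" "x = rk e'" by blast
      then show ?thesis using that by (auto simp: btw_def)
    qed
    then show ?thesis by (auto simp: btw_def)
  qed
  have "card (btw v e) = card (rk ` btw v e)" by (rule card_image[OF inj, symmetric])
  then show ?thesis unfolding img by simp
qed

text \<open>The conditional expectation of \<open>gpX\<close> when the edges below \<open>i\<close>
  have been decided with outcome \<open>X\<close>: an edge stays at the level of \<open>v\<close> if
  no separating edge has been sampled so far and all undecided ones will be missed.\<close>

definition Psi :: "nat \<Rightarrow> nat set \<Rightarrow> nat \<Rightarrow> real" where
  "Psi i X v = (\<Sum>e<m. of_bool (X \<inter> btw v e = {}) * (1 - 1 / real T) ^ card (btw v e \<inter> {i..<m}))"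

lemma Psi_end: assumes "X \<subseteq> {..<m}" shows "Psi m X v = real (gpX X v)"
proof -
  have "gpX X v = card {e. e < m \<and> X \<inter> btw v e = {}}" unfolding gpX_def using LevX_eq_iff[OF assms] by simp
  also have "{e. e < m \<and> X \<inter> btw v e = {}} = {..<m} \<inter> {e. X \<inter> btw v e = {}}" by auto
  finally show ?thesis unfolding Psi_def by simp
qed

text \<open>The martingale property. The decision on \<open>i\<close> matters only for edges that
  \<open>i\<close> separates from \<open>v\<close>: these survive exactly when \<open>i\<close> is
  missed, which contributes the additional factor.\<close>

lemma Psi_step: assumes "i < m"
  shows "1 / real T * Psi (Suc i) (insert i X) v + (1 - 1 / real T) * Psi (Suc i) X v = Psi i X v"
  unfolding Psi_def sum_distrib_left sum.distrib[symmetric]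
proof (rule sum.cong[OF refl])
  fix e
  show "1 / real T * (of_bool (insert i X \<inter> btw v e = {}) * (1 - 1 / real T) ^ card (btw v e \<inter> {Suc i..<m})) +
    (1 - 1 / real T) * (of_bool (X \<inter> btw v e = {}) * (1 - 1 / real T) ^ card (btw v e \<inter> {Suc i..<m})) =
    of_bool (X \<inter> btw v e = {}) * (1 - 1 / real T) ^ card (btw v e \<inter> {i..<m})"
  proof (cases "i \<in> btw v e")
    case True
    have "btw v e \<inter> {i..<m} = insert i (btw v e \<inter> {Suc i..<m})" using True assms by auto
    then have "card (btw v e \<inter> {i..<m}) = Suc (card (btw v e \<inter> {Suc i..<m}))" by simp
    then show ?thesis using True by simp
  next
    case False
    have "btw v e \<inter> {i..<m} = btw v e \<inter> {Suc i..<m}"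
    proof -
      have "x \<in> {i..<m} \<longleftrightarrow> x \<in> {Suc i..<m}" if "x \<in> btw v e" for x
        using that False by (cases "x = i") auto
      then show ?thesis by blast
    qed
    moreover have "insert i X \<inter> btw v e = X \<inter> btw v e" using False by auto
    ultimately show ?thesis by (simp add: algebra_simps)
  qed
qed

text \<open>Ranks are distinct, so at most two edges lie at each distance from \<open>Bn v\<close>.
  This leaves two geometric series of ratio \<open>1 - 1 / T\<close>, each with sum at most
  \<open>T\<close>.\<close>

lemma Psi_start: "Psi 0 {} v \<le> 2 * real T"
proof -
  define q where "q = 1 - 1 / real T"
  have q: "0 \<le> q" using T_pos by (simp add: q_def)
  define f where "f = (\<lambda>x. q ^ (if x \<le> Bn v then Bn v - x else x - Bn v))"
  have f0: "0 \<le> f x" for x using q by (simp add: f_def)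
  have "Psi 0 {} v = (\<Sum>e<m. f (rk e))"
    unfolding Psi_def
  proof (rule sum.cong[OF refl])
    fix e assume e: "e \<in> {..<m}"
    have "btw v e \<inter> {0..<m} = btw v e" by (auto simp: btw_def)
    then show "of_bool ({} \<inter> btw v e = {}) * (1 - 1 / real T) ^ card (btw v e \<inter> {0..<m}) = f (rk e)"
      using card_btw[of e v] e by (simp add: f_def q_def)
  qed
  also have "\<dots> = (\<Sum>x\<in>{1..m}. f x)" by (rule sum.reindex_bij_betw[OF rk_bij])
  also have "\<dots> \<le> (\<Sum>x\<in>{..Bn v} \<union> {Bn v<..m}. f x)" by (rule sum_mono2) (use f0 in auto)
  also have "\<dots> = (\<Sum>x\<in>{..Bn v}. f x) + (\<Sum>x\<in>{Bn v<..m}. f x)" by (rule sum.union_disjoint) auto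
  also have "(\<Sum>x\<in>{..Bn v}. f x) = (\<Sum>k<Suc (Bn v). q ^ k)"
    by (rule sum.reindex_bij_witness[where i = "\<lambda>k. Bn v - k" and j = "\<lambda>x. Bn v - x"]) (auto simp: f_def)
  also have "(\<Sum>x\<in>{Bn v<..m}. f x) \<le> (\<Sum>k<Suc m. q ^ k)"
  proof -
    have "(\<Sum>x\<in>{Bn v<..m}. f x) = (\<Sum>k\<in>(\<lambda>x. x - Bn v) ` {Bn v<..m}. q ^ k)"
      by (subst sum.reindex) (auto simp: f_def inj_on_def)
    also have "\<dots> \<le> (\<Sum>k<Suc m. q ^ k)" by (rule sum_mono2) (use q in auto)
    finally show ?thesis .
  qed
  also have "(\<Sum>k<Suc (Bn v). q ^ k) + (\<Sum>k<Suc m. q ^ k) \<le> real T + real T"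
    unfolding q_def by (intro add_mono geometric_le T_pos)
  finally show ?thesis by simp
qed

section \<open>Expected cost of the whole run\<close>

definition fixed_cost :: nat where
  "fixed_cost = (10 * T + 100) * (12 * m) + T * (1500 * m + 210) + 700 * m + 200"

text \<open>\<open>pcost\<close> averaged over the undecided edges, with 12 steps for each remaining
  draw and a margin of 2 for leaving the loop.\<close>

definition ecost :: "nat \<Rightarrow> nat set \<Rightarrow> real" where
  "ecost i X = 80 * (real T * real T) * (real (card X) + real (m - i) / real T) + real fixed_cost +
     (\<Sum>v\<in>ssbp_run.V es. 85 * (1 + real T + Psi i X v)) + 12 * real (m - i) + 2"

lemma ecost_end: assumes "X \<subseteq> {..<m}" shows "real (pcost X) + 2 = ecost m X"
  unfolding pcost_def ecost_def fixed_cost_def by (simp add: Psi_end[OF assms] add.assoc)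

text \<open>The cost is affine in the sample size and in \<open>Psi\<close>, so the martingale
  property carries over. Being an equality, it loses nothing in the induction over the
  edges.\<close>

lemma ecost_step: assumes i: "i < m" and X: "X \<subseteq> {..<i}"
  shows "1 / real T * ecost (Suc i) (insert i X) + (1 - 1 / real T) * ecost (Suc i) X + 12 = ecost i X"
proof -
  define q where "q = 1 / real T"
  define S where "S = (\<lambda>i X. \<Sum>v\<in>ssbp_run.V es. 85 * (1 + real T + Psi i X v))"
  have fX: "finite X" using X finite_subset by blast
  have iX: "i \<notin> X" using X by auto
  have c: "card (insert i X) = Suc (card X)" using fX iX by simp
  have mi: "real (m - i) = real (m - Suc i) + 1" using i by (simp add: of_nat_diff)
  have "q * S (Suc i) (insert i X) + (1 - q) * S (Suc i) X = S i X"
    unfolding S_def sum_distrib_left sum.distrib[symmetric]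
  proof (rule sum.cong[OF refl])
    fix v
    have "Psi i X v = q * Psi (Suc i) (insert i X) v + (1 - q) * Psi (Suc i) X v" using Psi_step[OF i] by (simp add: q_def)
    then show "q * (85 * (1 + real T + Psi (Suc i) (insert i X) v)) + (1 - q) * (85 * (1 + real T + Psi (Suc i) X v)) =
       85 * (1 + real T + Psi i X v)" by (simp add: algebra_simps)
  qed
  moreover define t where "t = 80 * (real T * real T)"
  ultimately have eq: "q * (t * (real (Suc (card X)) + real (m - Suc i) * q) + real fixed_cost + S (Suc i) (insert i X) + 12 * real (m - Suc i) + 2) +
     (1 - q) * (t * (real (card X) + real (m - Suc i) * q) + real fixed_cost + S (Suc i) X + 12 * real (m - Suc i) + 2) + 12 =
     t * (real (card X) + (real (m - Suc i) + 1) * q) + real fixed_cost + S i X + 12 * (real (m - Suc i) + 1) + 2"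
    by (simp add: algebra_simps)
  have Sf: "(\<Sum>v\<in>ssbp_run.V es. 85 * (1 + real T + Psi i X v)) = S i X" for i X by (simp only: S_def)
  have d: "x / real T = x * q" for x by (simp add: q_def)
  show ?thesis using eq unfolding ecost_def c mi Sf d mult_1 t_def .
qed

lemma ecost_nonneg: "0 \<le> ecost i X"
proof -
  have "0 \<le> Psi i X v" for v unfolding Psi_def using T_pos by (intro sum_nonneg mult_nonneg_nonneg zero_le_power) auto
  then show ?thesis unfolding ecost_def by (intro add_nonneg_nonneg sum_nonneg mult_nonneg_nonneg) auto
qed

text \<open>Backward induction over the undecided edges: both outcomes of a draw are bounded by the
  induction hypothesis and averaged by \<open>good_step\<close>.\<close>

lemma good_sample:
  assumes W: "M = 2 ^ W" and p: "prep st" and sc: "scalar st ''r'' = card X" "scalar st ''o'' = 0" "scalar st ''i'' = i" "i \<le> m"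
    and X: "X \<subseteq> {..<i}" "(\<lambda>q. arr st ''S'' (q + 1)) ` {..<card X} = X"
  shows "good W le solved ([samp_c, sort_c ;; search_c], st) (ennreal (ecost i X))"
  using p sc X
proof (induction "m - i" arbitrary: i X st)
  case 0
  then have im: "i = m" by simp
  have mm: "scalar st ''m'' = m" using 0 by (simp add: prep_def)
  have "wp M le (sort_c ;; search_c) (\<lambda>st' _. solved st') st (pcost X)"
    by (rule wp_solve) (use 0 im in auto)
  then have "wp (2 ^ W) le (sort_c ;; search_c) (\<lambda>st' n'. good W le solved ([], st') (of_nat n' + 0)) st (pcost X)"
    unfolding W[symmetric] by (rule wp_mono) (simp add: good_Nil)
  then have "good W le solved ([sort_c ;; search_c], st) (of_nat (pcost X) + 0)" by (rule good_wp)
  then have "good W le solved ([samp_c, sort_c ;; search_c], st) (1 + (of_nat (pcost X) + 0))"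
    by (rule good_step_det[rotated]) (use 0 im mm in \<open>simp add: samp_c_def\<close>)
  then show ?case
  proof (rule good_mono)
    have "ennreal (real (pcost X) + 2) = of_nat (pcost X) + 2"
      by (simp add: ennreal_plus ennreal_of_nat_eq_real_of_nat)
    moreover have "real (pcost X) + 2 = ecost i X" using ecost_end[of X] 0 im by simp
    moreover have "1 + (of_nat (pcost X) + 0) \<le> of_nat (pcost X) + (2::ennreal)"
      by (simp add: add.commute add_left_mono)
    ultimately show "1 + (of_nat (pcost X) + 0) \<le> ennreal (ecost i X)" by simp
  qed
next
  case (Suc k)
  note p = Suc.prems(1) and sc = Suc.prems(2-5) and X = Suc.prems(6,7)
  have im: "i < m" using Suc.hyps(2) by simp
  have PT: "scalar st ''m'' = m" "scalar st ''T'' = T" using p by (simp_all add: prep_def)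
  define rest where "rest = Cond (Eq (Var ''x'') (Const 0))
        (Assign ''r'' (Add (Var ''r'') (Const 1)) ;; Store ''S'' (Var ''r'') (Var ''i'')) Skip ;;
      Assign ''i'' (Add (Var ''i'') (Const 1))"
  define K where "K = [samp_c, sort_c ;; search_c]"
  have Mb: "Suc (card X) < M" "Suc i < M"
  proof -
    have "X \<subseteq> {..<m}" using X(1) im by auto
    then have "card X \<le> m" using card_mono[of "{..<m}" X] by simp
    then show "Suc (card X) < M" "Suc i < M" using im M_T by linarith+
  qed
  have iX: "i \<notin> X" and fX: "finite X" using X(1) finite_subset by auto
  \<comment> \<open>9 steps suffice for the body after the draw; loop test, sequencing and draw
    complete the 12 of \<open>ecost_step\<close>.\<close>
  have hit: "good W le solved (rest # K, upds ''x'' 0 st) (of_nat 9 + ennreal (ecost (Suc i) (insert i X)))"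
  proof (rule good_wp)
    define st' where "st' = upda ''S'' (Suc (card X)) i st
       \<lparr>scalar := (scalar st)(''x'' := 0, ''r'' := Suc (card X), ''i'' := Suc i)\<rparr>"
    have "good W le solved ([samp_c, sort_c ;; search_c], st') (ennreal (ecost (Suc i) (insert i X)))"
    proof (rule Suc.hyps(1))
      show "k = m - Suc i" using Suc.hyps(2) by simp
      show "prep st'" by (rule prep_unch[OF p]) (auto simp: st'_def)
      show "scalar st' ''r'' = card (insert i X)" "scalar st' ''o'' = 0" "scalar st' ''i'' = Suc i"
        using sc iX fX by (simp_all add: st'_def)
      show "Suc i \<le> m" "insert i X \<subseteq> {..<Suc i}" using im X(1) by auto
      have "(\<lambda>q. arr st' ''S'' (q + 1)) ` {..<card X} = (\<lambda>q. arr st ''S'' (q + 1)) ` {..<card X}"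
        by (rule image_cong) (auto simp: st'_def)
      moreover have "arr st' ''S'' (card X + 1) = i" by (simp add: st'_def)
      ultimately show "(\<lambda>q. arr st' ''S'' (q + 1)) ` {..<card (insert i X)} = insert i X"
        using X(2) iX fX by (simp add: lessThan_Suc)
    qed
    then have g: "good W le solved (K, st') (b + ennreal (ecost (Suc i) (insert i X)))" for b
      unfolding K_def by (rule good_mono) simp
    show "wp (2 ^ W) le rest (\<lambda>st' n'. good W le solved (K, st') (of_nat n' + ennreal (ecost (Suc i) (insert i X)))) (upds ''x'' 0 st) 9"
      unfolding rest_def W[symmetric] using sc Mb g[unfolded st'_def] by (simp add: wps)
  qed
  have miss: "good W le solved (rest # K, upds ''x'' x st) (of_nat 9 + ennreal (ecost (Suc i) X))" if "x \<noteq> 0" for x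
  proof (rule good_wp)
    define st' where "st' = st\<lparr>scalar := (scalar st)(''x'' := x, ''i'' := Suc i)\<rparr>"
    have "good W le solved ([samp_c, sort_c ;; search_c], st') (ennreal (ecost (Suc i) X))"
    proof (rule Suc.hyps(1))
      show "k = m - Suc i" using Suc.hyps(2) by simp
      show "prep st'" by (rule prep_unch[OF p]) (auto simp: st'_def)
      show "scalar st' ''r'' = card X" "scalar st' ''o'' = 0" "scalar st' ''i'' = Suc i"
        using sc by (simp_all add: st'_def)
      show "Suc i \<le> m" "X \<subseteq> {..<Suc i}" using im X(1) by auto
      show "(\<lambda>q. arr st' ''S'' (q + 1)) ` {..<card X} = X" using X(2) by (simp add: st'_def)
    qed
    then have g: "good W le solved (K, st') (b + ennreal (ecost (Suc i) X))" for b
      unfolding K_def by (rule good_mono) simp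
    show "wp (2 ^ W) le rest (\<lambda>st' n'. good W le solved (K, st') (of_nat n' + ennreal (ecost (Suc i) X))) (upds ''x'' x st) 9"
      unfolding rest_def W[symmetric] using sc Mb g[unfolded st'_def] that by (simp add: wps)
  qed
  define B1 where "B1 = 9 + ecost (Suc i) (insert i X)"
  define B2 where "B2 = 9 + ecost (Suc i) X"
  have B: "0 \<le> B1" "0 \<le> B2" using ecost_nonneg[of "Suc i"] by (simp_all add: B1_def B2_def add_nonneg_nonneg)
  define f where "f = (\<lambda>d :: config. ennreal (if scalar (snd d) ''x'' = 0 then B1 else B2))"
  have avg: "(\<integral>\<^sup>+ d. f d \<partial>measure_pmf (step W le (Random ''x'' (Var ''T'') # rest # K, st))) = ennreal (1 / real T * B1 + (1 - 1 / real T) * B2)"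
  proof -
    have "(\<integral>\<^sup>+ d. f d \<partial>measure_pmf (step W le (Random ''x'' (Var ''T'') # rest # K, st))) =
       (\<integral>\<^sup>+ x. ennreal (if x = 0 then B1 else B2) \<partial>measure_pmf (pmf_of_set {..<T}))"
      using T_pos PT by (simp add: f_def)
    also have "\<dots> = (\<Sum>x<T. ennreal (if x = 0 then B1 else B2)) / of_nat T"
      using T_pos by (subst nn_integral_pmf_of_set) (auto simp: lessThan_empty_iff)
    also have "(\<Sum>x<T. ennreal (if x = 0 then B1 else B2)) = ennreal (\<Sum>x<T. if x = 0 then B1 else B2)"
      using B by (intro sum_ennreal) auto
    also have "(\<Sum>x<T. if x = 0 then B1 else B2) = B1 + (real T - 1) * B2"
    proof -
      obtain t where t: "T = Suc t" using T_pos by (cases T) auto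
      show ?thesis unfolding t sum.lessThan_Suc_shift by simp
    qed
    also have "ennreal (B1 + (real T - 1) * B2) / of_nat T = ennreal ((B1 + (real T - 1) * B2) / real T)"
      using T_pos B by (subst divide_ennreal[symmetric]) (auto simp: ennreal_of_nat_eq_real_of_nat)
    also have "(B1 + (real T - 1) * B2) / real T = 1 / real T * B1 + (1 - 1 / real T) * B2"
      using T_pos by (simp add: field_simps)
    finally show ?thesis .
  qed
  have "good W le solved (Random ''x'' (Var ''T'') # rest # K, st) (1 + ennreal (1 / real T * B1 + (1 - 1 / real T) * B2))"
  proof (rule good_step[where f = f])
    show "\<not> halted (Random ''x'' (Var ''T'') # rest # K, st)" by (simp add: halted_def)
    fix d assume "d \<in> set_pmf (step W le (Random ''x'' (Var ''T'') # rest # K, st))"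
    then obtain x where d: "d = (rest # K, upds ''x'' x st)" using T_pos PT by auto
    show "good W le solved d (f d)"
    proof (cases "x = 0")
      case True
      have "f d = of_nat 9 + ennreal (ecost (Suc i) (insert i X))"
        using True ecost_nonneg by (simp add: f_def d B1_def ennreal_plus)
      then show ?thesis using hit True by (simp add: d)
    next
      case False
      have "f d = of_nat 9 + ennreal (ecost (Suc i) X)"
        using False ecost_nonneg by (simp add: f_def d B2_def ennreal_plus)
      then show ?thesis using miss[OF False] by (simp add: d)
    qed
  qed (simp only: avg order_refl)
  then have "good W le solved (samp_body_c # K, st) (1 + (1 + ennreal (1 / real T * B1 + (1 - 1 / real T) * B2)))"
    unfolding samp_body_c_def rest_def by (rule good_step_det[rotated]) simp
  then have "good W le solved (samp_c # [sort_c ;; search_c], st) (1 + (1 + (1 + ennreal (1 / real T * B1 + (1 - 1 / real T) * B2))))"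
    unfolding K_def by (rule good_step_det[rotated]) (use sc im PT in \<open>simp add: samp_c_def\<close>)
  then show ?case
  proof (rule good_mono)
    have "1 / real T * B1 + (1 - 1 / real T) * B2 = 9 + (1 / real T * ecost (Suc i) (insert i X) + (1 - 1 / real T) * ecost (Suc i) X)"
      using T_pos by (simp add: B1_def B2_def field_simps)
    then have e: "ecost i X = 3 + (1 / real T * B1 + (1 - 1 / real T) * B2)" using ecost_step[OF im X(1)] by simp
    have "0 \<le> 1 / real T * B1 + (1 - 1 / real T) * B2" using T_pos B by simp
    then have "ennreal (ecost i X) = 3 + ennreal (1 / real T * B1 + (1 - 1 / real T) * B2)" unfolding e by (simp add: ennreal_plus)
    then show "1 + (1 + (1 + ennreal (1 / real T * B1 + (1 - 1 / real T) * B2))) \<le> ennreal (ecost i X)"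
      by (simp add: add.assoc[symmetric])
  qed
qed

lemma good_ssbp:
  assumes W: "M = 2 ^ W"
  shows "good W le solved ([ssbp_c], initial_state N es s) (ennreal (60 * real m + 60 + ecost 0 {}))"
proof -
  define B where "B = ennreal (ecost 0 {})"
  define K where "K = [Assign ''i'' (Const 0) ;; samp_c ;; sort_c ;; search_c]"
  have rest: "good W le solved (K, st) (3 + B)" if "prep st" "scalar st ''r'' = 0" "scalar st ''o'' = 0" for st
  proof -
    have "good W le solved ([samp_c, sort_c ;; search_c], upds ''i'' 0 st) B"
      unfolding B_def by (rule good_sample[OF W]) (use that in \<open>auto intro: prep_unch\<close>)
    then have "good W le solved ([samp_c ;; sort_c ;; search_c], upds ''i'' 0 st) (1 + B)"
      by (rule good_step_det[rotated]) simp
    then have "good W le solved ([Assign ''i'' (Const 0), samp_c ;; sort_c ;; search_c], st) (1 + (1 + B))"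
      by (rule good_step_det[rotated]) simp
    then have "good W le solved (K, st) (1 + (1 + (1 + B)))"
      unfolding K_def by (rule good_step_det[rotated]) simp
    then show ?thesis by (simp add: add.assoc[symmetric])
  qed
  have "wp (2 ^ W) le (size_c ;; init_c) (\<lambda>st' n'. good W le solved (K, st') (of_nat n' + (3 + B))) (initial_state N es s) (60 * m + 50)"
    unfolding W[symmetric] by (rule wp_prep[OF order_refl]) (auto intro: good_mono[OF rest])
  then have "good W le solved ((size_c ;; init_c) # K, initial_state N es s) (of_nat (60 * m + 50) + (3 + B))" by (rule good_wp)
  then have "good W le solved ([ssbp_c], initial_state N es s) (1 + (of_nat (60 * m + 50) + (3 + B)))"
    unfolding K_def ssbp_c_def by (rule good_step_det[rotated]) simp
  then show ?thesis
  proof (rule good_mono)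
    have "1 + (of_nat (60 * m + 50) + (3 + B)) = ennreal (1 + (real (60 * m + 50) + (3 + ecost 0 {})))"
      unfolding B_def using ecost_nonneg by (simp add: ennreal_plus ennreal_of_nat_eq_real_of_nat del: of_nat_add of_nat_mult)
    also have "\<dots> \<le> ennreal (60 * real m + 60 + ecost 0 {})" by (intro ennreal_leI) simp
    finally show "1 + (of_nat (60 * m + 50) + (3 + B)) \<le> ennreal (60 * real m + 60 + ecost 0 {})" .
  qed
qed

section \<open>Bounds in terms of the numbers of edges and vertices\<close>

lemma ecost_le: assumes "1 \<le> m" shows "60 * real m + 60 + ecost 0 {} \<le> 6000 * (real m * real T)"
proof -
  define z where "z = real m * real T"
  have T1: "1 \<le> real T" and m1: "1 \<le> real m" using T_pos assms by auto
  have z: "real m \<le> z" "real T \<le> z" "1 \<le> z"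
    using mult_left_mono[OF T1, of "real m"] mult_right_mono[OF m1, of "real T"] T1 m1 unfolding z_def by auto
  have "(\<Sum>v\<in>ssbp_run.V es. 85 * (1 + real T + Psi 0 {} v)) \<le> (\<Sum>v\<in>ssbp_run.V es. 85 * (1 + real T + 2 * real T))"
    using Psi_start by (intro sum_mono mult_left_mono add_left_mono) auto
  also have "\<dots> = real (card (ssbp_run.V es)) * (85 * (1 + 3 * real T))" by simp
  also have "\<dots> \<le> real (2 * m) * (85 * (1 + 3 * real T))"
    using card_V' by (intro mult_right_mono of_nat_mono) auto
  also have "\<dots> = 170 * real m + 510 * z" by (simp add: z_def algebra_simps)
  finally have s: "(\<Sum>v\<in>ssbp_run.V es. 85 * (1 + real T + Psi 0 {} v)) \<le> 170 * real m + 510 * z" .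
  have f: "real fixed_cost = 1620 * z + 1900 * real m + 210 * real T + 200"
    unfolding fixed_cost_def z_def by (simp add: algebra_simps)
  have "80 * (real T * real T) * (real (card ({}::nat set)) + real (m - 0) / real T) = 80 * z"
    using T1 by (simp add: z_def field_simps)
  then show ?thesis unfolding ecost_def f z_def[symmetric] using s z by simp
qed

text \<open>Minimality of \<open>T\<close> bounds the square of \<open>T - 1\<close> by the
  logarithm of \<open>m\<close>, which is at most twice that of \<open>n\<close>. As the logarithm
  of \<open>n\<close> is at least 1, the additive 1 is absorbed into the factor 3.\<close>

lemma T_le_sqrt: assumes "m \<le> n * n" "2 \<le> n" shows "real T \<le> 3 * sqrt (log 2 (real n))"
proof (cases "T = 1")
  case True
  have "1 \<le> log 2 (real n)" using assms(2) by (simp add: le_log_iff)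
  then have "1 \<le> sqrt (log 2 (real n))" by simp
  moreover have "real T = 1" using True by simp
  ultimately show ?thesis by linarith
next
  case False
  have L: "1 \<le> log 2 (real n)" using assms(2) by (simp add: le_log_iff)
  have "2 ^ ((T - 1) * (T - 1)) \<le> m" using T_min[of "T - 1"] T_pos False by simp
  then have "2 ^ ((T - 1) * (T - 1)) \<le> n * n" using assms(1) by simp
  then have "real (2 ^ ((T - 1) * (T - 1))) \<le> real (n * n)" by (rule of_nat_mono)
  then have "2 ^ ((T - 1) * (T - 1)) \<le> real n ^ 2" by (simp add: power2_eq_square)
  then have "log 2 (2 ^ ((T - 1) * (T - 1))) \<le> log 2 (real n ^ 2)" using assms(2) by (subst log_le_cancel_iff) auto
  then have "real ((T - 1) * (T - 1)) \<le> log 2 (real n ^ 2)" by (simp only: log_pow_cancel)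
  also have "\<dots> = 2 * log 2 (real n)" using assms(2) by (simp add: log_nat_power)
  finally have sq: "(real T - 1)\<^sup>2 \<le> 2 * log 2 (real n)" using T_pos by (simp add: of_nat_diff power2_eq_square)
  have "real T - 1 \<le> sqrt (2 * log 2 (real n))" by (rule real_le_rsqrt[OF sq])
  also have "\<dots> \<le> sqrt (4 * log 2 (real n))" using L by simp
  also have "\<dots> = 2 * sqrt (log 2 (real n))" by (simp add: real_sqrt_mult)
  finally have "real T \<le> 1 + 2 * sqrt (log 2 (real n))" by simp
  moreover have "1 \<le> sqrt (log 2 (real n))" using L by simp
  ultimately show ?thesis by linarith
qed

end

text \<open>With \<open>L\<close> digits for \<open>n\<close>, \<open>m + 2\<close> needs at most
  \<open>2 * L\<close> bits and its sixth power \<open>12 * L\<close>; the constant 10000 takes 14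
  more. As \<open>L\<close> is at least 1, \<open>30 * L\<close> bits are ample.\<close>

lemma word_bits_large:
  assumes "1 \<le> n" "m \<le> n * n"
  shows "10000 * (m + 2) ^ 6 < (2::nat) ^ word_bits 30 n" "n < (2::nat) ^ word_bits 30 n"
proof -
  define L where "L = floorlog 2 n"
  have L: "n < 2 ^ L" using floorlog_bounds[of n 2] assms(1) by (simp add: L_def)
  have L1: "1 \<le> L" using L assms(1) by (cases L) auto
  have m: "m + 2 \<le> 2 ^ (2 * L)"
  proof -
    define a where "a = (2::nat) ^ L"
    have a: "n + 1 \<le> a" using L by (simp add: a_def)
    have "2 \<le> a" using assms(1) a by simp
    have "(n + 1) * (n + 1) \<le> a * a" using a by (intro mult_le_mono)
    then have "n * n + 2 \<le> a * a" using assms(1) by simp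
    then show ?thesis using assms(2) by (simp add: a_def mult_2 power_add)
  qed
  have "(m + 2) ^ 6 \<le> (2 ^ (2 * L)) ^ 6" using m by (rule power_mono) simp
  also have "\<dots> = 2 ^ (12 * L)" by (simp add: power_mult[symmetric] mult.commute)
  finally have "10000 * (m + 2) ^ 6 \<le> 10000 * 2 ^ (12 * L)" by simp
  also have "\<dots> < 2 ^ 14 * 2 ^ (12 * L)" by simp
  also have "\<dots> = 2 ^ (14 + 12 * L)" by (simp only: power_add)
  also have "\<dots> \<le> (2::nat) ^ (30 * L)" using L1 by (intro power_increasing) auto
  finally show "10000 * (m + 2) ^ 6 < (2::nat) ^ word_bits 30 n" by (simp add: word_bits_def L_def)
  have "(2::nat) ^ L \<le> 2 ^ (30 * L)" by (intro power_increasing) auto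
  from less_le_trans[OF L this] show "n < (2::nat) ^ word_bits 30 n" by (simp only: word_bits_def L_def)
qed

theorem theorem1:
  shows "\<exists>(P :: com) (c :: nat) (C :: real).
    \<forall>(G :: nat pair_pre_digraph) (es :: (nat \<times> nat) list) (w :: nat \<times> nat \<Rightarrow> real) (s :: nat) (n :: nat) (m :: nat).
      pair_fin_digraph G \<and> pverts G = {..<n} \<and> card (parcs G) = m \<and>
      distinct es \<and> set es = parcs G \<and> s \<in> pverts G \<longrightarrow>
      (let W = word_bits c n; le = edge_le es w; init = ([P], initial_state n es s) in
        (\<forall>k. \<forall>(K, \<sigma>)\<in>set_pmf (run W le k init).
           halted (K, \<sigma>) \<longrightarrow> ssbp_output_correct G es w s \<sigma>) \<and>
        expected_time W le init < \<infinity> \<and>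
        (2 \<le> n \<and> 1 \<le> m \<longrightarrow>
           expected_time W le init \<le> ennreal (C * real m * sqrt (log 2 (real n)))))"
proof (intro exI[of _ ssbp_c] exI[of _ "30::nat"] exI[of _ "18000::real"] allI impI)
  fix G :: "nat pair_pre_digraph" and es :: "(nat \<times> nat) list" and w :: "nat \<times> nat \<Rightarrow> real" and s n m :: nat
  assume *: "pair_fin_digraph G \<and> pverts G = {..<n} \<and> card (parcs G) = m \<and>
      distinct es \<and> set es = parcs G \<and> s \<in> pverts G"
  then have G: "pair_fin_digraph G" "pverts G = {..<n}" "set es = parcs G" "s < n" "s \<in> pverts G" by auto
  interpret pair_fin_digraph G by (rule G)
  have m: "length es = m" using * by (metis distinct_card)
  have arcs: "set es \<subseteq> {..<n} \<times> {..<n}"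
  proof
    fix a assume "a \<in> set es"
    then have "fst a \<in> pverts G" "snd a \<in> pverts G" using G(3) in_arcsD1 in_arcsD2 by (cases a; force)+
    then show "a \<in> {..<n} \<times> {..<n}" using G(2) by (cases a) auto
  qed
  have "card (set es) \<le> card ({..<n} \<times> {..<n})" by (rule card_mono[OF _ arcs]) simp
  then have mn: "length es \<le> n * n" using * m by (simp add: card_cartesian_product)
  have ends: "fst (es ! e) < n" "snd (es ! e) < n" if "e < length es" for e using nth_mem[OF that] arcs by auto
  define W where "W = word_bits 30 n"
  \<comment> \<open>Without edges \<open>t = 0\<close> would satisfy the inequality, hence the
    explicit lower bound.\<close>
  define T where "T = (LEAST t. 1 \<le> t \<and> length es < 2 ^ (t * t))"
  obtain k where k: "1 \<le> k \<and> length es < 2 ^ (k * k)"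
  proof
    have "length es < 2 ^ length es" by (rule less_exp)
    also have "\<dots> \<le> (2::nat) ^ (Suc (length es) * Suc (length es))" by (rule power_increasing) auto
    finally show "1 \<le> Suc (length es) \<and> length es < 2 ^ (Suc (length es) * Suc (length es))" by (rule conjI[rotated]) (rule Suc_leI[OF zero_less_Suc, unfolded One_nat_def[symmetric]])
  qed
  have T: "1 \<le> T \<and> length es < 2 ^ (T * T)"
    unfolding T_def by (rule LeastI[of "\<lambda>t. 1 \<le> t \<and> length es < 2 ^ (t * t)", OF k])
  have wb: "10000 * (length es + 2) ^ 6 < (2::nat) ^ W" "n < 2 ^ W"
    unfolding W_def using word_bits_large[of n] mn G(4) by auto
  interpret A: ssbp_pre es w s "2 ^ W" T
  proof
    show "2 ^ (t * t) \<le> length es" if "1 \<le> t" "t < T" for t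
      using not_less_Least[of t "\<lambda>t. 1 \<le> t \<and> length es < 2 ^ (t * t)"] that by (simp add: T_def not_less)
  qed (use T wb ends G(4) in \<open>force simp: less_imp_le_nat\<close>)+
  let ?init = "([ssbp_c], initial_state n es s)"
  have good: "good W (edge_le es w) A.solved ?init (ennreal (60 * real (length es) + 60 + A.ecost 0 {}))"
    by (rule A.good_ssbp[OF refl])
  have correct: "ssbp_output_correct G es w s st" if "A.solved st" for st
    unfolding ssbp_output_correct_def
  proof
    fix t assume "t \<in> pverts G"
    show "decode_value es w (arr st ''out'' t) = bottleneck G w s t"
    proof (cases "t = s")
      case True
      then show ?thesis using that A.decode_source[OF G(1,5), of "arr st ''out'' s"] by (simp add: A.solved_def)
    next
      case False
      then show ?thesis using that A.decode_bottleneck[OF G(1,3,5), of "arr st ''out'' t" t] by (simp add: A.solved_def)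
    qed
  qed
  show "let W = word_bits 30 n; le = edge_le es w; init = ?init in
        (\<forall>k. \<forall>(K, st)\<in>set_pmf (run W le k init). halted (K, st) \<longrightarrow> ssbp_output_correct G es w s st) \<and>
        expected_time W le init < \<infinity> \<and>
        (2 \<le> n \<and> 1 \<le> m \<longrightarrow> expected_time W le init \<le> ennreal (18000 * real m * sqrt (log 2 (real n))))"
    unfolding Let_def W_def[symmetric]
  proof (intro conjI impI allI)
    show "\<forall>(K, st)\<in>set_pmf (run W (edge_le es w) k ?init). halted (K, st) \<longrightarrow> ssbp_output_correct G es w s st" for k
      using good correct by (fastforce simp: good_def)
    have e: "expected_time W (edge_le es w) ?init \<le> ennreal (60 * real (length es) + 60 + A.ecost 0 {})"
      using good by (simp add: good_def)
    then show "expected_time W (edge_le es w) ?init < \<infinity>" by (rule le_less_trans) simp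
    assume nm: "2 \<le> n \<and> 1 \<le> m"
    note e
    also have "ennreal (60 * real (length es) + 60 + A.ecost 0 {}) \<le> ennreal (6000 * (real m * real T))"
      using A.ecost_le nm m by (intro ennreal_leI) simp
    also have "\<dots> \<le> ennreal (18000 * real m * sqrt (log 2 (real n)))"
    proof (rule ennreal_leI)
      \<comment> \<open>The constant 18000 is the 6000 of \<open>ecost_le\<close> times the 3 of
        \<open>T_le_sqrt\<close>.\<close>
      have "real m * real T \<le> real m * (3 * sqrt (log 2 (real n)))"
        using A.T_le_sqrt[OF mn] nm by (intro mult_left_mono) auto
      then show "6000 * (real m * real T) \<le> 18000 * real m * sqrt (log 2 (real n))" by (simp add: algebra_simps)
    qed
    finally show "expected_time W (edge_le es w) ?init \<le> ennreal (18000 * real m * sqrt (log 2 (real n)))" .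
  qed
qed

end
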